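(* Let $(X,\omega_0)$ be a compact Kähler manifold and let $\beta\ge0$ be a closed semipositive $(1,1)$-form with $c_1(X)=[\omega_0]+[\beta]$. Let $\varphi=\varphi(t)$, $t\in[0,\infty)$, be a solution of the inverse Monge-Ampère flow. Then there is a constant $M>0$ such that $$\|\varphi(t)\|_{C^0}\le M(t+1)$$ for all $t\ge0$ along the flow.
   Context: Notation. $V=\int_X\omega_0^n$, $n=\dim_{\mathbb C}X$; $\mathcal H=\{\varphi\in C^\infty(X,\mathbb R): \omega_\varphi:=\omega_0+\sqrt{-1}\partial\bar\partial\varphi>0\}$. The Ricci form is $\mathrm{Ric}(\omega)=-\sqrt{-1}\partial\bar\partial\log\omega^n$ and represents $c_1(X)$ in the normalization used here. For $\varphi\in\mathcal H$ the Ricci potential $\rho=\rho_\varphi$ is determined by $\mathrm{Ric}(\omega_\varphi)=\omega_\varphi+\beta+\sqrt{-1}\partial\bar\partial\rho$ and $\frac1V\int_Xe^\rho\omega_\varphi^n=1$. The inverse Monge-Ampère flow is $\dot\varphi=1-e^{\rho_\varphi}$ for smooth $\varphi(t)\in\mathcal H$, with initial datum in $\mathcal H$. *)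

theory Defs
  imports "HOL-Analysis.Analysis"
begin

section \<open>Calculus on domains of complex coordinate space\<close>

text \<open>
  Derivatives are taken within \<open>S\<close>. The sets \<open>S\<close> used below are open, or products
  of \<open>[0,\<infinity>)\<close> with an open set; on these, derivatives within \<open>S\<close> are unique, and in the latter
  case the definition gives smoothness up to the boundary.
\<close>

primrec Ck_on :: "nat \<Rightarrow> ('e::real_normed_vector \<Rightarrow> 'f::real_normed_vector) \<Rightarrow> 'e set \<Rightarrow> bool" where
  "Ck_on 0 f S \<longleftrightarrow> continuous_on S f"
| "Ck_on (Suc k) f S \<longleftrightarrow> f differentiable_on S \<and>
     (\<forall>v. Ck_on k (\<lambda>z. frechet_derivative f (at z within S) v) S)"

definition smooth_on :: "'e::real_normed_vector set \<Rightarrow> ('e \<Rightarrow> 'f::real_normed_vector) \<Rightarrow> bool" where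
  "smooth_on S f \<longleftrightarrow> (\<forall>k. Ck_on k f S)"

definition hol_map_on :: "(complex^'n) set \<Rightarrow> (complex^'n \<Rightarrow> complex^'n) \<Rightarrow> bool" where
  "hol_map_on S f \<longleftrightarrow>
     (\<forall>z\<in>S. \<exists>f'. (f has_derivative f') (at z) \<and> (\<forall>a v. f' (a *s v) = a *s f' v))"

text \<open>The Wirtinger derivatives \<open>\<partial>/\<partial>z\<^sub>j\<close> and \<open>\<partial>/\<partial>zbar\<^sub>j\<close>.\<close>

definition wirt :: "'n::finite \<Rightarrow> (complex^'n \<Rightarrow> complex) \<Rightarrow> complex^'n \<Rightarrow> complex" where
  "wirt j f z = (frechet_derivative f (at z) (axis j 1)
                 - \<i> * frechet_derivative f (at z) (axis j \<i>)) / 2"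

definition wirt_bar :: "'n::finite \<Rightarrow> (complex^'n \<Rightarrow> complex) \<Rightarrow> complex^'n \<Rightarrow> complex" where
  "wirt_bar j f z = (frechet_derivative f (at z) (axis j 1)
                     + \<i> * frechet_derivative f (at z) (axis j \<i>)) / 2"


section \<open>Compact complex manifolds\<close>

text \<open>The underlying space of the manifold is the type \<open>'a\<close>; a chart is a pair (domain, coordinates).\<close>

type_synonym ('a, 'n) chart = "'a set \<times> ('a \<Rightarrow> complex^'n)"

abbreviation chart_image :: "('a, 'n) chart \<Rightarrow> (complex^'n) set" where
  "chart_image c \<equiv> snd c ` fst c"

abbreviation chart_inv :: "('a, 'n) chart \<Rightarrow> complex^'n \<Rightarrow> 'a" where
  "chart_inv c \<equiv> inv_into (fst c) (snd c)"

definition transition :: "('a, 'n) chart \<Rightarrow> ('a, 'n) chart \<Rightarrow> complex^'n \<Rightarrow> complex^'n" where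
  "transition c c' = snd c' \<circ> chart_inv c"

definition complex_atlas :: "('a::t2_space, 'n::finite) chart set \<Rightarrow> bool" where
  "complex_atlas A \<longleftrightarrow>
     (\<Union>c\<in>A. fst c) = UNIV \<and>
     (\<forall>c\<in>A. open (fst c) \<and> open (chart_image c) \<and>
        homeomorphism (fst c) (chart_image c) (snd c) (chart_inv c)) \<and>
     (\<forall>c\<in>A. \<forall>c'\<in>A. hol_map_on (snd c ` (fst c \<inter> fst c')) (transition c c'))"

text \<open>
  Manifolds are connected, as usual; the Ricci potential below is only determined by its
  normalisation on a connected manifold. The complex dimension is \<open>CARD('n)\<close>.
\<close>

definition compact_complex_manifold :: "('a::t2_space, 'n::finite) chart set \<Rightarrow> bool" where
  "compact_complex_manifold A \<longleftrightarrow>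
     compact (UNIV :: 'a set) \<and> connected (UNIV :: 'a set) \<and> complex_atlas A"

definition smooth_fun :: "('a, 'n::finite) chart set \<Rightarrow> ('a \<Rightarrow> real) \<Rightarrow> bool" where
  "smooth_fun A f \<longleftrightarrow> (\<forall>c\<in>A. smooth_on (chart_image c) (f \<circ> chart_inv c))"


section \<open>Differential forms\<close>

text \<open>
  A real (1,1)-form is given in each chart by the coefficients \<open>h\<^sub>j\<^sub>k\<close> in
  \<open>\<alpha> = \<i> \<Sum>\<^sub>j\<^sub>k h\<^sub>j\<^sub>k dz\<^sub>j \<and> dzbar\<^sub>k\<close>, as functions of the coordinates; it is real iff \<open>h\<close> is Hermitian.
  A real 1-form \<open>\<eta> = \<Sum>\<^sub>j (a\<^sub>j dz\<^sub>j + cnj a\<^sub>j dzbar\<^sub>j)\<close> is given by the coefficients \<open>a\<^sub>j\<close> of its (1,0)-part.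
  Values outside the chart images are irrelevant.
\<close>

type_synonym ('a, 'n) form11 = "('a, 'n) chart \<Rightarrow> complex^'n \<Rightarrow> complex^'n^'n"
type_synonym ('a, 'n) form1 = "('a, 'n) chart \<Rightarrow> complex^'n \<Rightarrow> complex^'n"

definition real_form11 :: "('a, 'n::finite) chart set \<Rightarrow> ('a, 'n) form11 \<Rightarrow> bool" where
  "real_form11 A \<alpha> \<longleftrightarrow>
     (\<forall>c\<in>A. smooth_on (chart_image c) (\<alpha> c)) \<and>
     (\<forall>c\<in>A. \<forall>z\<in>chart_image c. \<forall>j k. \<alpha> c z $ k $ j = cnj (\<alpha> c z $ j $ k)) \<and>
     (\<forall>c\<in>A. \<forall>c'\<in>A. \<forall>z \<in> snd c ` (fst c \<inter> fst c'). \<forall>j k.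
        \<alpha> c z $ j $ k =
          (\<Sum>p\<in>UNIV. \<Sum>q\<in>UNIV. wirt j (\<lambda>u. transition c c' u $ p) z *
             cnj (wirt k (\<lambda>u. transition c c' u $ q) z) * \<alpha> c' (transition c c' z) $ p $ q))"

definition real_form1 :: "('a, 'n::finite) chart set \<Rightarrow> ('a, 'n) form1 \<Rightarrow> bool" where
  "real_form1 A \<eta> \<longleftrightarrow>
     (\<forall>c\<in>A. smooth_on (chart_image c) (\<eta> c)) \<and>
     (\<forall>c\<in>A. \<forall>c'\<in>A. \<forall>z \<in> snd c ` (fst c \<inter> fst c'). \<forall>j.
        \<eta> c z $ j =
          (\<Sum>p\<in>UNIV. wirt j (\<lambda>u. transition c c' u $ p) z * \<eta> c' (transition c c' z) $ p))"

text \<open>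
  \<open>\<partial>\<alpha> = 0\<close> in components; \<open>dbar \<alpha> = 0\<close> is its complex conjugate, since \<open>\<alpha>\<close> is real.
\<close>

definition closed_real_form11 :: "('a, 'n::finite) chart set \<Rightarrow> ('a, 'n) form11 \<Rightarrow> bool" where
  "closed_real_form11 A \<alpha> \<longleftrightarrow> real_form11 A \<alpha> \<and>
     (\<forall>c\<in>A. \<forall>z\<in>chart_image c. \<forall>l j k.
        wirt l (\<lambda>u. \<alpha> c u $ j $ k) z = wirt j (\<lambda>u. \<alpha> c u $ l $ k) z)"

text \<open>
  \<open>\<alpha> = d\<eta>\<close>. The first condition says that the (2,0)-part of \<open>d\<eta>\<close>, hence also its conjugate, the
  (0,2)-part, vanishes; the (1,1)-part of \<open>d\<eta>\<close> is
  \<open>\<Sum>\<^sub>j\<^sub>k (\<partial>cnj a\<^sub>k/\<partial>z\<^sub>j - \<partial>a\<^sub>j/\<partial>zbar\<^sub>k) dz\<^sub>j \<and> dzbar\<^sub>k\<close>.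
\<close>

definition is_ext_deriv ::
    "('a, 'n::finite) chart set \<Rightarrow> ('a, 'n) form1 \<Rightarrow> ('a, 'n) form11 \<Rightarrow> bool" where
  "is_ext_deriv A \<eta> \<alpha> \<longleftrightarrow> (\<forall>c\<in>A. \<forall>z\<in>chart_image c. \<forall>j k.
     wirt k (\<lambda>u. \<eta> c u $ j) z = wirt j (\<lambda>u. \<eta> c u $ k) z \<and>
     \<i> * \<alpha> c z $ j $ k =
       wirt j (\<lambda>u. cnj (\<eta> c u $ k)) z - wirt_bar k (\<lambda>u. \<eta> c u $ j) z)"

text \<open>Equality of de Rham classes.\<close>

definition cohomologous ::
    "('a, 'n::finite) chart set \<Rightarrow> ('a, 'n) form11 \<Rightarrow> ('a, 'n) form11 \<Rightarrow> bool" where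
  "cohomologous A \<alpha> \<gamma> \<longleftrightarrow> (\<exists>\<eta>. real_form1 A \<eta> \<and> is_ext_deriv A \<eta> (\<lambda>c z. \<alpha> c z - \<gamma> c z))"

definition form_value :: "complex^'n::finite^'n \<Rightarrow> complex^'n \<Rightarrow> real" where
  "form_value h v = Re (\<Sum>j\<in>UNIV. \<Sum>k\<in>UNIV. h $ j $ k * v $ j * cnj (v $ k))"

definition semipositive :: "('a, 'n::finite) chart set \<Rightarrow> ('a, 'n) form11 \<Rightarrow> bool" where
  "semipositive A \<alpha> \<longleftrightarrow> (\<forall>c\<in>A. \<forall>z\<in>chart_image c. \<forall>v. 0 \<le> form_value (\<alpha> c z) v)"

definition positive :: "('a, 'n::finite) chart set \<Rightarrow> ('a, 'n) form11 \<Rightarrow> bool" where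
  "positive A \<alpha> \<longleftrightarrow> (\<forall>c\<in>A. \<forall>z\<in>chart_image c. \<forall>v. v \<noteq> 0 \<longrightarrow> 0 < form_value (\<alpha> c z) v)"

definition kaehler_form :: "('a, 'n::finite) chart set \<Rightarrow> ('a, 'n) form11 \<Rightarrow> bool" where
  "kaehler_form A \<omega> \<longleftrightarrow> closed_real_form11 A \<omega> \<and> positive A \<omega>"

text \<open>The form \<open>\<i> \<partial> dbar f\<close>.\<close>

definition ddbar :: "('a \<Rightarrow> real) \<Rightarrow> ('a, 'n::finite) form11" where
  "ddbar f = (\<lambda>c z. \<chi> j k. wirt j (wirt_bar k (\<lambda>u. complex_of_real (f (chart_inv c u)))) z)"

definition omega_pot :: "('a, 'n::finite) form11 \<Rightarrow> ('a \<Rightarrow> real) \<Rightarrow> ('a, 'n) form11" where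
  "omega_pot \<omega>\<^sub>0 \<phi> = (\<lambda>c z. \<omega>\<^sub>0 c z + ddbar \<phi> c z)"

definition kaehler_potentials ::
    "('a, 'n::finite) chart set \<Rightarrow> ('a, 'n) form11 \<Rightarrow> ('a \<Rightarrow> real) set" where
  "kaehler_potentials A \<omega>\<^sub>0 = {\<phi>. smooth_fun A \<phi> \<and> positive A (omega_pot \<omega>\<^sub>0 \<phi>)}"


section \<open>Volume form, integration and Ricci curvature\<close>

text \<open>
  Density of \<open>\<omega>\<^sup>n = n! det(h) \<Prod>\<^sub>j (\<i> dz\<^sub>j \<and> dzbar\<^sub>j)\<close> with respect to Lebesgue measure in the coordinates;
  note \<open>\<i> dz \<and> dzbar = 2 dx \<and> dy\<close>.
\<close>

definition vol_density :: "('a, 'n::finite) form11 \<Rightarrow> ('a, 'n) chart \<Rightarrow> complex^'n \<Rightarrow> real" where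
  "vol_density \<omega> c z = fact CARD('n) * 2 ^ CARD('n) * Re (det (\<omega> c z))"

definition partition_of_unity ::
    "('a::t2_space, 'n::finite) chart set \<Rightarrow> ('a, 'n) chart set \<times> (('a, 'n) chart \<Rightarrow> 'a \<Rightarrow> real) \<Rightarrow> bool"
  where
  "partition_of_unity A = (\<lambda>(C, \<theta>). finite C \<and> C \<subseteq> A \<and>
     (\<forall>c\<in>C. smooth_fun A (\<theta> c) \<and> (\<forall>x. 0 \<le> \<theta> c x) \<and> closure {x. \<theta> c x \<noteq> 0} \<subseteq> fst c) \<and>
     (\<forall>x. (\<Sum>c\<in>C. \<theta> c x) = 1))"

text \<open>
  \<open>\<integral>\<^sub>X f \<omega>\<^sup>n\<close>, as usual computed with some partition of unity; the value does not depend on its choice.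
\<close>

definition form_integral ::
    "('a::t2_space, 'n::finite) chart set \<Rightarrow> ('a, 'n) form11 \<Rightarrow> ('a \<Rightarrow> real) \<Rightarrow> real" where
  "form_integral A \<omega> f =
     (case (SOME P. partition_of_unity A P) of (C, \<theta>) \<Rightarrow>
       \<Sum>c\<in>C. LINT z : chart_image c | lborel.
         \<theta> c (chart_inv c z) * f (chart_inv c z) * vol_density \<omega> c z)"

text \<open>
  \<open>-\<i> \<partial> dbar log \<omega>\<^sup>n\<close>, where \<open>\<omega>\<^sup>n\<close> stands for its local density; this is independent of the coordinates.
\<close>

definition ricci_form :: "('a, 'n::finite) form11 \<Rightarrow> ('a, 'n) form11" where
  "ricci_form \<omega> =
     (\<lambda>c z. \<chi> j k. - wirt j (wirt_bar k (\<lambda>u. complex_of_real (ln (vol_density \<omega> c u)))) z)"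

text \<open>
  The closed form \<open>\<alpha>\<close> represents \<open>c\<^sub>1(X)\<close>, normalised (without a factor \<open>2\<pi>\<close>) as the class of the
  Ricci form; this class is the same for all Kaehler forms \<open>\<omega>\<close>.
\<close>

definition represents_c1 :: "('a, 'n::finite) chart set \<Rightarrow> ('a, 'n) form11 \<Rightarrow> bool" where
  "represents_c1 A \<alpha> \<longleftrightarrow> (\<exists>\<omega>. kaehler_form A \<omega> \<and> cohomologous A (ricci_form \<omega>) \<alpha>)"


section \<open>The inverse Monge-Ampere flow\<close>

definition ricci_potential ::
    "('a::t2_space, 'n::finite) chart set \<Rightarrow> ('a, 'n) form11 \<Rightarrow> ('a, 'n) form11 \<Rightarrow>
      ('a \<Rightarrow> real) \<Rightarrow> ('a \<Rightarrow> real) \<Rightarrow> bool" where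
  "ricci_potential A \<omega>\<^sub>0 \<beta> \<phi> \<rho> \<longleftrightarrow> smooth_fun A \<rho> \<and>
     (\<forall>c\<in>A. \<forall>z\<in>chart_image c.
        ricci_form (omega_pot \<omega>\<^sub>0 \<phi>) c z = omega_pot \<omega>\<^sub>0 \<phi> c z + \<beta> c z + ddbar \<rho> c z) \<and>
     form_integral A (omega_pot \<omega>\<^sub>0 \<phi>) (\<lambda>x. exp (\<rho> x)) / form_integral A \<omega>\<^sub>0 (\<lambda>x. 1) = 1"

text \<open>
  Solutions are smooth in space and time on \<open>[0,\<infinity>) \<times> X\<close>; the time derivative at \<open>0\<close> is one-sided.
\<close>

definition inverse_MA_flow ::
    "('a::t2_space, 'n::finite) chart set \<Rightarrow> ('a, 'n) form11 \<Rightarrow> ('a, 'n) form11 \<Rightarrow>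
      (real \<Rightarrow> 'a \<Rightarrow> real) \<Rightarrow> bool" where
  "inverse_MA_flow A \<omega>\<^sub>0 \<beta> \<phi> \<longleftrightarrow>
     (\<forall>c\<in>A. smooth_on ({0..} \<times> chart_image c) (\<lambda>(t, z). \<phi> t (chart_inv c z))) \<and>
     (\<forall>t\<ge>0. \<phi> t \<in> kaehler_potentials A \<omega>\<^sub>0) \<and>
     (\<forall>t\<ge>0. \<exists>\<rho>. ricci_potential A \<omega>\<^sub>0 \<beta> (\<phi> t) \<rho> \<and>
        (\<forall>x. ((\<lambda>s. \<phi> s x) has_real_derivative 1 - exp (\<rho> x)) (at t within {0..})))"

definition C0_norm :: "('a \<Rightarrow> real) \<Rightarrow> real" where
  "C0_norm f = (SUP x. \<bar>f x\<bar>)"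

end

theory Submission
  imports Defs "HOL-Complex_Analysis.Complex_Analysis"
begin

text \<open>
  Write \<open>Q = \<omega>\<^bsub>\<phi>(1)\<^esub>\<close> and \<open>\<eta>(t) = \<phi>(t) - \<phi>(1)\<close>. Since \<open>1 - e^\<rho> \<le> 1\<close>, only a lower bound for \<open>\<eta>\<close> is
  needed. Fix \<open>T \<ge> 1\<close> and let \<open>-B < 0\<close> be the minimum of \<open>\<eta>\<close> on \<open>[1,T]\<close>, attained at \<open>(t,p)\<close>. Maximum
  principles along the flow bound \<open>\<omega>\<^bsub>\<phi>\<^esub>\<close> from above by \<open>exp(C(1 + T + B)) Q\<close>, so on a coordinate ball of
  radius \<open>\<epsilon> = exp(-C'(1 + T + B))\<close> around \<open>p\<close> averages of \<open>\<eta>(t)\<close> exceed \<open>-B\<close> by at most a constant.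
  By concavity of the energy, \<open>\<integral> \<eta>(t) \<omega>\<^bsub>\<psi>\<^esub>^n \<ge> \<integral> \<psi> \<omega>\<^bsub>\<psi>\<^esub>^n\<close> for every potential \<open>\<psi> \<le> 0\<close>. For \<open>\<psi>\<close> equal to
  \<open>\<delta> log(\<bar>z - p\<bar>^2 + \<epsilon>^2)\<close> near \<open>p\<close> the measure \<open>\<omega>\<^bsub>\<psi>\<^esub>^n\<close> has mass of order \<open>\<delta>^n\<close> in that ball, while
  \<open>\<integral> -\<psi> \<omega>\<^bsub>\<psi>\<^esub>^n\<close> is at most \<open>C + C \<delta>^(n+1) log(1/\<epsilon>)\<close>. Hence \<open>c \<delta>^n B \<le> C(1 + T) + C \<delta>^(n+1)(1 + T + B)\<close>,
  and a small fixed \<open>\<delta>\<close> gives \<open>B \<le> M(1 + T)\<close>.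
\<close>

text \<open>The normalisation of the Ricci potential makes the mean of the time derivative of \<phi>
  vanish, so the Monge-Ampere energy is conserved along the flow. Conservation is what turns
  concavity into an inequality between \<open>\<eta> t\<close> and a test potential that is valid at
  all times. The obstacle is a circle: the radius of the ball on which averages of \<eta> are
  controlled shrinks exponentially with the very quantity B to be estimated. A logarithmic pole
  breaks it, because the mass that it puts into the ball does not depend on the radius, while
  smoothing it at scale \<epsilon> costs only log(1/\<epsilon>), which is linear in B and carries
  one more power of \<delta> than the mass. Time 1 is the origin because the calculus lives on open
  sets, hence on positive times; the interval [0,1] is left to compactness. The second order
  estimate avoids curvature tensors: it works with vectors that are constant in a chart, and
  closedness of the forms does the work of normal coordinates.\<close>

no_notation fps_nth (infixl "$" 75)

section \<open>Smooth functions on open sets\<close>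

text \<open>The direction comes first so that \<open>dv v f\<close> is again a function of the
  point. Iterated derivatives then stay among functions with the same target, in step with the
  recursion of \<open>Ck_on\<close>.\<close>

definition dv :: "'e::real_normed_vector => ('e => 'f::real_normed_vector) => 'e => 'f" where
 "dv v f z = frechet_derivative f (at z) v"

lemma has_derivative_imp_dv: "(f has_derivative f') (at z) ==> dv v f z = f' v"
 by (simp add: dv_def frechet_derivative_at[symmetric])

lemma frechet_derivative_within_cong:
 assumes "z : S" "!!x. x : S ==> f x = g x"
 shows "frechet_derivative f (at z within S) = frechet_derivative g (at z within S)"
proof -
 have "(f has_derivative f') (at z within S) \<longleftrightarrow> (g has_derivative f') (at z within S)" for f'
  using assms has_derivative_transform[of z S f g f'] has_derivative_transform[of z S g f f'] by auto
 thus ?thesis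
  unfolding frechet_derivative_def by simp
qed

lemma dv_cong_open:
 assumes "open S" "z : S" "!!x. x : S ==> f x = g x"
 shows "dv v f z = dv v g z"
 using frechet_derivative_within_cong[of z S f g] assms by (simp add: dv_def at_within_open[of _ S])

lemma Ck_on_cong:
 assumes "!!x. x : S ==> f x = g x"
 shows "Ck_on k f S = Ck_on k g S"
 using assms
proof (induction k arbitrary: f g)
 case 0
 thus ?case by (simp cong: continuous_on_cong)
next
 case (Suc k)
 have 1: "f differentiable_on S \<longleftrightarrow> g differentiable_on S"
  using Suc.prems unfolding differentiable_on_def differentiable_def
  by (metis has_derivative_transform)
 have "Ck_on k (%z. frechet_derivative f (at z within S) v) S
   \<longleftrightarrow> Ck_on k (%z. frechet_derivative g (at z within S) v) S" for v
  by (rule Suc.IH) (use frechet_derivative_within_cong[of _ S f g] Suc.prems in auto)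
 with 1 show ?case by simp
qed

lemma Ck_on_SucD: "Ck_on (Suc k) f S ==> Ck_on k f S"
 by (induction k arbitrary: f) (auto simp: differentiable_imp_continuous_on)

lemma Ck_on_subset_open:
 assumes "Ck_on k f S" "open T" "T \<subseteq> S"
 shows "Ck_on k f T"
 using assms(1)
proof (induction k arbitrary: f)
 case 0
 thus ?case using assms(3) continuous_on_subset by auto
next
 case (Suc k)
 have d: "f differentiable_on T"
  using Suc.prems assms(3) differentiable_on_subset by auto
 have "Ck_on k (%z. frechet_derivative f (at z within T) v) T" for v
 proof -
  have "Ck_on k (%z. frechet_derivative f (at z within S) v) T"
   using Suc by auto
  moreover have "at z within S = at z within T" if "z : T" for z
   using that assms(2,3) by (metis at_within_open at_within_open_subset)
  ultimately show ?thesis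
   by (subst Ck_on_cong[of T _ "%z. frechet_derivative f (at z within S) v"]) auto
 qed
 with d show ?case by simp
qed

lemma Ck_on_Suc_open:
 assumes "open S"
 shows "Ck_on (Suc k) f S \<longleftrightarrow> f differentiable_on S & (ALL v. Ck_on k (dv v f) S)"
proof -
 have "Ck_on k (%z. frechet_derivative f (at z within S) v) S = Ck_on k (dv v f) S" for v
  by (rule Ck_on_cong) (use assms in \<open>auto simp: dv_def at_within_open[of _ S]\<close>)
 thus ?thesis by simp
qed

lemma Ck_on_Suc_intro:
 assumes "open S" "!!z. z : S ==> (f has_derivative f' z) (at z)"
  "!!v. Ck_on k (%z. f' z v) S"
 shows "Ck_on (Suc k) f S"
proof -
 have "f differentiable_on S"
  using assms(1,2) by (auto simp: differentiable_on_def differentiable_def at_within_open[of _ S])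
 moreover have "Ck_on k (dv v f) S" for v
  using assms(3)[of v] by (subst Ck_on_cong[of S _ "%z. f' z v"]) (auto simp: has_derivative_imp_dv[OF assms(2)])
 ultimately show ?thesis using Ck_on_Suc_open[OF assms(1)] by blast
qed

lemma Ck_on_SucE:
 assumes "open S" "Ck_on (Suc k) f S" "z : S"
 shows "(f has_derivative (%v. dv v f z)) (at z)"
 using assms unfolding dv_def
 by (metis Ck_on.simps(2) at_within_open differentiable_on_def eta_contract_eq frechet_derivative_works)

lemma Ck_on_Suc_dv: "open S ==> Ck_on (Suc k) f S ==> Ck_on k (dv v f) S"
 using Ck_on_Suc_open by blast

lemma Ck_on_const: "open S ==> Ck_on k (%z. c) S"
 by (induction k arbitrary: c) (auto intro!: Ck_on_Suc_intro[where f'="%_ _. 0"] simp del: Ck_on.simps(2))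

lemma Ck_on_linear:
 assumes "bounded_linear L" "open S" "Ck_on k f S"
 shows "Ck_on k (%z. L (f z)) S"
 using assms(3)
proof (induction k arbitrary: f)
 case 0
 thus ?case
  using assms(1) by (auto intro: bounded_linear.continuous_on)
next
 case (Suc k)
 show ?case
 proof (rule Ck_on_Suc_intro[OF assms(2)])
  show "((%z. L (f z)) has_derivative (%v. L (dv v f z))) (at z)" if "z : S" for z
   using Ck_on_SucE[OF assms(2) Suc.prems that] assms(1) by (rule bounded_linear.has_derivative[rotated])
  show "Ck_on k (%z. L (dv v f z)) S" for v
   using Suc assms(2) Ck_on_Suc_dv by blast
 qed
qed

lemma Ck_on_id: "open S ==> Ck_on k (%z. z) S"
proof (cases k)
 case (Suc m)
 assume "open S"
 thus ?thesis unfolding Suc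
  by (auto intro!: Ck_on_Suc_intro[where f'="%_ v. v"] Ck_on_const simp del: Ck_on.simps(2))
qed auto

lemma Ck_on_add:
 assumes "open S" "Ck_on k f S" "Ck_on k g S"
 shows "Ck_on k (%z. f z + g z) S"
 using assms(2,3)
proof (induction k arbitrary: f g)
 case 0
 thus ?case by (auto intro: continuous_on_add)
next
 case (Suc k)
 show ?case
  by (rule Ck_on_Suc_intro[OF assms(1), where f'="%z v. dv v f z + dv v g z"])
    (use Suc assms(1) in \<open>auto intro!: has_derivative_add Ck_on_SucE Suc.IH Ck_on_Suc_dv simp del: Ck_on.simps(2)\<close>)
qed

lemma Ck_on_bilinear:
 assumes B: "bounded_bilinear B" and S: "open S" and f: "Ck_on k f S" and g: "Ck_on k g S"
 shows "Ck_on k (%z. B (f z) (g z)) S"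
 using f g
proof (induction k arbitrary: f g)
 case 0
 thus ?case using bounded_bilinear.continuous_on[OF B] by auto
next
 case (Suc k)
 show ?case
 proof (rule Ck_on_Suc_intro[OF S, where f'="%z v. B (f z) (dv v g z) + B (dv v f z) (g z)"])
  show "((%z. B (f z) (g z)) has_derivative (%v. B (f z) (dv v g z) + B (dv v f z) (g z))) (at z)" if "z : S" for z
   using bounded_bilinear.FDERIV[OF B Ck_on_SucE[OF S Suc.prems(1) that] Ck_on_SucE[OF S Suc.prems(2) that]] .
  show "Ck_on k (%z. B (f z) (dv v g z) + B (dv v f z) (g z)) S" for v
   by (intro Ck_on_add Suc.IH S Ck_on_Suc_dv Suc.prems Ck_on_SucD[OF Suc.prems(1)] Ck_on_SucD[OF Suc.prems(2)])
 qed
qed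

lemma Ck_on_sum:
 assumes "open S" "!!i. i : I ==> Ck_on k (f i) S"
 shows "Ck_on k (%z. SUM i:I. f i z) S"
 using assms(2)
 by (induction I rule: infinite_finite_induct) (auto intro: Ck_on_const Ck_on_add assms(1))

text \<open>The chain rule differentiates \<open>g\<close> in the direction \<open>dv v f z\<close>,
  which moves with \<open>z\<close>. Expanding that direction in \<open>Basis\<close> leaves
  products of coefficients with derivatives of \<open>g\<close> in fixed directions, to which the
  induction applies; hence the Euclidean space in the middle.\<close>

lemma Ck_on_compose:
 fixes f :: "'e::real_normed_vector => 'f::euclidean_space" and g :: "'f => 'h::real_normed_vector"
 assumes S: "open S" and T: "open T" and f: "Ck_on k f S" and g: "Ck_on k g T" and fS: "f ` S \<subseteq> T"
 shows "Ck_on k (%z. g (f z)) S"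
 using f g
proof (induction k arbitrary: g)
 case 0
 thus ?case using fS by (auto intro: continuous_on_compose2)
next
 case (Suc k)
 have d: "((%z. g (f z)) has_derivative (%v. SUM b:Basis. (dv v f z \<bullet> b) *\<^sub>R dv b g (f z))) (at z)" if "z : S" for z
 proof -
  have fz: "f z : T" using that fS by auto
  have "((%z. g (f z)) has_derivative (%v. dv (dv v f z) g (f z))) (at z)"
   using has_derivative_compose[OF Ck_on_SucE[OF S Suc.prems(1) that] Ck_on_SucE[OF T Suc.prems(2) fz]] .
  moreover have "dv w g (f z) = (SUM b:Basis. (w \<bullet> b) *\<^sub>R dv b g (f z))" for w
  proof -
   interpret bounded_linear "%v. dv v g (f z)"
    using Ck_on_SucE[OF T Suc.prems(2) fz] by (rule has_derivative_bounded_linear)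
   have "dv w g (f z) = dv (SUM b:Basis. (w \<bullet> b) *\<^sub>R b) g (f z)"
    by (simp add: euclidean_representation)
   also have "... = (SUM b:Basis. (w \<bullet> b) *\<^sub>R dv b g (f z))"
    unfolding sum scaleR ..
   finally show ?thesis .
  qed
  ultimately show ?thesis by (rule back_subst[OF _ ext, where P="%D. (_ has_derivative D) _"])
 qed
 show ?case
 proof (rule Ck_on_Suc_intro[OF S d])
  show "Ck_on k (%z. SUM b:Basis. (dv v f z \<bullet> b) *\<^sub>R dv b g (f z)) S" for v
  proof (intro Ck_on_sum S Ck_on_bilinear[OF bounded_bilinear_scaleR])
   fix b :: 'f
   show "Ck_on k (%z. dv v f z \<bullet> b) S"
    by (rule Ck_on_linear[OF bounded_linear_inner_left S]) (rule Ck_on_Suc_dv[OF S Suc.prems(1)])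
   show "Ck_on k (%z. dv b g (f z)) S"
    by (rule Suc.IH) (use Suc.prems T in \<open>auto intro: Ck_on_SucD Ck_on_Suc_dv simp del: Ck_on.simps(2)\<close>)
  qed
 qed
qed

named_theorems smooth_intros

lemma smooth_on_cong:
 "(!!x. x : S ==> f x = g x) ==> smooth_on S f \<longleftrightarrow> smooth_on S g"
 unfolding smooth_on_def by (metis Ck_on_cong)

lemma smooth_on_dv: "open S ==> smooth_on S f ==> smooth_on S (dv v f)"
 unfolding smooth_on_def using Ck_on_Suc_dv by blast

lemma smooth_on_has_derivative:
 "open S ==> smooth_on S f ==> z : S ==> (f has_derivative (%v. dv v f z)) (at z)"
 unfolding smooth_on_def using Ck_on_SucE by blast

lemma smooth_continuous: "smooth_on S f ==> continuous_on S f"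
 unfolding smooth_on_def using Ck_on.simps(1) by blast

lemma smooth_on_subset: "smooth_on S f ==> open T ==> T \<subseteq> S ==> smooth_on T f"
 unfolding smooth_on_def using Ck_on_subset_open by blast

text \<open>Membership in a class that is closed under directional derivatives yields every order of
  differentiability at once. Holomorphic functions, exp and inverse powers are treated this
  way.\<close>

lemma smooth_on_coinduct:
 assumes "open S" "P f"
  and "!!f. P f ==> f differentiable_on S"
  and "!!f v. P f ==> EX g. P g & (ALL z:S. dv v f z = g z)"
 shows "smooth_on S f"
proof -
 have "Ck_on k f S" for k
  using assms(2)
 proof (induction k arbitrary: f)
  case 0
  thus ?case using assms(3) differentiable_imp_continuous_on by auto
 next
  case (Suc k)
  thus ?case
   unfolding Ck_on_Suc_open[OF assms(1)] using assms(3,4) Ck_on_cong by metis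
 qed
 thus ?thesis by (simp add: smooth_on_def)
qed

lemma smooth_on_local:
 assumes "open S" "!!z. z : S ==> EX T. open T & z : T & smooth_on T f"
 shows "smooth_on S f"
proof -
 have "Ck_on k f S" if "!!z. z : S ==> EX T. open T & z : T & Ck_on k f T" for k
  using that
 proof (induction k arbitrary: f)
  case 0
  hence "continuous (at z) f" if "z : S" for z
   using that by (metis Ck_on.simps(1) continuous_on_eq_continuous_at)
  thus ?case by (simp add: continuous_at_imp_continuous_on)
 next
  case (Suc k)
  have "(f has_derivative (%v. dv v f z)) (at z)" if "z : S" for z
   using Suc.prems[OF that] Ck_on_SucE by blast
  moreover have "Ck_on k (dv v f) S" for v
   by (rule Suc.IH) (meson Suc.prems Ck_on_Suc_dv)
  ultimately show ?case by (rule Ck_on_Suc_intro[OF assms(1)])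
 qed
 thus ?thesis using assms(2) unfolding smooth_on_def by blast
qed

lemma smooth_on_const [smooth_intros]: "open S ==> smooth_on S (%z. c)"
 by (simp add: smooth_on_def Ck_on_const)

lemma smooth_on_ident [smooth_intros]: "open S ==> smooth_on S (%z. z)"
 by (simp add: smooth_on_def Ck_on_id)

lemma smooth_on_linear: "bounded_linear L ==> open S ==> smooth_on S f ==> smooth_on S (%z. L (f z))"
 by (simp add: smooth_on_def Ck_on_linear)

lemma smooth_on_bilinear:
 "bounded_bilinear B ==> open S ==> smooth_on S f ==> smooth_on S g ==> smooth_on S (%z. B (f z) (g z))"
 by (simp add: smooth_on_def Ck_on_bilinear)

lemma smooth_on_compose:
 fixes f :: "'e::real_normed_vector => 'f::euclidean_space" and g :: "'f => 'h::real_normed_vector"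
 shows "open S ==> open T ==> smooth_on S f ==> smooth_on T g ==> f ` S \<subseteq> T ==> smooth_on S (%z. g (f z))"
 unfolding smooth_on_def using Ck_on_compose by blast

lemma smooth_on_add [smooth_intros]:
 "open S ==> smooth_on S f ==> smooth_on S g ==> smooth_on S (%z. f z + g z)"
 by (simp add: smooth_on_def Ck_on_add)

lemma smooth_on_minus [smooth_intros]: "open S ==> smooth_on S f ==> smooth_on S (%z. - f z)"
 by (rule smooth_on_linear[where L="%x. - x"]) (auto intro: bounded_linear_minus bounded_linear_ident)

lemma smooth_on_diff [smooth_intros]:
 "open S ==> smooth_on S f ==> smooth_on S g ==> smooth_on S (%z. f z - g z)"
 using smooth_on_add[OF _ _ smooth_on_minus, of S f g] by simp

lemma smooth_on_mult [smooth_intros]: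
 fixes f g :: "'e::real_normed_vector => 'f::real_normed_algebra"
 shows "open S ==> smooth_on S f ==> smooth_on S g ==> smooth_on S (%z. f z * g z)"
 using smooth_on_bilinear[OF bounded_bilinear_mult] .

lemma smooth_on_scaleR [smooth_intros]:
 "open S ==> smooth_on S f ==> smooth_on S g ==> smooth_on S (%z. f z *\<^sub>R g z)"
 using smooth_on_bilinear[OF bounded_bilinear_scaleR] .

lemma smooth_on_sum [smooth_intros]:
 "open S ==> (!!i. i : I ==> smooth_on S (f i)) ==> smooth_on S (%z. SUM i:I. f i z)"
 by (simp add: smooth_on_def Ck_on_sum)

lemma smooth_on_prod [smooth_intros]:
 fixes f :: "'i => 'e::real_normed_vector => 'f::real_normed_field"
 assumes "open S" "!!i. i : I ==> smooth_on S (f i)"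
 shows "smooth_on S (%z. \<Prod>i\<in>I. f i z)"
 using assms(2)
 by (induction I rule: infinite_finite_induct) (auto intro: smooth_intros assms(1))

lemma smooth_on_of_real [smooth_intros]:
 "open S ==> smooth_on S f ==> smooth_on S (%z. of_real (f z) :: complex)"
 by (rule smooth_on_linear[OF bounded_linear_of_real])

lemma smooth_on_cnj [smooth_intros]: "open S ==> smooth_on S f ==> smooth_on S (%z. cnj (f z))"
 by (rule smooth_on_linear[OF bounded_linear_cnj])

lemma smooth_on_Re [smooth_intros]: "open S ==> smooth_on S f ==> smooth_on S (%z. Re (f z))"
 by (rule smooth_on_linear[OF bounded_linear_Re])

lemma smooth_on_nth [smooth_intros]:
 "open S ==> smooth_on S f ==> smooth_on S (%z. f z $ i)"
 by (rule smooth_on_linear[OF bounded_linear_vec_nth])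

lemma smooth_on_vec:
 fixes f :: "'e::real_normed_vector => 'f::euclidean_space ^ 'n"
 assumes "open S" "!!i. smooth_on S (%z. f z $ i)"
 shows "smooth_on S f"
proof -
 have bl: "bounded_linear (axis i :: 'f => 'f ^ 'n)" for i
  unfolding linear_conv_bounded_linear[symmetric] by (auto intro!: linearI simp: axis_def vec_eq_iff)
 have "f = (%z. SUM i:UNIV. axis i (f z $ i))"
  by (auto simp: vec_eq_iff axis_def fun_eq_iff if_distrib cong: if_cong)
 moreover have "smooth_on S (%z. SUM i:UNIV. axis i (f z $ i))"
  by (intro smooth_on_sum smooth_on_linear[OF bl] assms)
 ultimately show ?thesis by simp
qed

text \<open>In dimension one \<open>dv v f\<close> is \<open>v\<close> times the derivative, so
  closure under scaling takes care of all directions.\<close>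

lemma smooth_on_real_coinduct:
 fixes g :: "real => real"
 assumes "open S" "P g"
  and "!!f. P f ==> EX f'. P f' & (ALL x:S. (f has_real_derivative f' x) (at x))"
  and scale: "!!f c. P f ==> P (%x. c * f x)"
 shows "smooth_on S g"
proof (rule smooth_on_coinduct[where P=P])
 fix f assume "P f"
 then obtain f' where f': "P f'" "!!x. x : S ==> (f has_real_derivative f' x) (at x)"
  using assms(3) by blast
 show "f differentiable_on S"
  using f'(2) assms(1) unfolding differentiable_on_def differentiable_def has_field_derivative_def
  by (metis at_within_open)
 show "EX g. P g & (ALL z:S. dv v f z = g z)" for v
  by (rule exI[of _ "%x. v * f' x"])
    (use f' scale in \<open>auto simp: has_field_derivative_def intro!: has_derivative_imp_dv[THEN trans]\<close>)
qed (use assms in auto)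

lemma smooth_on_exp_real: "smooth_on UNIV (exp :: real => real)"
proof (rule smooth_on_real_coinduct[where P="%f. EX c. f = (%x. c * exp x)"])
 show "EX c. exp = (%x::real. c * exp x)" by (rule exI[of _ 1]) simp
 fix f :: "real => real" assume "EX c. f = (%x. c * exp x)"
 then obtain c where f: "f = (%x. c * exp x)" by blast
 have "(f has_real_derivative c * exp x) (at x)" for x
  unfolding f by (auto intro!: derivative_eq_intros)
 with f show "EX f'. (EX c. f' = (%x. c * exp x)) & (ALL x:UNIV. (f has_real_derivative f' x) (at x))"
  by blast
 show "EX c'. (%x. d * f x) = (%x. c' * exp x)" for d
  by (rule exI[of _ "d * c"]) (simp add: f mult.assoc)
qed simp

lemma smooth_on_exp [smooth_intros]:
 fixes f :: "'e::real_normed_vector => real"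
 shows "open S ==> smooth_on S f ==> smooth_on S (%z. exp (f z))"
 using smooth_on_compose[OF _ open_UNIV _ smooth_on_exp_real] by auto

lemma smooth_on_inverse_power_real: "smooth_on (-{0}) (%x::real. inverse x ^ n)"
proof (rule smooth_on_real_coinduct[where P="%f. EX c n. f = (%x. c * inverse x ^ n)"])
 fix f :: "real => real" assume "EX c n. f = (%x. c * inverse x ^ n)"
 then obtain c n where f: "f = (%x. c * inverse x ^ n)" by blast
 have "(f has_real_derivative (- real n * c) * inverse x ^ (Suc n)) (at x)" if "x : -{0}" for x
 proof -
  have "c * (real n * (- (inverse x ^ Suc (Suc 0)) * inverse x ^ (n - Suc 0))) = (- real n * c) * inverse x ^ (Suc n)"
   by (cases n) (auto simp: algebra_simps)
  moreover have "((%x. c * inverse x ^ n) has_real_derivative c * (real n * (- (inverse x ^ Suc (Suc 0)) * inverse x ^ (n - Suc 0)))) (at x)"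
   using that by (intro DERIV_cmult DERIV_power DERIV_inverse) auto
  ultimately show ?thesis unfolding f by metis
 qed
 thus "EX f'. (EX c n. f' = (%x. c * inverse x ^ n)) & (ALL x:- {0}. (f has_real_derivative f' x) (at x))"
  by (intro exI[of _ "%x. (- real n * c) * inverse x ^ (Suc n)"]) blast
next
 show "EX c n'. (%x::real. inverse x ^ n) = (%x. c * inverse x ^ n')"
  by (intro exI[of _ 1] exI[of _ n]) auto
next
 fix f :: "real => real" and d assume "EX c n. f = (%x. c * inverse x ^ n)"
 then obtain c n where "f = (%x. c * inverse x ^ n)" by blast
 thus "EX c n. (%x. d * f x) = (%x. c * inverse x ^ n)"
  by (intro exI[of _ "d * c"] exI[of _ n]) (simp add: mult.assoc)
qed auto

lemma smooth_on_inverse_real [smooth_intros]: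
 fixes f :: "'e::real_normed_vector => real"
 assumes "open S" "smooth_on S f" "!!z. z : S ==> f z ~= 0"
 shows "smooth_on S (%z. inverse (f z))"
proof -
 have "open (- {0::real})" by auto
 from smooth_on_compose[OF assms(1) this assms(2) smooth_on_inverse_power_real[of 1]] show ?thesis
  using assms(3) by (force simp: image_iff)
qed

lemma smooth_on_divide_real [smooth_intros]:
 fixes f g :: "'e::real_normed_vector => real"
 assumes "open S" "smooth_on S f" "smooth_on S g" "!!z. z : S ==> g z ~= 0"
 shows "smooth_on S (%z. f z / g z)"
 unfolding divide_inverse by (intro smooth_intros assms)

lemma smooth_on_inverse_complex [smooth_intros]:
 fixes f :: "'e::real_normed_vector => complex"
 assumes "open S" "smooth_on S f" "!!z. z : S ==> f z ~= 0"
 shows "smooth_on S (%z. inverse (f z))"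
proof -
 have "inverse w = cnj w * of_real (inverse (Re (w * cnj w)))" if "w ~= 0" for w
 proof -
  have n: "w * cnj w = of_real ((norm w)^2)"
   by (rule complex_norm_square[symmetric])
  have "w * (cnj w * of_real (inverse (Re (w * cnj w)))) = of_real ((norm w)^2 * inverse ((norm w)^2))"
   unfolding mult.assoc[symmetric] n by simp
  also have "... = 1" using that by simp
  finally show ?thesis by (rule inverse_unique)
 qed
 hence "smooth_on S (%z. inverse (f z)) \<longleftrightarrow> smooth_on S (%z. cnj (f z) * of_real (inverse (Re (f z * cnj (f z)))))"
  using assms(3) by (intro smooth_on_cong) auto
 moreover have "smooth_on S (%z. cnj (f z) * of_real (inverse (Re (f z * cnj (f z)))))"
  by (intro smooth_intros assms) (use assms(3) in \<open>simp add: complex_mult_cnj sum_power2_eq_zero_iff complex_eq_iff\<close>)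
 ultimately show ?thesis by simp
qed

lemma smooth_on_ln_real: "smooth_on {0<..} (ln :: real => real)"
 unfolding smooth_on_def
proof
 fix k
 show "Ck_on k (ln :: real => real) {0<..}"
 proof (cases k)
  case 0
  thus ?thesis by (auto intro!: continuous_intros)
 next
  case (Suc m)
  show ?thesis unfolding Suc
  proof (rule Ck_on_Suc_intro[where f'="%x v. v * inverse x"])
   show "Ck_on m (%z. v * inverse z) {0<..}" for v :: real
    using smooth_on_mult[of "{0<..}" "%_. v", OF _ _ smooth_on_inverse_real[of "{0<..}" "%x. x"]]
    by (simp add: smooth_on_def Ck_on_const Ck_on_id)
   show "(ln has_derivative (%v. v * inverse z)) (at z)" if "z : {0<..}" for z :: real
    using that by (auto intro!: derivative_eq_intros simp: divide_inverse)
  qed auto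
 qed
qed

lemma smooth_on_ln [smooth_intros]:
 fixes f :: "'e::real_normed_vector => real"
 assumes "open S" "smooth_on S f" "!!z. z : S ==> f z > 0"
 shows "smooth_on S (%z. ln (f z))"
 using smooth_on_compose[OF assms(1) _ assms(2) smooth_on_ln_real] assms(3) by auto

lemma dv_path:
 assumes "open S" "smooth_on S f" "x + s *\<^sub>R v : S"
 shows "((%s. f (x + s *\<^sub>R v)) has_vector_derivative dv v f (x + s *\<^sub>R v)) (at s)"
proof -
 have 1: "(f has_derivative (%w. dv w f (x + s *\<^sub>R v))) (at (x + s *\<^sub>R v))"
  using smooth_on_has_derivative assms by blast
 have 2: "((%s. x + s *\<^sub>R v) has_derivative (%h. h *\<^sub>R v)) (at s)"
  by (auto intro!: derivative_eq_intros)
 interpret bounded_linear "%w. dv w f (x + s *\<^sub>R v)"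
  using 1 by (rule has_derivative_bounded_linear)
 show ?thesis
  using has_derivative_compose[OF 2 1] by (simp add: has_vector_derivative_def scaleR)
qed

lemma dv_linear:
 assumes "open S" "smooth_on S f" "z : S"
 shows "bounded_linear (%v. dv v f z)"
 using smooth_on_has_derivative[OF assms] by (rule has_derivative_bounded_linear)

lemma dv_linear_comp:
 assumes "bounded_linear L" "open S" "smooth_on S f" "z : S"
 shows "dv v (%z. L (f z)) z = L (dv v f z)"
 by (rule has_derivative_imp_dv) (rule bounded_linear.has_derivative[OF assms(1) smooth_on_has_derivative[OF assms(2-)]])

section \<open>Symmetry of second derivatives\<close>

lemma second_difference_mvt:
 fixes f :: "'e::real_normed_vector => real"
 assumes S: "open S" and f: "smooth_on S f" and r: "r > 0"
  and sub: "!!a b. 0 <= a ==> a <= r ==> 0 <= b ==> b <= r ==> z + a *\<^sub>R v + b *\<^sub>R w : S"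
 shows "EX a b. 0 < a & a < r & 0 < b & b < r &
  f (z + r *\<^sub>R v + r *\<^sub>R w) - f (z + r *\<^sub>R v) - f (z + r *\<^sub>R w) + f z
   = r * r * dv w (dv v f) (z + a *\<^sub>R v + b *\<^sub>R w)"
proof -
 let ?g = "%s. f (z + s *\<^sub>R v + r *\<^sub>R w) - f (z + s *\<^sub>R v)"
 have "EX a>0. a < r & ?g r - ?g 0 = (r - 0) * (dv v f (z + a *\<^sub>R v + r *\<^sub>R w) - dv v f (z + a *\<^sub>R v))"
 proof (rule MVT2[OF r])
  fix s assume s: "0 <= s" "s <= r"
  have 1: "((%s. f ((z + r *\<^sub>R w) + s *\<^sub>R v)) has_vector_derivative dv v f ((z + r *\<^sub>R w) + s *\<^sub>R v)) (at s)"
   by (rule dv_path[OF S f]) (use sub[of s r] s r in \<open>auto simp: algebra_simps\<close>)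
  have 2: "((%s. f (z + s *\<^sub>R v)) has_vector_derivative dv v f (z + s *\<^sub>R v)) (at s)"
   by (rule dv_path[OF S f]) (use sub[of s 0] s r in \<open>auto simp: algebra_simps\<close>)
  from 1 2 show "(?g has_real_derivative dv v f (z + s *\<^sub>R v + r *\<^sub>R w) - dv v f (z + s *\<^sub>R v)) (at s)"
   unfolding has_real_derivative_iff_has_vector_derivative
   by (auto intro!: has_vector_derivative_diff simp: algebra_simps)
 qed
 then obtain a where a: "0 < a" "a < r" and
  ea: "?g r - ?g 0 = r * (dv v f (z + a *\<^sub>R v + r *\<^sub>R w) - dv v f (z + a *\<^sub>R v))" by auto
 have "EX b>0. b < r & dv v f (z + a *\<^sub>R v + r *\<^sub>R w) - dv v f (z + a *\<^sub>R v + 0 *\<^sub>R w)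
   = (r - 0) * dv w (dv v f) (z + a *\<^sub>R v + b *\<^sub>R w)"
 proof (rule MVT2[OF r])
  fix s assume s: "0 <= s" "s <= r"
  show "((%s. dv v f (z + a *\<^sub>R v + s *\<^sub>R w)) has_real_derivative dv w (dv v f) (z + a *\<^sub>R v + s *\<^sub>R w)) (at s)"
   unfolding has_real_derivative_iff_has_vector_derivative
   by (rule dv_path[OF S smooth_on_dv[OF S f]]) (use sub[of a s] a s in auto)
 qed
 then obtain b where b: "0 < b" "b < r" and
  eb: "dv v f (z + a *\<^sub>R v + r *\<^sub>R w) - dv v f (z + a *\<^sub>R v) = r * dv w (dv v f) (z + a *\<^sub>R v + b *\<^sub>R w)" by auto
 have "f (z + r *\<^sub>R v + r *\<^sub>R w) - f (z + r *\<^sub>R v) - f (z + r *\<^sub>R w) + f z = ?g r - ?g 0"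
  by simp
 also have "... = r * r * dv w (dv v f) (z + a *\<^sub>R v + b *\<^sub>R w)"
  unfolding ea eb by simp
 finally show ?thesis using a b by blast
qed

text \<open>The mixed second difference over a parallelogram is symmetric in \<open>v\<close> and
  \<open>w\<close>, and by \<open>second_difference_mvt\<close> it equals \<open>r * r\<close> times
  either mixed derivative at some point of the parallelogram. Continuity at \<open>z\<close> forces
  the two to agree as the parallelogram shrinks.\<close>

lemma dv_commute_real:
 fixes f :: "'e::real_normed_vector => real"
 assumes S: "open S" and f: "smooth_on S f" and z: "z : S"
 shows "dv v (dv w f) z = dv w (dv v f) z"
proof (rule ccontr)
 assume ne: "dv v (dv w f) z ~= dv w (dv v f) z"
 define e where "e = \<bar>dv v (dv w f) z - dv w (dv v f) z\<bar> / 2"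
 have e: "e > 0" using ne by (simp add: e_def)
 have c1: "isCont (dv v (dv w f)) z" and c2: "isCont (dv w (dv v f)) z"
  using smooth_continuous[OF smooth_on_dv[OF S smooth_on_dv[OF S f]]] z
  by (auto simp: continuous_on_eq_continuous_at[OF S])
 obtain d1 where d1: "d1 > 0" "!!x. dist x z < d1 ==> dist (dv v (dv w f) x) (dv v (dv w f) z) < e"
  using c1 e unfolding continuous_at_eps_delta dist_norm by (metis)
 obtain d2 where d2: "d2 > 0" "!!x. dist x z < d2 ==> dist (dv w (dv v f) x) (dv w (dv v f) z) < e"
  using c2 e unfolding continuous_at_eps_delta dist_norm by (metis)
 obtain d3 where d3: "d3 > 0" "ball z d3 \<subseteq> S" using S z openE by blast
 define d where "d = min d1 (min d2 d3)"
 \<comment> \<open>Keeps the whole parallelogram spanned by \<open>r\<close> times \<open>v\<close>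
   and \<open>r\<close> times \<open>w\<close> within distance \<open>d\<close> of \<open>z\<close>;
   the summand 1 covers the case that both vectors vanish.\<close>
 define r where "r = d / (2 * (norm v + norm w + 1))"
 have d: "d > 0" using d1 d2 d3 by (auto simp: d_def)
 hence r: "r > 0" by (auto simp: r_def intro!: divide_pos_pos add_nonneg_pos)
 have close: "dist (z + a *\<^sub>R v + b *\<^sub>R w) z < d" if "0 <= a" "a <= r" "0 <= b" "b <= r" for a b
 proof -
  have "dist (z + a *\<^sub>R v + b *\<^sub>R w) z <= a * norm v + b * norm w"
   using that norm_triangle_ineq[of "a *\<^sub>R v" "b *\<^sub>R w"] by (simp add: dist_norm)
  also have "... <= r * norm v + r * norm w"
   using that by (intro add_mono mult_right_mono) auto
  also have "... = d * ((norm v + norm w) / (2 * (norm v + norm w + 1)))" by (simp add: r_def algebra_simps add_divide_distrib)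
  also have "... < d * 1"
   using d norm_ge_zero[of v] norm_ge_zero[of w] by (intro mult_strict_left_mono) (auto simp: divide_less_eq add_nonneg_pos)
  finally show ?thesis by simp
 qed
 have in_S: "z + a *\<^sub>R v + b *\<^sub>R w : S" if "0 <= a" "a <= r" "0 <= b" "b <= r" for a b
  using close[OF that] d3 by (auto simp: d_def dist_commute subset_iff)
 have in_S': "z + a *\<^sub>R w + b *\<^sub>R v : S" if "0 <= a" "a <= r" "0 <= b" "b <= r" for a b
  using in_S[of b a] that by (simp add: algebra_simps)
 obtain a b where ab: "0 < a" "a < r" "0 < b" "b < r"
  "f (z + r *\<^sub>R v + r *\<^sub>R w) - f (z + r *\<^sub>R v) - f (z + r *\<^sub>R w) + f z = r * r * dv w (dv v f) (z + a *\<^sub>R v + b *\<^sub>R w)"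
  using second_difference_mvt[OF S f r in_S] by blast
 obtain a' b' where ab': "0 < a'" "a' < r" "0 < b'" "b' < r"
  "f (z + r *\<^sub>R w + r *\<^sub>R v) - f (z + r *\<^sub>R w) - f (z + r *\<^sub>R v) + f z = r * r * dv v (dv w f) (z + a' *\<^sub>R w + b' *\<^sub>R v)"
  using second_difference_mvt[OF S f r in_S'] by blast
 have comm: "z + r *\<^sub>R w + r *\<^sub>R v = z + r *\<^sub>R v + r *\<^sub>R w" "z + a' *\<^sub>R w + b' *\<^sub>R v = z + b' *\<^sub>R v + a' *\<^sub>R w"
  by (auto simp: algebra_simps)
 have "r * r * dv w (dv v f) (z + a *\<^sub>R v + b *\<^sub>R w) = r * r * dv v (dv w f) (z + b' *\<^sub>R v + a' *\<^sub>R w)"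
  using ab(5) ab'(5) unfolding comm by linarith
 hence eq: "dv w (dv v f) (z + a *\<^sub>R v + b *\<^sub>R w) = dv v (dv w f) (z + b' *\<^sub>R v + a' *\<^sub>R w)"
  using r by simp
 have "dist (dv w (dv v f) (z + a *\<^sub>R v + b *\<^sub>R w)) (dv w (dv v f) z) < e"
  using close[of a b] ab by (intro d2(2)) (auto simp: d_def)
 moreover have "dist (dv v (dv w f) (z + b' *\<^sub>R v + a' *\<^sub>R w)) (dv v (dv w f) z) < e"
  using close[of b' a'] ab' by (intro d1(2)) (auto simp: d_def)
 ultimately show False unfolding eq e_def dist_real_def
  by (smt (verit, best) field_sum_of_halves)
qed

lemma dv_commute:
 fixes f :: "'e::real_normed_vector => 'f::euclidean_space"
 assumes S: "open S" and f: "smooth_on S f" and z: "z : S"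
 shows "dv v (dv w f) z = dv w (dv v f) z"
proof (rule euclidean_eqI)
 fix b :: 'f
 have bl: "bounded_linear (%x. x \<bullet> b)" by (rule bounded_linear_inner_left)
 have eq: "dv v (dv w f) z \<bullet> b = dv v (dv w (%x. f x \<bullet> b)) z" for v w
 proof -
  have "dv v (dv w (%x. f x \<bullet> b)) z = dv v (%x. dv w f x \<bullet> b) z"
   by (rule dv_cong_open[OF S z]) (rule dv_linear_comp[OF bl S f])
  also have "... = dv v (dv w f) z \<bullet> b"
   by (rule dv_linear_comp[OF bl S smooth_on_dv[OF S f] z])
  finally show ?thesis by simp
 qed
 show "dv v (dv w f) z \<bullet> b = dv w (dv v f) z \<bullet> b"
  unfolding eq by (rule dv_commute_real[OF S smooth_on_linear[OF bl S f] z])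
qed

lemma dv_const: "dv v (%z. c) z = 0"
 by (rule has_derivative_imp_dv) simp

lemma dv_ident: "dv v (%z. z) z = v"
 by (rule has_derivative_imp_dv) simp

lemma dv_add:
 assumes "open S" "smooth_on S f" "smooth_on S g" "z : S"
 shows "dv v (%z. f z + g z) z = dv v f z + dv v g z"
 by (rule has_derivative_imp_dv) (intro has_derivative_add smooth_on_has_derivative[OF assms(1)] assms)

lemma dv_minus:
 assumes "open S" "smooth_on S f" "z : S"
 shows "dv v (%z. - f z) z = - dv v f z"
 by (rule has_derivative_imp_dv) (intro has_derivative_minus smooth_on_has_derivative[OF assms(1)] assms)

lemma dv_diff:
 assumes "open S" "smooth_on S f" "smooth_on S g" "z : S"
 shows "dv v (%z. f z - g z) z = dv v f z - dv v g z"
 by (rule has_derivative_imp_dv) (intro has_derivative_diff smooth_on_has_derivative[OF assms(1)] assms)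

lemma dv_mult:
 fixes f g :: "'e::real_normed_vector => 'f::real_normed_algebra"
 assumes "open S" "smooth_on S f" "smooth_on S g" "z : S"
 shows "dv v (%z. f z * g z) z = f z * dv v g z + dv v f z * g z"
 by (rule has_derivative_imp_dv) (intro has_derivative_mult smooth_on_has_derivative[OF assms(1)] assms)

lemma dv_sum:
 assumes "open S" "!!i. i : I ==> smooth_on S (f i)" "z : S"
 shows "dv v (%z. SUM i:I. f i z) z = (SUM i:I. dv v (f i) z)"
 by (rule has_derivative_imp_dv) (intro has_derivative_sum smooth_on_has_derivative[OF assms(1)] assms)

lemma dv_compose:
 assumes "open S" "open T" "smooth_on S f" "smooth_on T g" "f z : T" "z : S"
 shows "dv v (%z. g (f z)) z = dv (dv v f z) g (f z)"
 by (rule has_derivative_imp_dv)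
   (rule has_derivative_compose[OF smooth_on_has_derivative[OF assms(1,3,6)] smooth_on_has_derivative[OF assms(2,4,5)]])

lemma dv_compose_real:
 fixes f :: "'e::real_normed_vector => real" and g :: "real => real"
 assumes "open S" "smooth_on S f" "z : S" "(g has_real_derivative g') (at (f z))"
 shows "dv v (%z. g (f z)) z = g' * dv v f z"
 using has_derivative_compose[OF smooth_on_has_derivative[OF assms(1-3)] assms(4)[unfolded has_field_derivative_def]]
 by (rule has_derivative_imp_dv)

lemma dv_of_real:
 assumes "open S" "smooth_on S f" "z : S"
 shows "dv v (%z. of_real (f z) :: complex) z = of_real (dv v f z)"
 by (rule dv_linear_comp[OF bounded_linear_of_real assms])

lemma dv_cnj:
 assumes "open S" "smooth_on S f" "z : S"
 shows "dv v (%z. cnj (f z)) z = cnj (dv v f z)"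
 by (rule dv_linear_comp[OF bounded_linear_cnj assms])

section \<open>Functions of a parameter and a point\<close>

lemma open_slice: "open S ==> open {z. (t, z) : S}"
 using open_vimage[of S "%z. (t, z)", OF _ continuous_on_Pair[OF continuous_on_const continuous_on_id]]
 by (simp add: vimage_def)

lemma smooth_on_slice:
 fixes F :: "'p::euclidean_space \<times> 'e::euclidean_space => 'f::real_normed_vector"
 assumes S: "open S" and F: "smooth_on S F"
 shows "smooth_on {z. (t, z) : S} (%z. F (t, z))"
proof (rule smooth_on_compose[OF open_slice[OF S] S _ F])
 have "smooth_on {z. (t, z) : S} (%z. (t, 0) + (0, z))"
  using open_slice[OF S, of t]
  by (intro smooth_intros smooth_on_linear[where L="%z. (0, z)" and f="%z. z"]) (auto intro: bounded_linear_intros bounded_linear_Pair bounded_linear_zero bounded_linear_ident)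
 thus "smooth_on {z. (t, z) : S} (Pair t)" by simp
qed auto

lemma dv_slice:
 assumes S: "open S" and F: "smooth_on S F" and z: "(t, z) : S"
 shows "dv v (%z. F (t, z)) z = dv (0, v) F (t, z)"
proof (rule has_derivative_imp_dv)
 have "((%z. (t, z)) has_derivative (%v. (0, v))) (at z)"
  by (auto intro!: derivative_eq_intros)
 from has_derivative_compose[OF this smooth_on_has_derivative[OF S F z]]
 show "((%z. F (t, z)) has_derivative (%v. dv (0, v) F (t, z))) (at z)" .
qed

lemma dv_time_slice:
 assumes S: "open S" and F: "smooth_on S F" and z: "(t, z) : S"
 shows "((%t. F (t, z)) has_vector_derivative dv (1, 0) F (t, z)) (at t)"
proof -
 have "((%t. (t, z)) has_derivative (%h. (h, 0))) (at t)"
  by (auto intro!: derivative_eq_intros)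
 from has_derivative_compose[OF this smooth_on_has_derivative[OF S F z]]
 have 1: "((%t. F (t, z)) has_derivative (%h. dv (h, 0) F (t, z))) (at t)" .
 interpret bounded_linear "%v. dv v F (t, z)" by (rule dv_linear[OF S F z])
 have "(%h. dv (h, 0) F (t, z)) = (%h. h *\<^sub>R dv (1, 0) F (t, z))"
 proof
  fix h
  show "dv (h, 0) F (t, z) = h *\<^sub>R dv (1, 0) F (t, z)"
   using scaleR[of h "(1,0)"] unfolding scaleR_prod_def by simp
 qed
 from 1[unfolded this] show ?thesis unfolding has_vector_derivative_def .
qed

section \<open>Hermitian matrices\<close>

definition sesq :: "complex^'n::finite^'n => complex^'n => complex^'n => complex" where
 "sesq A v w = (SUM j:UNIV. SUM k:UNIV. A $ j $ k * v $ j * cnj (w $ k))"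

abbreviation "qf A v \<equiv> Re (sesq A v v)"

definition cjm :: "complex^'n^'m => complex^'n^'m" where
 "cjm A = (\<chi> i j. cnj (A $ i $ j))"

text \<open>The coefficients of a (1,1)-form after a linear change of coordinates \<open>E\<close>,
  equally the Gram matrix of the columns of \<open>E\<close>. The transpose stands on the left
  because \<open>sesq\<close> is linear in its first argument.\<close>

definition cong :: "complex^'n::finite^'n => complex^'n^'n => complex^'n^'n" where
 "cong E A = transpose E ** A ** cjm E"

definition herm :: "complex^'n^'n => bool" where
 "herm A \<longleftrightarrow> (ALL j k. A $ k $ j = cnj (A $ j $ k))"

definition pd :: "complex^'n::finite^'n => bool" where
 "pd A \<longleftrightarrow> herm A & (ALL v. v ~= 0 \<longrightarrow> 0 < qf A v)"

definition diagm :: "('n => real) => complex^'n^'n" where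
 "diagm \<mu> = (\<chi> i j. if i = j then of_real (\<mu> i) else 0)"

text \<open>The trace of the form \<open>Q\<close> in a basis that is orthonormal for
  \<open>A\<close>. With a Kaehler metric \<open>A\<close> and a complex Hessian \<open>Q\<close> it
  is the complex Laplacian.\<close>

definition tr :: "complex^'n::finite^'n => complex^'n^'n => real" where
 "tr A Q = Re (trace (matrix_inv A ** Q))"

lemma form_value_sesq: "form_value A v = qf A v"
 by (simp add: form_value_def sesq_def)

lemma Re_complex_of_real_mult: "Re (of_real r * z) = r * Re z"
 by simp

lemma sesq_add1: "sesq A (v + v') w = sesq A v w + sesq A v' w"
 by (simp add: sesq_def algebra_simps sum.distrib)
lemma sesq_add2: "sesq A v (w + w') = sesq A v w + sesq A v w'"
 by (simp add: sesq_def algebra_simps sum.distrib)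
lemma sesq_scale1: "sesq A (c *s v) w = c * sesq A v w"
 by (simp add: sesq_def sum_distrib_left mult_ac)
lemma sesq_scale2: "sesq A v (c *s w) = cnj c * sesq A v w"
 by (simp add: sesq_def sum_distrib_left mult_ac)
lemma sesq_zero1 [simp]: "sesq A 0 w = 0" and sesq_zero2 [simp]: "sesq A v 0 = 0"
 by (simp_all add: sesq_def)
lemma sesq_sum1: "sesq A (SUM i:I. x i) w = (SUM i:I. sesq A (x i) w)"
 by (induction I rule: infinite_finite_induct) (auto simp: sesq_add1)
lemma sesq_sum2: "sesq A v (SUM i:I. x i) = (SUM i:I. sesq A v (x i))"
 by (induction I rule: infinite_finite_induct) (auto simp: sesq_add2)
lemma sesq_matrix_add: "sesq (A + B) v w = sesq A v w + sesq B v w"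
 by (simp add: sesq_def algebra_simps sum.distrib)
lemma sesq_matrix_diff: "sesq (A - B) v w = sesq A v w - sesq B v w"
 by (simp add: sesq_def algebra_simps sum_subtractf)
lemma sesq_matrix_scaleR: "sesq (c *\<^sub>R A) v w = of_real c * sesq A v w"
 by (simp add: sesq_def sum_distrib_left mult_ac) (simp add: scaleR_conv_of_real mult_ac)

lemma sesq_axis: "sesq A (axis j a) (axis k b) = A $ j $ k * a * cnj b"
proof -
 have "sesq A (axis j a) (axis k b) = (SUM p:UNIV. if p = j then SUM q:UNIV. if q = k then A $ p $ q * a * cnj b else 0 else 0)"
  unfolding sesq_def axis_def by (intro sum.cong refl) (auto intro!: sum.neutral sum.cong simp del: sum.delta)
 thus ?thesis by simp
qed

lemma sesq_mat1: "sesq (mat 1) v w = (SUM j:UNIV. v $ j * cnj (w $ j))"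
 unfolding sesq_def mat_def by (simp add: if_distrib[where f="%x. x * _"] cong: if_cong)

lemma Re_sesq_mat1: "qf (mat 1) v = (norm v)^2"
proof -
 have "sesq (mat 1) v v = of_real (SUM j:UNIV. (cmod (v $ j))^2)"
  unfolding sesq_mat1 of_real_sum by (intro sum.cong refl complex_norm_square[symmetric])
 moreover have "(norm v)^2 = (SUM j:UNIV. (cmod (v $ j))^2)"
  unfolding norm_vec_def L2_set_def by (simp add: sum_nonneg)
 ultimately show ?thesis by simp
qed

lemma herm_sesq: "herm A ==> sesq A w v = cnj (sesq A v w)"
proof -
 assume A: "herm A"
 have A': "cnj (A $ j $ k) = A $ k $ j" for j k using A unfolding herm_def by metis
 have "cnj (sesq A v w) = (SUM j:UNIV. SUM k:UNIV. A $ k $ j * w $ k * cnj (v $ j))"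
  unfolding sesq_def by (simp add: A' mult_ac)
 also have "... = sesq A w v" unfolding sesq_def by (rule sum.swap)
 finally show ?thesis by simp
qed

lemma herm_sesq_real: "herm A ==> sesq A v v = of_real (qf A v)"
 using herm_sesq[of A v v] by (metis Reals_cnj_iff of_real_Re)

lemma herm_add: "herm A ==> herm B ==> herm (A + B)"
 unfolding herm_def vector_add_component complex_cnj_add by metis
lemma herm_diff: "herm A ==> herm B ==> herm (A - B)"
 unfolding herm_def vector_minus_component complex_cnj_diff by metis
lemma herm_scaleR: "herm A ==> herm (c *\<^sub>R A)"
 unfolding herm_def vector_scaleR_component complex_cnj_scaleR by metis
lemma herm_mat1: "herm (mat 1)"
 by (auto simp: herm_def mat_def)

lemma pd_mat1: "pd (mat 1)"
 by (auto simp: pd_def herm_mat1 Re_sesq_mat1)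

lemma pd_convex:
 assumes "pd A" "pd B" "0 <= s" "s <= 1"
 shows "pd ((1 - s) *\<^sub>R A + s *\<^sub>R B)"
proof -
 have "0 < (1 - s) * qf A v + s * qf B v" if "v ~= 0" for v
 proof (cases "s = 0")
  case False
  thus ?thesis using assms that
   by (intro add_nonneg_pos mult_nonneg_nonneg mult_pos_pos) (auto simp: pd_def less_imp_le)
 qed (use assms that in \<open>auto simp: pd_def\<close>)
 thus ?thesis using assms by (auto simp: pd_def herm_add herm_scaleR sesq_matrix_add sesq_matrix_scaleR)
qed

lemma cong_nth: "cong E A $ a $ b = sesq A (column a E) (column b E)"
 by (simp add: cong_def sesq_def matrix_matrix_mult_def transpose_def cjm_def column_def
   sum_distrib_left sum_distrib_right mult_ac) (subst sum.swap, simp)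

lemma sesq_matrix_vector: "sesq A (E *v x) (E *v y) = (SUM i:UNIV. SUM j:UNIV. x $ i * cnj (y $ j) * sesq A (column i E) (column j E))"
proof -
 have "sesq A (E *v x) (E *v y) = (SUM i:UNIV. x $ i * (SUM j:UNIV. cnj (y $ j) * sesq A (column i E) (column j E)))"
  unfolding matrix_mult_sum sesq_sum1 sesq_scale1 unfolding sesq_sum2 sesq_scale2 ..
 thus ?thesis by (simp add: sum_distrib_left mult.assoc)
qed

lemma sesq_cong: "sesq (cong E A) x y = sesq A (E *v x) (E *v y)"
 unfolding sesq_matrix_vector unfolding sesq_def[of "cong E A"] cong_nth by (simp add: mult_ac)

lemma cjm_mult: "cjm (A ** B) = cjm A ** cjm B"
 by (simp add: cjm_def matrix_matrix_mult_def vec_eq_iff)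

lemma cong_cong: "cong F (cong E A) = cong (E ** F) A"
 by (simp add: cong_def matrix_transpose_mul cjm_mult matrix_mul_assoc)

lemma det_cjm: "det (cjm A) = cnj (det A)"
 by (simp add: det_def cjm_def)

lemma det_cong: "det (cong E A) = of_real ((cmod (det E))^2) * det A"
by (unfold complex_norm_square, simp add: cong_def det_mul det_cjm)

lemma det_diagm: "det (diagm \<mu>) = of_real (\<Prod>i\<in>UNIV. \<mu> i)"
 by (subst det_diagonal) (auto simp: diagm_def)

lemma herm_cong: "herm A ==> herm (cong E A)"
 unfolding herm_def[of "cong E A"] cong_nth using herm_sesq by blast

text \<open>The orthogonality conditions are the rows of \<open>M\<close>, and the row at the free
  index \<open>i\<close> is zero, so \<open>M\<close> is singular.\<close>

lemma exists_orthogonal_vector: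
 fixes e :: "'n::finite => complex^'n"
 assumes "i \<notin> I"
 shows "EX w. w ~= 0 & (ALL j:I. sesq A w (e j) = 0)"
proof -
 define M :: "complex^'n^'n" where "M = (\<chi> j p. if j : I then (SUM k:UNIV. A $ p $ k * cnj (e j $ k)) else 0)"
 have M: "(M *v w) $ j = (if j : I then sesq A w (e j) else 0)" for w j
  by (simp add: M_def matrix_vector_mult_def sesq_def sum_distrib_left sum_distrib_right mult_ac)
 have "row i M = 0" using assms by (simp add: row_def M_def vec_eq_iff)
 hence "det M = 0" by (rule det_zero_row)
 hence "\<not> (EX B. B ** M = mat 1)"
  using invertible_det_nz invertible_left_inverse by blast
 then obtain w where w: "M *v w = 0" "w ~= 0"
  unfolding matrix_left_invertible_ker by blast
 show ?thesis
 proof (intro exI conjI ballI)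
  fix j assume "j : I"
  thus "sesq A w (e j) = 0" using M[of w j] w(1) by simp
 qed (fact w)
qed

text \<open>A nonzero \<open>sesq G w v\<close> would contribute a term of first order in
  \<open>t\<close>, which is negative for suitable phase and beats the second order term when
  \<open>t\<close> is small.\<close>

lemma psd_null_vector:
 assumes G: "herm G" and psd: "!!t. 0 <= qf G (v + t *s w)" and v: "sesq G v v = 0"
 shows "sesq G w v = 0"
proof (rule ccontr)
 assume z: "sesq G w v ~= 0"
 define z where "z = sesq G w v"
 define F where "F = qf G w"
 \<comment> \<open>Small enough that \<open>s * F <= 1\<close>, against the
   \<open>s * F >= 2\<close> that nonnegativity would force.\<close>
 define s where "s = 1 / (\<bar>F\<bar> + 1)"
 have vw: "sesq G v w = cnj z" unfolding z_def by (rule herm_sesq[OF G])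
 have exp: "qf G (v + t *s w) = 2 * Re (t * z) + (cmod t)^2 * F" for t
 proof -
  have "sesq G (v + t *s w) (v + t *s w) = cnj (t * z) + t * z + t * cnj t * sesq G w w"
   by (simp add: sesq_add1 sesq_add2 sesq_scale1 sesq_scale2 v vw z_def[symmetric] algebra_simps)
  thus ?thesis
   by (simp add: complex_norm_square[symmetric] F_def)
 qed
 have cz: "cnj z * z = of_real ((cmod z)^2)" unfolding complex_norm_square by simp
 have "0 <= 2 * Re ((- of_real s * cnj z) * z) + (cmod (- of_real s * cnj z))^2 * F"
  using psd[of "- of_real s * cnj z"] unfolding exp .
 also have "... = (cmod z)^2 * s * (s * F - 2)"
  unfolding mult.assoc cz by (simp add: norm_mult power_mult_distrib) (simp add: algebra_simps power2_eq_square)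
 finally have "0 <= (cmod z)^2 * s * (s * F - 2)" .
 moreover have "0 < (cmod z)^2 * s" using z by (simp add: s_def z_def add_nonneg_pos)
 ultimately have "s * F >= 2" by (simp add: zero_le_mult_iff)
 moreover have "s * F <= 1" by (simp add: s_def divide_le_eq add_nonneg_pos)
 ultimately show False by simp
qed

lemma continuous_on_sesq: "continuous_on S (%v. qf A v)"
 unfolding sesq_def by (intro continuous_intros)

lemma norm_complex_scale: "norm (c *s (v :: complex^'n)) = cmod c * norm v"
 by (simp add: norm_vec_def norm_mult L2_set_right_distrib)

lemma pd_lower_bound:
 fixes A :: "complex^'n::finite^'n"
 assumes "pd A"
 obtains c where "c > 0" "!!v. c * (norm v)^2 <= qf A v"
proof -
 have "compact (sphere (0::complex^'n) 1)" "sphere (0::complex^'n) 1 ~= {}" by auto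
 from continuous_attains_inf[OF this continuous_on_sesq[of _ A]]
 obtain v0 where v0: "v0 : sphere 0 1" "!!v. v : sphere 0 1 ==> qf A v0 <= qf A v"
  by blast
 show ?thesis
 proof
  have "v0 ~= 0" using v0(1) by auto
  thus "0 < qf A v0" using assms by (auto simp: pd_def)
  fix v :: "complex^'n"
  show "qf A v0 * (norm v)^2 <= qf A v"
  proof (cases "v = 0")
   case False
   define u where "u = of_real (inverse (norm v)) *s v"
   have u: "norm u = 1" unfolding u_def norm_complex_scale using False by (simp add: norm_inverse)
   have "v = of_real (norm v) *s u" using False by (simp add: u_def vec_eq_iff)
   hence "qf A v = (norm v)^2 * qf A u"
    by (metis (no_types, lifting) Re_complex_of_real complex_cnj_complex_of_real mult.assoc of_real_mult power2_eq_square
      sesq_scale1 sesq_scale2 Re_complex_of_real_mult)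
   thus ?thesis using v0(2)[of u] u by (simp add: mult.commute[of "(norm v)^2"] mult_right_mono)
  qed simp
 qed
qed

text \<open>
 The basis is built one vector at a time, maximising \<open>Q\<close> on the unit sphere of \<open>A\<close> inside the
 orthogonal complement of the vectors found so far.
\<close>

theorem simultaneous_diagonalization:
 fixes A Q :: "complex^'n::finite^'n"
 assumes A: "pd A" and Q: "herm Q"
 obtains E \<mu> where "cong E A = mat 1" "cong E Q = diagm \<mu>"
proof -
 obtain c where c: "c > 0" "!!v. c * (norm v)^2 <= qf A v" by (rule pd_lower_bound[OF A]) blast
 have hA: "herm A" using A by (simp add: pd_def)
 \<comment> \<open>The last clause is the invariant that carries the induction: whatever is
   \<open>A\<close>-orthogonal to the chosen vectors is also \<open>Q\<close>-orthogonal to them, so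
   no later choice can destroy the diagonal form.\<close>
 define good where "good I e \<longleftrightarrow>
   (ALL i:I. ALL j:I. sesq A (e i) (e j) = (if i = j then 1 else 0)) &
   (ALL i:I. ALL j:I. i ~= j \<longrightarrow> sesq Q (e i) (e j) = 0) &
   (ALL w. (ALL j:I. sesq A w (e j) = 0) \<longrightarrow> (ALL j:I. sesq Q w (e j) = 0))" for I and e :: "'n => complex^'n"
 have "EX e. good I e" if "finite I" for I
  using that
 proof (induction I)
  case empty
  show ?case by (simp add: good_def)
 next
  case (insert i I)
  then obtain e where e: "good I e" by blast
  define W where "W = {w. ALL j:I. sesq A w (e j) = 0}"
  have W_lin: "a *s v + b *s w : W" if "v : W" "w : W" for a b v w
   using that by (simp add: W_def sesq_add1 sesq_scale1)
  define S where "S = {w : W. qf A w = 1}"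
  obtain w0 where w0: "w0 ~= 0" "w0 : W"
   using exists_orthogonal_vector[OF insert.hyps(2), of A e] unfolding W_def by blast
  have normalize: "EX r>0. of_real r *s w : S" if "w : W" "w ~= 0" for w
  proof -
   have p: "qf A w > 0" using A that by (auto simp: pd_def)
   define r where "r = 1 / sqrt (qf A w)"
   have "qf A (of_real r *s w) = r^2 * qf A w"
    by (simp add: sesq_scale1 sesq_scale2 power2_eq_square mult.assoc)
   also have "... = 1" using p by (simp add: r_def power_divide)
   finally have "of_real r *s w : S"
    using W_lin[OF that(1) that(1), of "of_real r" 0] by (simp add: S_def)
   moreover have "r > 0" using p by (simp add: r_def)
   ultimately show ?thesis by blast
  qed
  have "compact S"
  proof -
   have "bounded S"
   proof (rule boundedI)
    fix w assume "w : S"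
    hence "c * (norm w)^2 <= 1" using c(2)[of w] by (simp add: S_def)
    hence "(norm w)^2 <= (sqrt (1 / c))^2" using c(1) by (simp add: field_simps)
    thus "norm w <= sqrt (1 / c)" by (rule power2_le_imp_le) (use c in auto)
   qed
   moreover have "closed S"
   proof -
    have "S = (\<Inter>j\<in>I. {w. sesq A w (e j) = 0}) \<inter> {w. qf A w = 1}"
     by (auto simp: S_def W_def)
    moreover have "closed {w. sesq A w (e j) = 0}" for j
     unfolding sesq_def by (intro closed_Collect_eq continuous_intros)
    moreover have "closed {w. qf A w = 1}"
     unfolding sesq_def by (intro closed_Collect_eq continuous_intros)
    ultimately show ?thesis by (simp add: closed_INT closed_Int)
   qed
   ultimately show ?thesis by (simp add: compact_eq_bounded_closed)
  qed
  have "S ~= {}" using normalize[OF w0(2,1)] by blast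
  from continuous_attains_sup[OF \<open>compact S\<close> this continuous_on_sesq[of _ Q]]
  obtain v where v: "v : S" and vmax: "!!w. w : S ==> qf Q w <= qf Q v"
   by blast
  define \<mu> where "\<mu> = qf Q v"
  have vW: "v : W" and "qf A v = 1" using v by (auto simp: S_def)
  hence v1: "sesq A v v = 1" using herm_sesq_real[OF hA, of v] by (metis of_real_1)
  have Qvv: "sesq Q v v = of_real \<mu>" unfolding \<mu>_def by (rule herm_sesq_real[OF Q])
  \<comment> \<open>Maximality of \<open>v\<close> makes \<open>G\<close> nonnegative on
    \<open>W\<close> with a zero at \<open>v\<close>; \<open>psd_null_vector\<close> then gives the
    eigenvector equation for \<open>v\<close>, tested against all of \<open>W\<close>.\<close>
  define G where "G = \<mu> *\<^sub>R A - Q"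
  have hG: "herm G" by (simp add: G_def herm_diff herm_scaleR hA Q)
  have G0: "sesq G v v = 0"
   by (simp add: G_def sesq_matrix_diff sesq_matrix_scaleR v1 Qvv)
  have Gpsd: "0 <= qf G w" if w: "w : W" for w
  proof (cases "w = 0")
   case False
   obtain r where r: "r > 0" "of_real r *s w : S" using normalize[OF w False] by blast
   have "qf Q (of_real r *s w) <= \<mu> * qf A (of_real r *s w)"
    using vmax[OF r(2)] r(2) by (simp add: \<mu>_def S_def)
   hence "r * (r * qf Q w) <= \<mu> * (r * (r * qf A w))"
    by (simp add: sesq_scale1 sesq_scale2)
   hence "r * r * (\<mu> * qf A w - qf Q w) >= 0"
    by (simp add: algebra_simps)
   moreover have "r * r > 0" using r(1) by simp
   ultimately show ?thesis
    by (auto simp: G_def sesq_matrix_diff sesq_matrix_scaleR zero_le_mult_iff)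
  qed simp
  have Qv: "sesq Q w v = of_real \<mu> * sesq A w v" if "w : W" for w
  proof -
   have "sesq G w v = 0"
    by (rule psd_null_vector[OF hG Gpsd G0]) (use W_lin[OF vW that, of 1] in simp)
   thus ?thesis by (simp add: G_def sesq_matrix_diff sesq_matrix_scaleR)
  qed
  define e' where "e' = e(i := v)"
  have ev: "sesq A v (e j) = 0" "sesq A (e j) v = 0" "sesq Q v (e j) = 0" "sesq Q (e j) v = 0" if "j : I" for j
  proof -
   show 1: "sesq A v (e j) = 0" using vW that by (simp add: W_def)
   thus "sesq A (e j) v = 0" using herm_sesq[OF hA, of "e j" v] by simp
   show 2: "sesq Q v (e j) = 0" using e vW that by (auto simp: good_def W_def)
   thus "sesq Q (e j) v = 0" using herm_sesq[OF Q, of "e j" v] by simp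
  qed
  have "good (insert i I) e'"
   unfolding good_def
  proof (intro conjI ballI allI impI)
   fix a b assume ab: "a : insert i I" "b : insert i I"
   show "sesq A (e' a) (e' b) = (if a = b then 1 else 0)"
    using ab e ev v1 insert.hyps(2) by (auto simp: e'_def good_def)
   show "sesq Q (e' a) (e' b) = 0" if "a ~= b"
    using ab e ev that insert.hyps(2) by (auto simp: e'_def good_def)
  next
   fix w j assume w: "ALL j:insert i I. sesq A w (e' j) = 0" and j: "j : insert i I"
   have "w : W" using w insert.hyps(2) by (auto simp: W_def e'_def split: if_splits)
   moreover have "sesq A w v = 0" using w by (auto simp: e'_def)
   ultimately show "sesq Q w (e' j) = 0"
    using e j Qv[of w] by (auto simp: e'_def good_def W_def)
  qed
  thus ?case by blast
 qed
 from this[OF finite] obtain e :: "'n => complex^'n" where e: "good UNIV e" ..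
 define E :: "complex^'n^'n" where "E = (\<chi> a b. e b $ a)"
 have col: "column a E = e a" for a by (simp add: E_def column_def)
 have "cong E A = mat 1"
  using e by (simp add: vec_eq_iff cong_nth col good_def mat_def)
 moreover have "cong E Q = diagm (%i. qf Q (e i))"
 proof -
  have "cong E Q $ a $ b = diagm (%i. qf Q (e i)) $ a $ b" for a b
  proof (cases "a = b")
   case True
   thus ?thesis unfolding cong_nth col diagm_def
    by (simp add: herm_sesq_real[OF Q, symmetric])
  next
   case False
   thus ?thesis using e unfolding cong_nth col diagm_def good_def by simp
  qed
  thus ?thesis by (simp add: vec_eq_iff)
 qed
 ultimately show ?thesis using that by blast
qed

lemma orthonormal_basis:
 assumes "pd A"
 obtains E where "cong E A = mat 1"
 using simultaneous_diagonalization[OF assms herm_mat1] by blast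

lemma cong_mat1_inverse:
 assumes "cong E A = mat 1"
 shows "matrix_inv A = cjm E ** transpose E" "A ** (cjm E ** transpose E) = mat 1" "(cjm E ** transpose E) ** A = mat 1"
  "det E ~= 0" "invertible E"
proof -
 have "cjm E ** (transpose E ** A) = mat 1"
  using assms unfolding cong_def by (rule matrix_left_right_inverse1)
 thus 1: "(cjm E ** transpose E) ** A = mat 1" by (simp add: matrix_mul_assoc)
 thus 2: "A ** (cjm E ** transpose E) = mat 1" by (rule matrix_left_right_inverse1)
 show "matrix_inv A = cjm E ** transpose E"
 proof -
  have "invertible A" using 1 2 unfolding invertible_def by blast
  hence "A ** matrix_inv A = mat 1"
   unfolding invertible_def matrix_inv_def by (metis (mono_tags, lifting) someI_ex)
  hence "(cjm E ** transpose E) ** (A ** matrix_inv A) = cjm E ** transpose E" by simp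
  thus ?thesis by (simp add: matrix_mul_assoc 1)
 qed
 have "det (cong E A) = 1" using assms by simp
 thus "det E ~= 0" unfolding det_cong by auto
 thus "invertible E" by (simp add: invertible_det_nz)
qed

lemma trace_inv_orthonormal:
 assumes "cong E A = mat 1"
 shows "trace (matrix_inv A ** Q) = (SUM a:UNIV. sesq Q (column a E) (column a E))"
proof -
 have "trace (matrix_inv A ** Q) = trace (cjm E ** (transpose E ** Q))"
  by (simp add: cong_mat1_inverse(1)[OF assms] matrix_mul_assoc)
 also have "... = trace (cong E Q)" by (subst trace_mul_sym) (simp add: cong_def)
 finally show ?thesis by (simp add: trace_def cong_nth)
qed

lemma tr_orthonormal:
 assumes "cong E A = mat 1"
 shows "tr A Q = (SUM a:UNIV. qf Q (column a E))"
 by (simp add: tr_def trace_inv_orthonormal[OF assms])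

lemma trace_inv_real:
 assumes "pd A" "herm Q"
 shows "trace (matrix_inv A ** Q) = of_real (tr A Q)"
proof -
 obtain E where E: "cong E A = mat 1" using orthonormal_basis assms by blast
 show ?thesis unfolding trace_inv_orthonormal[OF E] tr_orthonormal[OF E] of_real_sum
  by (intro sum.cong refl herm_sesq_real assms)
qed

lemma pd_inverse:
 assumes "pd A"
 shows "A ** matrix_inv A = mat 1" "matrix_inv A ** A = mat 1" "invertible A"
proof -
 obtain E where E: "cong E A = mat 1" using orthonormal_basis assms by blast
 thus 1: "A ** matrix_inv A = mat 1" "matrix_inv A ** A = mat 1"
  using cong_mat1_inverse[OF E] by auto
 thus "invertible A" unfolding invertible_def by blast
qed

lemma pd_det:
 assumes "pd A"
 shows "Re (det A) > 0" "det A = of_real (Re (det A))"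
proof -
 obtain E where E: "cong E A = mat 1" using orthonormal_basis assms by blast
 have 1: "of_real ((cmod (det E))^2) * det A = 1" using det_cong[of E A] E by simp
 have "det E ~= 0" using cong_mat1_inverse[OF E] by simp
 hence "det A = of_real (1 / (cmod (det E))^2)" using 1 by (simp add: field_simps)
 thus "Re (det A) > 0" "det A = of_real (Re (det A))" using \<open>det E ~= 0\<close> by auto
qed

lemma pd_cong:
 assumes "pd A" "det J ~= 0"
 shows "pd (cong J A)"
proof -
 have "J *v v ~= 0" if "v ~= 0" for v
  using assms(2) that invertible_det_nz invertible_left_inverse matrix_left_invertible_ker by blast
 thus ?thesis using assms by (auto simp: pd_def herm_cong sesq_cong)
qed

text \<open>If \<open>E\<close> is orthonormal for the transformed \<open>A\<close>, then
  \<open>J ** E\<close> is orthonormal for \<open>A\<close>. This is why Laplacians do not depend on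
  the chart.\<close>

lemma tr_cong:
 assumes A: "pd A" and J: "det J ~= 0"
 shows "tr (cong J A) (cong J Q) = tr A Q"
proof -
 obtain E where E: "cong E (cong J A) = mat 1" using orthonormal_basis pd_cong[OF assms] by blast
 hence E': "cong (J ** E) A = mat 1" by (simp add: cong_cong)
 have "cong E (cong J Q) = cong (J ** E) Q" by (rule cong_cong)
 hence "sesq (cong J Q) (column a E) (column a E) = sesq Q (column a (J ** E)) (column a (J ** E))" for a
  by (metis cong_nth)
 thus ?thesis unfolding tr_orthonormal[OF E] tr_orthonormal[OF E'] by simp
qed

lemma tr_add: "tr A (P + Q) = tr A P + tr A Q"
 by (simp add: tr_def matrix_add_ldistrib trace_add)
lemma tr_diff: "tr A (P - Q) = tr A P - tr A Q"
 using tr_add[of A "P - Q" Q] by simp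
lemma tr_scaleR: "tr A (c *\<^sub>R Q) = c * tr A Q"
 by (simp add: tr_def matrix_matrix_mult_def trace_def sum_distrib_left)

lemma tr_self:
 assumes "pd (A :: complex^'n::finite^'n)"
 shows "tr A A = real CARD('n)"
 by (simp add: tr_def pd_inverse[OF assms] trace_I)

lemma tr_nonneg:
 assumes "pd A" "!!v. 0 <= qf Q v"
 shows "0 <= tr A Q"
proof -
 obtain E where E: "cong E A = mat 1" using orthonormal_basis assms by blast
 show ?thesis unfolding tr_orthonormal[OF E] by (intro sum_nonneg assms)
qed

lemma tr_mono:
 assumes "pd A" "!!v. qf P v <= qf Q v"
 shows "tr A P <= tr A Q"
 using tr_nonneg[OF assms(1), of "Q - P"] assms(2) by (simp add: tr_diff sesq_matrix_diff)

section \<open>Comparison of Hermitian forms through relative eigenvalues\<close>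

lemma diag_form:
 assumes "cong E Q = diagm \<mu>"
 shows "qf Q (E *v x) = (SUM i:UNIV. \<mu> i * (cmod (x $ i))^2)"
proof -
 have "sesq Q (E *v x) (E *v x) = sesq (diagm \<mu>) x x" by (simp add: sesq_cong[symmetric] assms)
 also have "... = (SUM i:UNIV. of_real (\<mu> i) * (x $ i * cnj (x $ i)))"
  unfolding sesq_def diagm_def by (simp add: if_distrib[where f="%x. x * _"] mult.assoc cong: if_cong)
 also have "... = of_real (SUM i:UNIV. \<mu> i * (cmod (x $ i))^2)"
  unfolding of_real_sum of_real_mult complex_norm_square ..
 finally show ?thesis by simp
qed

lemma mat1_diagm: "mat 1 = diagm (%_. 1)"
 by (simp add: mat_def diagm_def vec_eq_iff)

lemma orthonormal_expansion:
 assumes "cong E A = mat 1"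
 obtains x where "v = E *v x"
proof -
 obtain F where "E ** F = mat 1"
  using cong_mat1_inverse(5)[OF assms] invertible_right_inverse by blast
 hence "v = E *v (F *v v)" by (simp add: matrix_vector_mul_assoc)
 thus ?thesis using that by blast
qed

lemma diag_eigenvalue:
 assumes "cong E Q = diagm \<mu>"
 shows "qf Q (column i E) = \<mu> i"
 using arg_cong[OF assms, of "%M. Re (M $ i $ i)"] by (simp add: cong_nth diagm_def)

lemma orthonormal_column:
 assumes "cong E A = mat 1"
 shows "qf A (column i E) = 1"
 using arg_cong[OF assms, of "%M. Re (M $ i $ i)"] by (simp add: cong_nth mat_def)

lemma det_diag_ratio:
 assumes A: "pd A" and E: "cong E A = mat 1" and Q: "cong E Q = diagm \<mu>"
 shows "Re (det Q) = Re (det A) * (\<Prod>i\<in>UNIV. \<mu> i)"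
proof -
 define d where "d = (cmod (det E))^2"
 have d: "d > 0" using cong_mat1_inverse(4)[OF E] by (simp add: d_def)
 have "of_real d * det A = 1" using det_cong[of E A] E by (simp add: d_def)
 moreover have "of_real d * det Q = of_real (\<Prod>i\<in>UNIV. \<mu> i)"
  using det_cong[of E Q] Q det_diagm[of \<mu>] unfolding d_def by (metis)
 ultimately have "d * Re (det A) = 1" "d * Re (det Q) = (\<Prod>i\<in>UNIV. \<mu> i)"
  by (metis Re_complex_of_real Re_complex_of_real_mult one_complex.sel(1))+
 thus ?thesis using d by (metis mult.assoc mult.commute mult_1)
qed

lemma det_le_of_form_le:
 fixes A Q :: "complex^'n::finite^'n"
 assumes A: "pd A" and Q: "herm Q" "!!v. 0 <= qf Q v" and le: "!!v. qf Q v <= qf A v"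
 shows "Re (det Q) <= Re (det A)"
proof -
 obtain E \<mu> where E: "cong E A = mat 1" "cong E Q = diagm \<mu>"
  using simultaneous_diagonalization[OF A Q(1)] by blast
 have "0 <= \<mu> i" "\<mu> i <= 1" for i
  using Q(2)[of "column i E"] le[of "column i E"] diag_eigenvalue[OF E(2), of i] orthonormal_column[OF E(1), of i] by auto
 hence "(\<Prod>i\<in>UNIV. \<mu> i) <= 1" by (intro prod_le_1) auto
 thus ?thesis
  using det_diag_ratio[OF A E] pd_det(1)[OF A] by (simp add: mult_le_cancel_left1)
qed

lemma det_ge_of_form_ge:
 fixes A Q :: "complex^'n::finite^'n"
 assumes A: "pd A" and Q: "herm Q" and c: "0 <= c" and ge: "!!v. c * qf A v <= qf Q v"
 shows "c ^ CARD('n) * Re (det A) <= Re (det Q)"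
proof -
 obtain E \<mu> where E: "cong E A = mat 1" "cong E Q = diagm \<mu>"
  using simultaneous_diagonalization[OF A Q(1)] by blast
 have "c <= \<mu> i" for i
  using ge[of "column i E"] diag_eigenvalue[OF E(2), of i] orthonormal_column[OF E(1), of i] by auto
 hence "(\<Prod>i\<in>(UNIV::'n set). c) <= (\<Prod>i\<in>UNIV. \<mu> i)" using c by (intro prod_mono) auto
 thus ?thesis
  using det_diag_ratio[OF A E] pd_det(1)[OF A] by (simp add: mult.commute)
qed

text \<open>The eigenvalues of \<open>h\<close> relative to \<open>k\<close> are at least
  \<open>1 / C\<close> and their product is at most \<open>D\<close>, so each is at most
  \<open>D\<close> times the power n - 1 of \<open>C\<close>. In the second order estimate this
  turns a bound on the trace of the inverse metric into a bound on the metric.\<close>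

lemma form_le_of_det_le:
 fixes h k :: "complex^'n::finite^'n"
 assumes k: "pd k" and h: "pd h" and C: "C > 0" "!!v. qf k v <= C * qf h v"
  and D: "Re (det h) <= D * Re (det k)"
 shows "qf h v <= D * C ^ (CARD('n) - 1) * qf k v"
proof -
 have "herm h" using h by (simp add: pd_def)
 obtain E \<mu> where E: "cong E k = mat 1" "cong E h = diagm \<mu>"
  using simultaneous_diagonalization[OF k \<open>herm h\<close>] by blast
 have mu: "1 / C <= \<mu> i" for i
  using C(2)[of "column i E"] C(1) diag_eigenvalue[OF E(2), of i] orthonormal_column[OF E(1), of i]
  by (auto simp: field_simps)
 have mu0: "0 < \<mu> i" for i using mu[of i] C(1) by (meson divide_pos_pos less_le_trans zero_less_one)
 have "(\<Prod>i\<in>UNIV. \<mu> i) <= D"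
  using D det_diag_ratio[OF k E] pd_det(1)[OF k] by (simp add: mult.commute)
 have bd: "\<mu> i <= D * C ^ (CARD('n) - 1)" for i
 proof -
  have "(1 / C) ^ (CARD('n) - 1) = (\<Prod>j\<in>UNIV - {i}. 1 / C)" by simp
  also have "... <= (\<Prod>j\<in>UNIV - {i}. \<mu> j)" using mu C(1) by (intro prod_mono) auto
  finally have "\<mu> i * (1 / C) ^ (CARD('n) - 1) <= \<mu> i * (\<Prod>j\<in>UNIV - {i}. \<mu> j)"
   using mu0[of i] by simp
  also have "... = (\<Prod>j\<in>UNIV. \<mu> j)" by (simp add: prod.remove[of UNIV i])
  also have "... <= D" by fact
  finally show ?thesis using C(1) by (simp add: power_divide field_simps)
 qed
 obtain x where x: "v = E *v x" using orthonormal_expansion[OF E(1)] by blast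
 have "qf h v = (SUM i:UNIV. \<mu> i * (cmod (x $ i))^2)" unfolding x by (rule diag_form[OF E(2)])
 also have "... <= (SUM i:UNIV. D * C ^ (CARD('n) - 1) * (cmod (x $ i))^2)"
  by (intro sum_mono mult_right_mono bd) auto
 also have "... = D * C ^ (CARD('n) - 1) * qf k v"
  unfolding x diag_form[OF E(1)[unfolded mat1_diagm]] by (simp add: sum_distrib_left)
 finally show ?thesis .
qed

text \<open>The relative eigenvalues are nonnegative, so each of them is bounded by their
  sum.\<close>

lemma form_le_tr:
 fixes A K :: "complex^'n::finite^'n"
 assumes A: "pd A" and K: "herm K" "!!v. 0 <= qf K v"
 shows "qf K v <= tr A K * qf A v"
proof -
 obtain E \<mu> where E: "cong E A = mat 1" "cong E K = diagm \<mu>"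
  using simultaneous_diagonalization[OF A K(1)] by blast
 have mu: "0 <= \<mu> i" for i
  using K(2)[of "column i E"] diag_eigenvalue[OF E(2), of i] by auto
 have t: "tr A K = (SUM i:UNIV. \<mu> i)" unfolding tr_orthonormal[OF E(1)] using diag_eigenvalue[OF E(2)] by simp
 have bd: "\<mu> i <= tr A K" for i unfolding t by (rule member_le_sum) (use mu in auto)
 obtain x where x: "v = E *v x" using orthonormal_expansion[OF E(1)] by blast
 have "qf K v = (SUM i:UNIV. \<mu> i * (cmod (x $ i))^2)" unfolding x by (rule diag_form[OF E(2)])
 also have "... <= (SUM i:UNIV. tr A K * (cmod (x $ i))^2)"
  by (intro sum_mono mult_right_mono bd) auto
 also have "... = tr A K * qf A v"
  unfolding x diag_form[OF E(1)[unfolded mat1_diagm]] by (simp add: sum_distrib_left)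
 finally show ?thesis .
qed

section \<open>Wirtinger derivatives\<close>

text \<open>The operators d/dz and d/dzbar along an arbitrary vector: \<open>wd\<close> is complex
  linear in \<open>v\<close>, \<open>wdb\<close> conjugate linear. Bases adapted to a metric can
  thus be used without changing coordinates.\<close>

definition wd :: "complex^'n => (complex^'n::finite => complex) => complex^'n => complex" where
 "wd v f z = (dv v f z - \<i> * dv (\<i> *s v) f z) / 2"

definition wdb :: "complex^'n => (complex^'n::finite => complex) => complex^'n => complex" where
 "wdb v f z = (dv v f z + \<i> * dv (\<i> *s v) f z) / 2"

lemma i_axis: "\<i> *s axis j 1 = (axis j \<i> :: complex^'n)"
 by (simp add: vec_eq_iff axis_def)

lemma wirt_wd: "wirt j = wd (axis j 1)"
 by (rule ext)+ (simp add: wirt_def wd_def dv_def i_axis)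

lemma wirt_bar_wdb: "wirt_bar j = wdb (axis j 1)"
 by (rule ext)+ (simp add: wirt_bar_def wdb_def dv_def i_axis)

lemma smooth_on_wd: "open S ==> smooth_on S f ==> smooth_on S (wd v f)"
 unfolding wd_def divide_inverse by (intro smooth_intros smooth_on_dv)

lemma smooth_on_wdb: "open S ==> smooth_on S f ==> smooth_on S (wdb v f)"
 unfolding wdb_def divide_inverse by (intro smooth_intros smooth_on_dv)

lemma wd_cong_open: "open S ==> z : S ==> (!!x. x : S ==> f x = g x) ==> wd v f z = wd v g z"
 using dv_cong_open[of S z f g] by (simp add: wd_def)

lemma wdb_cong_open: "open S ==> z : S ==> (!!x. x : S ==> f x = g x) ==> wdb v f z = wdb v g z"
 using dv_cong_open[of S z f g] by (simp add: wdb_def)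

lemma complex_scale_decompose: "c *s (v :: complex^'n) = Re c *\<^sub>R v + Im c *\<^sub>R (\<i> *s v)"
 by (simp add: vec_eq_iff complex_eq_iff)

lemma bounded_linear_complex_scale_i:
 assumes "bounded_linear D"
 shows "D (c *s (v :: complex^'n)) = Re c *\<^sub>R D v + Im c *\<^sub>R D (\<i> *s v)"
proof -
 interpret bounded_linear D by fact
 show ?thesis by (subst complex_scale_decompose) (simp only: add scaleR)
qed

lemma
 assumes S: "open S" "smooth_on S f" "z : S"
 shows wd_add_dir: "wd (v + w) f z = wd v f z + wd w f z"
  and wdb_add_dir: "wdb (v + w) f z = wdb v f z + wdb w f z"
  and wd_scale_dir: "wd (c *s v) f z = c * wd v f z"
  and wdb_scale_dir: "wdb (c *s v) f z = cnj c * wdb v f z"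
proof -
 have bl: "bounded_linear (%v. dv v f z)" by (rule dv_linear[OF assms])
 have add: "dv (v + w) f z = dv v f z + dv w f z" for v w
  using bl by (rule linear_simps)
 show "wd (v + w) f z = wd v f z + wd w f z" "wdb (v + w) f z = wdb v f z + wdb w f z"
  by (simp_all add: wd_def wdb_def vector_add_ldistrib add field_simps)
 have sc: "dv (c *s v) f z = Re c *\<^sub>R dv v f z + Im c *\<^sub>R dv (\<i> *s v) f z"
  and sc': "dv (\<i> *s (c *s v)) f z = - Im c *\<^sub>R dv v f z + Re c *\<^sub>R dv (\<i> *s v) f z"
  using bounded_linear_complex_scale_i[OF bl, of c v] bounded_linear_complex_scale_i[OF bl, of "\<i> * c" v]
  by (simp_all add: vector_smult_assoc)
 show "wd (c *s v) f z = c * wd v f z" "wdb (c *s v) f z = cnj c * wdb v f z"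
  unfolding wd_def wdb_def sc sc' by (simp_all add: complex_eq_iff field_simps)
qed

lemma wd_expand_dir:
 assumes S: "open S" "smooth_on S f" "z : S"
 shows "wd v f z = (SUM j:UNIV. v $ j * wd (axis j 1) f z)"
  and "wdb v f z = (SUM j:UNIV. cnj (v $ j) * wdb (axis j 1) f z)"
proof -
 have z: "wd 0 f z = 0" "wdb 0 f z = 0" 
  using wd_scale_dir[OF assms, of 0 0] wdb_scale_dir[OF assms, of 0 0] by simp_all
 have "wd (SUM j:J. x j) f z = (SUM j:J. wd (x j) f z)" "wdb (SUM j:J. x j) f z = (SUM j:J. wdb (x j) f z)" for J and x :: "'a => complex^'a"
  by (induction J rule: infinite_finite_induct) (auto simp: z wd_add_dir[OF assms] wdb_add_dir[OF assms])
 hence "wd (SUM j:UNIV. v $ j *s axis j 1) f z = (SUM j:UNIV. v $ j * wd (axis j 1) f z)"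
   "wdb (SUM j:UNIV. v $ j *s axis j 1) f z = (SUM j:UNIV. cnj (v $ j) * wdb (axis j 1) f z)"
  by (simp_all add: wd_scale_dir[OF assms] wdb_scale_dir[OF assms])
 thus "wd v f z = (SUM j:UNIV. v $ j * wd (axis j 1) f z)"
  "wdb v f z = (SUM j:UNIV. cnj (v $ j) * wdb (axis j 1) f z)"
  by (simp_all add: basis_expansion)
qed

lemma wd_const: "wd v (%z. c) z = 0" and wdb_const: "wdb v (%z. c) z = 0"
 by (simp_all add: wd_def wdb_def dv_const)

lemma
 assumes "open S" "smooth_on S f" "smooth_on S g" "z : S"
 shows wd_add: "wd v (%z. f z + g z) z = wd v f z + wd v g z"
  and wdb_add: "wdb v (%z. f z + g z) z = wdb v f z + wdb v g z"
  and wd_diff: "wd v (%z. f z - g z) z = wd v f z - wd v g z"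
  and wdb_diff: "wdb v (%z. f z - g z) z = wdb v f z - wdb v g z"
  and wd_mult: "wd v (%z. f z * g z) z = f z * wd v g z + wd v f z * g z"
  and wdb_mult: "wdb v (%z. f z * g z) z = f z * wdb v g z + wdb v f z * g z"
 unfolding wd_def wdb_def dv_add[OF assms] dv_diff[OF assms] dv_mult[OF assms]
 by (simp_all add: field_simps)

lemma
 assumes "open S" "smooth_on S f" "z : S"
 shows wd_minus: "wd v (%z. - f z) z = - wd v f z"
  and wdb_minus: "wdb v (%z. - f z) z = - wdb v f z"
  and wd_cnj: "wd v (%z. cnj (f z)) z = cnj (wdb v f z)"
  and wdb_cnj: "wdb v (%z. cnj (f z)) z = cnj (wd v f z)"
  and wd_cmult: "wd v (%z. c * f z) z = c * wd v f z"
  and wdb_cmult: "wdb v (%z. c * f z) z = c * wdb v f z"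
 using wd_mult[OF assms(1) smooth_on_const[OF assms(1), of c] assms(2-)] wdb_mult[OF assms(1) smooth_on_const[OF assms(1), of c] assms(2-)]
 by (simp_all add: wd_def wdb_def dv_minus[OF assms] dv_cnj[OF assms] dv_const add_divide_distrib diff_divide_distrib)

lemma
 assumes "open S" "!!i. i : I ==> smooth_on S (f i)" "z : S"
 shows wd_sum: "wd v (%z. SUM i:I. f i z) z = (SUM i:I. wd v (f i) z)"
  and wdb_sum: "wdb v (%z. SUM i:I. f i z) z = (SUM i:I. wdb v (f i) z)"
proof -
 have e: "dv v (%z. SUM i:I. f i z) z = (SUM i:I. dv v (f i) z)" for v by (rule dv_sum[OF assms])
 show "wd v (%z. SUM i:I. f i z) z = (SUM i:I. wd v (f i) z)"
  "wdb v (%z. SUM i:I. f i z) z = (SUM i:I. wdb v (f i) z)"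
 unfolding wd_def wdb_def e
 by (simp_all add: sum_distrib_left sum.distrib sum_subtractf sum_divide_distrib[symmetric])
qed

lemma dv_cmult:
 fixes f :: "'e::real_normed_vector => complex"
 assumes "open S" "smooth_on S f" "z : S"
 shows "dv v (%z. c * f z) z = c * dv v f z"
 using dv_mult[OF assms(1) smooth_on_const[OF assms(1), of c] assms(2-), of v] by (simp add: dv_const)

lemma dv_wd:
 assumes "open S" "smooth_on S f" "z : S"
 shows "dv v (wd w f) z = (dv v (dv w f) z - \<i> * dv v (dv (\<i> *s w) f) z) / 2"
  and "dv v (wdb w f) z = (dv v (dv w f) z + \<i> * dv v (dv (\<i> *s w) f) z) / 2"
proof -
 note sm = smooth_on_dv[OF assms(1,2)]
 have "dv v (wd w f) z = dv v (%z. (1/2) * (dv w f z - \<i> * dv (\<i> *s w) f z)) z"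
  by (rule dv_cong_open[OF assms(1,3)]) (simp add: wd_def)
 also have "... = (1/2) * dv v (%z. dv w f z - \<i> * dv (\<i> *s w) f z) z"
  by (rule dv_cmult[OF assms(1) _ assms(3)]) (intro smooth_intros sm assms(1))
 also have "dv v (%z. dv w f z - \<i> * dv (\<i> *s w) f z) z = dv v (dv w f) z - dv v (%z. \<i> * dv (\<i> *s w) f z) z"
  by (rule dv_diff[OF assms(1) _ _ assms(3)]) (intro smooth_intros sm assms(1))+
 finally show "dv v (wd w f) z = (dv v (dv w f) z - \<i> * dv v (dv (\<i> *s w) f) z) / 2"
  using dv_cmult[OF assms(1) sm assms(3)] by simp
 have "dv v (wdb w f) z = dv v (%z. (1/2) * (dv w f z + \<i> * dv (\<i> *s w) f z)) z"
  by (rule dv_cong_open[OF assms(1,3)]) (simp add: wdb_def)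
 also have "... = (1/2) * dv v (%z. dv w f z + \<i> * dv (\<i> *s w) f z) z"
  by (rule dv_cmult[OF assms(1) _ assms(3)]) (intro smooth_intros sm assms(1))
 also have "dv v (%z. dv w f z + \<i> * dv (\<i> *s w) f z) z = dv v (dv w f) z + dv v (%z. \<i> * dv (\<i> *s w) f z) z"
  by (rule dv_add[OF assms(1) _ _ assms(3)]) (intro smooth_intros sm assms(1))+
 finally show "dv v (wdb w f) z = (dv v (dv w f) z + \<i> * dv v (dv (\<i> *s w) f) z) / 2"
  using dv_cmult[OF assms(1) sm assms(3)] by simp
qed

lemma wd_wdb_commute:
 assumes "open S" "smooth_on S f" "z : S"
 shows "wd v (wdb w f) z = wdb w (wd v f) z"
  and "wd v (wd w f) z = wd w (wd v f) z"
  and "wdb v (wdb w f) z = wdb w (wdb v f) z"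
 unfolding wd_def[of v "wdb w f"] wdb_def[of w "wd v f"] wd_def[of v "wd w f"] wd_def[of w "wd v f"]
  wdb_def[of v "wdb w f"] wdb_def[of w "wdb v f"] dv_wd[OF assms]
 by (simp_all add: dv_commute[OF assms, of w v] dv_commute[OF assms, of "\<i> *s w" v]
  dv_commute[OF assms, of w "\<i> *s v"] dv_commute[OF assms, of "\<i> *s w" "\<i> *s v"] algebra_simps add_divide_distrib diff_divide_distrib)

section \<open>The complex Hessian, as a matrix and as a sesquilinear form\<close>

definition levm :: "(complex^'n::finite => real) => complex^'n => complex^'n^'n" where
 "levm f z = (\<chi> j k. wirt j (wirt_bar k (%u. complex_of_real (f u))) z)"

definition levi :: "(complex^'n::finite => real) => complex^'n => complex^'n => complex^'n => complex" where
 "levi f z v w = wd v (wdb w (%u. complex_of_real (f u))) z"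

lemma ddbar_levm: "ddbar f c z = levm (%u. f (chart_inv c u)) z"
 by (simp add: ddbar_def levm_def)

lemma levm_cong_open: "open S ==> z : S ==> (!!x. x : S ==> f x = g x) ==> levm f z = levm g z"
 unfolding levm_def wirt_wd wirt_bar_wdb
 by (intro arg_cong[where f=vec_lambda] ext wd_cong_open[of S z] wdb_cong_open[of S]) auto

lemma sesq_levm:
 assumes "open S" "smooth_on S f" "z : S"
 shows "sesq (levm f z) v w = levi f z v w"
proof -
 let ?F = "%u. complex_of_real (f u)"
 have F: "smooth_on S ?F" by (intro smooth_intros assms)
 have "levi f z v w = wd v (%z. SUM k:UNIV. cnj (w $ k) * wdb (axis k 1) ?F z) z"
  unfolding levi_def by (rule wd_cong_open[OF assms(1,3)]) (rule wd_expand_dir(2)[OF assms(1) F])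
 also have "... = (SUM k:UNIV. wd v (%z. cnj (w $ k) * wdb (axis k 1) ?F z) z)"
  by (rule wd_sum[OF assms(1) _ assms(3)]) (intro smooth_intros assms(1) smooth_on_wdb F)
 also have "... = (SUM k:UNIV. cnj (w $ k) * wd v (wdb (axis k 1) ?F) z)"
  by (intro sum.cong refl wd_cmult[OF assms(1) _ assms(3)] smooth_on_wdb F assms(1))
 also have "... = (SUM k:UNIV. cnj (w $ k) * (SUM j:UNIV. v $ j * wd (axis j 1) (wdb (axis k 1) ?F) z))"
  by (subst wd_expand_dir(1)[OF assms(1) smooth_on_wdb[OF assms(1) F] assms(3)]) simp
 also have "... = sesq (levm f z) v w"
  unfolding sesq_def levm_def wirt_wd wirt_bar_wdb
  by (simp add: sum_distrib_left mult_ac) (rule sum.swap)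
 finally show ?thesis by simp
qed

text \<open>On the complex line spanned by \<open>v\<close> the Levi form is a quarter of the real
  Laplacian. Maxima and mean values are accessible through this identity.\<close>

lemma levi_real:
 assumes "open S" "smooth_on S f" "z : S"
 shows "levi f z v v = of_real ((dv v (dv v f) z + dv (\<i> *s v) (dv (\<i> *s v) f) z) / 4)"
proof -
 let ?F = "%u. complex_of_real (f u)"
 have F: "smooth_on S ?F" by (intro smooth_intros assms)
 have dd: "dv a (dv b ?F) z = of_real (dv a (dv b f) z)" for a b
 proof -
  have "dv a (dv b ?F) z = dv a (%z. of_real (dv b f z)) z"
   by (rule dv_cong_open[OF assms(1,3)]) (rule dv_of_real[OF assms(1,2)])
  thus ?thesis using dv_of_real[OF assms(1) smooth_on_dv[OF assms(1,2)] assms(3)] by simp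
 qed
 show ?thesis
  unfolding levi_def wd_def[of v "wdb v ?F"] dv_wd[OF assms(1) F assms(3)] dd
  by (simp add: dv_commute[OF assms, of "\<i> *s v" v] algebra_simps add_divide_distrib)
qed

lemma levi_herm:
 assumes "open S" "smooth_on S f" "z : S"
 shows "levi f z w v = cnj (levi f z v w)"
proof -
 let ?F = "%u. complex_of_real (f u)"
 have F: "smooth_on S ?F" by (intro smooth_intros assms)
 have c: "wd v (%z. cnj (?F z)) x = wd v ?F x" for x v by simp
 have "cnj (levi f z v w) = wdb v (%z. cnj (wdb w ?F z)) z"
  unfolding levi_def using wdb_cnj[OF assms(1) smooth_on_wdb[OF assms(1) F] assms(3)] by simp
 also have "... = wdb v (wd w ?F) z"
  by (rule wdb_cong_open[OF assms(1,3)]) (use wd_cnj[OF assms(1) F] in \<open>simp add: c\<close>)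
 also have "... = levi f z w v" unfolding levi_def using wd_wdb_commute(1)[OF assms(1) F assms(3)] by simp
 finally show ?thesis by simp
qed

lemma herm_levm:
 assumes "open S" "smooth_on S f" "z : S"
 shows "herm (levm f z)"
 unfolding herm_def
proof (intro allI)
 fix j k
 have "levm f z $ a $ b = levi f z (axis a 1) (axis b 1)" for a b
  using sesq_levm[OF assms, of "axis a 1" "axis b 1"] by (simp add: sesq_axis)
 thus "levm f z $ k $ j = cnj (levm f z $ j $ k)" using levi_herm[OF assms, of "axis k 1" "axis j 1"] by metis
qed

lemma
 assumes "open S" "smooth_on S f" "smooth_on S g" "z : S"
 shows levm_add: "levm (%z. f z + g z) z = levm f z + levm g z"
  and levm_diff: "levm (%z. f z - g z) z = levm f z - levm g z"
proof -
 let ?F = "%u. complex_of_real (f u)" and ?G = "%u. complex_of_real (g u)"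
 have F: "smooth_on S ?F" and G: "smooth_on S ?G" by (intro smooth_intros assms)+
 have "wirt j (wirt_bar k (%u. complex_of_real (f u + g u))) z = wirt j (wirt_bar k ?F) z + wirt j (wirt_bar k ?G) z" for j k
 proof -
  have "wirt j (wirt_bar k (%u. complex_of_real (f u + g u))) z = wirt j (%u. wirt_bar k ?F u + wirt_bar k ?G u) z"
   unfolding wirt_wd wirt_bar_wdb
   by (rule wd_cong_open[OF assms(1,4)]) (simp add: wdb_add[OF assms(1) F G])
  thus ?thesis unfolding wirt_wd wirt_bar_wdb
   by (simp add: wd_add[OF assms(1) smooth_on_wdb[OF assms(1) F] smooth_on_wdb[OF assms(1) G] assms(4)])
 qed
 thus "levm (%z. f z + g z) z = levm f z + levm g z" by (simp add: levm_def vec_eq_iff)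
 have "wirt j (wirt_bar k (%u. complex_of_real (f u - g u))) z = wirt j (wirt_bar k ?F) z - wirt j (wirt_bar k ?G) z" for j k
 proof -
  have "wirt j (wirt_bar k (%u. complex_of_real (f u - g u))) z = wirt j (%u. wirt_bar k ?F u - wirt_bar k ?G u) z"
   unfolding wirt_wd wirt_bar_wdb
   by (rule wd_cong_open[OF assms(1,4)]) (simp add: wdb_diff[OF assms(1) F G])
  thus ?thesis unfolding wirt_wd wirt_bar_wdb
   by (simp add: wd_diff[OF assms(1) smooth_on_wdb[OF assms(1) F] smooth_on_wdb[OF assms(1) G] assms(4)])
 qed
 thus "levm (%z. f z - g z) z = levm f z - levm g z" by (simp add: levm_def vec_eq_iff)
qed

lemma levm_scale:
 assumes "open S" "smooth_on S f" "z : S"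
 shows "levm (%z. c * f z) z = c *\<^sub>R levm f z"
proof -
 let ?F = "%u. complex_of_real (f u)"
 have F: "smooth_on S ?F" by (intro smooth_intros assms)+
 have "wirt j (wirt_bar k (%u. complex_of_real (c * f u))) z = of_real c * wirt j (wirt_bar k ?F) z" for j k
 proof -
  have "wirt j (wirt_bar k (%u. complex_of_real (c * f u))) z = wirt j (%u. of_real c * wirt_bar k ?F u) z"
   unfolding wirt_wd wirt_bar_wdb
   by (rule wd_cong_open[OF assms(1,3)]) (simp add: wdb_cmult[OF assms(1) F])
  thus ?thesis unfolding wirt_wd wirt_bar_wdb
   by (simp add: wd_cmult[OF assms(1) smooth_on_wdb[OF assms(1) F] assms(3)])
 qed
 thus ?thesis by (simp add: levm_def vec_eq_iff) (simp add: scaleR_conv_of_real)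
qed

lemma levm_const: "levm (%z. c) z = 0"
 by (simp add: levm_def vec_eq_iff wirt_wd wirt_bar_wdb wdb_const[abs_def] wd_const)

text \<open>If \<open>l\<close> were positive, \<open>g'\<close>, which vanishes at 0, would be
  positive just to the right of 0, and \<open>g\<close> would exceed \<open>g 0\<close>
  there.\<close>

lemma second_deriv_nonpos:
 fixes g g' :: "real => real"
 assumes d: "d > 0" "!!s. \<bar>s\<bar> < d ==> g s <= g 0"
  and g': "!!s. \<bar>s\<bar> < d ==> (g has_real_derivative g' s) (at s)"
  and g'': "(g' has_real_derivative l) (at 0)"
 shows "l <= 0"
proof (rule ccontr)
 assume "\<not> l <= 0"
 hence l: "0 < l" by simp
 have "g' 0 = 0"
  by (rule DERIV_local_max[OF g'[of 0] d(1)]) (use d in auto)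
 obtain e where e: "e > 0" "!!h. 0 < h ==> h < e ==> g' 0 < g' (0 + h)"
  using DERIV_pos_inc_right[OF g'' l] by auto
 define r where "r = min d e / 2"
 have r: "0 < r" "r < d" "r < e" using d e by (auto simp: r_def)
 obtain x where "0 < x" "x < r" "g r - g 0 = (r - 0) * g' x"
  using MVT2[OF r(1), of g g'] g' r by (metis abs_of_nonneg less_eq_real_def order_le_less_trans)
 moreover have "g' x > 0" using e(2)[of x] calculation r \<open>g' 0 = 0\<close> by auto
 ultimately have "g r > g 0" using r by (smt (verit) mult_pos_pos)
 thus False using d(2)[of r] r by simp
qed

lemma dv_dv_nonpos_at_max:
 fixes f :: "'e::real_normed_vector => real"
 assumes S: "open S" "smooth_on S f" "z : S" and max: "!!x. x : S ==> f x <= f z"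
 shows "dv v (dv v f) z <= 0"
proof -
 obtain d where d: "d > 0" "!!s. \<bar>s\<bar> < d ==> z + s *\<^sub>R v : S"
 proof -
  obtain e where e: "e > 0" "ball z e \<subseteq> S" using S(1,3) openE by blast
  have "z + s *\<^sub>R v : S" if "\<bar>s\<bar> < e / (norm v + 1)" for s
  proof -
   have "\<bar>s\<bar> * norm v <= \<bar>s\<bar> * (norm v + 1)" by (simp add: mult_left_mono)
   also have "... < e" using that by (simp add: pos_less_divide_eq add_nonneg_pos)
   finally show ?thesis using e(2) by (auto simp: subset_iff dist_norm)
  qed
  moreover have "e / (norm v + 1) > 0" using e(1) by (simp add: add_nonneg_pos)
  ultimately show ?thesis using that by blast
 qed
 show ?thesis
 proof (rule second_deriv_nonpos[OF d(1)])
  show "f (z + s *\<^sub>R v) <= f (z + 0 *\<^sub>R v)" if "\<bar>s\<bar> < d" for s using max d(2)[OF that] by simp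
  show "((%s. f (z + s *\<^sub>R v)) has_real_derivative dv v f (z + s *\<^sub>R v)) (at s)" if "\<bar>s\<bar> < d" for s
   unfolding has_real_derivative_iff_has_vector_derivative using dv_path[OF S(1,2) d(2)[OF that]] .
  show "((%s. dv v f (z + s *\<^sub>R v)) has_real_derivative dv v (dv v f) z) (at 0)"
   unfolding has_real_derivative_iff_has_vector_derivative
   using dv_path[OF S(1) smooth_on_dv[OF S(1,2)] d(2)[of 0]] d(1) by simp
 qed
qed

lemma levi_nonpos_at_max:
 assumes "open S" "smooth_on S f" "z : S" "!!x. x : S ==> f x <= f z"
 shows "Re (levi f z v v) <= 0"
 unfolding levi_real[OF assms(1-3)]
 using dv_dv_nonpos_at_max[OF assms, of v] dv_dv_nonpos_at_max[OF assms, of "\<i> *s v"] by simp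


section \<open>Holomorphic maps\<close>

text \<open>Complex differentiability at each point, as in \<open>hol_map_on\<close>. Continuity of
  the derivative is not built in; it comes out of Cauchy's formula.\<close>

definition hol_fun :: "(complex^'n::finite) set => (complex^'n => complex) => bool" where
 "hol_fun S f \<longleftrightarrow> (ALL z:S. EX f'. (f has_derivative f') (at z) & (ALL a v. f' (a *s v) = a * f' v))"

lemma hol_fun_D:
 assumes "hol_fun S f" "z : S"
 shows "(f has_derivative (%v. dv v f z)) (at z)" "dv (a *s v) f z = a * dv v f z"
proof -
 obtain f' where f': "(f has_derivative f') (at z)" "!!a v. f' (a *s v) = a * f' v"
  using assms unfolding hol_fun_def by blast
 have "f' = (%v. dv v f z)" using has_derivative_imp_dv[OF f'(1)] by auto
 with f' show "(f has_derivative (%v. dv v f z)) (at z)" "dv (a *s v) f z = a * dv v f z" by auto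
qed

lemma hol_fun_continuous: "hol_fun S f ==> continuous_on S f"
 by (meson continuous_at_imp_continuous_on has_derivative_continuous hol_fun_D(1))

lemma complex_scale_has_derivative: "((%c. z + c *s (v :: complex^'n)) has_derivative (%h. h *s v)) (at c)"
proof -
 have "bounded_linear (%c. c *s (v :: complex^'n))"
  unfolding linear_conv_bounded_linear[symmetric]
  by (auto intro!: linearI simp: vec_eq_iff algebra_simps)
 from bounded_linear_imp_has_derivative[OF this, of "at c"] show ?thesis
  by (auto intro!: derivative_eq_intros)
qed

definition circ :: "real => real => complex" where
 "circ r t = of_real r * exp (2 * of_real pi * \<i> * of_real t)"

lemma norm_circ: "r > 0 ==> cmod (circ r t) = r"
 by (simp add: circ_def norm_mult)

lemma continuous_on_circ [continuous_intros]: "continuous_on S g ==> continuous_on S (%x. circ r (g x))"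
 unfolding circ_def by (intro continuous_intros)

text \<open>One complex variable is enough: on the line through \<open>z\<close> in direction
  \<open>v\<close> the function is holomorphic on a disc. Writing the contour integral over
  \<open>{0..1}\<close> prepares differentiation under the integral sign.\<close>

lemma cauchy_dv:
 fixes f :: "complex^'n::finite => complex"
 assumes S: "open S" and f: "hol_fun S f" and r: "r > 0"
  and disc: "!!c. cmod c <= r ==> z + c *s v : S"
 shows "dv v f z = integral {0..1} (%t. f (z + circ r t *s v) / circ r t)"
proof -
 let ?g = "%c. f (z + c *s v)"
 have d: "(?g has_field_derivative dv v f (z + c *s v)) (at c)" if "cmod c <= r" for c
 proof -
  have "(?g has_derivative (%h. dv (h *s v) f (z + c *s v))) (at c)"
   using has_derivative_compose[OF complex_scale_has_derivative hol_fun_D(1)[OF f disc[OF that]]] .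
  thus ?thesis unfolding has_field_derivative_def
   by (rule back_subst[where P="%D. (_ has_derivative D) _"]) (auto simp: fun_eq_iff hol_fun_D(2)[OF f disc[OF that]] mult.commute)
 qed
 have c: "continuous_on (cball 0 r) ?g"
  by (intro continuous_at_imp_continuous_on ballI DERIV_isCont[OF d]) simp
 have h: "?g holomorphic_on ball 0 r"
  unfolding holomorphic_on_def field_differentiable_def
  by (metis d has_field_derivative_at_within less_eq_real_def mem_ball_0)
 have "(?g has_field_derivative (1 / (2 * of_real pi * \<i>) * contour_integral(circlepath 0 r) (%u. ?g u / (u-0)^2))) (at 0)"
  using Cauchy_derivative_integral_circlepath(2)[OF c h, of 0] r by simp
 hence "dv v f z = 1 / (2 * of_real pi * \<i>) * contour_integral(circlepath 0 r) (%u. ?g u / (u-0)^2)"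
  using DERIV_unique[OF d[of 0]] r by simp
 also have "... = integral {0..1} (%t. 1 / (2 * of_real pi * \<i>) * (?g (circlepath 0 r t) / (circlepath 0 r t)^2 * vector_derivative (circlepath 0 r) (at t)))"
  unfolding contour_integral_integral diff_zero by (rule integral_mult_right[symmetric])
 also have "... = integral {0..1} (%t. ?g (circ r t) / circ r t)"
 proof (intro integral_cong)
  fix t
  have c: "circlepath 0 r t = circ r t" by (simp add: circlepath circ_def)
  have "circ r t ~= 0" using norm_circ[OF r, of t] r by auto
  moreover have "vector_derivative (circlepath 0 r) (at t) = 2 * of_real pi * \<i> * circ r t"
   unfolding vector_derivative_circlepath by (simp add: circ_def)
  ultimately show "1 / (2 * of_real pi * \<i>) * (?g (circlepath 0 r t) / (circlepath 0 r t)^2 * vector_derivative (circlepath 0 r) (at t)) = ?g (circ r t) / circ r t"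
   unfolding c by (simp add: field_simps power2_eq_square)
 qed
 finally show ?thesis .
qed

text \<open>One radius serves all centres near \<open>z0\<close>, so the circle in Cauchy's formula
  stays fixed while \<open>z\<close> varies.\<close>

lemma disc_nbhd:
 fixes v :: "complex^'n::finite"
 assumes "open S" "z0 : S"
 obtains U r where "open U" "convex U" "z0 : U" "r > 0" "U \<subseteq> S" "!!z c. z : U ==> cmod c <= r ==> z + c *s v : S"
proof -
 obtain e where e: "e > 0" "ball z0 e \<subseteq> S" using assms openE by blast
 define r where "r = e / (2 * (norm v + 1))"
 have v1: "norm v + 1 > 0" by (simp add: add_nonneg_pos)
 have r: "r > 0" using e v1 by (simp add: r_def)
 have "z + c *s v : S" if "z : ball z0 (e/2)" "cmod c <= r" for z c
 proof -
  have "cmod c * norm v <= r * (norm v + 1)" using that r by (intro mult_mono) auto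
  also have "... = e / 2" using v1 unfolding r_def by (simp add: field_simps)
  finally have "norm (c *s v) <= e / 2" by (simp add: norm_complex_scale)
  hence "dist z0 (z + c *s v) < e" using that(1) norm_triangle_ineq4[of "z0 - z" "c *s v"]
   by (simp add: dist_norm algebra_simps)
  thus ?thesis using e by auto
 qed
 moreover have "ball z0 (e/2) \<subseteq> S" using e by (auto simp: subset_iff)
 ultimately show ?thesis using that[of "ball z0 (e/2)" r] r e by auto
qed

lemma continuous_on_vec_scale [continuous_intros]:
 "continuous_on S f ==> continuous_on S g ==> continuous_on S (%x. f x *s (g x :: complex^'n))"
 unfolding vector_scalar_mult_def by (intro continuous_intros)

text \<open>Cauchy's formula expresses the derivative through values of \<open>f\<close>, which are
  continuous. It has to precede \<open>hol_fun_dv\<close>, where \<open>leibniz_rule\<close> asks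
  for a continuous derivative of the integrand.\<close>

lemma continuous_on_dv_hol:
 fixes f :: "complex^'n::finite => complex"
 assumes S: "open S" and f: "hol_fun S f"
 shows "continuous_on S (dv v f)"
proof (rule continuous_at_imp_continuous_on, rule ballI)
 fix z0 assume "z0 : S"
 obtain U r where U: "open U" "convex U" "z0 : U" "r > 0" "U \<subseteq> S" "!!z c. z : U ==> cmod c <= r ==> z + c *s v : S"
  using disc_nbhd[OF S \<open>z0 : S\<close>] by blast
 have circ0: "circ r t ~= 0" for t using norm_circ[OF U(4), of t] U(4) by auto
 have inS: "z + circ r t *s v : S" if "z : U" for z t
  using U(6)[OF that] norm_circ[OF U(4), of t] by simp
 have "continuous_on (U \<times> cbox 0 1) (%(z, t). f (z + circ r t *s v) / circ r t)"
  unfolding split_beta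
  by (intro continuous_intros continuous_on_compose2[OF hol_fun_continuous[OF f]])
    (use inS circ0 in auto)
 hence "continuous_on U (%z. integral (cbox 0 1) (%t. f (z + circ r t *s v) / circ r t))"
  by (rule integral_continuous_on_param)
 moreover have "dv v f z = integral (cbox 0 1) (%t. f (z + circ r t *s v) / circ r t)" if "z : U" for z
  using cauchy_dv[OF S f U(4), of z v] U(6)[OF that] by simp
 ultimately have "continuous_on U (dv v f)" by (simp cong: continuous_on_cong)
 thus "isCont (dv v f) z0" using U(1,3) continuous_on_eq_continuous_at by blast
qed

text \<open>Cauchy's formula is differentiated under the integral, and complex linearity passes from
  the integrand to the integral. Holomorphic functions are therefore a class to which
  \<open>smooth_on_coinduct\<close> applies.\<close>

lemma hol_fun_dv:
 fixes f :: "complex^'n::finite => complex"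
 assumes S: "open S" and f: "hol_fun S f"
 shows "hol_fun S (dv v f)"
 unfolding hol_fun_def
proof
 fix z0 assume "z0 : S"
 obtain U r where U: "open U" "convex U" "z0 : U" "r > 0" "U \<subseteq> S" "!!z c. z : U ==> cmod c <= r ==> z + c *s v : S"
  using disc_nbhd[OF S \<open>z0 : S\<close>] by blast
 define G where "G z t = f (z + circ r t *s v) / circ r t" for z t
 define D where "D z t = Blinfun (%w. dv w f (z + circ r t *s v) / circ r t)" for z t
 have circ0: "circ r t ~= 0" for t using norm_circ[OF U(4), of t] U(4) by auto
 have inS: "z + circ r t *s v : S" if "z : U" for z t
  using U(6)[OF that] norm_circ[OF U(4), of t] by simp
 have bl: "bounded_linear (%w. dv w f (z + circ r t *s v) / circ r t)" if "z : U" for z t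
  by (rule bounded_linear_divide[THEN bounded_linear_compose])
    (rule has_derivative_bounded_linear[OF hol_fun_D(1)[OF f inS[OF that]]])
 have D: "blinfun_apply (D z t) = (%w. dv w f (z + circ r t *s v) / circ r t)" if "z : U" for z t
  unfolding D_def by (rule bounded_linear_Blinfun_apply[OF bl[OF that]])
 have contf: "continuous_on (U \<times> cbox 0 1) (%(z, t). h (z + circ r t *s v) / circ r t)" if "continuous_on S h" for h
  unfolding split_beta
  by (intro continuous_intros continuous_on_compose2[OF that]) (use inS circ0 in auto)
 have der: "((%z. integral (cbox 0 1) (G z)) has_derivative integral (cbox 0 1) (D z0)) (at z0 within U)"
 proof (rule leibniz_rule)
  fix z t assume z: "z : U" and "t : cbox 0 (1::real)"
  have "((%z. z + circ r t *s v) has_derivative (%h. h)) (at z)" by (auto intro!: derivative_eq_intros)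
  from has_derivative_compose[OF this hol_fun_D(1)[OF f inS[OF z]]]
  have "((%z. f (z + circ r t *s v)) has_derivative (%w. dv w f (z + circ r t *s v))) (at z)" .
  from bounded_linear.has_derivative[OF bounded_linear_divide this]
  show "((%z. G z t) has_derivative blinfun_apply (D z t)) (at z within U)"
   unfolding G_def D[OF z] by (rule has_derivative_at_withinI)
 next
  show "G z integrable_on cbox 0 1" if "z : U" for z
  proof (rule integrable_continuous)
   show "continuous_on (cbox 0 1) (G z)"
    unfolding G_def by (intro continuous_intros continuous_on_compose2[OF hol_fun_continuous[OF f]])
     (use inS[OF that] circ0 in auto)
  qed
  show "continuous_on (U \<times> cbox 0 1) (%(x, y). D x y)"
  proof (rule continuous_on_blinfun_componentwise)
   fix w :: "complex^'n"
   have "continuous_on (U \<times> cbox 0 1) (%(z, t). dv w f (z + circ r t *s v) / circ r t)"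
    by (rule contf[OF continuous_on_dv_hol[OF S f]])
   thus "continuous_on (U \<times> cbox 0 1) (%x. blinfun_apply (case x of (x, xa) => D x xa) w)"
    by (rule continuous_on_eq) (auto simp: D)
  qed
 qed (use U in auto)
 have int: "D z0 integrable_on cbox 0 1"
 proof (rule integrable_continuous, rule continuous_on_blinfun_componentwise)
  fix w :: "complex^'n"
  have "continuous_on (cbox 0 1) (%t. dv w f (z0 + circ r t *s v) / circ r t)"
   by (intro continuous_intros continuous_on_compose2[OF continuous_on_dv_hol[OF S f]]) (use inS[OF U(3)] circ0 in auto)
  thus "continuous_on (cbox 0 1) (%x. blinfun_apply (D z0 x) w)" using D[OF U(3)] by simp
 qed
 have eq: "dv v f z = integral (cbox 0 1) (G z)" if "z : U" for z
  unfolding G_def using cauchy_dv[OF S f U(4), of z v] U(6)[OF that] by simp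
 have "(dv v f has_derivative blinfun_apply (integral (cbox 0 1) (D z0))) (at z0)"
 proof (rule has_derivative_transform_within_open[OF _ U(1,3)])
  show "((%z. integral (cbox 0 1) (G z)) has_derivative blinfun_apply (integral (cbox 0 1) (D z0))) (at z0)"
   using der U(1,3) by (metis at_within_open)
 qed (use eq in simp)
 moreover have "blinfun_apply (integral (cbox 0 1) (D z0)) (a *s w) = a * blinfun_apply (integral (cbox 0 1) (D z0)) w" for a w
  unfolding blinfun_apply_integral[OF int] D[OF U(3)] hol_fun_D(2)[OF f inS[OF U(3)]]
  by (simp add: integral_mult_right[symmetric])
 ultimately show "EX f'. (dv v f has_derivative f') (at z0) & (ALL a v. f' (a *s v) = a * f' v)" by blast
qed

lemma hol_fun_smooth:
 assumes "open S" "hol_fun S f"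
 shows "smooth_on S f"
proof (rule smooth_on_coinduct[where P="hol_fun S"])
 show "f differentiable_on S" if "hol_fun S f" for f :: "complex^'a => complex"
  unfolding differentiable_on_def differentiable_def
  using hol_fun_D(1)[OF that] has_derivative_at_withinI by blast
 show "EX g. hol_fun S g & (ALL z:S. dv v f z = g z)" if "hol_fun S f" for f :: "complex^'a => complex" and v
  using hol_fun_dv[OF assms(1) that] by blast
qed (use assms in auto)

lemma hol_fun_wdb:
 assumes "hol_fun S f" "z : S"
 shows "wdb v f z = 0" "wd v f z = dv v f z"
 by (simp_all add: wdb_def wd_def hol_fun_D(2)[OF assms] mult.assoc[symmetric])

lemma hol_map_component:
 assumes "hol_map_on S T"
 shows "hol_fun S (%z. T z $ i)"
 unfolding hol_fun_def
proof
 fix z assume "z : S"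
 then obtain f' where f': "(T has_derivative f') (at z)" "!!a v. f' (a *s v) = a *s f' v"
  using assms unfolding hol_map_on_def by blast
 from bounded_linear.has_derivative[OF bounded_linear_vec_nth f'(1)] f'(2)
 show "EX f'. ((%z. T z $ i) has_derivative f') (at z) & (ALL a v. f' (a *s v) = a * f' v)"
  by (intro exI[of _ "%v. f' v $ i"]) simp
qed

lemma hol_map_smooth:
 assumes "open S" "hol_map_on S T"
 shows "smooth_on S T"
 by (rule smooth_on_vec[OF assms(1)]) (rule hol_fun_smooth[OF assms(1) hol_map_component[OF assms(2)]])

lemma hol_map_dv:
 assumes "open S" "hol_map_on S T" "z : S"
 shows "dv v T z $ i = dv v (%z. T z $ i) z" "dv (a *s v) T z = a *s dv v T z"
proof -
 show 1: "dv v T z $ i = dv v (%z. T z $ i) z" for v i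
  using dv_linear_comp[OF bounded_linear_vec_nth assms(1) hol_map_smooth[OF assms(1,2)] assms(3)] by metis
 show "dv (a *s v) T z = a *s dv v T z"
  by (simp add: vec_eq_iff 1 hol_fun_D(2)[OF hol_map_component[OF assms(2)] assms(3)])
qed

definition jac :: "(complex^'n::finite => complex^'n) => complex^'n => complex^'n^'n" where
 "jac T z = (\<chi> p j. wirt j (%u. T u $ p) z)"

lemma jac_mult:
 assumes "open S" "hol_map_on S T" "z : S"
 shows "jac T z *v v = dv v T z"
proof -
 have "(jac T z *v v) $ p = dv v T z $ p" for p
 proof -
  have h: "hol_fun S (%u. T u $ p)" by (rule hol_map_component[OF assms(2)])
  have "(jac T z *v v) $ p = (SUM j:UNIV. v $ j * wd (axis j 1) (%u. T u $ p) z)"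
   by (simp add: jac_def matrix_vector_mult_def wirt_wd mult.commute)
  also have "... = wd v (%u. T u $ p) z"
   by (rule wd_expand_dir(1)[OF assms(1) hol_fun_smooth[OF assms(1) h] assms(3), symmetric])
  finally show ?thesis using hol_fun_wdb[OF h assms(3)] hol_map_dv(1)[OF assms] by simp
 qed
 thus ?thesis by (simp add: vec_eq_iff)
qed

text \<open>The derivative of \<open>T\<close> along \<open>w\<close> enters through the
  antiholomorphic factors \<open>cnj (h q x)\<close>, which \<open>wd\<close> annihilates. No second
  derivative of \<open>T\<close> survives, so the Levi form pulls back like a tensor.\<close>

lemma levi_compose_hol:
 fixes f :: "complex^'n::finite => real"
 assumes S: "open S" and V: "open V" and T: "hol_map_on S T" and TS: "T ` S \<subseteq> V"
  and f: "smooth_on V f" and z: "z : S"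
 shows "levi (%u. f (T u)) z v w = levi f (T z) (dv v T z) (dv w T z)"
proof -
 let ?F = "%u. complex_of_real (f u)"
 have F: "smooth_on V ?F" by (intro smooth_intros f V)
 have Tsm: "smooth_on S T" by (rule hol_map_smooth[OF S T])
 have comp: "dv a (%u. H (T u)) x = dv (dv a T x) H (T x)" if "smooth_on V H" "x : S" for a x and H :: "complex^'n => complex"
  by (rule dv_compose[OF S V Tsm that(1) _ that(2)]) (use TS that in auto)
 have wdc: "wd a (%u. H (T u)) x = wd (dv a T x) H (T x)" "wdb a (%u. H (T u)) x = wdb (dv a T x) H (T x)"
  if "smooth_on V H" "x : S" for a x and H :: "complex^'n => complex"
  by (simp_all add: wd_def wdb_def comp[OF that] hol_map_dv(2)[OF S T that(2)])
 define h where "h q = (%x. dv w (%u. T u $ q) x)" for q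
 define H where "H q = wdb (axis q 1) ?F" for q
 have h: "hol_fun S (h q)" for q unfolding h_def by (rule hol_fun_dv[OF S hol_map_component[OF T]])
 have h_eq: "h q x = dv w T x $ q" if "x : S" for x q unfolding h_def using hol_map_dv(1)[OF S T that] by simp
 have hs: "smooth_on S (h q)" for q by (rule hol_fun_smooth[OF S h])
 have Hs: "smooth_on V (H q)" for q unfolding H_def by (rule smooth_on_wdb[OF V F])
 have HTs: "smooth_on S (%u. H q (T u))" for q by (rule smooth_on_compose[OF S V Tsm Hs TS])
 have "levi (%u. f (T u)) z v w = wd v (%x. SUM q:UNIV. cnj (h q x) * H q (T x)) z"
  unfolding levi_def
 proof (rule wd_cong_open[OF S z])
  fix x assume x: "x : S"
  have "wdb w (%u. ?F (T u)) x = wdb (dv w T x) ?F (T x)" by (rule wdc(2)[OF F x])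
  also have "... = (SUM q:UNIV. cnj (h q x) * H q (T x))"
   unfolding H_def using wd_expand_dir(2)[OF V F, of "T x"] TS x by (auto simp: h_eq)
  finally show "wdb w (%u. complex_of_real (f (T u))) x = (SUM q:UNIV. cnj (h q x) * H q (T x))" .
 qed
 also have "... = (SUM q:UNIV. wd v (%x. cnj (h q x) * H q (T x)) z)"
  by (rule wd_sum[OF S _ z]) (intro smooth_intros S hs HTs)
 also have "... = (SUM q:UNIV. cnj (h q z) * wd (dv v T z) (H q) (T z))"
 proof (rule sum.cong[OF refl])
  fix q
  have "wd v (%x. cnj (h q x) * H q (T x)) z
    = cnj (h q z) * wd v (%x. H q (T x)) z + wd v (%x. cnj (h q x)) z * H q (T z)"
   by (rule wd_mult[OF S _ HTs z]) (intro smooth_intros S hs)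
  also have "wd v (%x. cnj (h q x)) z = 0"
   using wd_cnj[OF S hs z] hol_fun_wdb(1)[OF h z] by simp
  finally show "wd v (%x. cnj (h q x) * H q (T x)) z = cnj (h q z) * wd (dv v T z) (H q) (T z)"
   using wdc(1)[OF Hs z] by simp
 qed
 also have "... = levi f (T z) (dv v T z) (dv w T z)"
 proof -
  have Tz: "T z : V" using TS z by blast
  have "levi f (T z) (dv v T z) (dv w T z) = wd (dv v T z) (%x. SUM q:UNIV. cnj (dv w T z $ q) * H q x) (T z)"
   unfolding levi_def H_def by (rule wd_cong_open[OF V Tz]) (rule wd_expand_dir(2)[OF V F])
  also have "... = (SUM q:UNIV. wd (dv v T z) (%x. cnj (dv w T z $ q) * H q x) (T z))"
   by (rule wd_sum[OF V _ Tz]) (intro smooth_intros V Hs)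
  also have "... = (SUM q:UNIV. cnj (dv w T z $ q) * wd (dv v T z) (H q) (T z))"
   by (intro sum.cong refl wd_cmult[OF V Hs Tz])
  finally show ?thesis by (simp add: h_eq[OF z])
 qed
 finally show ?thesis .
qed

lemma levm_compose_hol:
 fixes f :: "complex^'n::finite => real"
 assumes S: "open S" and V: "open V" and T: "hol_map_on S T" and TS: "T ` S \<subseteq> V"
  and f: "smooth_on V f" and z: "z : S"
 shows "levm (%u. f (T u)) z = cong (jac T z) (levm f (T z))"
proof -
 have fT: "smooth_on S (%u. f (T u))" by (rule smooth_on_compose[OF S V hol_map_smooth[OF S T] f TS])
 have Tz: "T z : V" using TS z by blast
 have "sesq (levm (%u. f (T u)) z) v w = sesq (cong (jac T z) (levm f (T z))) v w" for v w
  unfolding sesq_levm[OF S fT z] sesq_cong sesq_levm[OF V f Tz] jac_mult[OF S T z]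
  by (rule levi_compose_hol[OF assms])
 from this[of "axis _ 1" "axis _ 1"] show ?thesis by (simp add: sesq_axis vec_eq_iff)
qed

section \<open>Derivatives of determinants and inverse matrices\<close>

lemma smooth_on_entry [smooth_intros]:
 "open S ==> smooth_on S H ==> smooth_on S (%z. H z $ i $ j)"
 by (intro smooth_on_nth)

lemma smooth_on_matrix:
 fixes H :: "'e::real_normed_vector => complex^'n^'m"
 assumes "open S" "!!i j. smooth_on S (%z. H z $ i $ j)"
 shows "smooth_on S H"
 by (intro smooth_on_vec assms)

lemma dv_entry:
 fixes H :: "'e::real_normed_vector => complex^'n^'m"
 assumes "open S" "smooth_on S H" "z : S"
 shows "dv v (%z. H z $ i $ j) z = dv v H z $ i $ j"
 by (rule has_derivative_imp_dv)
   (intro bounded_linear.has_derivative[OF bounded_linear_vec_nth] smooth_on_has_derivative[OF assms])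

lemma smooth_on_det [smooth_intros]:
 fixes H :: "'e::real_normed_vector => complex^'n^'n"
 assumes "open S" "smooth_on S H"
 shows "smooth_on S (%z. det (H z))"
 unfolding det_def by (intro smooth_intros assms)

lemma det_nz_inverse:
 fixes A :: "complex^'n^'n"
 assumes "det A ~= 0"
 shows "A ** matrix_inv A = mat 1" "matrix_inv A ** A = mat 1"
proof -
 have "EX B. A ** B = mat 1 & B ** A = mat 1"
  using assms unfolding invertible_det_nz[symmetric] invertible_def .
 from someI_ex[OF this] show "A ** matrix_inv A = mat 1" "matrix_inv A ** A = mat 1"
  unfolding matrix_inv_def by auto
qed

text \<open>Exhibits the entries of the inverse as quotients of determinants, from which their
  smoothness can be read off.\<close>

lemma matrix_inv_cramer:
 fixes A :: "complex^'n^'n"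
 assumes "det A ~= 0"
 shows "matrix_inv A $ k $ j = det (\<chi> i l. if l = k then axis j 1 $ i else A $ i $ l) / det A"
proof -
 have "A ** matrix_inv A = mat 1" by (rule det_nz_inverse[OF assms])
 hence "A *v (matrix_inv A *v axis j 1) = axis j 1" by (simp add: matrix_vector_mul_assoc)
 hence "matrix_inv A *v axis j 1 = (\<chi> k. det (\<chi> i l. if l = k then axis j 1 $ i else A $ i $ l) / det A)"
  using cramer[OF assms] by blast
 moreover have "(matrix_inv A *v axis j 1) $ k = matrix_inv A $ k $ j"
  by (simp add: matrix_vector_mult_def axis_def if_distrib cong: if_cong)
 ultimately show ?thesis by simp
qed

lemma smooth_on_matrix_inv [smooth_intros]:
 fixes H :: "'e::real_normed_vector => complex^'n^'n"
 assumes S: "open S" and H: "smooth_on S H" and nz: "!!z. z : S ==> det (H z) ~= 0"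
 shows "smooth_on S (%z. matrix_inv (H z))"
proof (rule smooth_on_matrix[OF S])
 fix k j
 have "smooth_on S (%z. (\<chi> i l. if l = k then axis j 1 $ i else H z $ i $ l) :: complex^'n^'n)"
 proof (rule smooth_on_matrix[OF S])
  fix i l
  show "smooth_on S (%z. ((\<chi> i l. if l = k then axis j 1 $ i else H z $ i $ l) :: complex^'n^'n) $ i $ l)"
   by (cases "l = k") (auto intro!: smooth_intros S H)
 qed
 hence "smooth_on S (%z. det (\<chi> i l. if l = k then axis j 1 $ i else H z $ i $ l) * inverse (det (H z)))"
  by (intro smooth_intros S H nz)
 thus "smooth_on S (%z. matrix_inv (H z) $ k $ j)"
  by (subst smooth_on_cong[where g="%z. det (\<chi> i l. if l = k then axis j 1 $ i else H z $ i $ l) * inverse (det (H z))"])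
    (auto simp: matrix_inv_cramer[OF nz] divide_inverse)
qed

text \<open>A permutation other than the identity moves at least two indices, so after one factor
  has been differentiated an off-diagonal zero of \<open>mat 1\<close> is still among the
  others.\<close>

lemma det_has_derivative_mat1:
 "(det has_derivative trace) (at (mat 1 :: complex^'n^'n))"
proof -
 let ?P = "{p. p permutes (UNIV :: 'n set)}"
 have "((%X :: complex^'n^'n. SUM p:?P. of_int (sign p) * (\<Prod>i\<in>UNIV. X $ i $ p i)) has_derivative
   (%Y. SUM p:?P. of_int (sign p) * (SUM i:UNIV. Y $ i $ p i * (\<Prod>j\<in>UNIV - {i}. mat 1 $ j $ p j)))) (at (mat 1))"
  by (intro has_derivative_sum has_derivative_mult_right has_derivative_prod
   bounded_linear.has_derivative[OF bounded_linear_vec_nth] has_derivative_ident)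
 moreover have "(SUM p:?P. of_int (sign p) * (SUM i:UNIV. Y $ i $ p i * (\<Prod>j\<in>UNIV - {i}. (mat 1 :: complex^'n^'n) $ j $ p j))) = trace Y"
  for Y :: "complex^'n^'n"
 proof -
  have 0: "of_int (sign p) * (SUM i:UNIV. Y $ i $ p i * (\<Prod>j\<in>UNIV - {i}. (mat 1 :: complex^'n^'n) $ j $ p j)) = 0"
   if p: "p : ?P - {id}" for p
  proof -
   have "(\<Prod>j\<in>UNIV - {i}. (mat 1 :: complex^'n^'n) $ j $ p j) = 0" for i
   proof -
    obtain a where a: "p a ~= a" using p by fastforce
    have inj: "p x = p y ==> x = y" for x y using p permutes_inj[of p UNIV] by (auto dest: injD)
    obtain j where "j ~= i" "p j ~= j" using a inj by metis
    thus ?thesis by (intro prod_zero bexI[of _ j]) (auto simp: mat_def)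
   qed
   thus ?thesis by (simp only: mult_zero_right sum.neutral_const)
  qed
  have "(SUM p:?P. of_int (sign p) * (SUM i:UNIV. Y $ i $ p i * (\<Prod>j\<in>UNIV - {i}. (mat 1 :: complex^'n^'n) $ j $ p j)))
    = (SUM p:{id}. of_int (sign p) * (SUM i:UNIV. Y $ i $ p i * (\<Prod>j\<in>UNIV - {i}. (mat 1 :: complex^'n^'n) $ j $ p j)))"
   by (rule sum.mono_neutral_right) (use 0 in \<open>auto simp: permutes_id\<close>)
  also have "... = trace Y" by (simp add: sign_id trace_def mat_def)
  finally show ?thesis .
 qed
 ultimately show ?thesis unfolding det_def[abs_def] by simp
qed

lemma bounded_linear_matrix_left: "bounded_linear (%X :: complex^'n^'n. M ** X)"
 unfolding linear_conv_bounded_linear[symmetric]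
 by (rule linearI, rule matrix_add_ldistrib) (auto simp: matrix_matrix_mult_def vec_eq_iff scaleR_sum_right)

text \<open>Jacobi's formula at an arbitrary matrix follows from the derivative at the identity,
  applied to \<open>M ** H w\<close> with the inverse \<open>M\<close> frozen at
  \<open>z\<close>.\<close>

lemma dv_det:
 fixes H :: "'e::real_normed_vector => complex^'n^'n"
 assumes S: "open S" and H: "smooth_on S H" and z: "z : S" and nz: "det (H z) ~= 0"
 shows "dv v (%z. det (H z)) z = det (H z) * trace (matrix_inv (H z) ** dv v H z)"
proof -
 define M where "M = matrix_inv (H z)"
 have M: "H z ** M = mat 1" "M ** H z = mat 1"
  unfolding M_def using det_nz_inverse[OF nz] by auto
 have "((%w. M ** H w) has_derivative (%v. M ** dv v H z)) (at z)"
  by (rule bounded_linear.has_derivative[OF bounded_linear_matrix_left smooth_on_has_derivative[OF S H z]])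
 moreover have "(det has_derivative trace) (at (M ** H z))" unfolding M by (rule det_has_derivative_mat1)
 ultimately have "((%w. det (M ** H w)) has_derivative (%v. trace (M ** dv v H z))) (at z)"
  by (rule has_derivative_compose)
 from has_derivative_mult_right[OF this, of "det (H z)"]
 have "((%w. det (H z) * det (M ** H w)) has_derivative (%v. det (H z) * trace (M ** dv v H z))) (at z)" .
 moreover have "det (H z) * det (M ** H w) = det (H w)" for w
  by (metis M(1) det_mul matrix_mul_assoc matrix_mul_lid)
 ultimately show ?thesis unfolding M_def by (simp add: has_derivative_imp_dv)
qed

lemma dv_matrix_inv:
 fixes H :: "'e::real_normed_vector => complex^'n^'n"
 assumes S: "open S" and H: "smooth_on S H" and z: "z : S" and nz: "!!z. z : S ==> det (H z) ~= 0"
 shows "dv v (%z. matrix_inv (H z)) z = - (matrix_inv (H z) ** dv v H z ** matrix_inv (H z))"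
proof -
 define M where "M = (%z. matrix_inv (H z))"
 have M: "H w ** M w = mat 1" "M w ** H w = mat 1" if "w : S" for w
  unfolding M_def using det_nz_inverse[OF nz[OF that]] by auto
 have Ms: "smooth_on S M" unfolding M_def by (intro smooth_intros S H nz)
 have "(M z ** dv v H z + dv v M z ** H z) $ i $ j = 0" for i j
 proof -
  have "dv v (%w. SUM k:UNIV. M w $ i $ k * H w $ k $ j) z = (SUM k:UNIV. dv v (%w. M w $ i $ k * H w $ k $ j) z)"
   by (rule dv_sum[OF S _ z]) (intro smooth_intros S H Ms)
  also have "... = (SUM k:UNIV. M z $ i $ k * dv v H z $ k $ j + dv v M z $ i $ k * H z $ k $ j)"
  proof (rule sum.cong[OF refl])
   fix k
   show "dv v (%w. M w $ i $ k * H w $ k $ j) z = M z $ i $ k * dv v H z $ k $ j + dv v M z $ i $ k * H z $ k $ j"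
    unfolding dv_entry[OF S H z, symmetric] dv_entry[OF S Ms z, symmetric]
    by (rule dv_mult[OF S _ _ z]) (intro smooth_intros S H Ms)+
  qed
  also have "... = (M z ** dv v H z + dv v M z ** H z) $ i $ j"
   by (simp add: matrix_matrix_mult_def sum.distrib)
  finally have "(M z ** dv v H z + dv v M z ** H z) $ i $ j = dv v (%w. SUM k:UNIV. M w $ i $ k * H w $ k $ j) z" by simp
  also have "... = dv v (%w. (mat 1 :: complex^'n^'n) $ i $ j) z"
   by (rule dv_cong_open[OF S z]) (use M(2) in \<open>simp add: matrix_matrix_mult_def vec_eq_iff\<close>)
  finally show ?thesis by (simp add: dv_const)
 qed
 hence "dv v M z ** H z = - (M z ** dv v H z)"
  by (metis (no_types, lifting) add_eq_0_iff vec_eq_iff zero_index)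
 have "dv v M z = dv v M z ** (H z ** M z)" by (simp add: M(1)[OF z])
 also have "... = (dv v M z ** H z) ** M z" by (rule matrix_mul_assoc)
 also have "... = (- (M z ** dv v H z)) ** M z" by (simp only: \<open>dv v M z ** H z = - (M z ** dv v H z)\<close>)
 also have "... = - (M z ** dv v H z ** M z)"
  by (simp add: matrix_matrix_mult_def vec_eq_iff sum_negf)
 finally have "dv v M z = - (M z ** dv v H z ** M z)" .
 thus ?thesis by (simp add: M_def)
qed

definition wdm :: "complex^'n => (complex^'n::finite => complex^'n^'n) => complex^'n => complex^'n^'n" where
 "wdm v H z = (\<chi> i j. wd v (%u. H u $ i $ j) z)"

definition wdbm :: "complex^'n => (complex^'n::finite => complex^'n^'n) => complex^'n => complex^'n^'n" where
 "wdbm v H z = (\<chi> i j. wdb v (%u. H u $ i $ j) z)"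

lemma wdm_entry: "wdm v H z $ i $ j = wd v (%u. H u $ i $ j) z"
 and wdbm_entry: "wdbm v H z $ i $ j = wdb v (%u. H u $ i $ j) z"
 by (simp_all add: wdm_def wdbm_def)

lemma smooth_on_wdbm: "open S ==> smooth_on S H ==> smooth_on S (wdbm v H)"
 by (rule smooth_on_matrix) (auto simp: wdbm_entry intro!: smooth_on_wdb smooth_intros)

lemma
 assumes "open S" "smooth_on S H" "z : S"
 shows wdm_entry_dv: "wdm v H z $ i $ j = (dv v H z $ i $ j - \<i> * dv (\<i> *s v) H z $ i $ j) / 2"
  and wdbm_entry_dv: "wdbm v H z $ i $ j = (dv v H z $ i $ j + \<i> * dv (\<i> *s v) H z $ i $ j) / 2"
 by (simp_all add: wdm_entry wdbm_entry wd_def wdb_def dv_entry[OF assms])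

lemma trace_mult_entries: "trace (A ** B) = (SUM i:UNIV. SUM k:UNIV. A $ i $ k * B $ k $ i)"
 by (simp add: trace_def matrix_matrix_mult_def)

lemma
 assumes "open S" "smooth_on S H" "z : S" and nz: "!!z. z : S ==> det (H z) ~= 0"
 shows wd_det: "wd v (%z. det (H z)) z = det (H z) * trace (matrix_inv (H z) ** wdm v H z)"
  and wdb_det: "wdb v (%z. det (H z)) z = det (H z) * trace (matrix_inv (H z) ** wdbm v H z)"
  and wdm_matrix_inv: "wdm v (%z. matrix_inv (H z)) z = - (matrix_inv (H z) ** wdm v H z ** matrix_inv (H z))"
  and wdbm_matrix_inv: "wdbm v (%z. matrix_inv (H z)) z = - (matrix_inv (H z) ** wdbm v H z ** matrix_inv (H z))"
proof -
 have t: "trace (A ** wdm v H z) = (trace (A ** dv v H z) - \<i> * trace (A ** dv (\<i> *s v) H z)) / 2"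
  "trace (A ** wdbm v H z) = (trace (A ** dv v H z) + \<i> * trace (A ** dv (\<i> *s v) H z)) / 2" for A
  unfolding trace_mult_entries wdm_entry_dv[OF assms(1-3)] wdbm_entry_dv[OF assms(1-3)]
  by (simp_all add: sum_distrib_left sum_subtractf[symmetric] sum.distrib[symmetric] sum_divide_distrib algebra_simps)
 show "wd v (%z. det (H z)) z = det (H z) * trace (matrix_inv (H z) ** wdm v H z)"
  "wdb v (%z. det (H z)) z = det (H z) * trace (matrix_inv (H z) ** wdbm v H z)"
  unfolding wd_def wdb_def dv_det[OF assms(1-3) nz[OF assms(3)]] t by (simp_all add: algebra_simps)
 have Ms: "smooth_on S (%z. matrix_inv (H z))" by (intro smooth_intros assms)
 have m: "(A ** wdm v H z ** A) $ i $ j = ((A ** dv v H z ** A) $ i $ j - \<i> * (A ** dv (\<i> *s v) H z ** A) $ i $ j) / 2"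
  "(A ** wdbm v H z ** A) $ i $ j = ((A ** dv v H z ** A) $ i $ j + \<i> * (A ** dv (\<i> *s v) H z ** A) $ i $ j) / 2" for A i j
  unfolding matrix_matrix_mult_def
  by (simp_all add: wdm_entry_dv[OF assms(1-3)] wdbm_entry_dv[OF assms(1-3)] sum_distrib_left sum_distrib_right
    sum_subtractf[symmetric] sum.distrib[symmetric] sum_divide_distrib algebra_simps)
 show "wdm v (%z. matrix_inv (H z)) z = - (matrix_inv (H z) ** wdm v H z ** matrix_inv (H z))"
  "wdbm v (%z. matrix_inv (H z)) z = - (matrix_inv (H z) ** wdbm v H z ** matrix_inv (H z))"
  by (simp_all add: vec_eq_iff wdm_entry_dv[OF assms(1) Ms assms(3)] wdbm_entry_dv[OF assms(1) Ms assms(3)] dv_matrix_inv[OF assms(1-3) nz] m field_simps)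
qed

lemma smooth_on_sesq [smooth_intros]:
 "open S ==> smooth_on S H ==> smooth_on S (%z. sesq (H z) x y)"
 unfolding sesq_def by (intro smooth_intros)

lemma
 assumes "open S" "smooth_on S H" "z : S"
 shows wd_sesq: "wd v (%z. sesq (H z) x y) z = sesq (wdm v H z) x y"
  and wdb_sesq: "wdb v (%z. sesq (H z) x y) z = sesq (wdbm v H z) x y"
proof -
 have e: "sesq A x y = (SUM j:UNIV. SUM k:UNIV. (x $ j * cnj (y $ k)) * A $ j $ k)" for A
  by (simp add: sesq_def mult_ac)
 have s: "smooth_on S (%z. H z $ i $ j)" for i j by (intro smooth_intros assms)
 show "wd v (%z. sesq (H z) x y) z = sesq (wdm v H z) x y"
 proof -
  have "wd v (%z. sesq (H z) x y) z = (SUM j:UNIV. wd v (%z. SUM k:UNIV. (x $ j * cnj (y $ k)) * H z $ j $ k) z)"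
   unfolding e by (rule wd_sum[OF assms(1) _ assms(3)]) (intro smooth_intros assms)
  also have "... = (SUM j:UNIV. SUM k:UNIV. wd v (%z. (x $ j * cnj (y $ k)) * H z $ j $ k) z)"
   by (intro sum.cong refl wd_sum[OF assms(1) _ assms(3)]) (intro smooth_intros assms)
  also have "... = sesq (wdm v H z) x y" unfolding e wdm_entry
   by (intro sum.cong refl wd_cmult[OF assms(1) s assms(3)])
  finally show ?thesis .
 qed
 show "wdb v (%z. sesq (H z) x y) z = sesq (wdbm v H z) x y"
 proof -
  have "wdb v (%z. sesq (H z) x y) z = (SUM j:UNIV. wdb v (%z. SUM k:UNIV. (x $ j * cnj (y $ k)) * H z $ j $ k) z)"
   unfolding e by (rule wdb_sum[OF assms(1) _ assms(3)]) (intro smooth_intros assms)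
  also have "... = (SUM j:UNIV. SUM k:UNIV. wdb v (%z. (x $ j * cnj (y $ k)) * H z $ j $ k) z)"
   by (intro sum.cong refl wdb_sum[OF assms(1) _ assms(3)]) (intro smooth_intros assms)
  also have "... = sesq (wdbm v H z) x y" unfolding e wdbm_entry
   by (intro sum.cong refl wdb_cmult[OF assms(1) s assms(3)])
  finally show ?thesis .
 qed
qed

section \<open>The logarithm of the determinant and closed forms\<close>

definition lndet :: "('e => complex^'n::finite^'n) => 'e => real" where
 "lndet H z = ln (Re (det (H z)))"

lemma smooth_on_lndet:
 fixes H :: "'e::real_normed_vector => complex^'n::finite^'n"
 assumes "open S" "smooth_on S H" "!!z. z : S ==> pd (H z)"
 shows "smooth_on S (lndet H)"
 unfolding lndet_def[abs_def] by (intro smooth_intros assms pd_det)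

lemma pd_det_nz: "pd A ==> det A ~= 0"
 using pd_det(1)[of A] by auto

lemma dv_lndet:
 fixes H :: "'e::real_normed_vector => complex^'n::finite^'n"
 assumes S: "open S" and H: "smooth_on S H" and pd: "!!z. z : S ==> pd (H z)" and z: "z : S"
 shows "complex_of_real (dv v (lndet H) z) = trace (matrix_inv (H z) ** dv v H z)"
  and "dv v (lndet H) z = tr (H z) (dv v H z)"
proof -
 have ds: "smooth_on S (%z. det (H z))" by (intro smooth_intros S H)
 have Rs: "smooth_on S (%z. Re (det (H z)))" by (intro smooth_intros S H)
 have "dv v (%z. of_real (Re (det (H z))) :: complex) z = dv v (%z. det (H z)) z"
  by (rule dv_cong_open[OF S z]) (use pd_det(2)[OF pd] in simp)
 hence 1: "of_real (dv v (%z. Re (det (H z))) z) = det (H z) * trace (matrix_inv (H z) ** dv v H z)"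
  unfolding dv_of_real[OF S Rs z] dv_det[OF S H z pd_det_nz[OF pd[OF z]]] .
 have "dv v (lndet H) z = 1 / Re (det (H z)) * dv v (%z. Re (det (H z))) z"
  unfolding lndet_def[abs_def]
  by (rule dv_compose_real[OF S Rs z]) (use pd_det(1)[OF pd[OF z]] in \<open>auto intro!: derivative_eq_intros\<close>)
 hence "complex_of_real (dv v (lndet H) z) = 1 / of_real (Re (det (H z))) * of_real (dv v (%z. Re (det (H z))) z)"
  by simp
 also have "... = trace (matrix_inv (H z) ** dv v H z)"
  unfolding 1 pd_det(2)[OF pd[OF z], symmetric] using pd_det_nz[OF pd[OF z]] by simp
 finally show "complex_of_real (dv v (lndet H) z) = trace (matrix_inv (H z) ** dv v H z)" .
 thus "dv v (lndet H) z = tr (H z) (dv v H z)" unfolding tr_def by (metis Re_complex_of_real)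
qed

lemma wdb_lndet:
 fixes H :: "complex^'n::finite => complex^'n^'n"
 assumes S: "open S" and H: "smooth_on S H" and pd: "!!z. z : S ==> pd (H z)" and z: "z : S"
 shows "wdb v (%u. of_real (lndet H u)) z = trace (matrix_inv (H z) ** wdbm v H z)"
proof -
 have e: "dv v (%u. complex_of_real (lndet H u)) z = trace (matrix_inv (H z) ** dv v H z)" for v
  by (rule trans[OF dv_of_real[OF S smooth_on_lndet[OF S H pd] z] dv_lndet(1)[OF S H pd z]])
 show ?thesis
  unfolding wdb_def e trace_mult_entries wdbm_entry_dv[OF S H z]
  by (simp_all add: sum_distrib_left sum.distrib[symmetric] sum_divide_distrib algebra_simps)
qed

lemma trace_orthonormal_product:
 assumes E: "cong E A = mat 1"
 shows "trace (matrix_inv A ** P ** matrix_inv A ** Q)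
   = (SUM a:UNIV. SUM b:UNIV. sesq P (column a E) (column b E) * sesq Q (column b E) (column a E))"
proof -
 have "trace (matrix_inv A ** P ** matrix_inv A ** Q) = trace (cjm E ** (transpose E ** P ** cjm E ** (transpose E ** Q)))"
  unfolding cong_mat1_inverse(1)[OF E] by (simp add: matrix_mul_assoc)
 also have "... = trace (cong E P ** cong E Q)"
  by (subst trace_mul_sym) (simp add: cong_def matrix_mul_assoc)
 finally show ?thesis by (simp add: trace_mult_entries cong_nth)
qed

lemma
 fixes H :: "complex^'n::finite => complex^'n^'n"
 assumes S: "open S" and H: "smooth_on S H" and pd: "!!z. z : S ==> pd (H z)" and z: "z : S"
 shows wdb_sesq_herm: "wdb v (%u. sesq (H u) x y) z = cnj (wd v (%u. sesq (H u) y x) z)"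
  and wd_sesq_herm: "wd v (%u. sesq (H u) x y) z = cnj (wdb v (%u. sesq (H u) y x) z)"
proof -
 have s: "smooth_on S (%u. sesq (H u) y x)" by (intro smooth_intros S H)
 have e: "sesq (H u) x y = cnj (sesq (H u) y x)" if "u : S" for u
  by (rule herm_sesq) (use pd[OF that] in \<open>simp only: pd_def\<close>)
 have "wdb v (%u. sesq (H u) x y) z = wdb v (%u. cnj (sesq (H u) y x)) z"
  by (rule wdb_cong_open[OF S z e])
 thus "wdb v (%u. sesq (H u) x y) z = cnj (wd v (%u. sesq (H u) y x) z)" by (simp add: wdb_cnj[OF S s z])
 have "wd v (%u. sesq (H u) x y) z = wd v (%u. cnj (sesq (H u) y x)) z"
  by (rule wd_cong_open[OF S z e])
 thus "wd v (%u. sesq (H u) x y) z = cnj (wdb v (%u. sesq (H u) y x) z)" by (simp add: wd_cnj[OF S s z])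
qed

text \<open>\<open>E\<close> is a constant basis, orthonormal for the metric at the single point
  \<open>z\<close>. The second sum stems from the derivative of the inverse matrix; its squares
  absorb the gradient term in \<open>tr_levi_ln_form_ge\<close>.\<close>

lemma levi_lndet:
 fixes H :: "complex^'n::finite => complex^'n^'n"
 assumes S: "open S" and H: "smooth_on S H" and pd: "!!z. z : S ==> pd (H z)" and z: "z : S"
  and E: "cong E (H z) = mat 1"
 shows "levi (lndet H) z v v
   = (SUM a:UNIV. wd v (wdb v (%u. sesq (H u) (column a E) (column a E))) z)
   - (SUM a:UNIV. SUM b:UNIV. of_real ((cmod (wd v (%u. sesq (H u) (column a E) (column b E)) z))^2))"
proof -
 define M where "M = (%z. matrix_inv (H z))"
 have nz: "det (H z) ~= 0" if "z : S" for z by (rule pd_det_nz[OF pd[OF that]])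
 have Ms: "smooth_on S M" unfolding M_def by (intro smooth_intros S H nz)
 have Ws: "smooth_on S (wdbm v H)" by (rule smooth_on_wdbm[OF S H])
 have "levi (lndet H) z v v = wd v (%u. SUM i:UNIV. SUM k:UNIV. M u $ i $ k * wdbm v H u $ k $ i) z"
  unfolding levi_def
  by (rule wd_cong_open[OF S z]) (simp add: wdb_lndet[OF S H pd] M_def trace_mult_entries)
 also have "... = (SUM i:UNIV. wd v (%u. SUM k:UNIV. M u $ i $ k * wdbm v H u $ k $ i) z)"
  by (rule wd_sum[OF S _ z]) (intro smooth_intros S Ms Ws)
 also have "... = (SUM i:UNIV. SUM k:UNIV. wd v (%u. M u $ i $ k * wdbm v H u $ k $ i) z)"
  by (intro sum.cong refl wd_sum[OF S _ z]) (intro smooth_intros S Ms Ws)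
 also have "... = (SUM i:UNIV. SUM k:UNIV. M z $ i $ k * wdm v (wdbm v H) z $ k $ i + wdm v M z $ i $ k * wdbm v H z $ k $ i)"
  unfolding wdm_entry
  by (intro sum.cong refl wd_mult[OF S _ _ z]) (intro smooth_intros S Ms Ws)+
 also have "... = trace (M z ** wdm v (wdbm v H) z) + trace (wdm v M z ** wdbm v H z)"
  unfolding trace_mult_entries by (simp add: sum.distrib)
 also have "trace (wdm v M z ** wdbm v H z) = - trace (M z ** wdm v H z ** M z ** wdbm v H z)"
 proof -
  have wi: "wdm v M z = - (M z ** wdm v H z ** M z)" unfolding M_def by (rule wdm_matrix_inv[OF S H z nz])
  show ?thesis unfolding wi trace_mult_entries by (simp add: sum_negf)
 qed
 also have "trace (M z ** wdm v H z ** M z ** wdbm v H z)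
   = (SUM a:UNIV. SUM b:UNIV. of_real ((cmod (wd v (%u. sesq (H u) (column a E) (column b E)) z))^2))"
  unfolding M_def trace_orthonormal_product[OF E] wd_sesq[OF S H z, symmetric] wdb_sesq[OF S H z, symmetric]
  by (intro sum.cong refl) (simp only: wdb_sesq_herm[OF S H pd z] complex_norm_square)
 also have "trace (M z ** wdm v (wdbm v H) z) = (SUM a:UNIV. wd v (wdb v (%u. sesq (H u) (column a E) (column a E))) z)"
  unfolding M_def trace_inv_orthonormal[OF E] wd_sesq[OF S Ws z, symmetric]
  by (intro sum.cong refl wd_cong_open[OF S z]) (simp add: wdb_sesq[OF S H])
 finally show ?thesis by simp
qed

definition closedm :: "(complex^'n::finite) set => (complex^'n => complex^'n^'n) => bool" where
 "closedm S H \<longleftrightarrow> (ALL z:S. ALL l j k. wirt l (%u. H u $ j $ k) z = wirt j (%u. H u $ l $ k) z)"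

text \<open>For constant vectors, closedness lets the direction of differentiation and the first
  argument of the form change places. All later uses of the Kaehler condition go through this
  exchange.\<close>

lemma closedm_sesq:
 assumes S: "open S" and H: "smooth_on S H" and c: "closedm S H" and z: "z : S"
 shows "wd a (%u. sesq (H u) b x) z = wd b (%u. sesq (H u) a x) z"
proof -
 have e: "wd a (%u. sesq (H u) b x) z = (SUM l:UNIV. SUM j:UNIV. SUM k:UNIV. a $ l * b $ j * cnj (x $ k) * wirt l (%u. H u $ j $ k) z)" for a b
 proof -
  have s: "smooth_on S (%u. H u $ j $ k)" for j k by (intro smooth_intros S H)
  have "wd a (%u. sesq (H u) b x) z = (SUM j:UNIV. SUM k:UNIV. (b $ j * cnj (x $ k)) * wd a (%u. H u $ j $ k) z)"
   unfolding wd_sesq[OF S H z] unfolding sesq_def wdm_entry by (simp add: mult_ac)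
  also have "... = (SUM j:UNIV. SUM k:UNIV. SUM l:UNIV. a $ l * b $ j * cnj (x $ k) * wirt l (%u. H u $ j $ k) z)"
  proof (intro sum.cong refl)
   fix j k
   have "wd a (%u. H u $ j $ k) z = (SUM l:UNIV. a $ l * wd (axis l 1) (%u. H u $ j $ k) z)"
    by (rule wd_expand_dir(1)[OF S s z])
   thus "(b $ j * cnj (x $ k)) * wd a (%u. H u $ j $ k) z = (SUM l:UNIV. a $ l * b $ j * cnj (x $ k) * wirt l (%u. H u $ j $ k) z)"
    unfolding wirt_wd by (simp only: sum_distrib_left) (intro sum.cong refl, simp)
  qed
  also have "... = (SUM j:UNIV. SUM l:UNIV. SUM k:UNIV. a $ l * b $ j * cnj (x $ k) * wirt l (%u. H u $ j $ k) z)"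
   by (intro sum.cong refl sum.swap)
  also have "... = (SUM l:UNIV. SUM j:UNIV. SUM k:UNIV. a $ l * b $ j * cnj (x $ k) * wirt l (%u. H u $ j $ k) z)"
   by (rule sum.swap)
  finally show ?thesis .
 qed
 have "wd a (%u. sesq (H u) b x) z = (SUM l:UNIV. SUM j:UNIV. SUM k:UNIV. b $ j * a $ l * cnj (x $ k) * wirt j (%u. H u $ l $ k) z)"
  unfolding e using c z unfolding closedm_def by (intro sum.cong refl) (metis mult.commute)
 also have "... = wd b (%u. sesq (H u) a x) z"
  unfolding e[of b a] by (rule sum.swap)
 finally show ?thesis .
qed

lemma levi_compose:
 fixes h :: "complex^'n::finite => real" and f :: "real => real"
 assumes S: "open S" and h: "smooth_on S h" and z: "z : S" and J: "open J" "!!u. u : S ==> h u : J"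
  and f: "smooth_on J f" "smooth_on J f1"
  and d: "!!x. x : J ==> (f has_real_derivative f1 x) (at x)" "!!x. x : J ==> (f1 has_real_derivative f2 x) (at x)"
 shows "levi (%u. f (h u)) z v v = of_real (f1 (h z)) * levi h z v v
  + of_real (f2 (h z) * (cmod (wd v (%u. of_real (h u)) z))^2)"
proof -
 have fs: "smooth_on S (%u. f (h u))" "smooth_on S (%u. f1 (h u))"
  by (rule smooth_on_compose[OF S J(1) h]; use f J(2) in auto)+
 have 2: "dv w (dv w (%u. f (h u))) z = f1 (h z) * dv w (dv w h) z + f2 (h z) * (dv w h z)^2" for w
 proof -
  have "dv w (dv w (%u. f (h u))) z = dv w (%u. f1 (h u) * dv w h u) z"
   by (rule dv_cong_open[OF S z dv_compose_real[OF S h _ d(1)[OF J(2)]]])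
  also have "... = f1 (h z) * dv w (dv w h) z + dv w (%u. f1 (h u)) z * dv w h z"
   by (rule dv_mult[OF S fs(2) smooth_on_dv[OF S h] z])
  finally show ?thesis
   unfolding dv_compose_real[OF S h z d(2)[OF J(2)[OF z]]] by (simp add: power2_eq_square)
 qed
 have "(cmod (wd v (%u. of_real (h u)) z))^2 = ((dv v h z)^2 + (dv (\<i> *s v) h z)^2) / 4"
  unfolding wd_def dv_of_real[OF S h z] cmod_power2 by (simp add: power_divide)
 thus ?thesis unfolding levi_real[OF S fs(1) z] levi_real[OF S h z] 2
  by (simp add: algebra_simps add_divide_distrib)
qed

lemma levi_ln:
 fixes h :: "complex^'n::finite => real"
 assumes S: "open S" and h: "smooth_on S h" and pos: "!!z. z : S ==> h z > 0" and z: "z : S"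
 shows "levi (%u. ln (h u)) z v v = levi h z v v / of_real (h z)
  - of_real ((cmod (wd v (%u. of_real (h u)) z))^2 / (h z)^2)"
proof -
 have "levi (%u. ln (h u)) z v v = of_real (inverse (h z)) * levi h z v v
  + of_real (- inverse ((h z)^2) * (cmod (wd v (%u. of_real (h u)) z))^2)"
  by (rule levi_compose[OF S h z, where J="{0<..}"])
   (auto intro!: smooth_intros derivative_eq_intros simp: pos power2_eq_square divide_inverse)
 thus ?thesis by (simp add: divide_inverse mult.commute)
qed

text \<open>
 In Yau's second order estimate, the third order terms in \<open>tr_H (\<partial>dbar log H(v,v))\<close> are absorbed by
 those in \<open>\<partial>\<^sub>v dbar\<^sub>v log det H\<close>; \<open>v\<close> is a constant vector in the chart.
\<close>

theorem tr_levi_ln_form_ge: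
 fixes H :: "complex^'n::finite => complex^'n^'n"
 assumes S: "open S" and H: "smooth_on S H" and pd: "!!z. z : S ==> pd (H z)" and c: "closedm S H"
  and z: "z : S" and v: "v ~= 0"
 shows "Re (levi (lndet H) z v v) / qf (H z) v
  <= tr (H z) (levm (%u. ln (qf (H u) v)) z)"
proof -
 define h where "h = (%u. qf (H u) v)"
 have hc: "complex_of_real (h u) = sesq (H u) v v" if "u : S" for u
  unfolding h_def using herm_sesq_real[of "H u" v] pd[OF that] by (simp add: pd_def)
 have hs: "smooth_on S h" unfolding h_def by (intro smooth_intros S H)
 have hpos: "h u > 0" if "u : S" for u unfolding h_def using pd[OF that] v by (simp add: pd_def)
 have lns: "smooth_on S (%u. ln (h u))" by (intro smooth_intros S hs hpos)
 obtain E where E: "cong E (H z) = mat 1" using orthonormal_basis[OF pd[OF z]] by blast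
 define e where "e a = column a E" for a
 define p where "p a b = wd v (%u. sesq (H u) (e a) (e b)) z" for a b
 obtain x where x: "v = E *v x" using orthonormal_expansion[OF E] by blast
 have vx: "v = (SUM b:UNIV. x $ b *s e b)" unfolding x e_def matrix_mult_sum ..
 have hx: "h z = (SUM b:UNIV. (cmod (x $ b))^2)"
  unfolding h_def x using diag_form[OF E[unfolded mat1_diagm], of x] by simp
 \<comment> \<open>Closedness is used once for each of the two Wirtinger derivatives, trading the
   direction \<open>e a\<close> for \<open>v\<close> in the second derivatives of the
   metric.\<close>
 have lh: "levi h z (e a) (e a) = wd v (wdb v (%u. sesq (H u) (e a) (e a))) z" for a
 proof -
  have s: "smooth_on S (%u. sesq (H u) x y)" for x y by (intro smooth_intros S H)
  have 1: "wdb (e a) (%u. complex_of_real (h u)) y = wdb v (%u. sesq (H u) v (e a)) y" if y: "y : S" for y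
  proof -
   have "wdb (e a) (%u. complex_of_real (h u)) y = wdb (e a) (%u. sesq (H u) v v) y"
    by (rule wdb_cong_open[OF S y]) (rule hc)
   also have "... = cnj (wd (e a) (%u. sesq (H u) v v) y)" by (rule wdb_sesq_herm[OF S H pd y])
   also have "... = cnj (wd v (%u. sesq (H u) (e a) v) y)" by (subst closedm_sesq[OF S H c y]) simp
   also have "... = wdb v (%u. sesq (H u) v (e a)) y" by (rule wdb_sesq_herm[OF S H pd y, symmetric])
   finally show ?thesis .
  qed
  have "levi h z (e a) (e a) = wd (e a) (wdb v (%u. sesq (H u) v (e a))) z"
   unfolding levi_def by (rule wd_cong_open[OF S z 1])
  also have "... = wdb v (wd (e a) (%u. sesq (H u) v (e a))) z"
   by (rule wd_wdb_commute(1)[OF S s z])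
  also have "... = wdb v (wd v (%u. sesq (H u) (e a) (e a))) z"
   by (rule wdb_cong_open[OF S z]) (rule closedm_sesq[OF S H c])
  also have "... = wd v (wdb v (%u. sesq (H u) (e a) (e a))) z"
   by (rule wd_wdb_commute(1)[OF S s z, symmetric])
  finally show ?thesis .
 qed
 have wh: "wd (e a) (%u. complex_of_real (h u)) z = (SUM b:UNIV. cnj (x $ b) * p a b)" for a
 proof -
  have s: "smooth_on S (%u. sesq (H u) x y)" for x y by (intro smooth_intros S H)
  have "wd (e a) (%u. complex_of_real (h u)) z = wd (e a) (%u. sesq (H u) v v) z"
   by (rule wd_cong_open[OF S z]) (rule hc)
  also have "... = wd v (%u. sesq (H u) (e a) v) z" by (rule closedm_sesq[OF S H c z])
  also have "... = wd v (%u. SUM b:UNIV. cnj (x $ b) * sesq (H u) (e a) (e b)) z"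
  proof (rule wd_cong_open[OF S z])
   fix u
   have "sesq (H u) (e a) (SUM b:UNIV. x $ b *s e b) = (SUM b:UNIV. cnj (x $ b) * sesq (H u) (e a) (e b))"
    by (simp add: sesq_sum2 sesq_scale2)
   thus "sesq (H u) (e a) v = (SUM b:UNIV. cnj (x $ b) * sesq (H u) (e a) (e b))"
    by (simp only: vx[symmetric])
  qed
  also have "... = (SUM b:UNIV. wd v (%u. cnj (x $ b) * sesq (H u) (e a) (e b)) z)"
   by (rule wd_sum[OF S _ z]) (intro smooth_intros S H)
  also have "... = (SUM b:UNIV. cnj (x $ b) * p a b)"
   unfolding p_def by (intro sum.cong refl wd_cmult[OF S s z])
  finally show ?thesis .
 qed
 \<comment> \<open>Cauchy-Schwarz, with \<open>h z\<close> as the squared length of the coefficients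
   of \<open>v\<close>: the gradient term produced by the logarithm is dominated by the squares of
   the \<open>p a b\<close>.\<close>
 have cs: "(cmod (SUM b:UNIV. cnj (x $ b) * p a b))^2 <= h z * (SUM b:UNIV. (cmod (p a b))^2)" for a
 proof -
  have "cmod (SUM b:UNIV. cnj (x $ b) * p a b) <= (SUM b:UNIV. \<bar>cmod (x $ b)\<bar> * \<bar>cmod (p a b)\<bar>)"
   by (rule order_trans[OF norm_sum]) (simp add: norm_mult)
  also have "... <= L2_set (%b. cmod (x $ b)) UNIV * L2_set (%b. cmod (p a b)) UNIV"
   by (rule L2_set_mult_ineq)
  finally have "(cmod (SUM b:UNIV. cnj (x $ b) * p a b))^2 <= (L2_set (%b. cmod (x $ b)) UNIV * L2_set (%b. cmod (p a b)) UNIV)^2"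
   by (rule power_mono) simp
  thus ?thesis by (simp add: hx L2_set_def power_mult_distrib sum_nonneg)
 qed
 have "Re (levi (lndet H) z v v) = (SUM a:UNIV. Re (levi h z (e a) (e a))) - (SUM a:UNIV. SUM b:UNIV. (cmod (p a b))^2)"
 proof -
  have ll: "levi (lndet H) z v v = (SUM a:UNIV. levi h z (e a) (e a)) - (SUM a:UNIV. SUM b:UNIV. of_real ((cmod (p a b))^2))"
   using levi_lndet[OF S H pd z E, of v] unfolding lh unfolding p_def e_def by simp
  show ?thesis unfolding ll by simp
 qed
 hence L: "(SUM a:UNIV. Re (levi h z (e a) (e a))) = Re (levi (lndet H) z v v) + (SUM a:UNIV. SUM b:UNIV. (cmod (p a b))^2)"
  by simp
 have "tr (H z) (levm (%u. ln (h u)) z) = (SUM a:UNIV. Re (levi h z (e a) (e a)) / h z - (cmod (SUM b:UNIV. cnj (x $ b) * p a b))^2 / (h z)^2)"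
 proof -
  have ll: "levi (%u. ln (h u)) z (e a) (e a) = levi h z (e a) (e a) / of_real (h z)
    - of_real ((cmod (SUM b:UNIV. cnj (x $ b) * p a b))^2 / (h z)^2)" for a
   unfolding wh[symmetric] by (rule levi_ln[OF S hs hpos z])
  show ?thesis unfolding tr_orthonormal[OF E] sesq_levm[OF S lns z] e_def[symmetric] ll by simp
 qed
 also have "... >= (SUM a:UNIV. Re (levi h z (e a) (e a)) / h z - (SUM b:UNIV. (cmod (p a b))^2) / h z)"
 proof (rule sum_mono)
  fix a
  have "(cmod (SUM b:UNIV. cnj (x $ b) * p a b))^2 / (h z)^2 <= (h z * (SUM b:UNIV. (cmod (p a b))^2)) / (h z)^2"
   by (rule divide_right_mono[OF cs]) simp
  also have "... = (SUM b:UNIV. (cmod (p a b))^2) / h z" using hpos[OF z] by (simp add: power2_eq_square)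
  finally show "Re (levi h z (e a) (e a)) / h z - (SUM b:UNIV. (cmod (p a b))^2) / h z
   <= Re (levi h z (e a) (e a)) / h z - (cmod (SUM b:UNIV. cnj (x $ b) * p a b))^2 / (h z)^2" by simp
 qed
 finally have "(SUM a:UNIV. Re (levi h z (e a) (e a)) / h z - (SUM b:UNIV. (cmod (p a b))^2) / h z) <= tr (H z) (levm (%u. ln (h u)) z)" .
 moreover have "(SUM a:UNIV. Re (levi h z (e a) (e a)) / h z - (SUM b:UNIV. (cmod (p a b))^2) / h z) = Re (levi (lndet H) z v v) / h z"
  unfolding sum_subtractf sum_divide_distrib[symmetric] L by (simp add: add_divide_distrib)
 ultimately show ?thesis by (simp add: h_def)
qed

text \<open>Differentiating the determinant and the inverse gives two triple sums, which coincide
  once closedness allows the indices \<open>k\<close> and \<open>q\<close> to be exchanged. So the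
  cofactor matrix of a Kaehler metric is divergence free, and a Laplacian times the volume density
  is a divergence.\<close>

lemma piola:
 fixes H :: "complex^'n::finite => complex^'n^'n"
 assumes S: "open S" and H: "smooth_on S H" and pd: "!!z. z : S ==> pd (H z)" and c: "closedm S H" and z: "z : S"
 shows "(SUM k:UNIV. wirt_bar k (%u. det (H u) * matrix_inv (H u) $ k $ j) z) = 0"
proof -
 define M where "M = matrix_inv (H z)"
 have nz: "det (H z) ~= 0" if "z : S" for z by (rule pd_det_nz[OF pd[OF that]])
 define D where "D k p q = wirt_bar k (%u. H u $ p $ q) z" for k p q
 have sym: "D k p q = D q p k" for k p q
 proof -
  have "wdb a (%u. sesq (H u) x b) z = wdb b (%u. sesq (H u) x a) z" for a b x
  proof -
   have "wdb a (%u. sesq (H u) x b) z = cnj (wd a (%u. sesq (H u) b x) z)"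
    by (rule wdb_sesq_herm[OF S H pd z])
   also have "... = cnj (wd b (%u. sesq (H u) a x) z)"
    by (rule arg_cong[OF closedm_sesq[OF S H c z]])
   also have "... = wdb b (%u. sesq (H u) x a) z"
    by (rule wdb_sesq_herm[OF S H pd z, symmetric])
   finally show ?thesis .
  qed
  from this[of "axis k 1" "axis p 1" "axis q 1"] show ?thesis
   by (simp add: D_def wirt_bar_wdb sesq_axis)
 qed
 have "wirt_bar k (%u. det (H u) * matrix_inv (H u) $ k $ j) z
   = det (H z) * ((SUM q:UNIV. SUM p:UNIV. M $ q $ p * D k p q * M $ k $ j) - (SUM q:UNIV. SUM p:UNIV. M $ k $ p * D k p q * M $ q $ j))" for k
 proof -
  have "wirt_bar k (%u. det (H u) * matrix_inv (H u) $ k $ j) z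
   = det (H z) * wdbm (axis k 1) (%u. matrix_inv (H u)) z $ k $ j + wdb (axis k 1) (%u. det (H u)) z * M $ k $ j"
   unfolding wirt_bar_wdb wdbm_entry M_def
   by (rule wdb_mult[OF S _ _ z]) (intro smooth_intros S H nz)+
  also have "wdbm (axis k 1) (%u. matrix_inv (H u)) z $ k $ j = - (SUM q:UNIV. SUM p:UNIV. M $ k $ p * D k p q * M $ q $ j)"
  proof -
   have wi: "wdbm (axis k 1) (%u. matrix_inv (H u)) z = - (M ** wdbm (axis k 1) H z ** M)"
    unfolding M_def by (rule wdbm_matrix_inv[OF S H z nz])
   show ?thesis unfolding wi
    by (simp add: matrix_matrix_mult_def sum_distrib_right wdbm_entry D_def wirt_bar_wdb)
  qed
  also have "wdb (axis k 1) (%u. det (H u)) z = det (H z) * (SUM q:UNIV. SUM p:UNIV. M $ q $ p * D k p q)"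
  proof -
   have wi: "wdb (axis k 1) (%u. det (H u)) z = det (H z) * trace (M ** wdbm (axis k 1) H z)"
    unfolding M_def by (rule wdb_det[OF S H z nz])
   show ?thesis unfolding wi trace_mult_entries by (simp add: wdbm_entry D_def wirt_bar_wdb)
  qed
  finally show ?thesis by (simp add: algebra_simps sum_distrib_left sum_distrib_right)
 qed
 hence "(SUM k:UNIV. wirt_bar k (%u. det (H u) * matrix_inv (H u) $ k $ j) z)
  = det (H z) * ((SUM k:UNIV. SUM q:UNIV. SUM p:UNIV. M $ q $ p * D k p q * M $ k $ j) - (SUM k:UNIV. SUM q:UNIV. SUM p:UNIV. M $ k $ p * D k p q * M $ q $ j))"
  by (simp add: sum_distrib_left[symmetric] sum_subtractf)
 also have "(SUM k:UNIV. SUM q:UNIV. SUM p:UNIV. M $ k $ p * D k p q * M $ q $ j) = (SUM q:UNIV. SUM k:UNIV. SUM p:UNIV. M $ k $ p * D k p q * M $ q $ j)"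
  by (rule sum.swap)
 also have "... = (SUM q:UNIV. SUM k:UNIV. SUM p:UNIV. M $ k $ p * D q p k * M $ q $ j)"
  by (intro sum.cong refl) (metis sym)
 finally show ?thesis by simp
qed

section \<open>Integrals of compactly supported functions\<close>

text \<open>Nothing is asked outside \<open>U\<close>: the functions are local expressions in a
  chart and have no meaning beyond its image.\<close>

definition supp_in :: "'e::euclidean_space set => 'e set => ('e => real) => bool" where
 "supp_in U K g \<longleftrightarrow> open U & compact K & K \<subseteq> U & (ALL z:U - K. g z = 0)"

definition ext0 :: "'e set => ('e => real) => 'e => real" where
 "ext0 U g z = (if z : U then g z else 0)"

text \<open>The products of \<open>P\<close> with \<open>U\<close> and with the complement of
  \<open>K\<close> are relatively open and cover everything; on their overlap both definitions give
  0.\<close>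

lemma continuous_on_ext0_param:
 fixes G :: "'p::topological_space => 'e::euclidean_space => real"
 assumes U: "open U" "compact K" "K \<subseteq> U" and 0: "!!p z. p : P ==> z : U - K ==> G p z = 0"
  and c: "continuous_on (P \<times> U) (%(p, z). G p z)"
 shows "continuous_on (P \<times> UNIV) (%(p, z). ext0 U (G p) z)"
proof -
 have un: "P \<times> UNIV = (P \<times> U) \<union> (P \<times> (- K))" using U(3) by auto
 have "continuous_on ((P \<times> U) \<union> (P \<times> (- K))) (%x. if snd x : U then (case x of (p, z) => G p z) else 0)"
 proof (rule continuous_on_cases_local_open)
  show "openin (top_of_set (P \<times> U \<union> P \<times> (- K))) (P \<times> U)"
   unfolding un[symmetric] by (intro openin_Times) (use U(1) in \<open>auto simp: open_openin[symmetric]\<close>)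
  show "openin (top_of_set (P \<times> U \<union> P \<times> (- K))) (P \<times> (- K))"
   unfolding un[symmetric] using compact_imp_closed[OF U(2)]
   by (intro openin_Times) (auto simp: open_openin[symmetric])
 qed (use c 0 in \<open>auto intro: continuous_on_const\<close>)
 thus ?thesis unfolding un by (rule continuous_on_eq) (auto simp: ext0_def)
qed

lemma continuous_on_param_slice:
 assumes "continuous_on (P \<times> U) (%(p, z). F p z)" "p : P"
 shows "continuous_on U (F p)"
proof -
 have "continuous_on U (%z. case (p, z) of (p, z) => F p z)"
  by (rule continuous_on_compose2[OF assms(1)]) (auto intro!: continuous_intros assms)
 thus ?thesis by simp
qed

lemma continuous_on_ext0:
 assumes "supp_in U K g" "continuous_on U g"
 shows "continuous_on UNIV (ext0 U g)"
proof -
 have "continuous_on ({0::real} \<times> U) (%(p, z). g z)"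
  unfolding split_beta by (rule continuous_on_compose2[OF assms(2)]) (auto intro: continuous_intros)
 hence "continuous_on ({0::real} \<times> UNIV) (%(p, z). ext0 U g z)"
  using assms(1) unfolding supp_in_def by (intro continuous_on_ext0_param[of U K]) auto
 from continuous_on_param_slice[OF this] show ?thesis by simp
qed

lemma set_integral_ext0: "(LBINT z:U. g z) = (LBINT z. ext0 U g z)"
 unfolding set_lebesgue_integral_def by (intro Bochner_Integration.integral_cong) (auto simp: ext0_def)

lemma continuous_compact_integrable:
 fixes g :: "'e::euclidean_space => real"
 assumes "continuous_on UNIV g" "compact K" "!!z. z \<notin> K ==> g z = 0"
 shows "integrable lborel g"
proof -
 have "integrable lborel (%x. indicator K x *\<^sub>R g x)"
  using assms(1,2) by (intro borel_integrable_compact) (auto intro: continuous_on_subset)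
 moreover have "(%x. indicator K x *\<^sub>R g x) = g"
  using assms(3) by (auto simp: fun_eq_iff indicator_def)
 ultimately show ?thesis by simp
qed

lemma integrable_ext0:
 assumes "supp_in U K g" "continuous_on U g"
 shows "integrable lborel (ext0 U g)"
 by (rule continuous_compact_integrable[OF continuous_on_ext0[OF assms], of K])
   (use assms(1) in \<open>auto simp: supp_in_def ext0_def\<close>)

text \<open>Passing to an integral over a compact box opens the way to the theorems about integrals
  that depend on a parameter.\<close>

lemma lint_cbox:
 fixes g :: "'e::euclidean_space => real"
 assumes "continuous_on UNIV g" "!!z. z \<notin> cbox a b ==> g z = 0"
 shows "(LBINT z. g z) = integral (cbox a b) g"
proof -
 have i: "integrable lborel g" by (rule continuous_compact_integrable[OF assms(1) compact_cbox assms(2)])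
 have "(LBINT z. g z) = integral UNIV g"
  using integral_lborel[OF i] by simp
 also have "... = integral (cbox a b) g"
 proof -
  have "g = (%x. if x : cbox a b then g x else 0)" using assms(2) by auto
  thus ?thesis by (metis integral_restrict_UNIV)
 qed
 finally show ?thesis .
qed

lemma supp_cbox:
 fixes K :: "'e::euclidean_space set"
 assumes "compact K"
 obtains a b where "K \<subseteq> cbox a b"
 using bounded_subset_cbox_symmetric[OF compact_imp_bounded[OF assms]] by metis

lemma continuous_on_lint_param:
 fixes G :: "'p::topological_space => 'e::euclidean_space => real"
 assumes U: "open U" "compact K" "K \<subseteq> U" and 0: "!!p z. p : P ==> z : U - K ==> G p z = 0"
  and c: "continuous_on (P \<times> U) (%(p, z). G p z)"
 shows "continuous_on P (%p. LBINT z:U. G p z)"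
proof -
 obtain a b where ab: "K \<subseteq> cbox a b" using supp_cbox[OF U(2)] .
 note ce = continuous_on_ext0_param[OF U 0 c]
 have "(LBINT z:U. G p z) = integral (cbox a b) (ext0 U (G p))" if "p : P" for p
  unfolding set_integral_ext0
 proof (rule lint_cbox)
  show "continuous_on UNIV (ext0 U (G p))"
   by (rule continuous_on_param_slice[OF ce that])
 qed (use ab 0 that in \<open>auto simp: ext0_def\<close>)
 moreover have "continuous_on P (%p. integral (cbox a b) (ext0 U (G p)))"
  by (rule integral_continuous_on_param) (rule continuous_on_subset[OF ce], auto)
 ultimately show ?thesis by (simp cong: continuous_on_cong)
qed

lemma lint_param_derivative:
 fixes G G' :: "real => 'e::euclidean_space => real"
 assumes U: "open U" "compact K" "K \<subseteq> U"
  and 0: "!!p z. p : P ==> z : U - K ==> G p z = 0" "!!p z. p : P ==> z : U - K ==> G' p z = 0"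
  and d: "!!p z. p : P ==> z : U ==> ((%p. G p z) has_real_derivative G' p z) (at p within P)"
  and c: "!!p. p : P ==> continuous_on U (G p)" "continuous_on (P \<times> U) (%(p, z). G' p z)"
  and P: "convex P" "p : P"
 shows "((%p. LBINT z:U. G p z) has_real_derivative (LBINT z:U. G' p z)) (at p within P)"
proof -
 obtain a b where ab: "K \<subseteq> cbox a b" using supp_cbox[OF U(2)] .
 note ce' = continuous_on_ext0_param[OF U 0(2) c(2)]
 have ce: "continuous_on UNIV (ext0 U (G p))" if "p : P" for p
  by (rule continuous_on_ext0[OF _ c(1)[OF that], of K]) (use U 0 that in \<open>auto simp: supp_in_def\<close>)
 have eq: "(LBINT z:U. G p z) = integral (cbox a b) (ext0 U (G p))" if "p : P" for p
  unfolding set_integral_ext0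
  by (rule lint_cbox[OF ce[OF that]]) (use ab 0 that in \<open>auto simp: ext0_def\<close>)
 have eq': "(LBINT z:U. G' p z) = integral (cbox a b) (ext0 U (G' p))" if "p : P" for p
  unfolding set_integral_ext0
 proof (rule lint_cbox)
  show "continuous_on UNIV (ext0 U (G' p))"
   by (rule continuous_on_param_slice[OF ce' that])
 qed (use ab 0(2)[OF that] in \<open>auto simp: ext0_def subset_iff\<close>)
 have "((%p. integral (cbox a b) (ext0 U (G p))) has_field_derivative integral (cbox a b) (ext0 U (G' p))) (at p within P)"
 proof (rule leibniz_rule_field_derivative)
  show "((%p. ext0 U (G p) t) has_field_derivative ext0 U (G' p) t) (at p within P)" if "p : P" for p t
   using d[OF that] by (cases "t : U") (auto simp: ext0_def)
  show "ext0 U (G p) integrable_on cbox a b" if "p : P" for p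
   by (rule integrable_continuous) (rule continuous_on_subset[OF ce[OF that]], auto)
  show "continuous_on (P \<times> cbox a b) (%(x, t). ext0 U (G' x) t)"
   by (rule continuous_on_subset[OF ce']) auto
 qed (use P in auto)
 thus ?thesis
  unfolding eq'[OF P(2)]
  by (rule has_field_derivative_transform_within[OF _ zero_less_one P(2)]) (simp add: eq)
qed

lemma smooth_on_ext0:
 assumes "supp_in U K g" "smooth_on U g"
 shows "smooth_on UNIV (ext0 U g)"
proof (rule smooth_on_local[OF open_UNIV])
 fix z :: 'a
 have U: "open U" "compact K" "K \<subseteq> U" and 0: "!!z. z : U - K ==> g z = 0"
  using assms(1) by (auto simp: supp_in_def)
 have o: "open (- K)" using compact_imp_closed[OF U(2)] by auto
 show "EX T. open T & z : T & smooth_on T (ext0 U g)"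
 proof (cases "z : K")
  case True
  have "smooth_on U (ext0 U g)"
   using assms(2) by (subst smooth_on_cong[where g=g]) (auto simp: ext0_def)
  thus ?thesis using True U by blast
 next
  case False
  have "smooth_on (- K) (ext0 U g)"
   using smooth_on_const[OF o, of 0] 0 by (subst smooth_on_cong[where g="%_. 0"]) (auto simp: ext0_def)
  thus ?thesis using False o by blast
 qed
qed

lemma lint_translate:
 fixes g :: "'e::euclidean_space => real"
 assumes "g : borel_measurable borel"
 shows "(LBINT z. g (a + z)) = (LBINT z. g z)"
proof -
 have "(LBINT z. g z) = (LINT z|distr lborel borel ((+) a). g z)" by (simp add: lborel_distr_plus)
 also have "... = (LBINT z. g (a + z))" by (rule integral_distr) (use assms in auto)
 finally show ?thesis by simp
qed

text \<open>The integral of a translate of \<open>g\<close> along \<open>v\<close> does not depend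
  on the translation; its derivative at 0, taken under the integral, is the integral of
  \<open>dv v g\<close>.\<close>

lemma lint_dv_zero:
 fixes g :: "'e::euclidean_space => real"
 assumes sg: "supp_in U K g" and g: "smooth_on U g"
 shows "(LBINT z:U. dv v g z) = 0"
proof -
 define h where "h = ext0 U g"
 have h: "smooth_on UNIV h" unfolding h_def by (rule smooth_on_ext0[OF assms])
 have U: "open U" "compact K" "K \<subseteq> U" and 0: "!!z. z : U - K ==> g z = 0"
  using sg by (auto simp: supp_in_def)
 have o: "open (- K)" using compact_imp_closed[OF U(2)] by auto
 have h0: "h z = 0" if "z \<notin> K" for z using that 0 by (auto simp: h_def ext0_def)
 have dh0: "dv v h z = 0" if "z \<notin> K" for z
  using dv_cong_open[OF o, of z h "%_. 0" v] h0 that by (simp add: dv_const)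
 \<comment> \<open>Contains the supports of all translates by \<open>s *\<^sub>R v\<close> with
   \<open>s\<close> in \<open>{-1..1}\<close>.\<close>
 define K' where "K' = (%(x, s). x - s *\<^sub>R v) ` (K \<times> {-1..1})"
 have K': "compact K'" unfolding K'_def
  by (intro compact_continuous_image compact_Times U) (auto simp: split_beta intro!: continuous_intros)
 have out: "z + s *\<^sub>R v \<notin> K" if "z \<notin> K'" "s : {-1..1}" for z s
 proof
  assume "z + s *\<^sub>R v : K"
  hence "(%(x, s). x - s *\<^sub>R v) (z + s *\<^sub>R v, s) : K'" unfolding K'_def using that(2) by blast
  thus False using that(1) by simp
 qed
 have "((%s. LBINT z:UNIV. h (z + s *\<^sub>R v)) has_real_derivative (LBINT z:UNIV. dv v h (z + 0 *\<^sub>R v))) (at 0 within {-1..1})"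
 proof (rule lint_param_derivative[where K=K'])
  show "((%s. h (z + s *\<^sub>R v)) has_real_derivative dv v h (z + p *\<^sub>R v)) (at p within {- 1..1})" for p z
   unfolding has_real_derivative_iff_has_vector_derivative
   by (rule has_vector_derivative_at_within[OF dv_path[OF open_UNIV h]]) simp
  show "continuous_on UNIV (%z. h (z + p *\<^sub>R v))" for p
   by (rule continuous_on_compose2[OF smooth_continuous[OF h]]) (auto intro!: continuous_intros)
  show "continuous_on ({- 1..1} \<times> UNIV) (%(p, z). dv v h (z + p *\<^sub>R v))"
   unfolding split_beta
   by (rule continuous_on_compose2[OF smooth_continuous[OF smooth_on_dv[OF open_UNIV h]]]) (auto intro!: continuous_intros)
 qed (use K' out h0 dh0 in auto)
 moreover have "(LBINT z:UNIV. h (z + s *\<^sub>R v)) = (LBINT z. h z)" for s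
 proof -
  have "h : borel_measurable borel"
   using smooth_continuous[OF h] by (rule borel_measurable_continuous_onI)
  from lint_translate[OF this, of "s *\<^sub>R v"] show ?thesis
   by (simp add: set_lebesgue_integral_def add.commute)
 qed
 ultimately have "((%s. LBINT z. h z) has_real_derivative (LBINT z. dv v h z)) (at 0 within {-1..1})"
  by (simp add: set_lebesgue_integral_def)
 hence "((%s. LBINT z. h z) has_real_derivative (LBINT z. dv v h z)) (at 0)"
  by (subst (asm) at_within_interior) auto
 hence "(LBINT z. dv v h z) = 0" by (rule DERIV_unique) simp
 moreover have "dv v h = ext0 U (dv v g)"
 proof
  fix z
  show "dv v h z = ext0 U (dv v g) z"
  proof (cases "z : U")
   case True
   have "dv v h z = dv v g z" by (rule dv_cong_open[OF U(1) True]) (simp add: h_def ext0_def)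
   thus ?thesis using True by (simp add: ext0_def)
  next
   case False
   thus ?thesis using dh0[of z] U(3) by (auto simp: ext0_def)
  qed
 qed
 ultimately show ?thesis unfolding set_integral_ext0 by simp
qed

section \<open>Change of variables for holomorphic maps\<close>

text \<open>The type \<open>'n bit0\<close> has twice as many elements as \<open>'n\<close>, so
  \<open>real^('n bit0)\<close> can serve as the real coordinate space underlying
  \<open>complex^'n\<close>.\<close>

lemma complex_vec_basis_enumeration:
 obtains b :: "'n::finite bit0 => complex^'n" where "bij_betw b UNIV Basis"
proof -
 have "card (UNIV :: 'n bit0 set) = card (Basis :: (complex^'n) set)"
  by (simp add: mult.commute)
 thus ?thesis using that finite_same_card_bij[of "UNIV :: 'n bit0 set" "Basis :: (complex^'n) set"] by auto
qed

definition cbas :: "'n::finite bit0 => complex^'n" where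
 "cbas = (SOME b. bij_betw b UNIV Basis)"

lemma cbas: "bij_betw (cbas :: 'n::finite bit0 => complex^'n) UNIV Basis"
 unfolding cbas_def using complex_vec_basis_enumeration by (metis someI_ex)

definition to_real_vec :: "complex^'n::finite => real^('n bit0)" where
 "to_real_vec z = (\<chi> i. z \<bullet> cbas i)"

definition of_real_vec :: "real^('n bit0) => complex^'n::finite" where
 "of_real_vec x = (SUM i:UNIV. (x $ i) *\<^sub>R cbas i)"

lemma
 fixes i j :: "'n::finite bit0"
 shows cbas_in: "cbas i : Basis" and cbas_inner: "cbas i \<bullet> cbas j = (if i = j then 1 else 0)"
proof -
 show in_b: "cbas i : Basis" for i :: "'n bit0" using cbas by (auto simp: bij_betw_def)
 have "inj (cbas :: 'n bit0 => complex^'n)" using cbas by (auto simp: bij_betw_def)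
 thus "cbas i \<bullet> cbas j = (if i = j then 1 else 0)"
  using inner_Basis[OF in_b in_b, of i j] by (auto simp: inj_eq)
qed

lemma ball_Basis_cbas: "(ALL b:Basis. P b) \<longleftrightarrow> (ALL i. P (cbas i))"
 using bij_betw_imp_surj_on[OF cbas] by (metis (no_types, lifting) UNIV_I image_iff)

lemma sum_Basis_cbas: "(SUM b:Basis. f b) = (SUM i:UNIV. f (cbas i))"
 using sum.reindex_bij_betw[OF cbas, of f] by simp

lemma prod_Basis_cbas: "(\<Prod>b\<in>Basis. f b) = (\<Prod>i\<in>UNIV. f (cbas i))"
 using prod.reindex_bij_betw[OF cbas, of f] by simp

lemma of_to_real_vec [simp]: "of_real_vec (to_real_vec z) = z"
 unfolding of_real_vec_def to_real_vec_def
 using euclidean_representation[of z] by (simp add: sum_Basis_cbas)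

lemma to_of_real_vec [simp]: "to_real_vec (of_real_vec x) = x"
 by (simp add: of_real_vec_def to_real_vec_def vec_eq_iff inner_sum_left cbas_inner if_distrib cong: if_cong)

lemma linear_to_real_vec: "linear to_real_vec"
 by (rule linearI) (auto simp: to_real_vec_def vec_eq_iff inner_add_left)

lemma linear_of_real_vec: "linear of_real_vec"
 by (rule linearI) (auto simp: of_real_vec_def scaleR_add_left sum.distrib scaleR_sum_right)

lemma bounded_linear_to_real_vec: "bounded_linear to_real_vec"
 and bounded_linear_of_real_vec: "bounded_linear of_real_vec"
 using linear_to_real_vec linear_of_real_vec by (auto simp: linear_conv_bounded_linear)

lemma norm_to_real_vec: "norm (to_real_vec z) = norm z"
proof -
 have "(norm z)^2 = (SUM i:UNIV. (z \<bullet> cbas i)^2)"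
  unfolding power2_norm_eq_inner by (subst euclidean_inner) (simp add: sum_Basis_cbas power2_eq_square)
 also have "... = (norm (to_real_vec z))^2"
  by (simp add: norm_vec_def L2_set_def sum_nonneg to_real_vec_def)
 finally show ?thesis by (simp add: power2_eq_iff_nonneg)
qed

text \<open>The preimage of a box is a box with the same side lengths in another enumeration, and
  boxes determine Lebesgue measure.\<close>

lemma distr_of_real_vec: "distr lborel borel (of_real_vec :: _ => complex^'n::finite) = lborel"
proof (rule lborel_eqI[symmetric])
 have m: "(of_real_vec :: _ => complex^'n) : borel_measurable borel"
  by (intro borel_measurable_continuous_onI linear_continuous_on bounded_linear_of_real_vec)
 fix l u :: "complex^'n" assume lu: "!!b. b : Basis ==> l \<bullet> b <= u \<bullet> b"
 have eq: "of_real_vec -` box l u = box (to_real_vec l) (to_real_vec u)"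
 proof -
  have "x : of_real_vec -` box l u \<longleftrightarrow> x : box (to_real_vec l) (to_real_vec u)" for x
  proof -
   have "of_real_vec x \<bullet> cbas i = x $ i" for i
    using to_of_real_vec[of x] by (metis to_real_vec_def vec_lambda_beta)
   hence "of_real_vec x : box l u \<longleftrightarrow> (ALL i. l \<bullet> cbas i < x $ i & x $ i < u \<bullet> cbas i)"
    unfolding mem_box ball_Basis_cbas by simp
   thus ?thesis by (simp add: mem_box_cart to_real_vec_def)
  qed
  thus ?thesis by blast
 qed
 have le: "to_real_vec l \<bullet> b <= to_real_vec u \<bullet> b" if "b : Basis" for b
  using that lu[OF cbas_in] by (auto simp: Basis_vec_def inner_axis to_real_vec_def)
 have "emeasure (distr lborel borel of_real_vec) (box l u) = emeasure lborel (box (to_real_vec l) (to_real_vec u))"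
  using m by (simp add: emeasure_distr eq)
 also have "... = (\<Prod>b\<in>Basis. (to_real_vec u - to_real_vec l) \<bullet> b)" by (rule emeasure_lborel_box[OF le])
 also have "(\<Prod>b\<in>Basis. (to_real_vec u - to_real_vec l) \<bullet> b) = (\<Prod>i\<in>UNIV. (u - l) \<bullet> cbas i)"
 proof -
  have B: "(Basis :: (real^('n bit0)) set) = range (%i. axis i 1)" by (auto simp: Basis_vec_def)
  have "inj (%i. axis i 1 :: real^('n bit0))" by (auto simp: inj_def axis_eq_axis)
  thus ?thesis unfolding B by (subst prod.reindex) (auto simp: inner_axis to_real_vec_def inner_diff_left)
 qed
 also have "... = (\<Prod>b\<in>Basis. (u - l) \<bullet> b)" by (simp add: prod_Basis_cbas)
 finally show "emeasure (distr lborel borel of_real_vec) (box l u) = (\<Prod>b\<in>Basis. (u - l) \<bullet> b)" .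
qed simp

text \<open>The factor in the real change of variables formula. The absolute value makes it equal to
  1 on every linear isometry.\<close>

definition rdet :: "(complex^'n::finite => complex^'n) => real" where
 "rdet J = \<bar>det (matrix (to_real_vec \<circ> J \<circ> of_real_vec))\<bar>"

lemma linear_matrix_vector: "linear (%v. (A :: complex^'n^'n) *v v)"
 by (rule linearI, rule matrix_vector_right_distrib) (simp add: matrix_vector_mult_def vec_eq_iff scaleR_sum_right)

lemma rdet_mult: "rdet (%v. (A ** B) *v v) = rdet (%v. A *v v) * rdet (%v. B *v v)"
proof -
 have l: "linear (to_real_vec \<circ> (%v. A *v v) \<circ> of_real_vec)" for A :: "complex^'a^'a"
  by (intro linear_compose linear_to_real_vec linear_of_real_vec linear_matrix_vector)
 have "to_real_vec \<circ> (%v. (A ** B) *v v) \<circ> of_real_vec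
   = (to_real_vec \<circ> (%v. A *v v) \<circ> of_real_vec) \<circ> (to_real_vec \<circ> (%v. B *v v) \<circ> of_real_vec)"
  by (auto simp: fun_eq_iff matrix_vector_mul_assoc)
 thus ?thesis
  unfolding rdet_def by (simp add: matrix_compose[OF l l] det_mul abs_mult)
qed

lemma rdet_unitary:
 assumes "cong W (mat 1) = mat 1"
 shows "rdet (%v. W *v v) = 1"
proof -
 have "norm (W *v v) = norm v" for v
 proof -
  have "(norm (W *v v))^2 = (norm v)^2"
   unfolding Re_sesq_mat1[symmetric] sesq_cong[symmetric] assms ..
  thus ?thesis by (simp add: power2_eq_iff_nonneg)
 qed
 moreover have "norm (of_real_vec x) = norm x" for x :: "real^('a bit0)"
  using norm_to_real_vec[of "of_real_vec x"] by simp
 moreover have "linear (to_real_vec \<circ> (%v. W *v v) \<circ> of_real_vec)"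
  by (intro linear_compose linear_to_real_vec linear_of_real_vec linear_matrix_vector)
 ultimately have "orthogonal_transformation (to_real_vec \<circ> (%v. W *v v) \<circ> of_real_vec)"
  unfolding orthogonal_transformation by (simp add: norm_to_real_vec)
 thus ?thesis unfolding rdet_def by simp
qed

lemma rdet_diagm: "rdet (%v. (diagm d :: complex^'n::finite^'n) *v v) = (\<Prod>j\<in>UNIV. (d j)^2)"
proof -
 let ?D = "%v. (diagm d :: complex^'n^'n) *v v"
 have D: "?D v $ j = of_real (d j) * v $ j" for v j
  by (simp add: diagm_def matrix_vector_mult_def if_distrib[where f="%x. x * _"] cong: if_cong)
 define s where "s b = (THE j. b $ j ~= 0)" for b :: "complex^'n"
 have s: "s (axis j u) = j" if "u ~= 0" for j u
  unfolding s_def using that by (intro the_equality) (auto simp: axis_def split: if_splits)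
 have Db: "?D b = d (s b) *\<^sub>R b" if "b : Basis" for b
 proof -
  obtain j u where b: "b = axis j u" "u : Basis" using \<open>b : Basis\<close> unfolding Basis_vec_def by blast
  hence "u ~= 0" by auto
  thus ?thesis unfolding b(1) s[OF \<open>u ~= 0\<close>] by (simp add: vec_eq_iff D) (simp add: axis_def scaleR_conv_of_real)
 qed
 have ent: "matrix (to_real_vec \<circ> ?D \<circ> of_real_vec) $ i $ k = (if i = k then d (s (cbas k)) else 0)" for i k :: "'n bit0"
 proof -
  have "of_real_vec (axis k 1) = cbas k"
   by (simp add: of_real_vec_def axis_def if_distrib[where f="%x. x *\<^sub>R _"] cong: if_cong)
  thus ?thesis by (simp add: matrix_def to_real_vec_def Db[OF cbas_in] cbas_inner)
 qed
 have "det (matrix (to_real_vec \<circ> ?D \<circ> of_real_vec)) = (\<Prod>i\<in>UNIV. d (s (cbas i)))"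
  by (subst det_diagonal) (simp_all add: ent)
 also have "... = (\<Prod>b\<in>Basis. d (s b))" by (simp add: prod_Basis_cbas)
 also have "... = (\<Prod>(j, u)\<in>UNIV \<times> Basis. d (s (axis j u)))"
 proof -
  have B: "(Basis :: (complex^'n) set) = (%(j, u). axis j u) ` (UNIV \<times> Basis)"
   by (force simp: Basis_vec_def)
  have "inj_on (%(j, u). axis j u :: complex^'n) (UNIV \<times> Basis)"
   by (auto simp: inj_on_def axis_eq_axis)
  from prod.reindex[OF this, of "%b. d (s b)"] B show ?thesis by (simp add: split_beta o_def)
 qed
 also have "... = (\<Prod>(j, u)\<in>UNIV \<times> (Basis :: complex set). d j)"
  by (intro prod.cong refl) (auto simp: s Basis_complex_def)
 also have "... = (\<Prod>j\<in>UNIV. (d j)^2)"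
  by (subst prod.cartesian_product[symmetric]) simp
 finally show ?thesis unfolding rdet_def by (simp add: prod_nonneg)
qed

text \<open>In effect a singular value decomposition: \<open>J ** E ** D\<close> is unitary for a
  unitary \<open>E\<close> and a positive diagonal \<open>D\<close>, and \<open>rdet\<close> is
  known for unitary and for diagonal matrices.\<close>

lemma rdet_complex:
 assumes J: "det (J :: complex^'n::finite^'n) ~= 0"
 shows "rdet (%v. J *v v) = (cmod (det J))^2"
proof -
 define P where "P = cong J (mat 1)"
 have P: "pd P" unfolding P_def by (rule pd_cong[OF pd_mat1 J])
 hence "herm P" by (simp add: pd_def)
 obtain E \<mu> where E: "cong E (mat 1) = mat 1" "cong E P = diagm \<mu>"
  using simultaneous_diagonalization[OF pd_mat1 \<open>herm P\<close>] by blast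
 have E1: "cmod (det E) = 1"
  using det_cong[of E "mat 1"] E(1) cong_mat1_inverse(4)[OF E(1)]
  by simp (metis norm_ge_zero norm_of_real norm_one norm_power abs_norm_cancel power2_eq_1_iff
    add_nonneg_eq_0_iff neg_0_le_iff_le not_one_le_zero)
 have mu: "\<mu> i > 0" for i
 proof -
  have "column i E ~= 0" using orthonormal_column[OF E(1), of i] by auto
  thus ?thesis using P diag_eigenvalue[OF E(2), of i] by (auto simp: pd_def)
 qed
 \<comment> \<open>Rescales the columns of \<open>J ** E\<close>, which are orthogonal with squared
   lengths \<open>\<mu> i\<close>, to unit length.\<close>
 define D where "D = diagm (%i. 1 / sqrt (\<mu> i))"
 define W where "W = J ** E ** D"
 have "cong W (mat 1) = cong D (diagm \<mu>)"
  unfolding W_def by (simp add: cong_cong[symmetric] P_def[symmetric] E)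
 also have "... = mat 1"
 proof -
  have c: "column a D = of_real (1 / sqrt (\<mu> a)) *s axis a 1" for a
   by (auto simp: D_def column_def diagm_def vec_eq_iff axis_def)
  have "cong D (diagm \<mu>) $ a $ b = (mat 1 :: complex^'n^'n) $ a $ b" for a b
  proof -
   have "cong D (diagm \<mu>) $ a $ b = of_real (1 / sqrt (\<mu> a)) * of_real (1 / sqrt (\<mu> b)) * diagm \<mu> $ a $ b"
    by (simp add: cong_nth c sesq_scale1 sesq_scale2 sesq_axis)
   also have "... = (mat 1 :: complex^'n^'n) $ a $ b"
   proof (cases "a = b")
    case True
    have "1 / sqrt (\<mu> b) * (1 / sqrt (\<mu> b)) * \<mu> b = 1" using mu[of b] by (simp add: field_simps)
    hence "complex_of_real (1 / sqrt (\<mu> b)) * of_real (1 / sqrt (\<mu> b)) * of_real (\<mu> b) = 1"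
     by (metis of_real_1 of_real_mult)
    thus ?thesis using True by (simp add: diagm_def mat_def)
   qed (simp add: diagm_def mat_def)
   finally show ?thesis .
  qed
  thus ?thesis by (simp add: vec_eq_iff)
 qed
 finally have "rdet (%v. W *v v) = 1" by (rule rdet_unitary)
 hence "rdet (%v. J *v v) * rdet (%v. D *v v) = 1"
  unfolding W_def by (simp add: rdet_mult rdet_unitary[OF E(1)])
 moreover have "rdet (%v. D *v v) = (\<Prod>j\<in>UNIV. 1 / \<mu> j)"
  unfolding D_def rdet_diagm using mu by (intro prod.cong refl) (simp add: power_divide less_imp_le)
 moreover have "(\<Prod>j\<in>UNIV. \<mu> j) = (cmod (det J))^2"
 proof -
  have "complex_of_real (\<Prod>j\<in>UNIV. \<mu> j) = det (cong E P)" by (simp add: E(2) det_diagm)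
  also have "... = of_real ((cmod (det J))^2)" unfolding det_cong P_def by (simp add: E1)
  finally show ?thesis by (simp only: of_real_eq_iff)
 qed
 moreover have "(\<Prod>j\<in>UNIV. \<mu> j) > 0" using mu by (simp add: prod_pos)
 ultimately show ?thesis by (simp add: prod_dividef field_simps)
qed

lemma jac_inverse:
 assumes S: "open S" and V: "open V" and T: "hol_map_on S T" and R: "hol_map_on V R"
  and TV: "!!z. z : S ==> T z : V & R (T z) = z" and z: "z : S"
 shows "jac R (T z) ** jac T z = mat 1" "det (jac T z) ~= 0"
proof -
 have Tz: "T z : V" using TV[OF z] by simp
 have "(jac R (T z) ** jac T z) *v v = mat 1 *v v" for v
 proof -
  have "(jac R (T z) ** jac T z) *v v = dv (dv v T z) R (T z)"
   by (simp add: matrix_vector_mul_assoc[symmetric] jac_mult[OF S T z] jac_mult[OF V R Tz])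
  also have "... = dv v (%z. R (T z)) z"
   by (rule dv_compose[OF S V hol_map_smooth[OF S T] hol_map_smooth[OF V R] Tz z, symmetric])
  also have "... = dv v (%z. z) z" by (rule dv_cong_open[OF S z]) (use TV in auto)
  finally show ?thesis by (simp add: dv_ident)
 qed
 thus "jac R (T z) ** jac T z = mat 1" using matrix_eq by blast
 thus "det (jac T z) ~= 0" by (metis det_I det_mul mult_zero_right zero_neq_one)
qed

text \<open>The real theorem is applied after identification with the real coordinate space. By
  \<open>rdet_complex\<close> its Jacobian is the squared modulus of the complex one, exactly the
  factor by which \<open>vol_density\<close> transforms.\<close>

theorem change_of_variables_hol:
 fixes g :: "complex^'n::finite => real"
 assumes S: "open S" and V: "open V" and T: "hol_map_on S T" and R: "hol_map_on V R"
  and TV: "!!z. z : S ==> T z : V & R (T z) = z" and RS: "!!z. z : V ==> R z : S & T (R z) = z"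
  and g: "supp_in V K g" "continuous_on V g"
 shows "(LBINT z:S. g (T z) * (cmod (det (jac T z)))^2) = (LBINT z:V. g z)"
proof -
 let ?o = "of_real_vec :: _ => complex^'n" and ?t = "to_real_vec :: complex^'n => _"
 have cT: "continuous_on S T" by (rule smooth_continuous[OF hol_map_smooth[OF S T]])
 have cR: "continuous_on V R" by (rule smooth_continuous[OF hol_map_smooth[OF V R]])
 have KV: "compact K" "K \<subseteq> V" and g0: "!!z. z : V - K ==> g z = 0" using g(1) by (auto simp: supp_in_def)
 define f where "f z = g (T z) * (cmod (det (jac T z)))^2" for z
 have sf: "supp_in S (R ` K) f"
  unfolding supp_in_def
 proof (intro conjI ballI)
  show "compact (R ` K)" by (intro compact_continuous_image continuous_on_subset[OF cR] KV)
  show "R ` K \<subseteq> S" using KV(2) RS by auto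
  fix z assume z: "z : S - R ` K"
  hence "T z \<notin> K" using TV by force
  thus "f z = 0" using g0[of "T z"] TV z by (simp add: f_def)
 qed (rule S)
 have cf: "continuous_on S f"
 proof -
  have "continuous_on S (%z. jac T z $ p $ j)" for p j
  proof -
   have "smooth_on S (%z. wirt j (%u. T u $ p) z)"
    unfolding wirt_wd by (intro smooth_on_wd S smooth_intros hol_map_smooth[OF S T])
   from smooth_continuous[OF this] show ?thesis by (simp add: jac_def)
  qed
  hence "continuous_on S (%z. det (jac T z))"
   unfolding det_def by (intro continuous_on_sum continuous_on_mult continuous_on_const continuous_on_prod)
  thus ?thesis unfolding f_def using TV
   by (intro continuous_intros continuous_on_compose2[OF g(2) cT]) auto
 qed
 \<comment> \<open>Moves a Lebesgue integral over \<open>complex^'n\<close> to the real coordinate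
   space, in the form in which \<open>cov_invertible_real\<close> speaks of integrals.\<close>
 have tr: "(LBINT z:A. h z) = integral (?o -` A) (h \<circ> ?o)" "(h \<circ> ?o) absolutely_integrable_on (?o -` A)"
  if h: "supp_in A K' h" "continuous_on A h" for A K' h
 proof -
  have m: "?o : borel_measurable borel"
   by (intro borel_measurable_continuous_onI linear_continuous_on bounded_linear_of_real_vec)
  have "integrable (distr lborel borel ?o) (ext0 A h)" unfolding distr_of_real_vec by (rule integrable_ext0[OF h])
  hence i: "integrable lborel (%x. ext0 A h (?o x))" 
   by (subst (asm) integrable_distr_eq) (use m integrable_ext0[OF h] in auto)
  have e: "(%x. ext0 A h (?o x)) = (%x. if x : ?o -` A then (h \<circ> ?o) x else 0)"
   by (auto simp: ext0_def)
  have "(LBINT z:A. h z) = (LINT z|distr lborel borel ?o. ext0 A h z)"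
   unfolding distr_of_real_vec set_integral_ext0 ..
  also have "... = (LBINT x. ext0 A h (?o x))"
   by (rule integral_distr) (use m integrable_ext0[OF h] in auto)
  also have "... = integral UNIV (%x. ext0 A h (?o x))" using integral_lborel[OF i] by simp
  also have "... = integral (?o -` A) (h \<circ> ?o)" unfolding e by (rule integral_restrict_UNIV)
  finally show "(LBINT z:A. h z) = integral (?o -` A) (h \<circ> ?o)" .
  have "set_integrable lborel UNIV (%x. ext0 A h (?o x))" using i by (simp add: set_integrable_def)
  hence "(%x. ext0 A h (?o x)) absolutely_integrable_on UNIV"
   unfolding set_integrable_def by (subst integrable_completion) auto
  thus "(h \<circ> ?o) absolutely_integrable_on (?o -` A)"
   unfolding e using absolutely_integrable_restrict_UNIV[of "?o -` A" "h \<circ> ?o"] by simp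
 qed
 define G where "G = ?t \<circ> T \<circ> ?o"
 define H where "H = ?t \<circ> R \<circ> ?o"
 define G' where "G' x = ?t \<circ> (%v. dv v T (?o x)) \<circ> ?o" for x
 define H' where "H' x = ?t \<circ> (%v. dv v R (?o x)) \<circ> ?o" for x
 have dg: "(?t \<circ> F \<circ> ?o has_derivative ?t \<circ> (%v. dv v F (?o x)) \<circ> ?o) (at x within B)"
  if "open A" "smooth_on A F" "?o x : A" for A F x B
 proof -
  have "(?o has_derivative ?o) (at x)" by (rule bounded_linear_imp_has_derivative[OF bounded_linear_of_real_vec])
  from has_derivative_compose[OF this smooth_on_has_derivative[OF that]]
  have "((%x. F (?o x)) has_derivative (%v. dv (?o v) F (?o x))) (at x)" .
  from bounded_linear.has_derivative[OF bounded_linear_to_real_vec this]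
  show ?thesis by (auto simp: o_def intro: has_derivative_at_withinI)
 qed
 have "(%x. \<bar>det (matrix (G' x))\<bar> * (g \<circ> ?o) (G x)) absolutely_integrable_on (?o -` S) &
      integral (?o -` S) (%x. \<bar>det (matrix (G' x))\<bar> * (g \<circ> ?o) (G x)) = integral (?o -` V) (g \<circ> ?o)
    \<longleftrightarrow> (g \<circ> ?o) absolutely_integrable_on (?o -` V) & integral (?o -` V) (g \<circ> ?o) = integral (?o -` V) (g \<circ> ?o)"
 proof (rule cov_invertible_real)
  fix x assume "x : ?o -` S"
  thus "(G has_derivative G' x) (at x within ?o -` S)"
   unfolding G_def G'_def by (intro dg[OF S hol_map_smooth[OF S T]]) auto
 next
  fix y assume "y : ?o -` V"
  thus "(H has_derivative H' y) (at y within ?o -` V)"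
   unfolding H_def H'_def by (intro dg[OF V hol_map_smooth[OF V R]]) auto
 next
  show "G x : ?o -` V & H (G x) = x" if "x : ?o -` S" for x using TV that by (simp add: G_def H_def)
  show "H x : ?o -` S & G (H x) = x" if "x : ?o -` V" for x using RS that by (simp add: G_def H_def)
 next
  fix y assume y: "y : ?o -` V"
  let ?z = "R (?o y)"
  have z: "?z : S" "T ?z = ?o y" using RS y by auto
  have "dv (dv v T ?z) R (?o y) = v" for v
  proof -
   have "dv (dv v T ?z) R (?o y) = (jac R (T ?z) ** jac T ?z) *v v"
    using y by (simp add: matrix_vector_mul_assoc[symmetric] jac_mult[OF S T z(1)] jac_mult[OF V R] z(2))
   thus ?thesis using jac_inverse(1)[OF S V T R TV z(1)] by simp
  qed
  thus "H' y \<circ> G' (H y) = id" by (auto simp: H'_def G'_def H_def fun_eq_iff)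
 qed
 hence "integral (?o -` S) (%x. \<bar>det (matrix (G' x))\<bar> * (g \<circ> ?o) (G x)) = integral (?o -` V) (g \<circ> ?o)"
  using tr(2)[OF g] by blast
 moreover have "integral (?o -` S) (%x. \<bar>det (matrix (G' x))\<bar> * (g \<circ> ?o) (G x)) = integral (?o -` S) (f \<circ> ?o)"
 proof (rule integral_cong)
  fix x assume x: "x : ?o -` S"
  have "(%v. dv v T (?o x)) = (%v. jac T (?o x) *v v)" using x by (simp add: jac_mult[OF S T])
  hence "\<bar>det (matrix (G' x))\<bar> = (cmod (det (jac T (?o x))))^2"
   unfolding G'_def using rdet_complex[OF jac_inverse(2)[OF S V T R TV], of "?o x"] x by (simp add: rdet_def)
  thus "\<bar>det (matrix (G' x))\<bar> * (g \<circ> ?o) (G x) = (f \<circ> ?o) x" by (simp add: f_def G_def)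
 qed
 ultimately show ?thesis using tr(1)[OF sf cf] tr(1)[OF g] by (simp add: f_def)
qed

section \<open>Bump functions\<close>

text \<open>Carrying the power \<open>m\<close> along makes the family closed: the derivative of
  \<open>flat_exp m\<close> is a combination of the members \<open>m + 1\<close> and
  \<open>m + 2\<close>, also at 0. One induction then gives smoothness of every member.\<close>

definition flat_exp :: "nat => real => real" where
 "flat_exp m x = (if x > 0 then inverse x ^ m * exp (- inverse x) else 0)"

lemma flat_exp_nonneg: "0 <= flat_exp m x"
 by (simp add: flat_exp_def)

lemma flat_exp_tendsto: "(flat_exp m \<longlongrightarrow> 0) (at 0)"
proof -
 have "((%x. inverse x ^ m / exp (inverse x)) \<longlongrightarrow> (0::real)) (at_right 0)"
  by (rule filterlim_compose[OF tendsto_power_div_exp_0 filterlim_inverse_at_top_right])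
 hence r: "(flat_exp m \<longlongrightarrow> 0) (at_right 0)"
  by (rule Lim_transform_eventually)
    (auto simp: eventually_at_filter flat_exp_def exp_minus divide_inverse)
 have l: "(flat_exp m \<longlongrightarrow> 0) (at_left 0)"
  by (rule Lim_transform_eventually[OF tendsto_const])
    (auto simp: eventually_at_filter flat_exp_def)
 show ?thesis using l r filterlim_at_split by blast
qed

lemma flat_exp_deriv:
 "(flat_exp m has_real_derivative - real m * flat_exp (Suc m) x + flat_exp (Suc (Suc m)) x) (at x)"
proof -
 consider "x > 0" | "x < 0" | "x = 0" by linarith
 thus ?thesis
 proof cases
  case 1
  have "((%x. inverse x ^ m * exp (- inverse x)) has_real_derivative
    (real m * (- (inverse x ^ Suc (Suc 0)) * inverse x ^ (m - Suc 0))) * exp (- inverse x)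
    + exp (- inverse x) * (- (- (inverse x ^ Suc (Suc 0)))) * inverse x ^ m) (at x)"
   using 1 by (intro DERIV_mult DERIV_power DERIV_inverse DERIV_fun_exp DERIV_minus) auto
  moreover have "(real m * (- (inverse x ^ Suc (Suc 0)) * inverse x ^ (m - Suc 0))) * exp (- inverse x)
    + exp (- inverse x) * (- (- (inverse x ^ Suc (Suc 0)))) * inverse x ^ m
   = - real m * flat_exp (Suc m) x + flat_exp (Suc (Suc m)) x"
   using 1 by (cases m) (auto simp: flat_exp_def algebra_simps)
  ultimately have "((%x. inverse x ^ m * exp (- inverse x)) has_real_derivative
    - real m * flat_exp (Suc m) x + flat_exp (Suc (Suc m)) x) (at x)" by simp
  thus ?thesis
   by (rule has_field_derivative_transform_within_open[of _ _ _ "{0<..}"]) (use 1 in \<open>auto simp: flat_exp_def\<close>)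
 next
  case 2
  have "((%x. 0) has_real_derivative 0) (at x)" by simp
  hence "(flat_exp m has_real_derivative 0) (at x)"
   by (rule has_field_derivative_transform_within_open[of _ _ _ "{..<0}"]) (use 2 in \<open>auto simp: flat_exp_def\<close>)
  thus ?thesis using 2 by (simp add: flat_exp_def)
 next
  case 3
  have "((%h. (flat_exp m (0 + h) - flat_exp m 0) / h) \<longlongrightarrow> 0) (at 0)"
   by (rule Lim_transform_eventually[OF flat_exp_tendsto[of "Suc m"]])
     (auto simp: eventually_at_filter flat_exp_def divide_inverse)
  thus ?thesis using 3 by (simp add: DERIV_def flat_exp_def)
 qed
qed

lemma smooth_on_flat_exp: "smooth_on UNIV (flat_exp m)"
 unfolding smooth_on_def
proof
 fix k
 show "Ck_on k (flat_exp m) UNIV"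
 proof (induction k arbitrary: m)
  case 0
  thus ?case using flat_exp_deriv by (auto intro!: continuous_at_imp_continuous_on DERIV_isCont)
 next
  case (Suc k)
  show ?case
  proof (rule Ck_on_Suc_intro[OF open_UNIV])
   show "(flat_exp m has_derivative (%v. v * (- real m * flat_exp (Suc m) z + flat_exp (Suc (Suc m)) z))) (at z)" for z
    using flat_exp_deriv[of m z] by (simp add: has_field_derivative_def mult_commute_abs)
   show "Ck_on k (%z. v * (- real m * flat_exp (Suc m) z + flat_exp (Suc (Suc m)) z)) UNIV" for v
    by (intro Ck_on_bilinear[OF bounded_bilinear_mult] Ck_on_add Ck_on_const Suc.IH open_UNIV)
  qed
 qed
qed

lemma smooth_on_norm_square:
 fixes p :: "'e::euclidean_space"
 assumes "open S"
 shows "smooth_on S (%z. (norm (z - p))^2)"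
 unfolding power2_norm_eq_inner
 by (intro smooth_on_bilinear[OF bounded_bilinear_inner] smooth_intros assms)

definition bump :: "'e::euclidean_space => real => 'e => real" where
 "bump p r z = flat_exp 0 (r^2 - (norm (z - p))^2)"

lemma smooth_on_bump: "open S ==> smooth_on S (bump p r)"
 unfolding bump_def[abs_def]
 by (rule smooth_on_compose[OF _ open_UNIV _ smooth_on_flat_exp]) (auto intro!: smooth_intros smooth_on_norm_square)

lemma bump_nonneg: "0 <= bump p r z"
 by (simp add: bump_def flat_exp_nonneg)

lemma bump_pos: "r > 0 ==> norm (z - p) < r ==> 0 < bump p r z"
 using power_strict_mono[of "norm (z - p)" r 2] by (simp add: bump_def flat_exp_def)

lemma bump_zero: "r > 0 ==> r <= norm (z - p) ==> bump p r z = 0"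
 by (simp add: bump_def flat_exp_def power_mono not_less)

section \<open>Compact complex manifolds\<close>

abbreviation im where "im c \<equiv> chart_image c"

lemma set_lint_sum:
 fixes f :: "'i => 'b => real"
 assumes "finite I" "!!i. i : I ==> set_integrable M U (f i)"
 shows "(LINT z:U|M. (SUM i:I. f i z)) = (SUM i:I. LINT z:U|M. f i z)"
 using assms(2) unfolding set_lebesgue_integral_def set_integrable_def scaleR_sum_right
 by (rule Bochner_Integration.integral_sum)

locale cmanifold =
 fixes A :: "('a::t2_space, 'n::finite) chart set"
 assumes man: "compact_complex_manifold A"
begin

abbreviation "FI \<equiv> form_integral A"

abbreviation loc :: "('a, 'n) chart => ('a => 'b) => complex^'n => 'b" where
 "loc c f \<equiv> (%z. f (chart_inv c z))"

definition ov :: "('a, 'n) chart => ('a, 'n) chart => (complex^'n) set" where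
 "ov c c' = snd c ` (fst c \<inter> fst c')"

lemma compact_X: "compact (UNIV :: 'a set)"
 using man by (simp add: compact_complex_manifold_def)

lemma atlas: "complex_atlas A"
 using man by (simp add: compact_complex_manifold_def)

lemma chart_at: obtains c where "c : A" "x : fst c"
 using atlas unfolding complex_atlas_def by (metis UN_E UNIV_I)

lemma
 assumes "c : A"
 shows open_chart: "open (fst c)" and open_image: "open (im c)"
  and chart_homeo: "homeomorphism (fst c) (im c) (snd c) (chart_inv c)"
 using assms atlas unfolding complex_atlas_def by blast+

lemma
 assumes "c : A"
 shows chart_inv_snd: "x : fst c ==> chart_inv c (snd c x) = x"
  and snd_chart_inv: "z : im c ==> snd c (chart_inv c z) = z"
  and chart_inv_in: "z : im c ==> chart_inv c z : fst c"
  and cont_chart: "continuous_on (fst c) (snd c)"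
  and cont_chart_inv: "continuous_on (im c) (chart_inv c)"
 using chart_homeo[OF assms] unfolding homeomorphism_def by auto

lemma open_image_of:
 assumes "c : A" "open W" "W \<subseteq> fst c"
 shows "open (snd c ` W)"
proof -
 have "openin (top_of_set (im c)) (snd c ` W)"
  using homeomorphism_imp_open_map[OF chart_homeo[OF assms(1)], of W] assms(2,3) open_chart[OF assms(1)]
  by (metis inf.absorb_iff2 openin_open_Int openin_open)
 thus ?thesis using open_image[OF assms(1)] openin_open_trans by blast
qed

lemma open_ov: "c : A ==> c' : A ==> open (ov c c')"
 unfolding ov_def by (intro open_image_of open_Int open_chart) auto

lemma ov_sub: "ov c c' \<subseteq> im c"
 by (auto simp: ov_def)

lemma ov_iff:
 assumes "c : A"
 shows "z : ov c c' \<longleftrightarrow> z : im c & chart_inv c z : fst c'"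
proof
 assume "z : ov c c'"
 then obtain x where "x : fst c" "x : fst c'" "z = snd c x" by (auto simp: ov_def)
 thus "z : im c & chart_inv c z : fst c'" using chart_inv_snd[OF assms] by auto
next
 assume z: "z : im c & chart_inv c z : fst c'"
 hence "z = snd c (chart_inv c z)" "chart_inv c z : fst c \<inter> fst c'"
  using snd_chart_inv[OF assms] chart_inv_in[OF assms] by auto
 thus "z : ov c c'" unfolding ov_def by (rule image_eqI)
qed

lemma transition_hol: "c : A ==> c' : A ==> hol_map_on (ov c c') (transition c c')"
 using atlas unfolding complex_atlas_def ov_def by blast

lemma transition_maps:
 assumes "c : A" "c' : A" "z : ov c c'"
 shows "transition c c' z : ov c' c" "transition c' c (transition c c' z) = z"
  "chart_inv c' (transition c c' z) = chart_inv c z" "transition c c' z : im c'"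
proof -
 have z: "z : im c" "chart_inv c z : fst c'" using assms ov_iff by auto
 have eq: "chart_inv c' (transition c c' z) = chart_inv c z"
  using z assms by (simp add: transition_def chart_inv_snd)
 have im: "transition c c' z : im c'" using z by (simp add: transition_def)
 show "chart_inv c' (transition c c' z) = chart_inv c z" "transition c c' z : im c'" by fact+
 show "transition c c' z : ov c' c"
  using ov_iff[OF assms(2)] eq im chart_inv_in[OF assms(1) z(1)] by simp
 show "transition c' c (transition c c' z) = z"
  using eq snd_chart_inv[OF assms(1) z(1)] by (simp add: transition_def)
qed

lemma smooth_fun_loc: "smooth_fun A f \<longleftrightarrow> (ALL c:A. smooth_on (im c) (loc c f))"
 by (simp add: smooth_fun_def o_def)

lemma smooth_funD: "smooth_fun A f ==> c : A ==> smooth_on (im c) (loc c f)"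
 by (simp add: smooth_fun_loc)

lemma smooth_fun_const: "smooth_fun A (%x. k)"
 by (simp add: smooth_fun_loc smooth_on_const open_image)

lemma
 assumes "smooth_fun A f" "smooth_fun A g"
 shows smooth_fun_add: "smooth_fun A (%x. f x + g x)"
  and smooth_fun_diff: "smooth_fun A (%x. f x - g x)"
  and smooth_fun_mult: "smooth_fun A (%x. f x * g x)"
 using assms by (auto simp: smooth_fun_loc intro!: smooth_intros open_image)

lemma smooth_fun_sum: "(!!i. i : I ==> smooth_fun A (f i)) ==> smooth_fun A (%x. SUM i:I. f i x)"
 by (auto simp: smooth_fun_loc intro!: smooth_intros open_image)

lemma smooth_fun_divide:
 "smooth_fun A f ==> smooth_fun A g ==> (!!x. g x ~= 0) ==> smooth_fun A (%x. f x / g x)"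
 by (auto simp: smooth_fun_loc intro!: smooth_intros open_image)

lemma continuous_on_X_iff:
 fixes f :: "'a => 'b::topological_space"
 shows "continuous_on UNIV f \<longleftrightarrow> (ALL c:A. continuous_on (im c) (loc c f))"
proof
 assume f: "continuous_on UNIV f"
 show "ALL c:A. continuous_on (im c) (loc c f)"
  by (auto intro: continuous_on_compose2[OF f cont_chart_inv])
next
 assume *: "ALL c:A. continuous_on (im c) (loc c f)"
 have "isCont f x" for x
 proof -
  obtain c where c: "c : A" "x : fst c" by (rule chart_at)
  have "continuous_on (fst c) (%x. loc c f (snd c x))"
   using * c by (intro continuous_on_compose2[OF _ cont_chart]) auto
  hence "continuous_on (fst c) f"
   by (rule continuous_on_eq) (use chart_inv_snd[OF c(1)] in auto)
  thus ?thesis using c open_chart continuous_on_eq_continuous_at by blast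
 qed
 thus "continuous_on UNIV f" by (simp add: continuous_at_imp_continuous_on)
qed

lemma smooth_fun_continuous: "smooth_fun A f ==> continuous_on UNIV f"
 using continuous_on_X_iff smooth_fun_loc smooth_continuous by blast

lemma continuous_loc: "continuous_on UNIV f ==> c : A ==> continuous_on (im c) (loc c f)"
 using continuous_on_X_iff by blast

section \<open>Functions supported in one chart and partitions of unity\<close>

definition glob :: "('a, 'n) chart => (complex^'n => real) => 'a => real" where
 "glob c g x = (if x : fst c then g (snd c x) else 0)"

lemma loc_glob: "c : A ==> z : im c ==> loc c (glob c g) z = g z"
 by (simp add: glob_def chart_inv_in snd_chart_inv)

lemma compact_inv_image:
 assumes "c : A" "compact K" "K \<subseteq> im c"
 shows "compact (chart_inv c ` K)" "closed (chart_inv c ` K)"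
proof -
 show "compact (chart_inv c ` K)"
  by (intro compact_continuous_image continuous_on_subset[OF cont_chart_inv[OF assms(1)]] assms)
 thus "closed (chart_inv c ` K)" by (rule compact_imp_closed)
qed

lemma glob_outside:
 assumes "c : A" "supp_in (im c) K g" "x \<notin> chart_inv c ` K"
 shows "glob c g x = 0"
proof (cases "x : fst c")
 case True
 hence "snd c x \<notin> K" using assms(3) rev_image_eqI[of "snd c x" K x "chart_inv c"] chart_inv_snd[OF assms(1)] by auto
 thus ?thesis using assms(2) True by (simp add: glob_def supp_in_def)
qed (simp add: glob_def)

lemma glob_vanish:
 assumes c: "c : A" and K: "supp_in (im c) K g" and c': "c' : A"
  and z: "z : im c'" "chart_inv c' z \<notin> fst c"
 obtains W where "open W" "z : W" "!!y. y : W ==> loc c' (glob c g) y = 0"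
proof (rule that[of "snd c' ` (fst c' - chart_inv c ` K)"])
 have K': "compact K" "K \<subseteq> im c" using K by (auto simp: supp_in_def)
 show "open (snd c' ` (fst c' - chart_inv c ` K))"
  by (intro open_image_of[OF c'] open_Diff open_chart[OF c'] compact_inv_image[OF c K']) auto
 have "chart_inv c' z : fst c' - chart_inv c ` K" using z(2) chart_inv_in[OF c' z(1)] chart_inv_in[OF c] K'(2) by auto
 from imageI[OF this, of "snd c'"] show "z : snd c' ` (fst c' - chart_inv c ` K)" unfolding snd_chart_inv[OF c' z(1)] .
 show "loc c' (glob c g) y = 0" if "y : snd c' ` (fst c' - chart_inv c ` K)" for y
  using that glob_outside[OF c K] chart_inv_snd[OF c'] by auto
qed

lemma smooth_fun_glob:
 assumes c: "c : A" and K: "supp_in (im c) K g" and g: "smooth_on (im c) g"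
 shows "smooth_fun A (glob c g)"
 unfolding smooth_fun_loc
proof
 fix c' assume c': "c' : A"
 show "smooth_on (im c') (loc c' (glob c g))"
 proof (rule smooth_on_local[OF open_image[OF c']])
  fix z assume z: "z : im c'"
  show "EX T. open T & z : T & smooth_on T (loc c' (glob c g))"
  proof (cases "chart_inv c' z : fst c")
   case True
   hence zo: "z : ov c' c" using ov_iff[OF c'] z by simp
   have "smooth_on (ov c' c) (%z. g (transition c' c z))"
   proof (rule smooth_on_compose[OF open_ov[OF c' c] open_image[OF c] _ g])
    show "smooth_on (ov c' c) (transition c' c)"
     by (rule hol_map_smooth[OF open_ov[OF c' c] transition_hol[OF c' c]])
   qed (use transition_maps[OF c' c] in auto)
   hence "smooth_on (ov c' c) (loc c' (glob c g))"
    by (subst smooth_on_cong[where g="%z. g (transition c' c z)"])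
      (auto simp: ov_iff[OF c'] glob_def transition_def)
   thus ?thesis using zo open_ov[OF c' c] by blast
  next
   case False
   then obtain W where W: "open W" "z : W" "!!y. y : W ==> loc c' (glob c g) y = 0"
    by (rule glob_vanish[OF c K c' z]) blast
   hence "smooth_on W (loc c' (glob c g))"
    by (subst smooth_on_cong[where g="%_. 0"]) (auto intro: smooth_on_const)
   thus ?thesis using W by blast
  qed
 qed
qed

lemma bump_at:
 obtains c H where "c : A" "smooth_fun A H" "!!x. 0 <= H x" "H x > 0" "closure {x. H x ~= 0} \<subseteq> fst c"
proof -
 obtain c where c: "c : A" "x : fst c" by (rule chart_at)
 define p where "p = snd c x"
 have "p : im c" using c by (simp add: p_def)
 then obtain r where r: "r > 0" "cball p r \<subseteq> im c" using open_image[OF c(1)] open_contains_cball by blast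
 have K: "supp_in (im c) (cball p r) (bump p r)"
  unfolding supp_in_def using open_image[OF c(1)] r
  by (auto intro!: bump_zero simp: dist_norm norm_minus_commute)
 define H where "H = glob c (bump p r)"
 have 1: "smooth_fun A H" unfolding H_def by (rule smooth_fun_glob[OF c(1) K smooth_on_bump[OF open_image[OF c(1)]]])
 have 2: "0 <= H y" for y by (simp add: H_def glob_def bump_nonneg)
 have 3: "H x > 0" using c r by (simp add: H_def glob_def p_def bump_pos)
 have "{y. H y ~= 0} \<subseteq> chart_inv c ` cball p r"
 proof
  fix y assume "y : {y. H y ~= 0}"
  hence y: "y : fst c" "bump p r (snd c y) ~= 0" by (auto simp: H_def glob_def split: if_splits)
  hence "\<not> r <= norm (snd c y - p)" using bump_zero[OF r(1)] by blast
  hence "snd c y : cball p r" by (simp add: dist_norm norm_minus_commute)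
  thus "y : chart_inv c ` cball p r" using chart_inv_snd[OF c(1) y(1)] by (metis imageI)
 qed
 hence "closure {y. H y ~= 0} \<subseteq> chart_inv c ` cball p r"
  by (intro closure_minimal compact_inv_image(2)[OF c(1) _ r(2)]) auto
 also have "... \<subseteq> fst c" using r(2) chart_inv_in[OF c(1)] by auto
 finally show ?thesis using that[OF c(1) 1 2 3] by blast
qed

lemma partition_exists: "EX P. partition_of_unity A P"
proof -
 have "EX c H. c : A & smooth_fun A H & (ALL x. 0 <= H x) & H x > 0 & closure {x. H x ~= 0} \<subseteq> fst c" for x
  by (rule bump_at[of x]) blast
 then obtain c H where b: "!!x. c x : A" "!!x. smooth_fun A (H x)" "!!x y. 0 <= H x y" "!!x. H x x > (0::real)"
   "!!x. closure {y. H x y ~= 0} \<subseteq> fst (c x)" by metis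
 have "open {y. 0 < H x y}" for x
  using open_Collect_less[OF continuous_on_const smooth_fun_continuous[OF b(2)]] .
 then obtain F where F: "finite F" "UNIV \<subseteq> (\<Union>x\<in>F. {y. 0 < H x y})"
 proof (rule compactE_image[OF compact_X])
  show "UNIV \<subseteq> (\<Union>x\<in>UNIV. {y. 0 < H x y})"
  proof
   fix y
   have "y : {y'. 0 < H y y'}" using b(4) by simp
   thus "y : (\<Union>x\<in>UNIV. {y. 0 < H x y})" by (rule UN_I[OF UNIV_I])
  qed
 qed (use that in auto)
 define S where "S y = (SUM x:F. H x y)" for y
 have S: "S y > 0" for y
 proof -
  obtain x where "x : F" "0 < H x y" using F(2) by blast
  thus ?thesis unfolding S_def using F(1) b(3) by (intro sum_pos2[of F x]) auto
 qed
 have Ssm: "smooth_fun A S" unfolding S_def[abs_def] by (intro smooth_fun_sum b)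
 \<comment> \<open>Partitions of unity are indexed by charts here, and several points of
   \<open>F\<close> may have received the same chart; their bumps are added up.\<close>
 define \<Theta> where "\<Theta> k y = (SUM x:{x:F. c x = k}. H x y) / S y" for k y
 have "partition_of_unity A (c ` F, \<Theta>)"
  unfolding partition_of_unity_def split_conv
 proof (intro conjI ballI allI)
  fix k assume "k : c ` F"
  have "S y ~= 0" for y using S[of y] by simp
  thus "smooth_fun A (\<Theta> k)" unfolding \<Theta>_def[abs_def]
   by (intro smooth_fun_divide smooth_fun_sum b Ssm)
  show "0 <= \<Theta> k y" for y unfolding \<Theta>_def using S[of y] b(3) by (intro divide_nonneg_pos sum_nonneg) auto
  have "{y. \<Theta> k y ~= 0} \<subseteq> (\<Union>x\<in>{x:F. c x = k}. closure {y. H x y ~= 0})"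
  proof
   fix y assume "y : {y. \<Theta> k y ~= 0}"
   hence "(SUM x:{x:F. c x = k}. H x y) ~= 0" by (auto simp: \<Theta>_def)
   then obtain x where "x : {x:F. c x = k}" "H x y ~= 0"
    by (rule sum.not_neutral_contains_not_neutral)
   moreover have "y : closure {y. H x y ~= 0}" using \<open>H x y ~= 0\<close> closure_subset[of "{y. H x y ~= 0}"] by auto
   ultimately show "y : (\<Union>x\<in>{x:F. c x = k}. closure {y. H x y ~= 0})" by auto
  qed
  hence "closure {y. \<Theta> k y ~= 0} \<subseteq> (\<Union>x\<in>{x:F. c x = k}. closure {y. H x y ~= 0})"
   by (rule closure_minimal) (use F(1) in auto)
  also have "... \<subseteq> fst k" using b(5) by auto
  finally show "closure {y. \<Theta> k y ~= 0} \<subseteq> fst k" .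
 next
  fix y
  have "(SUM k:c ` F. SUM x:{x:F. c x = k}. H x y) = S y"
   unfolding S_def using F(1) by (rule sum.image_gen[symmetric])
  thus "(SUM k:c ` F. \<Theta> k y) = 1"
   unfolding \<Theta>_def sum_divide_distrib[symmetric] using S[of y] by simp
 qed (use F b in auto)
 thus ?thesis by blast
qed

text \<open>The very choice made inside \<open>form_integral\<close>, so that the integral can be
  unfolded over this fixed partition.\<close>

definition PU where "PU = (SOME P. partition_of_unity A P)"
definition PC where "PC = fst PU"
definition P\<theta> where "P\<theta> = snd PU"

lemma PU: "partition_of_unity A (PC, P\<theta>)"
 unfolding PC_def P\<theta>_def PU_def using someI_ex[OF partition_exists] by simp

lemma
 shows PC: "finite PC" "PC \<subseteq> A"
  and P\<theta>_sum: "(SUM c:PC. P\<theta> c x) = 1"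
 using PU unfolding partition_of_unity_def by auto

lemma
 assumes "c : PC"
 shows P\<theta>_smooth: "smooth_fun A (P\<theta> c)" and P\<theta>_nonneg: "0 <= P\<theta> c x"
  and P\<theta>_supp: "closure {x. P\<theta> c x ~= 0} \<subseteq> fst c"
 using assms PU unfolding partition_of_unity_def by auto

lemma form_integral_PU:
 "FI \<omega> f = (SUM c:PC. LBINT z:im c. loc c (P\<theta> c) z * loc c f z * vol_density \<omega> c z)"
proof -
 have "(SOME P. partition_of_unity A P) = (PC, P\<theta>)" by (simp add: PC_def P\<theta>_def PU_def)
 thus ?thesis by (simp add: form_integral_def)
qed

lemma supp_chart:
 assumes c: "c : A" and L: "closed L" "L \<subseteq> fst c" and 0: "ALL x. x \<notin> L \<longrightarrow> f x = 0"
 shows "supp_in (im c) (snd c ` L) (%z. loc c f z * h z)"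
  "compact (snd c ` L)" "snd c ` L \<subseteq> im c" "!!z. z : im c - snd c ` L ==> loc c f z = 0"
proof -
 have "compact L" using compact_X L(1) compact_Int_closed[of UNIV L] by simp
 thus 1: "compact (snd c ` L)" by (intro compact_continuous_image continuous_on_subset[OF cont_chart[OF c] L(2)])
 show 2: "snd c ` L \<subseteq> im c" using L(2) by auto
 have "f (chart_inv c z) = 0" if "z : im c - snd c ` L" for z
 proof (rule 0[rule_format])
  show "chart_inv c z \<notin> L" using that snd_chart_inv[OF c, of z] by (metis DiffD1 DiffD2 imageI)
 qed
 thus 3: "!!z. z : im c - snd c ` L ==> loc c f z = 0" by blast
 show "supp_in (im c) (snd c ` L) (%z. loc c f z * h z)"
  unfolding supp_in_def using 1 2 3 open_image[OF c] by auto
qed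

lemma P\<theta>_zero: "ALL x. x \<notin> closure {x. P\<theta> c x ~= 0} \<longrightarrow> P\<theta> c x = 0"
 using closure_subset[of "{x. P\<theta> c x ~= 0}"] by (auto simp: subset_iff)

section \<open>Kaehler forms and integration in charts\<close>

definition kf :: "('a, 'n) form11 => bool" where
 "kf \<omega> \<longleftrightarrow> kaehler_form A \<omega>"

lemma real_form11_cong:
 assumes "real_form11 A \<alpha>" "c : A" "c' : A" "z : ov c c'"
 shows "\<alpha> c z = cong (jac (transition c c') z) (\<alpha> c' (transition c c' z))"
proof -
 have "\<alpha> c z $ j $ k =
     (SUM p:UNIV. SUM q:UNIV. wirt j (%u. transition c c' u $ p) z *
       cnj (wirt k (%u. transition c c' u $ q) z) * \<alpha> c' (transition c c' z) $ p $ q)" for j k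
  using assms unfolding real_form11_def ov_def by blast
 thus ?thesis
  by (simp add: vec_eq_iff cong_nth sesq_def column_def jac_def mult_ac)
qed

lemma
 assumes "kf \<omega>" "c : A"
 shows kf_smooth: "smooth_on (im c) (\<omega> c)"
  and kf_pd: "z : im c ==> pd (\<omega> c z)"
  and kf_closed: "closedm (im c) (\<omega> c)"
  and kf_cong: "c' : A ==> z : ov c c' ==> \<omega> c z = cong (jac (transition c c') z) (\<omega> c' (transition c c' z))"
proof -
 have k: "real_form11 A \<omega>" "positive A \<omega>" "closed_real_form11 A \<omega>"
  using assms(1) by (auto simp: kf_def kaehler_form_def closed_real_form11_def)
 show "smooth_on (im c) (\<omega> c)" using k(1) assms(2) by (auto simp: real_form11_def)
 show "pd (\<omega> c z)" if "z : im c"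
  unfolding pd_def
 proof
  show "herm (\<omega> c z)" using k(1) assms(2) that unfolding herm_def real_form11_def by blast
  show "ALL v. v ~= 0 \<longrightarrow> 0 < qf (\<omega> c z) v"
   using k(2) assms(2) that unfolding positive_def form_value_sesq by blast
 qed
 show "closedm (im c) (\<omega> c)" using k(3) assms(2) unfolding closed_real_form11_def closedm_def by blast
 show "\<omega> c z = cong (jac (transition c c') z) (\<omega> c' (transition c c' z))" if "c' : A" "z : ov c c'"
  by (rule real_form11_cong[OF k(1) assms(2) that])
qed

lemma jac_transition_nz:
 assumes "c : A" "c' : A" "z : ov c c'"
 shows "det (jac (transition c c') z) ~= 0"
 by (rule jac_inverse(2)[OF open_ov[OF assms(1,2)] open_ov[OF assms(2,1)] transition_hol[OF assms(1,2)] transition_hol[OF assms(2,1)] _ assms(3)])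
   (use transition_maps[OF assms(1,2)] in auto)

lemma levm_transition:
 assumes c: "c : A" "c' : A" "z : ov c c'" and f: "smooth_fun A f"
 shows "levm (loc c f) z = cong (jac (transition c c') z) (levm (loc c' f) (transition c c' z))"
proof -
 have "levm (loc c f) z = levm (%u. loc c' f (transition c c' u)) z"
  by (rule levm_cong_open[OF open_ov[OF c(1,2)] c(3)]) (use transition_maps[OF c(1,2)] in simp)
 also have "... = cong (jac (transition c c') z) (levm (loc c' f) (transition c c' z))"
  by (rule levm_compose_hol[OF open_ov[OF c(1,2)] open_image[OF c(2)] transition_hol[OF c(1,2)] _ smooth_funD[OF f c(2)] c(3)])
    (use transition_maps[OF c(1,2)] in auto)
 finally show ?thesis .
qed

lemma smooth_on_levm:
 assumes "open S" "smooth_on S f"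
 shows "smooth_on S (levm f)"
 by (rule smooth_on_matrix[OF assms(1)])
   (auto simp: levm_def wirt_wd wirt_bar_wdb intro!: smooth_on_wd smooth_on_wdb smooth_intros assms)

lemma cong_add: "cong E (P + Q) = cong E P + cong E Q"
 by (simp add: vec_eq_iff cong_nth sesq_matrix_add)

lemma real_form11_transition_iff:
 "real_form11 A \<alpha> \<longleftrightarrow> (ALL c:A. smooth_on (im c) (\<alpha> c)) & (ALL c:A. ALL z:im c. herm (\<alpha> c z)) &
  (ALL c:A. ALL c':A. ALL z:ov c c'. \<alpha> c z = cong (jac (transition c c') z) (\<alpha> c' (transition c c' z)))"
 unfolding real_form11_def herm_def ov_def
 by (simp add: vec_eq_iff cong_nth sesq_def column_def jac_def mult_ac)

lemma omega_pot_eq: "omega_pot Q P c z = Q c z + levm (loc c P) z"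
 by (simp add: omega_pot_def ddbar_levm)

text \<open>Closedness of the added term is the commutation of the two holomorphic derivatives; its
  compatibility with coordinate changes is the tensorial behaviour of the complex Hessian.\<close>

lemma kf_omega_pot:
 assumes Q: "kf Q" and P: "smooth_fun A P" and pos: "!!c z. c : A ==> z : im c ==> pd (Q c z + levm (loc c P) z)"
 shows "kf (omega_pot Q P)"
proof -
 have s: "smooth_on (im c) (%z. Q c z + levm (loc c P) z)" if "c : A" for c
  by (intro smooth_intros smooth_on_levm kf_smooth[OF Q that] smooth_funD[OF P that] open_image[OF that])
 have r: "real_form11 A (omega_pot Q P)"
  unfolding real_form11_transition_iff
 proof (intro conjI ballI)
  fix c assume c: "c : A"
  have "omega_pot Q P c = (%z. Q c z + levm (loc c P) z)" by (rule ext) (rule omega_pot_eq)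
  thus "smooth_on (im c) (omega_pot Q P c)" using s[OF c] by (simp only:)
 next
  fix c z assume "c : A" "z : im c"
  thus "herm (omega_pot Q P c z)" using pos[of c z] by (simp only: pd_def omega_pot_eq)
 next
  fix c c' z assume c: "c : A" and c': "c' : A" and z: "z : ov c c'"
  show "omega_pot Q P c z = cong (jac (transition c c') z) (omega_pot Q P c' (transition c c' z))"
   unfolding omega_pot_eq cong_add kf_cong[OF Q c c' z, symmetric] levm_transition[OF c c' z P, symmetric] ..
 qed
 moreover have "wirt l (%u. omega_pot Q P c u $ j $ k) z = wirt j (%u. omega_pot Q P c u $ l $ k) z"
  if c: "c : A" and z: "z : im c" for c z l j k
 proof -
  let ?S = "im c"
  let ?F = "%u. complex_of_real (loc c P u)"
  have S: "open ?S" by (rule open_image[OF c])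
  have F: "smooth_on ?S ?F" by (intro smooth_intros S smooth_funD[OF P c])
  have Ks: "smooth_on ?S (%u. Q c u $ j $ k)" for j k by (intro smooth_intros S kf_smooth[OF Q c])
  have Ls: "smooth_on ?S (wd (axis j 1) (wdb (axis k 1) ?F))" for j k by (intro smooth_on_wd smooth_on_wdb S F)
  have e: "wirt l (%u. omega_pot Q P c u $ j $ k) z = wirt l (%u. Q c u $ j $ k) z + wd (axis l 1) (wd (axis j 1) (wdb (axis k 1) ?F)) z" for l j k
   unfolding omega_pot_eq wirt_wd vector_add_component
   using wd_add[OF S Ks Ls z, of "axis l 1"] by (simp add: levm_def wirt_wd wirt_bar_wdb)
  show ?thesis
   unfolding e wd_wdb_commute(2)[OF S smooth_on_wdb[OF S F] z, of "axis l 1"]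
   using kf_closed[OF Q c, unfolded closedm_def, rule_format, OF z, of l j k] by simp
 qed
 moreover have "positive A (omega_pot Q P)"
  unfolding positive_def form_value_sesq omega_pot_eq using pos unfolding pd_def by blast
 ultimately show ?thesis unfolding kf_def kaehler_form_def closed_real_form11_def by blast
qed

lemma vol_density_pos: "kf \<omega> ==> c : A ==> z : im c ==> vol_density \<omega> c z > 0"
 using pd_det(1)[OF kf_pd] by (simp add: vol_density_def)

lemma vol_density_transition:
 assumes "kf \<omega>" "c : A" "c' : A" "z : ov c c'"
 shows "vol_density \<omega> c z = (cmod (det (jac (transition c c') z)))^2 * vol_density \<omega> c' (transition c c' z)"
 unfolding vol_density_def kf_cong[OF assms] det_cong by simp

lemma smooth_vol_density: "kf \<omega> ==> c : A ==> smooth_on (im c) (vol_density \<omega> c)"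
 unfolding vol_density_def[abs_def] by (intro smooth_intros open_image kf_smooth)

lemma lint_restrict:
 fixes g :: "complex^'n => real"
 assumes "V \<subseteq> U" "!!z. z : U - V ==> g z = 0"
 shows "(LBINT z:U. g z) = (LBINT z:V. g z)"
 unfolding set_lebesgue_integral_def
 by (rule Bochner_Integration.integral_cong) (use assms in \<open>auto simp: indicator_def\<close>)

lemma chart_integral_overlap:
 assumes \<omega>: "kf \<omega>" and c: "c : A" and c': "c' : A" and L: "closed L" "L \<subseteq> fst c" "L \<subseteq> fst c'"
  and f: "continuous_on UNIV f" and f0: "ALL x. x \<notin> L \<longrightarrow> f x = 0"
 shows "(LBINT z:im c. loc c f z * vol_density \<omega> c z) = (LBINT z:im c'. loc c' f z * vol_density \<omega> c' z)"
proof -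
 let ?T = "transition c c'" and ?R = "transition c' c"
 have z0: "loc a f z = 0" if "z : im a - ov a b" "a : A" "L \<subseteq> fst b" for a b z
 proof (rule f0[rule_format])
  show "chart_inv a z \<notin> L" using that ov_iff[OF that(2)] by auto
 qed
 have LL: "snd c' ` L \<subseteq> ov c' c" using L by (auto simp: ov_def)
 have sup: "supp_in (ov c' c) (snd c' ` L) (%z. loc c' f z * vol_density \<omega> c' z)"
  using supp_chart[OF c' L(1,3) f0] LL ov_sub[of c' c] open_ov[OF c' c]
  unfolding supp_in_def by (auto simp: subset_iff)
 have con: "continuous_on (ov c' c) (%z. loc c' f z * vol_density \<omega> c' z)"
  by (intro continuous_intros continuous_on_subset[OF _ ov_sub] continuous_loc[OF f c']
   smooth_continuous[OF smooth_vol_density[OF \<omega> c']])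
 have "(LBINT z:im c. loc c f z * vol_density \<omega> c z) = (LBINT z:ov c c'. loc c f z * vol_density \<omega> c z)"
  by (rule lint_restrict[OF ov_sub]) (simp only: z0[OF _ c L(3)] mult_zero_left)
 also have "... = (LBINT z:ov c c'. loc c' f (?T z) * vol_density \<omega> c' (?T z) * (cmod (det (jac ?T z)))^2)"
  by (rule set_lebesgue_integral_cong) 
    (use open_ov[OF c c'] in \<open>auto simp: transition_maps[OF c c'] vol_density_transition[OF \<omega> c c']\<close>)
 also have "... = (LBINT z:ov c' c. loc c' f z * vol_density \<omega> c' z)"
  by (rule change_of_variables_hol[OF open_ov[OF c c'] open_ov[OF c' c] transition_hol[OF c c'] transition_hol[OF c' c] _ _ sup con])
    (use transition_maps[OF c c'] transition_maps[OF c' c] in auto)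
 also have "... = (LBINT z:im c'. loc c' f z * vol_density \<omega> c' z)"
  by (rule lint_restrict[OF ov_sub, symmetric]) (simp only: z0[OF _ c' L(2)] mult_zero_left)
 finally show ?thesis .
qed

lemma chart_integrable:
 fixes f :: "'a => real"
 assumes c: "c : A" and L: "closed L" "L \<subseteq> fst c" and f0: "ALL x. x \<notin> L \<longrightarrow> f x = 0"
  and h: "continuous_on (im c) (%z. loc c f z * h z)"
 shows "set_integrable lborel (im c) (%z. loc c f z * h z)"
proof -
 have "integrable lborel (ext0 (im c) (%z. loc c f z * h z))"
  by (rule integrable_ext0[OF supp_chart(1)[OF c L f0] h])
 moreover have "ext0 (im c) (%z. loc c f z * h z) = (%z. indicator (im c) z *\<^sub>R (loc c f z * h z))"
  by (auto simp: ext0_def fun_eq_iff indicator_def)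
 ultimately show ?thesis unfolding set_integrable_def by simp
qed

text \<open>Each piece of \<open>f\<close> cut out by the partition is carried to the chart
  \<open>c\<close> by \<open>chart_integral_overlap\<close>, and there the partition functions add
  up to 1.\<close>

theorem form_integral_local:
 assumes \<omega>: "kf \<omega>" and c: "c : A" and L: "closed L" "L \<subseteq> fst c"
  and f: "continuous_on UNIV f" and f0: "ALL x. x \<notin> L \<longrightarrow> f x = 0"
 shows "FI \<omega> f = (LBINT z:im c. loc c f z * vol_density \<omega> c z)"
proof -
 have con: "continuous_on UNIV (%x. P\<theta> k x * f x)" if "k : PC" for k
  by (intro continuous_intros f smooth_fun_continuous[OF P\<theta>_smooth[OF that]])
 have 1: "(LBINT z:im k. loc k (P\<theta> k) z * loc k f z * vol_density \<omega> k z)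
  = (LBINT z:im c. loc c (%x. P\<theta> k x * f x) z * vol_density \<omega> c z)" if k: "k : PC" for k
 proof -
  have kA: "k : A" using PC k by auto
  show ?thesis
  proof (rule chart_integral_overlap[OF \<omega> kA c, where L="L \<inter> closure {x. P\<theta> k x ~= 0}"])
   show "ALL x. x \<notin> L \<inter> closure {x. P\<theta> k x ~= 0} \<longrightarrow> P\<theta> k x * f x = 0"
   proof (intro allI impI)
    fix x assume "x \<notin> L \<inter> closure {x. P\<theta> k x ~= 0}"
    then consider "x \<notin> L" | "x \<notin> closure {x. P\<theta> k x ~= 0}" by blast
    thus "P\<theta> k x * f x = 0"
    proof cases
     case 1
     thus ?thesis using f0 by simp
    next
     case 2
     hence "P\<theta> k x = 0" by (rule P\<theta>_zero[rule_format])
     thus ?thesis by simp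
    qed
   qed
  qed (use L P\<theta>_supp[OF k] con[OF k] in auto)
 qed
 have "FI \<omega> f = (SUM k:PC. LBINT z:im c. loc c (%x. P\<theta> k x * f x) z * vol_density \<omega> c z)"
  unfolding form_integral_PU by (rule sum.cong[OF refl 1])
 also have "... = (LBINT z:im c. (SUM k:PC. loc c (%x. P\<theta> k x * f x) z * vol_density \<omega> c z))"
 proof (rule set_lint_sum[symmetric, OF PC(1)])
  fix k assume k: "k : PC"
  show "set_integrable lborel (im c) (%z. loc c (%x. P\<theta> k x * f x) z * vol_density \<omega> c z)"
  proof (rule chart_integrable[OF c L])
   show "ALL x. x \<notin> L \<longrightarrow> P\<theta> k x * f x = 0" using f0 by simp
   show "continuous_on (im c) (%z. loc c (%x. P\<theta> k x * f x) z * vol_density \<omega> c z)"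
    by (intro continuous_on_mult smooth_continuous[OF smooth_vol_density[OF \<omega> c]] continuous_loc[OF con[OF k] c])
  qed
 qed
 also have "... = (LBINT z:im c. loc c f z * vol_density \<omega> c z)"
  by (rule set_lebesgue_integral_cong)
    (use open_image[OF c] in \<open>auto simp: sum_distrib_right[symmetric] P\<theta>_sum\<close>)
 finally show ?thesis .
qed

lemma form_integral_glob:
 assumes \<omega>: "kf \<omega>" and c: "c : A" and K: "supp_in (im c) K g" and g: "smooth_on (im c) g"
  and u: "continuous_on UNIV u"
 shows "FI \<omega> (%x. u x * glob c g x) = (LBINT z:im c. loc c u z * g z * vol_density \<omega> c z)"
proof -
 have K': "compact K" "K \<subseteq> im c" using K by (auto simp: supp_in_def)
 have "FI \<omega> (%x. u x * glob c g x) = (LBINT z:im c. loc c (%x. u x * glob c g x) z * vol_density \<omega> c z)"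
  by (rule form_integral_local[OF \<omega> c compact_inv_image(2)[OF c K']])
    (use K'(2) chart_inv_in[OF c] glob_outside[OF c K] in \<open>auto intro!: continuous_on_mult[OF u smooth_fun_continuous[OF smooth_fun_glob[OF c K g]]]\<close>)
 also have "... = (LBINT z:im c. loc c u z * g z * vol_density \<omega> c z)"
  by (rule set_lebesgue_integral_cong) (use open_image[OF c] in \<open>auto simp: loc_glob[OF c]\<close>)
 finally show ?thesis .
qed

lemma PU_integrable:
 assumes "k : PC" "continuous_on (im k) h"
 shows "set_integrable lborel (im k) (%z. loc k (P\<theta> k) z * h z)"
proof -
 have kA: "k : A" using PC assms(1) by auto
 show ?thesis
  by (rule chart_integrable[OF kA closed_closure P\<theta>_supp[OF assms(1)] P\<theta>_zero])
    (intro continuous_on_mult assms(2) smooth_continuous[OF smooth_funD[OF P\<theta>_smooth[OF assms(1)] kA]])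
qed

lemma
 assumes \<omega>: "kf \<omega>" and f: "continuous_on UNIV f" and g: "continuous_on UNIV g"
 shows form_integral_add: "FI \<omega> (%x. f x + g x) = FI \<omega> f + FI \<omega> g"
  and form_integral_diff: "FI \<omega> (%x. f x - g x) = FI \<omega> f - FI \<omega> g"
  and form_integral_mono: "(!!x. f x <= g x) ==> FI \<omega> f <= FI \<omega> g"
proof -
 have i: "set_integrable lborel (im k) (%z. loc k (P\<theta> k) z * loc k h z * vol_density \<omega> k z)"
  if "k : PC" "continuous_on UNIV h" for k h
 proof -
  have kA: "k : A" using PC that(1) by auto
  show ?thesis using PU_integrable[OF that(1), of "%z. loc k h z * vol_density \<omega> k z"]
   continuous_loc[OF that(2) kA] smooth_continuous[OF smooth_vol_density[OF \<omega> kA]]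
   by (simp add: mult.assoc continuous_on_mult)
 qed
 show "FI \<omega> (%x. f x + g x) = FI \<omega> f + FI \<omega> g"
  unfolding form_integral_PU sum.distrib[symmetric]
 proof (rule sum.cong[OF refl])
  fix k assume k: "k : PC"
  show "(LBINT z:im k. loc k (P\<theta> k) z * loc k (%x. f x + g x) z * vol_density \<omega> k z)
   = (LBINT z:im k. loc k (P\<theta> k) z * loc k f z * vol_density \<omega> k z) + (LBINT z:im k. loc k (P\<theta> k) z * loc k g z * vol_density \<omega> k z)"
   using set_integral_add(2)[OF i[OF k f] i[OF k g]] by (simp add: algebra_simps)
 qed
 show "FI \<omega> (%x. f x - g x) = FI \<omega> f - FI \<omega> g"
  unfolding form_integral_PU sum_subtractf[symmetric]
 proof (rule sum.cong[OF refl])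
  fix k assume k: "k : PC"
  show "(LBINT z:im k. loc k (P\<theta> k) z * loc k (%x. f x - g x) z * vol_density \<omega> k z)
   = (LBINT z:im k. loc k (P\<theta> k) z * loc k f z * vol_density \<omega> k z) - (LBINT z:im k. loc k (P\<theta> k) z * loc k g z * vol_density \<omega> k z)"
   using set_integral_diff(2)[OF i[OF k f] i[OF k g]] by (simp add: algebra_simps)
 qed
 assume le: "!!x. f x <= g x"
 show "FI \<omega> f <= FI \<omega> g"
  unfolding form_integral_PU
 proof (rule sum_mono)
  fix k assume k: "k : PC"
  have kA: "k : A" using PC k by auto
  show "(LBINT z:im k. loc k (P\<theta> k) z * loc k f z * vol_density \<omega> k z) <= (LBINT z:im k. loc k (P\<theta> k) z * loc k g z * vol_density \<omega> k z)"
   by (rule set_integral_mono[OF i[OF k f] i[OF k g]])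
     (intro mult_right_mono mult_left_mono le P\<theta>_nonneg[OF k] less_imp_le[OF vol_density_pos[OF \<omega> kA]])
 qed
qed

lemma form_integral_cmult:
 "FI \<omega> (%x. k * f x) = k * FI \<omega> f"
 unfolding form_integral_PU sum_distrib_left
proof (rule sum.cong[OF refl])
 fix c
 have "(LBINT z:im c. k * (loc c (P\<theta> c) z * loc c f z * vol_density \<omega> c z))
  = k * (LBINT z:im c. loc c (P\<theta> c) z * loc c f z * vol_density \<omega> c z)"
  by (rule set_integral_mult_right)
 moreover have "(%z. loc c (P\<theta> c) z * loc c (%x. k * f x) z * vol_density \<omega> c z)
   = (%z. k * (loc c (P\<theta> c) z * loc c f z * vol_density \<omega> c z))"
  by (simp add: mult_ac)
 ultimately show "(LBINT z:im c. loc c (P\<theta> c) z * loc c (%x. k * f x) z * vol_density \<omega> c z)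
  = k * (LBINT z:im c. loc c (P\<theta> c) z * loc c f z * vol_density \<omega> c z)" by simp
qed

lemma form_integral_sum:
 assumes \<omega>: "kf \<omega>" and f: "!!i. i : I ==> continuous_on UNIV (f i)"
 shows "FI \<omega> (%x. SUM i:I. f i x) = (SUM i:I. FI \<omega> (f i))"
 using f
proof (induction I rule: infinite_finite_induct)
 case (insert i I)
 thus ?case
  by (simp add: form_integral_add[OF \<omega>] continuous_on_sum)
qed (use form_integral_cmult[of \<omega> 0 "%_. 0"] in auto)

lemma form_integral_param_continuous:
 assumes c: "!!c. c : A ==> continuous_on (P \<times> im c) (%(p, z). loc c (f p) z * vol_density (\<omega> p) c z)"
 shows "continuous_on P (%p. FI (\<omega> p) (f p))"
 unfolding form_integral_PU
proof (rule continuous_on_sum)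
 fix k assume k: "k : PC"
 have kA: "k : A" using PC k by auto
 note sc = supp_chart[OF kA closed_closure P\<theta>_supp[OF k] P\<theta>_zero]
 show "continuous_on P (%p. LBINT z:im k. loc k (P\<theta> k) z * loc k (f p) z * vol_density (\<omega> p) k z)"
 proof (rule continuous_on_lint_param[OF open_image[OF kA] sc(2,3)])
  have "continuous_on (P \<times> im k) (%x. loc k (P\<theta> k) (snd x) * (case x of (p, z) => loc k (f p) z * vol_density (\<omega> p) k z))"
   by (intro continuous_on_mult c[OF kA] continuous_on_compose2[OF smooth_continuous[OF smooth_funD[OF P\<theta>_smooth[OF k] kA]]] continuous_on_snd continuous_on_id) auto
  thus "continuous_on (P \<times> im k) (%(p, z). loc k (P\<theta> k) z * loc k (f p) z * vol_density (\<omega> p) k z)"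
   by (simp add: split_beta mult.assoc)
 qed (use sc(4) in auto)
qed

lemma form_integral_param_derivative:
 assumes c: "!!c p. c : A ==> p : P ==> continuous_on (im c) (%z. loc c (f p) z * vol_density (\<omega> p) c z)"
  and c': "!!c. c : A ==> continuous_on (P \<times> im c) (%(p, z). loc c (f' p) z * vol_density (\<omega> p) c z)"
  and d: "!!c p z. c : A ==> p : P ==> z : im c ==>
   ((%p. loc c (f p) z * vol_density (\<omega> p) c z) has_real_derivative loc c (f' p) z * vol_density (\<omega> p) c z) (at p within P)"
  and P: "convex P" "p : P"
 shows "((%p. FI (\<omega> p) (f p)) has_real_derivative FI (\<omega> p) (f' p)) (at p within P)"
 unfolding form_integral_PU
proof (rule DERIV_sum)
 fix k assume k: "k : PC"
 have kA: "k : A" using PC k by auto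
 note sc = supp_chart[OF kA closed_closure P\<theta>_supp[OF k] P\<theta>_zero]
 note cth = smooth_continuous[OF smooth_funD[OF P\<theta>_smooth[OF k] kA]]
 show "((%p. LBINT z:im k. loc k (P\<theta> k) z * loc k (f p) z * vol_density (\<omega> p) k z) has_real_derivative
   (LBINT z:im k. loc k (P\<theta> k) z * loc k (f' p) z * vol_density (\<omega> p) k z)) (at p within P)"
 proof (rule lint_param_derivative[OF open_image[OF kA] sc(2,3)])
  have "continuous_on (P \<times> im k) (%x. loc k (P\<theta> k) (snd x) * (case x of (p, z) => loc k (f' p) z * vol_density (\<omega> p) k z))"
   by (intro continuous_on_mult c'[OF kA] continuous_on_compose2[OF cth] continuous_on_snd continuous_on_id) auto
  thus "continuous_on (P \<times> im k) (%(p, z). loc k (P\<theta> k) z * loc k (f' p) z * vol_density (\<omega> p) k z)"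
   by (simp add: split_beta mult.assoc)
  show "continuous_on (im k) (%z. loc k (P\<theta> k) z * loc k (f p) z * vol_density (\<omega> p) k z)" if "p : P" for p
   using continuous_on_mult[OF cth c[OF kA that]] by (simp add: mult.assoc)
  show "((%p. loc k (P\<theta> k) z * loc k (f p) z * vol_density (\<omega> p) k z) has_real_derivative
    loc k (P\<theta> k) z * loc k (f' p) z * vol_density (\<omega> p) k z) (at p within P)" if "p : P" "z : im k" for p z
   using DERIV_cmult[OF d[OF kA that], of "loc k (P\<theta> k) z"] by (simp add: mult.assoc)
 qed (use sc(4) P in auto)
qed

end

section \<open>Green's formula and the energy inequality\<close>

lemma pd_inverse_herm:
 assumes "pd A"
 shows "cnj (matrix_inv A $ k $ j) = matrix_inv A $ j $ k"
proof -
 obtain E where E: "cong E A = mat 1" using orthonormal_basis assms by blast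
 show ?thesis unfolding cong_mat1_inverse(1)[OF E]
  by (simp add: matrix_matrix_mult_def cjm_def transpose_def mult.commute)
qed

lemma Re_wdb:
 assumes "open S" "smooth_on S Y" "z : S"
 shows "Re (wdb v Y z) = (dv v (%z. Re (Y z)) z - dv (\<i> *s v) (%z. Im (Y z)) z) / 2"
 using dv_linear_comp[OF bounded_linear_Re assms] dv_linear_comp[OF bounded_linear_Im assms]
 by (simp add: wdb_def)

lemma lint_Re_wdb_zero:
 assumes U: "supp_in U K (%z. Re (Y z))" "supp_in U K (%z. Im (Y z))" and Y: "smooth_on U Y"
 shows "(LBINT z:U. Re (wdb v Y z)) = 0"
  and "set_integrable lborel U (%z. Re (wdb v Y z))"
proof -
 have o: "open U" "compact K" "K \<subseteq> U" using U(1) by (auto simp: supp_in_def)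
 have R: "smooth_on U (%z. Re (Y z))" and I: "smooth_on U (%z. Im (Y z))"
  using smooth_on_linear[OF bounded_linear_Re o(1) Y] smooth_on_linear[OF bounded_linear_Im o(1) Y] by auto
 have i: "set_integrable lborel U (dv w h)" if "smooth_on U h" "supp_in U K h" for w h
 proof -
  have "dv w h z = 0" if "z : U - K" for z
  proof -
   have "open (U - K)" using o compact_imp_closed by blast
   hence "dv w h z = dv w (%_. 0) z"
    by (rule dv_cong_open[OF _ that]) (use \<open>supp_in U K h\<close> in \<open>auto simp: supp_in_def\<close>)
   thus ?thesis by (simp add: dv_const)
  qed
  hence "supp_in U K (dv w h)" using o by (auto simp: supp_in_def)
  from integrable_ext0[OF this smooth_continuous[OF smooth_on_dv[OF o(1) that(1)]]]
  show ?thesis unfolding set_integrable_def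
   by (rule back_subst[where P="integrable lborel"]) (auto simp: ext0_def fun_eq_iff)
 qed
 have iR: "set_integrable lborel U (%z. dv v (%z. Re (Y z)) z / 2)"
  and iI: "set_integrable lborel U (%z. dv (\<i> *s v) (%z. Im (Y z)) z / 2)"
  using i[OF R U(1), of v] i[OF I U(2), of "\<i> *s v"] by auto
 have eq: "Re (wdb v Y z) = dv v (%z. Re (Y z)) z / 2 - dv (\<i> *s v) (%z. Im (Y z)) z / 2" if "z : U" for z
  using Re_wdb[OF o(1) Y that] by (simp add: diff_divide_distrib)
 have "(LBINT z:U. Re (wdb v Y z)) = (LBINT z:U. dv v (%z. Re (Y z)) z / 2 - dv (\<i> *s v) (%z. Im (Y z)) z / 2)"
  by (rule set_lebesgue_integral_cong) (use eq o in auto)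
 also have "... = 0"
  unfolding set_integral_diff(2)[OF iR iI]
  using lint_dv_zero[OF U(1) R, of v] lint_dv_zero[OF U(2) I, of "\<i> *s v"] by simp
 finally show "(LBINT z:U. Re (wdb v Y z)) = 0" .
 have "set_integrable lborel U (%z. dv v (%z. Re (Y z)) z / 2 - dv (\<i> *s v) (%z. Im (Y z)) z / 2)"
  by (rule set_integral_diff(1)[OF iR iI])
 moreover have "set_integrable lborel U (%z. Re (wdb v Y z)) \<longleftrightarrow> set_integrable lborel U (%z. dv v (%z. Re (Y z)) z / 2 - dv (\<i> *s v) (%z. Im (Y z)) z / 2)"
  unfolding set_integrable_def by (rule Bochner_Integration.integrable_cong) (auto simp: eq indicator_def)
 ultimately show "set_integrable lborel U (%z. Re (wdb v Y z))" by simp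
qed

text \<open>The integrand is the real divergence of a field \<open>Y\<close> supported in
  \<open>K\<close>. Compact support is asked of \<open>F\<close> alone, which lets
  \<open>green\<close> cut off one function and leave the other global.\<close>

theorem chart_green:
 fixes H :: "complex^'n::finite => complex^'n^'n"
 assumes H: "smooth_on U H" and pd: "!!z. z : U ==> pd (H z)" and cl: "closedm U H"
  and F: "smooth_on U F" and G: "smooth_on U G" and K: "supp_in U K F"
 shows "(LBINT z:U. (F z * tr (H z) (levm G z) - G z * tr (H z) (levm F z)) * Re (det (H z))) = 0"
proof -
 have U: "open U" "compact K" "K \<subseteq> U" and F0: "!!z. z : U - K ==> F z = 0" using K by (auto simp: supp_in_def)
 have UK: "open (U - K)" using U compact_imp_closed by blast
 define M where "M z = matrix_inv (H z)" for z
 have nz: "det (H z) ~= 0" if "z : U" for z by (rule pd_det_nz[OF pd[OF that]])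
 have Ms: "smooth_on U M" unfolding M_def[abs_def] by (intro smooth_intros U H nz)
 define C where "C k j z = det (H z) * M z $ k $ j" for k j z
 have Cs: "smooth_on U (C k j)" for k j unfolding C_def[abs_def] by (intro smooth_intros U H Ms)
 \<comment> \<open>\<open>C\<close> is the cofactor matrix, so \<open>X a\<close> is the gradient of
   \<open>a\<close> multiplied by the density; by \<open>piola\<close> its divergence contains no
   derivative of the metric.\<close>
 define X where "X a k z = (SUM j:UNIV. C k j z * wirt j (%u. complex_of_real (a u)) z)" for a k z
 have ws: "smooth_on U (wirt j (%u. complex_of_real (a u)))" if "smooth_on U a" for a j
  unfolding wirt_wd by (intro smooth_on_wd smooth_intros U that)
 have Xs: "smooth_on U (X a k)" if "smooth_on U a" for a k
  unfolding X_def[abs_def] by (intro smooth_intros U Cs ws that)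
 have divX: "(SUM k:UNIV. wirt_bar k (X a k) z) = det (H z) * of_real (tr (H z) (levm a z))"
  if a: "smooth_on U a" and z: "z : U" for a z
 proof -
  let ?a = "%u. complex_of_real (a u)"
  have "wirt_bar k (X a k) z = (SUM j:UNIV. C k j z * wirt_bar k (wirt j ?a) z + wirt_bar k (C k j) z * wirt j ?a z)" for k
  proof -
   have "wirt_bar k (X a k) z = (SUM j:UNIV. wirt_bar k (%z. C k j z * wirt j ?a z) z)"
    unfolding X_def[abs_def] wirt_bar_wdb
    by (rule wdb_sum[OF U(1) _ z]) (intro smooth_intros U Cs ws a)
   also have "... = (SUM j:UNIV. C k j z * wirt_bar k (wirt j ?a) z + wirt_bar k (C k j) z * wirt j ?a z)"
    unfolding wirt_bar_wdb by (intro sum.cong refl wdb_mult[OF U(1) Cs ws[OF a] z])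
   finally show ?thesis .
  qed
  hence "(SUM k:UNIV. wirt_bar k (X a k) z)
   = (SUM k:UNIV. SUM j:UNIV. C k j z * wirt_bar k (wirt j ?a) z) + (SUM k:UNIV. SUM j:UNIV. wirt_bar k (C k j) z * wirt j ?a z)"
   by (simp add: sum.distrib)
  also have "(SUM k:UNIV. SUM j:UNIV. wirt_bar k (C k j) z * wirt j ?a z) = (SUM j:UNIV. (SUM k:UNIV. wirt_bar k (C k j) z) * wirt j ?a z)"
   by (subst sum.swap) (simp add: sum_distrib_right)
  also have "... = 0"
   using piola[OF U(1) H pd cl z] unfolding C_def[abs_def] M_def by simp
  also have "(SUM k:UNIV. SUM j:UNIV. C k j z * wirt_bar k (wirt j ?a) z) = det (H z) * trace (M z ** levm a z)"
  proof -
   have "wirt_bar k (wirt j ?a) z = levm a z $ j $ k" for j k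
    unfolding levm_def wirt_wd wirt_bar_wdb
    using wd_wdb_commute(1)[OF U(1) _ z, of ?a "axis j 1" "axis k 1"] smooth_on_of_real[OF U(1) a] by simp
   thus ?thesis by (simp add: C_def trace_mult_entries sum_distrib_left mult.assoc)
  qed
  also have "trace (M z ** levm a z) = of_real (tr (H z) (levm a z))"
   unfolding M_def by (rule trace_inv_real[OF pd[OF z] herm_levm[OF U(1) a z]])
  finally show ?thesis by simp
 qed
 define Y where "Y k z = of_real (F z) * X G k z - of_real (G z) * X F k z" for k z
 have Ys: "smooth_on U (Y k)" for k unfolding Y_def[abs_def] by (intro smooth_intros U F G Xs)
 have Y0: "Y k z = 0" if "z : U - K" for k z
 proof -
  have "wirt j (%u. complex_of_real (F u)) z = wirt j (%u. 0) z" for j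
   unfolding wirt_wd by (rule wd_cong_open[OF UK that]) (use F0 in auto)
  hence "X F k z = 0" by (simp add: X_def wirt_wd wd_const)
  thus ?thesis using F0[OF that] by (simp add: Y_def)
 qed
 have sY: "supp_in U K (%z. Re (Y k z))" "supp_in U K (%z. Im (Y k z))" for k
  using U Y0 by (auto simp: supp_in_def)
 have "(F z * tr (H z) (levm G z) - G z * tr (H z) (levm F z)) * Re (det (H z)) = (SUM k:UNIV. Re (wdb (axis k 1) (Y k) z))"
  if z: "z : U" for z
 proof -
  let ?F = "%u. complex_of_real (F u)" and ?G = "%u. complex_of_real (G u)"
  have Fs: "smooth_on U ?F" and Gs: "smooth_on U ?G" by (intro smooth_intros U F G)+
  have "wirt_bar k (Y k) z = (?F z * wirt_bar k (X G k) z + wirt_bar k ?F z * X G k z) - (?G z * wirt_bar k (X F k) z + wirt_bar k ?G z * X F k z)" for k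
  proof -
   have "wirt_bar k (Y k) z = wirt_bar k (%z. ?F z * X G k z) z - wirt_bar k (%z. ?G z * X F k z) z"
    unfolding Y_def[abs_def] wirt_bar_wdb
    by (rule wdb_diff[OF U(1) _ _ z]) (intro smooth_intros U F G Xs)+
   thus ?thesis unfolding wirt_bar_wdb
    by (simp add: wdb_mult[OF U(1) Fs Xs[OF G] z] wdb_mult[OF U(1) Gs Xs[OF F] z])
  qed
  hence "(SUM k:UNIV. wirt_bar k (Y k) z)
    = ?F z * (SUM k:UNIV. wirt_bar k (X G k) z) - ?G z * (SUM k:UNIV. wirt_bar k (X F k) z)
    + ((SUM k:UNIV. wirt_bar k ?F z * X G k z) - (SUM k:UNIV. wirt_bar k ?G z * X F k z))"
   by (simp add: sum.distrib sum_subtractf sum_distrib_left)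
  \<comment> \<open>The two mixed gradient terms are conjugate to each other because the cofactor
    matrix is Hermitian, so their difference is purely imaginary.\<close>
  moreover have "Re ((SUM k:UNIV. wirt_bar k ?F z * X G k z) - (SUM k:UNIV. wirt_bar k ?G z * X F k z)) = 0"
  proof -
   let ?W = "%a b. SUM k:UNIV. wirt_bar k (%u. complex_of_real (a u)) z * X b k z"
   have cw: "cnj (wirt k (%u. complex_of_real (a u)) z) = wirt_bar k (%u. complex_of_real (a u)) z"
    "cnj (wirt_bar k (%u. complex_of_real (a u)) z) = wirt k (%u. complex_of_real (a u)) z" if "smooth_on U a" for a k
    using wdb_cnj[OF U(1) smooth_on_of_real[OF U(1) that] z, of "axis k 1"] wd_cnj[OF U(1) smooth_on_of_real[OF U(1) that] z, of "axis k 1"]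
    by (simp_all add: wirt_wd wirt_bar_wdb)
   have cC: "cnj (C k j z) = C j k z" for k j
   proof -
    have "cnj (det (H z)) = det (H z)" using pd_det(2)[OF pd[OF z]] by (metis complex_cnj_complex_of_real)
    thus ?thesis unfolding C_def M_def by (simp add: pd_inverse_herm[OF pd[OF z]])
   qed
   have "cnj (?W F G) = (SUM k:UNIV. SUM j:UNIV. wirt k ?F z * (C j k z * wirt_bar j ?G z))"
    unfolding X_def by (simp add: cw[OF F] cw[OF G] cC sum_distrib_left)
   also have "... = (SUM j:UNIV. SUM k:UNIV. wirt k ?F z * (C j k z * wirt_bar j ?G z))" by (rule sum.swap)
   also have "... = ?W G F" unfolding X_def by (simp add: sum_distrib_left mult_ac)
   finally have "cnj (?W F G) = ?W G F" .
   from arg_cong[OF this, of Re] show ?thesis by simp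
  qed
  ultimately have "Re (SUM k:UNIV. wirt_bar k (Y k) z)
    = Re (?F z * (det (H z) * of_real (tr (H z) (levm G z))) - ?G z * (det (H z) * of_real (tr (H z) (levm F z))))"
   unfolding divX[OF F z] divX[OF G z] by simp
  thus ?thesis by (simp add: wirt_bar_wdb algebra_simps)
 qed
 hence "(LBINT z:U. (F z * tr (H z) (levm G z) - G z * tr (H z) (levm F z)) * Re (det (H z)))
  = (LBINT z:U. (SUM k:UNIV. Re (wdb (axis k 1) (Y k) z)))"
  by (intro set_lebesgue_integral_cong) (use U in auto)
 also have "... = (SUM k:UNIV. LBINT z:U. Re (wdb (axis k 1) (Y k) z))"
  by (rule set_lint_sum[OF finite lint_Re_wdb_zero(2)[OF sY Ys]])
 also have "... = 0" by (simp add: lint_Re_wdb_zero(1)[OF sY Ys])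
 finally show ?thesis .
qed

text \<open>The discarded term is twice the squared modulus of the derivative of \<open>g\<close> in
  direction \<open>v\<close>.\<close>

lemma levi_square:
 fixes g :: "complex^'n::finite => real"
 assumes S: "open S" and g: "smooth_on S g" and z: "z : S"
 shows "Re (levi (%u. g u * g u) z v v) >= 2 * g z * Re (levi g z v v)"
proof -
 have "levi (%u. g u * g u) z v v = of_real (2 * g z) * levi g z v v
  + of_real (2 * (cmod (wd v (%u. of_real (g u)) z))^2)"
  by (rule levi_compose[OF S g z open_UNIV]) (auto intro!: smooth_intros derivative_eq_intros)
 thus ?thesis by simp
qed

context cmanifold
begin

text \<open>Computed in an arbitrarily chosen chart around the point; \<open>lap_loc\<close> shows
  that every chart gives the same value.\<close>

definition lap :: "('a, 'n) form11 => ('a => real) => 'a => real" where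
 "lap Q f x = (let c = (SOME c. c : A & x : fst c) in tr (Q c (snd c x)) (levm (loc c f) (snd c x)))"

lemma lap_loc:
 assumes Q: "kf Q" and f: "smooth_fun A f" and c: "c : A" and z: "z : im c"
 shows "loc c (lap Q f) z = tr (Q c z) (levm (loc c f) z)"
proof -
 define x where "x = chart_inv c z"
 define k where "k = (SOME c. c : A & x : fst c)"
 have "EX c. c : A & x : fst c" using chart_at by metis
 from someI_ex[OF this] have k: "k : A" "x : fst k" by (auto simp: k_def)
 have zo: "z : ov c k" using ov_iff[OF c] z k(2) by (simp add: x_def)
 have T: "transition c k z = snd k x" by (simp add: transition_def x_def)
 have "loc c (lap Q f) z = tr (Q k (snd k x)) (levm (loc k f) (snd k x))"
  unfolding lap_def x_def[symmetric] k_def[symmetric] Let_def ..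
 also have "... = tr (cong (jac (transition c k) z) (Q k (snd k x))) (cong (jac (transition c k) z) (levm (loc k f) (snd k x)))"
 proof (rule tr_cong[symmetric])
  show "pd (Q k (snd k x))" using k by (intro kf_pd[OF Q k(1)]) auto
 qed (rule jac_transition_nz[OF c k(1) zo])
 also have "... = tr (Q c z) (levm (loc c f) z)"
  unfolding T[symmetric] kf_cong[OF Q c k(1) zo, symmetric] levm_transition[OF c k(1) zo f, symmetric] ..
 finally show ?thesis .
qed

lemma smooth_on_tr:
 assumes "open S" "smooth_on S H" "!!z. z : S ==> det (H z) ~= 0" "smooth_on S Q"
 shows "smooth_on S (%z. tr (H z) (Q z))"
proof -
 define M where "M z = matrix_inv (H z)" for z
 have "smooth_on S M" unfolding M_def[abs_def] by (intro smooth_intros assms)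
 hence "smooth_on S (%z. Re (SUM i:UNIV. SUM k:UNIV. M z $ i $ k * Q z $ k $ i))" by (intro smooth_intros assms)
 thus ?thesis unfolding tr_def trace_mult_entries M_def .
qed

lemma smooth_fun_lap:
 assumes Q: "kf Q" and f: "smooth_fun A f"
 shows "smooth_fun A (lap Q f)"
 unfolding smooth_fun_loc
proof
 fix c assume c: "c : A"
 have "smooth_on (im c) (%z. tr (Q c z) (levm (loc c f) z))"
  by (intro smooth_on_tr smooth_on_levm open_image[OF c] kf_smooth[OF Q c] pd_det_nz kf_pd[OF Q c] smooth_funD[OF f c])
 thus "smooth_on (im c) (loc c (lap Q f))"
  by (subst smooth_on_cong[where g="%z. tr (Q c z) (levm (loc c f) z)"]) (simp_all add: lap_loc[OF Q f c])
qed

lemma lap_sum: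
 assumes Q: "kf Q" and f: "!!i. i : I ==> smooth_fun A (f i)"
 shows "lap Q (%x. SUM i:I. f i x) x = (SUM i:I. lap Q (f i) x)"
 using f
proof (induction I rule: infinite_finite_induct)
 case (insert i I)
 obtain c where c: "c : A" "x : fst c" by (rule chart_at)
 have x: "x = chart_inv c (snd c x)" "snd c x : im c" using c chart_inv_snd by auto
 have s: "smooth_fun A (f i)" "smooth_fun A (%x. SUM i:I. f i x)" using insert by (auto intro!: smooth_fun_sum)
 have "lap Q (%x. f i x + (SUM i:I. f i x)) x = lap Q (f i) x + lap Q (%x. SUM i:I. f i x) x"
  using lap_loc[OF Q smooth_fun_add[OF s] c(1) x(2)] lap_loc[OF Q s(1) c(1) x(2)] lap_loc[OF Q s(2) c(1) x(2)]
   levm_add[OF open_image[OF c(1)] smooth_funD[OF s(1) c(1)] smooth_funD[OF s(2) c(1)] x(2)]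
  by (simp add: x(1)[symmetric] tr_add)
 thus ?case using insert by simp
qed (auto simp: lap_def Let_def levm_const tr_def trace_def matrix_matrix_mult_def)

lemma lap_vanish:
 assumes Q: "kf Q" and f: "smooth_fun A f" and L: "closed L" "!!x. x \<notin> L ==> f x = 0" and x: "x \<notin> L"
 shows "lap Q f x = 0"
proof -
 obtain c where c: "c : A" "x : fst c" by (rule chart_at)
 have z: "snd c x : im c" and xe: "x = chart_inv c (snd c x)" using c chart_inv_snd by auto
 define W where "W = snd c ` (fst c - L)"
 have W: "open W" "snd c x : W" unfolding W_def
  using open_image_of[OF c(1), of "fst c - L"] open_chart[OF c(1)] L(1) c x by auto
 have "levm (loc c f) (snd c x) = levm (%_. 0) (snd c x)"
  by (rule levm_cong_open[OF W]) (use L(2) chart_inv_snd[OF c(1)] in \<open>auto simp: W_def\<close>)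
 thus ?thesis
  using lap_loc[OF Q f c(1) z] xe by (simp add: levm_const tr_def trace_def matrix_matrix_mult_def)
qed

theorem green:
 assumes Q: "kf Q" and F: "smooth_fun A F" and G: "smooth_fun A G"
 shows "FI Q (%x. F x * lap Q G x) = FI Q (%x. G x * lap Q F x)"
proof -
 define f where "f k x = P\<theta> k x * F x" for k x
 have f: "smooth_fun A (f k)" if "k : PC" for k
  unfolding f_def[abs_def] by (intro smooth_fun_mult P\<theta>_smooth[OF that] F)
 have F_sum: "F = (%x. SUM k:PC. f k x)" by (auto simp: f_def sum_distrib_right[symmetric] P\<theta>_sum)
 have cont: "continuous_on UNIV (%x. f k x * lap Q G x - G x * lap Q (f k) x)" if "k : PC" for k
  by (intro continuous_intros smooth_fun_continuous f[OF that] G smooth_fun_lap[OF Q])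
 have loc0: "FI Q (%x. f k x * lap Q G x - G x * lap Q (f k) x) = 0" if k: "k : PC" for k
 proof -
  have kA: "k : A" using PC k by auto
  define L where "L = closure {x. P\<theta> k x ~= 0}"
  have L: "closed L" "L \<subseteq> fst k" using P\<theta>_supp[OF k] by (auto simp: L_def)
  have f0: "f k x = 0" if "x \<notin> L" for x
  proof -
   have "P\<theta> k x = 0" using P\<theta>_zero[rule_format, of x k] that unfolding L_def by blast
   thus ?thesis by (simp add: f_def)
  qed
  have lf0: "lap Q (f k) x = 0" if "x \<notin> L" for x
   by (rule lap_vanish[OF Q f[OF k] L(1) f0 that])
  have "FI Q (%x. f k x * lap Q G x - G x * lap Q (f k) x)
   = (LBINT z:im k. loc k (%x. f k x * lap Q G x - G x * lap Q (f k) x) z * vol_density Q k z)"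
   by (rule form_integral_local[OF Q kA L cont[OF k]]) (simp add: f0 lf0)
  also have "... = (LBINT z:im k. fact CARD('n) * 2 ^ CARD('n) *
    ((loc k (f k) z * tr (Q k z) (levm (loc k G) z) - loc k G z * tr (Q k z) (levm (loc k (f k)) z)) * Re (det (Q k z))))"
   by (rule set_lebesgue_integral_cong)
     (use open_image[OF kA] in \<open>simp_all add: lap_loc[OF Q G kA] lap_loc[OF Q f[OF k] kA] vol_density_def\<close>)
  also have "... = fact CARD('n) * 2 ^ CARD('n) * (LBINT z:im k.
    (loc k (f k) z * tr (Q k z) (levm (loc k G) z) - loc k G z * tr (Q k z) (levm (loc k (f k)) z)) * Re (det (Q k z)))"
   by (rule set_integral_mult_right)
  also have "... = 0"
  proof -
   have "supp_in (im k) (snd k ` L) (loc k (f k))"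
    using supp_chart(1)[OF kA L, of "f k" "%_. 1"] f0 by simp
   thus ?thesis
    using chart_green[OF kf_smooth[OF Q kA] kf_pd[OF Q kA] kf_closed[OF Q kA] smooth_funD[OF f[OF k] kA] smooth_funD[OF G kA]]
    by simp
  qed
  finally show ?thesis .
 qed
 have "FI Q (%x. F x * lap Q G x - G x * lap Q F x)
   = FI Q (%x. SUM k:PC. f k x * lap Q G x - G x * lap Q (f k) x)"
 proof -
  have "F x * lap Q G x - G x * lap Q F x = (SUM k:PC. f k x * lap Q G x - G x * lap Q (f k) x)" for x
  proof -
   have "lap Q F x = (SUM k:PC. lap Q (f k) x)" by (subst F_sum) (rule lap_sum[OF Q f])
   moreover have "F x = (SUM k:PC. f k x)" using fun_cong[OF F_sum, of x] by simp
   ultimately show ?thesis by (simp add: sum_subtractf sum_distrib_right sum_distrib_left)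
  qed
  thus ?thesis by simp
 qed
 also have "... = 0" by (subst form_integral_sum[OF Q cont]) (simp_all add: loc0)
 finally have "FI Q (%x. F x * lap Q G x - G x * lap Q F x) = 0" .
 moreover have "continuous_on UNIV (%x. F x * lap Q G x)" "continuous_on UNIV (%x. G x * lap Q F x)"
  by (intro continuous_intros smooth_fun_continuous F G smooth_fun_lap[OF Q])+
 ultimately show ?thesis using form_integral_diff[OF Q] by simp
qed

lemma lap_const: "lap Q (%x. k) x = 0"
 by (simp add: lap_def Let_def levm_const tr_def trace_def matrix_matrix_mult_def)

lemma form_integral_lap: 
 assumes Q: "kf Q" and F: "smooth_fun A F"
 shows "FI Q (lap Q F) = 0"
 using green[OF Q smooth_fun_const[of 1] F] form_integral_cmult[of Q 0 "%_. 0"] by (simp add: lap_const)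

text \<open>Pointwise, \<open>2 * (G x * lap Q G x)\<close> is at most the Laplacian of the square
  of \<open>G\<close>, and that integrates to zero.\<close>

lemma dirichlet:
 assumes Q: "kf Q" and G: "smooth_fun A G"
 shows "FI Q (%x. G x * lap Q G x) <= 0"
proof -
 have G2: "smooth_fun A (%x. G x * G x)" by (intro smooth_fun_mult G)
 have "2 * (G x * lap Q G x) <= lap Q (%x. G x * G x) x" for x
 proof -
  obtain c where c: "c : A" "x : fst c" by (rule chart_at)
  have z: "snd c x : im c" and xe: "chart_inv c (snd c x) = x" using c chart_inv_snd by auto
  note S = open_image[OF c(1)] smooth_funD[OF G c(1)] z
  have pd: "pd (Q c (snd c x))" by (rule kf_pd[OF Q c(1) z])
  have "tr (Q c (snd c x)) ((2 * G x) *\<^sub>R levm (loc c G) (snd c x)) <= tr (Q c (snd c x)) (levm (loc c (%x. G x * G x)) (snd c x))"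
  proof (rule tr_mono[OF pd])
   fix v
   show "qf ((2 * G x) *\<^sub>R levm (loc c G) (snd c x)) v <= qf (levm (loc c (%x. G x * G x)) (snd c x)) v"
    using levi_square[OF S, of v] unfolding sesq_matrix_scaleR sesq_levm[OF S] sesq_levm[OF S(1) smooth_funD[OF G2 c(1)] S(3)]
    by (simp add: xe)
  qed
  thus ?thesis
   using lap_loc[OF Q G c(1) z] lap_loc[OF Q G2 c(1) z] by (simp add: xe tr_scaleR)
 qed
 hence "FI Q (%x. 2 * (G x * lap Q G x)) <= FI Q (lap Q (%x. G x * G x))"
  by (intro form_integral_mono[OF Q] continuous_intros smooth_fun_continuous G G2 smooth_fun_lap[OF Q])
 thus ?thesis using form_integral_lap[OF Q G2] form_integral_cmult[of Q 2] by simp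
qed

end

section \<open>Families of potentials\<close>

text \<open>Wirtinger derivatives in the point variable, expressed by real derivatives on the
  product with the parameter space. In this form the joint smoothness of complex Hessians follows
  from the calculus of \<open>dv\<close>.\<close>

definition wdp :: "complex^'n => ('p::euclidean_space \<times> (complex^'n::finite) => complex) => 'p \<times> (complex^'n) => complex" where
 "wdp v G q = (dv (0, v) G q - \<i> * dv (0, \<i> *s v) G q) / 2"

definition wdbp :: "complex^'n => ('p::euclidean_space \<times> (complex^'n::finite) => complex) => 'p \<times> (complex^'n) => complex" where
 "wdbp v G q = (dv (0, v) G q + \<i> * dv (0, \<i> *s v) G q) / 2"

lemma
 assumes "open S" "smooth_on S G"
 shows smooth_on_wdp: "smooth_on S (wdp v G)" and smooth_on_wdbp: "smooth_on S (wdbp v G)"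
 unfolding wdp_def[abs_def] wdbp_def[abs_def] divide_inverse
 by (intro smooth_intros smooth_on_dv assms)+

lemma
 assumes "open S" "smooth_on S G" "(p, z) : S"
 shows wd_slice: "wd v (%u. G (p, u)) z = wdp v G (p, z)" 
  and wdb_slice: "wdb v (%u. G (p, u)) z = wdbp v G (p, z)"
 by (simp_all add: wd_def wdb_def wdp_def wdbp_def dv_slice[OF assms])

lemma
 assumes "open S" "smooth_on S G" "q : S"
 shows dv_wdp: "dv (e, 0) (wdp v G) q = wdp v (dv (e, 0) G) q"
  and dv_wdbp: "dv (e, 0) (wdbp v G) q = wdbp v (dv (e, 0) G) q"
proof -
 have s: "smooth_on S (%q. \<i> * dv (0, \<i> *s v) G q)" "smooth_on S (dv (0, v) G)" "smooth_on S (dv (0, \<i> *s v) G)"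
  by (intro smooth_intros smooth_on_dv assms)+
 have c: "dv (e, 0) (%q. f q / 2) q = dv (e, 0) f q / 2" if "smooth_on S f" for f :: "_ => complex"
  by (rule dv_linear_comp[OF _ assms(1) that assms(3)])
    (rule bounded_linear_divide)
 note com = dv_commute[OF assms, of "(e, 0)"]
 show "dv (e, 0) (wdp v G) q = wdp v (dv (e, 0) G) q"
  unfolding wdp_def[abs_def]
  by (simp add: c[OF smooth_on_diff[OF assms(1) s(2,1)]] dv_diff[OF assms(1) s(2,1) assms(3)] dv_cmult[OF assms(1) s(3) assms(3)] com)
 show "dv (e, 0) (wdbp v G) q = wdbp v (dv (e, 0) G) q"
  unfolding wdbp_def[abs_def]
  by (simp add: c[OF smooth_on_add[OF assms(1) s(2,1)]] dv_add[OF assms(1) s(2,1) assms(3)] dv_cmult[OF assms(1) s(3) assms(3)] com)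
qed

lemma levm_slice_entry:
 fixes F :: "'p::euclidean_space \<times> (complex^'n::finite) => real"
 assumes S: "open S" and F: "smooth_on S F" and z: "(p, z) : S"
 shows "levm (%u. F (p, u)) z $ j $ k = wdp (axis j 1) (wdbp (axis k 1) (%q. complex_of_real (F q))) (p, z)"
proof -
 let ?G = "%q. complex_of_real (F q)"
 have G: "smooth_on S ?G" by (intro smooth_intros S F)
 have "levm (%u. F (p, u)) z $ j $ k = wd (axis j 1) (%u. wdbp (axis k 1) ?G (p, u)) z"
  unfolding levm_def vec_lambda_beta wirt_wd wirt_bar_wdb
  by (rule wd_cong_open[OF open_slice[OF S]]) (use z wdb_slice[OF S G] in auto)
 also have "... = wdp (axis j 1) (wdbp (axis k 1) ?G) (p, z)"
  by (rule wd_slice[OF S smooth_on_wdbp[OF S G] z])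
 finally show ?thesis .
qed

lemma smooth_on_levm_slice:
 fixes F :: "'p::euclidean_space \<times> (complex^'n::finite) => real"
 assumes S: "open S" and F: "smooth_on S F"
 shows "smooth_on S (%(p, z). levm (%u. F (p, u)) z)"
proof (rule smooth_on_matrix[OF S])
 fix j k
 have "smooth_on S (wdp (axis j 1) (wdbp (axis k 1) (%q. complex_of_real (F q))))"
  by (intro smooth_on_wdp smooth_on_wdbp smooth_intros S F)
 thus "smooth_on S (%q. (case q of (p, z) => levm (%u. F (p, u)) z) $ j $ k)"
  by (subst smooth_on_cong[where g="wdp (axis j 1) (wdbp (axis k 1) (%q. complex_of_real (F q)))"])
    (auto simp: levm_slice_entry[OF S F])
qed

text \<open>Mixed derivatives commute, so a parameter derivative passes through the complex
  Hessian.\<close>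

lemma dv_levm_slice:
 fixes F :: "'p::euclidean_space \<times> (complex^'n::finite) => real"
 assumes S: "open S" and F: "smooth_on S F" and z: "(p, z) : S"
 shows "dv (e, 0) (%(p, z). levm (%u. F (p, u)) z) (p, z) = levm (%u. dv (e, 0) F (p, u)) z"
proof -
 let ?G = "%q. complex_of_real (F q)" and ?L = "%(p, z). levm (%u. F (p, u)) z"
 have G: "smooth_on S ?G" by (intro smooth_intros S F)
 have wc: "wdp v f q = wdp v g q" if "!!q. q : S ==> f q = g q" "q : S" for f g :: "_ => complex" and v q
  unfolding wdp_def using dv_cong_open[OF S that(2,1)] by simp
 have wbc: "wdbp v f q = wdbp v g q" if "!!q. q : S ==> f q = g q" "q : S" for f g :: "_ => complex" and v q
  unfolding wdbp_def using dv_cong_open[OF S that(2,1)] by simp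
 have "dv (e, 0) ?L (p, z) $ j $ k = levm (%u. dv (e, 0) F (p, u)) z $ j $ k" for j k
 proof -
  have "dv (e, 0) ?L (p, z) $ j $ k = dv (e, 0) (%q. ?L q $ j $ k) (p, z)"
   by (rule dv_entry[OF S smooth_on_levm_slice[OF S F] z, symmetric])
  also have "... = dv (e, 0) (wdp (axis j 1) (wdbp (axis k 1) ?G)) (p, z)"
   by (rule dv_cong_open[OF S z]) (auto simp: levm_slice_entry[OF S F])
  also have "... = wdp (axis j 1) (dv (e, 0) (wdbp (axis k 1) ?G)) (p, z)"
   by (rule dv_wdp[OF S smooth_on_wdbp[OF S G] z])
  also have "... = wdp (axis j 1) (wdbp (axis k 1) (dv (e, 0) ?G)) (p, z)"
   by (rule wc[OF dv_wdbp[OF S G] z])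
  also have "... = wdp (axis j 1) (wdbp (axis k 1) (%q. complex_of_real (dv (e, 0) F q))) (p, z)"
   by (rule wc[OF wbc[OF dv_of_real[OF S F]] z])
  also have "... = levm (%u. dv (e, 0) F (p, u)) z $ j $ k"
   by (rule levm_slice_entry[OF S smooth_on_dv[OF S F] z, symmetric])
  finally show ?thesis .
 qed
 thus ?thesis by (simp add: vec_eq_iff)
qed

context cmanifold
begin

text \<open>Parameters range over an open set of a general Euclidean space because the energy
  argument needs both the time and the pair of a time and a position on a segment of
  potentials.\<close>

definition smooth_fam :: "'p::euclidean_space set => ('p => 'a => real) => bool" where
 "smooth_fam J F \<longleftrightarrow> open J & (ALL c:A. smooth_on (J \<times> im c) (%(p, z). loc c (F p) z))"

lemma famD: "smooth_fam J F ==> c : A ==> smooth_on (J \<times> im c) (%(p, z). loc c (F p) z)"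
 and fam_open: "smooth_fam J F ==> open J"
 by (auto simp: smooth_fam_def)

lemma open_prod: "open J ==> c : A ==> open (J \<times> im c)"
 by (intro open_Times open_image)

lemma fam_slice: 
 assumes "smooth_fam J F" "p : J" 
 shows "smooth_fun A (F p)"
 unfolding smooth_fun_loc
proof
 fix c assume c: "c : A"
 show "smooth_on (im c) (loc c (F p))"
  using smooth_on_slice[OF open_prod[OF fam_open[OF assms(1)] c] famD[OF assms(1) c], of p] assms(2) by simp
qed

lemma fam_compose:
 fixes g :: "'q::euclidean_space => 'p::euclidean_space"
 assumes "smooth_fam J F" "open I" "smooth_on I g" "g ` I \<subseteq> J"
 shows "smooth_fam I (%p. F (g p))"
 unfolding smooth_fam_def
proof (intro conjI ballI assms(2))
 fix c assume c: "c : A"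
 have "smooth_on (I \<times> im c) (%q. (g (fst q), 0) + (0, snd q))"
 proof (intro smooth_on_add open_prod assms c)
  show "smooth_on (I \<times> im c) (%q. (g (fst q), 0))"
   using open_prod[OF assms(2) c] assms(2-)
   by (intro smooth_on_linear[where L="%x. (x, 0)"] smooth_on_compose[OF _ assms(2) _ assms(3)] smooth_on_linear[where L=fst] smooth_intros)
     (auto intro: bounded_linear_intros bounded_linear_Pair bounded_linear_zero bounded_linear_ident bounded_linear_fst)
  show "smooth_on (I \<times> im c) (%q. (0, snd q))"
   using open_prod[OF assms(2) c]
   by (intro smooth_on_linear[where L="%x. (0, x)"] smooth_on_linear[where L=snd] smooth_intros)
     (auto intro: bounded_linear_Pair bounded_linear_zero bounded_linear_ident bounded_linear_snd)
 qed
 hence 1: "smooth_on (I \<times> im c) (%q. (g (fst q), snd q))" by simp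
 have "smooth_on (I \<times> im c) (%q. (%(p, z). loc c (F p) z) (g (fst q), snd q))"
  by (rule smooth_on_compose[OF open_prod[OF assms(2) c] open_prod[OF fam_open[OF assms(1)] c] 1 famD[OF assms(1) c]])
    (use assms in auto)
 thus "smooth_on (I \<times> im c) (%(p, z). loc c (F (g p)) z)" by (simp add: case_prod_unfold)
qed

lemma fam_fun:
 assumes "open J" "smooth_fun A f"
 shows "smooth_fam J (%p. f)"
 unfolding smooth_fam_def
proof (intro conjI ballI assms)
 fix c assume c: "c : A"
 have "smooth_on (J \<times> im c) (%q. loc c f (snd q))"
  by (rule smooth_on_compose[OF _ open_image[OF c] _ smooth_funD[OF assms(2) c]])
    (auto intro!: open_prod c assms smooth_on_linear[OF bounded_linear_snd] smooth_intros)
 thus "smooth_on (J \<times> im c) (%(p, z). loc c f z)" by (simp add: case_prod_unfold)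
qed

lemma fam_scalar:
 assumes "open J" "smooth_on J g"
 shows "smooth_fam J (%p x. g p)"
 unfolding smooth_fam_def
proof (intro conjI ballI assms)
 fix c assume c: "c : A"
 have "smooth_on (J \<times> im c) (%q. g (fst q))"
  by (rule smooth_on_compose[OF _ assms(1) _ assms(2)])
    (auto intro!: open_prod c assms smooth_on_linear[OF bounded_linear_fst] smooth_intros)
 thus "smooth_on (J \<times> im c) (%(p, z). g p)" by (simp add: case_prod_unfold)
qed

lemma
 assumes "smooth_fam J F" "smooth_fam J G"
 shows fam_add: "smooth_fam J (%p x. F p x + G p x)"
  and fam_diff: "smooth_fam J (%p x. F p x - G p x)"
  and fam_mult: "smooth_fam J (%p x. F p x * G p x)"
 using assms unfolding smooth_fam_def case_prod_unfold
 by (auto intro!: smooth_intros open_prod)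

lemma fam_deriv:
 assumes F: "smooth_fam J F" and d: "!!p x. p : J ==> ((%p. F p x) has_real_derivative F' p x) (at p)"
 shows "smooth_fam J F'"
  and "!!c p z. c : A ==> p : J ==> z : im c ==> dv (1, 0) (%(p, z). loc c (F p) z) (p, z) = loc c (F' p) z"
proof -
 show *: "dv (1, 0) (%(p, z). loc c (F p) z) (p, z) = loc c (F' p) z" if "c : A" "p : J" "z : im c" for c p z
 proof -
  have "((%p. loc c (F p) z) has_real_derivative dv (1, 0) (%(p, z). loc c (F p) z) (p, z)) (at p)"
   using dv_time_slice[OF open_prod[OF fam_open[OF F] that(1)] famD[OF F that(1)], of p z] that
   by (simp add: has_real_derivative_iff_has_vector_derivative)
  thus ?thesis using d[OF that(2)] by (rule DERIV_unique)
 qed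
 show "smooth_fam J F'" unfolding smooth_fam_def
 proof (intro conjI ballI fam_open[OF F])
  fix c assume c: "c : A"
  have "smooth_on (J \<times> im c) (dv (1, 0) (%(p, z). loc c (F p) z))"
   by (rule smooth_on_dv[OF open_prod[OF fam_open[OF F] c] famD[OF F c]])
  thus "smooth_on (J \<times> im c) (%(p, z). loc c (F' p) z)"
   by (subst smooth_on_cong[where g="dv (1, 0) (%(p, z). loc c (F p) z)"]) (auto simp: *[OF c])
 qed
qed

lemma fam_levm:
 assumes P: "smooth_fam J P" and c: "c : A"
 shows "smooth_on (J \<times> im c) (%(p, z). levm (loc c (P p)) z)"
 using smooth_on_levm_slice[OF open_prod[OF fam_open[OF P] c] famD[OF P c]] by simp

lemma fam_form:
 assumes Q: "kf Q" and P: "smooth_fam J P" and c: "c : A"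
 shows "smooth_on (J \<times> im c) (%(p, z). omega_pot Q (P p) c z)"
proof -
 have "smooth_on (J \<times> im c) (%q. Q c (snd q))"
  by (rule smooth_on_compose[OF _ open_image[OF c] _ kf_smooth[OF Q c]])
    (auto intro!: open_prod c fam_open[OF P] smooth_on_linear[OF bounded_linear_snd] smooth_intros)
 from smooth_on_add[OF open_prod[OF fam_open[OF P] c] this fam_levm[OF P c]]
 show ?thesis by (simp add: omega_pot_eq case_prod_unfold)
qed

lemma dv_fam_form:
 assumes Q: "kf Q" and P: "smooth_fam J P" and c: "c : A"
  and d: "!!p x. p : J ==> ((%p. P p x) has_real_derivative P' p x) (at p)"
  and p: "p : J" and z: "z : im c"
 shows "dv (1, 0) (%(p, z). omega_pot Q (P p) c z) (p, z) = levm (loc c (P' p)) z"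
proof -
 note S = open_prod[OF fam_open[OF P] c]
 have pz: "(p, z) : J \<times> im c" using p z by simp
 have k: "smooth_on (J \<times> im c) (%q. Q c (snd q))"
  by (rule smooth_on_compose[OF _ open_image[OF c] _ kf_smooth[OF Q c]])
    (auto intro!: S smooth_on_linear[OF bounded_linear_snd] smooth_intros)
 have "dv (1, 0) (%q. Q c (snd q)) (p, z) = dv (dv (1, 0) snd (p, z)) (Q c) (snd (p, z))"
  by (rule dv_compose[OF S open_image[OF c] _ kf_smooth[OF Q c]])
    (use z pz in \<open>auto intro!: S smooth_on_linear[OF bounded_linear_snd] smooth_intros\<close>)
 also have "dv (1, 0) snd (p, z) = (0 :: complex^'n)"
  using has_derivative_imp_dv[OF bounded_linear_imp_has_derivative[OF bounded_linear_snd], of "(1, 0)" "(p, z)"] by simp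
 also have "dv 0 (Q c) (snd (p, z)) = 0"
  using linear_0[OF bounded_linear.linear[OF dv_linear[OF open_image[OF c] kf_smooth[OF Q c] z]]] by simp
 finally have 0: "dv (1, 0) (%q. Q c (snd q)) (p, z) = 0" .
 have "dv (1, 0) (%(p, z). omega_pot Q (P p) c z) (p, z)
  = dv (1, 0) (%q. Q c (snd q)) (p, z) + dv (1, 0) (%(p, z). levm (loc c (P p)) z) (p, z)"
  using dv_add[OF S k fam_levm[OF P c] pz, of "(1, 0)"] by (simp add: omega_pot_eq case_prod_unfold)
 also have "dv (1, 0) (%(p, z). levm (loc c (P p)) z) (p, z) = levm (%u. dv (1, 0) (%(p, z). loc c (P p) z) (p, u)) z"
  using dv_levm_slice[OF S famD[OF P c] pz, of 1] by simp
 also have "... = levm (loc c (P' p)) z"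
  by (rule levm_cong_open[OF open_image[OF c] z]) (rule fam_deriv(2)[OF P d c p])
 finally show ?thesis using 0 by simp
qed

end

context cmanifold
begin

definition ks :: "('a, 'n) form11 => ('a => real) => bool" where
 "ks Q P \<longleftrightarrow> smooth_fun A P & (ALL c:A. ALL z:im c. pd (Q c z + levm (loc c P) z))"

lemma
 assumes "ks Q P"
 shows ks_smooth: "smooth_fun A P" 
  and ks_pd: "c : A ==> z : im c ==> pd (omega_pot Q P c z)"
  and ks_kf: "kf Q ==> kf (omega_pot Q P)"
 using assms kf_omega_pot by (auto simp: ks_def omega_pot_eq)

lemma ks_convex:
 assumes P: "ks \<kappa> P" and Q: "ks \<kappa> Q" and s: "0 <= s" "s <= 1"
 shows "ks \<kappa> (%x. P x + s * (Q x - P x))"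
 unfolding ks_def
proof (intro conjI ballI)
 have sPQ: "smooth_fun A (%x. s * (Q x - P x))"
  by (intro smooth_fun_mult smooth_fun_diff smooth_fun_const ks_smooth[OF P] ks_smooth[OF Q])
 show "smooth_fun A (%x. P x + s * (Q x - P x))"
  by (intro smooth_fun_add sPQ ks_smooth[OF P])
 fix c z assume c: "c : A" and z: "z : im c"
 note o = open_image[OF c] and p = smooth_funD[OF ks_smooth[OF P] c] and q = smooth_funD[OF ks_smooth[OF Q] c]
 have qp: "smooth_on (im c) (%z. loc c Q z - loc c P z)" by (intro smooth_intros o p q)
 have "levm (loc c (%x. P x + s * (Q x - P x))) z = levm (loc c P) z + s *\<^sub>R (levm (loc c Q) z - levm (loc c P) z)"
  using levm_add[OF o p smooth_funD[OF sPQ c] z] levm_scale[OF o qp z, of s] levm_diff[OF o q p z] by simp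
 hence "\<kappa> c z + levm (loc c (%x. P x + s * (Q x - P x))) z
   = (1 - s) *\<^sub>R omega_pot \<kappa> P c z + s *\<^sub>R omega_pot \<kappa> Q c z"
  by (simp add: omega_pot_eq algebra_simps)
 thus "pd (\<kappa> c z + levm (loc c (%x. P x + s * (Q x - P x))) z)"
  using pd_convex[OF ks_pd[OF P c z] ks_pd[OF Q c z] s] by simp
qed

text \<open>Positivity is available only for parameters in \<open>S\<close>, for instance a closed
  interval, while smoothness is a notion for open sets. The open set where the determinant does not
  vanish mediates between the two.\<close>

lemma fam_tr_continuous:
 assumes \<kappa>: "kf \<kappa>" and P: "smooth_fam J P" and h: "smooth_fam J h" and c: "c : A"
  and S: "S \<subseteq> J" "!!p. p : S ==> ks \<kappa> (P p)"
 shows "continuous_on (S \<times> im c) (%(p, z). tr (omega_pot \<kappa> (P p) c z) (levm (loc c (h p)) z))"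
proof -
 define H where "H q = omega_pot \<kappa> (P (fst q)) c (snd q)" for q
 define U where "U = {q : J \<times> im c. det (H q) ~= 0}"
 note JU = open_prod[OF fam_open[OF P] c]
 have H: "smooth_on (J \<times> im c) H"
  using fam_form[OF \<kappa> P c] by (simp add: H_def[abs_def] case_prod_unfold)
 have Q: "smooth_on (J \<times> im c) (%q. levm (loc c (h (fst q))) (snd q))"
  using fam_levm[OF h c] by (simp add: case_prod_unfold)
 have U: "open U"
 proof -
  have "open ((J \<times> im c) \<inter> (%q. det (H q)) -` (- {0}))"
   by (rule continuous_open_preimage[OF smooth_continuous[OF smooth_on_det[OF JU H]] JU]) auto
  thus ?thesis unfolding U_def by (rule back_subst[where P="open"]) auto
 qed
 have "smooth_on U (%q. tr (H q) (levm (loc c (h (fst q))) (snd q)))"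
  by (intro smooth_on_tr U smooth_on_subset[OF H U] smooth_on_subset[OF Q U]) (auto simp: U_def)
 moreover have "S \<times> im c \<subseteq> U"
  using S pd_det_nz[OF ks_pd[OF S(2) c]] by (auto simp: U_def H_def)
 ultimately show ?thesis
  using continuous_on_subset[OF smooth_continuous] by (simp add: H_def case_prod_unfold)
qed

lemma fam_integral_continuous:
 assumes Q: "kf Q" and P: "smooth_fam J P" and f: "smooth_fam J f" and g: "smooth_fam J g" and h: "smooth_fam J h"
  and S: "S \<subseteq> J" "!!p. p : S ==> ks Q (P p)"
 shows "continuous_on S (%p. FI (omega_pot Q (P p)) (%x. f p x + g p x * lap (omega_pot Q (P p)) (h p) x))"
  and "!!c. c : A ==> continuous_on (S \<times> im c) 
   (%(p, z). loc c (%x. f p x + g p x * lap (omega_pot Q (P p)) (h p) x) z * vol_density (omega_pot Q (P p)) c z)"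
proof -
 show *: "continuous_on (S \<times> im c) 
   (%(p, z). loc c (%x. f p x + g p x * lap (omega_pot Q (P p)) (h p) x) z * vol_density (omega_pot Q (P p)) c z)"
  if c: "c : A" for c
 proof -
  have sub: "S \<times> im c \<subseteq> J \<times> im c" using S by auto
  note JU = open_prod[OF fam_open[OF P] c]
  have cf: "continuous_on (S \<times> im c) (%q. loc c (F (fst q)) (snd q))" if "smooth_fam J F" for F
   using continuous_on_subset[OF smooth_continuous[OF famD[OF that c]] sub] by (simp add: case_prod_unfold)
  have ct: "continuous_on (S \<times> im c) (%q. tr (omega_pot Q (P (fst q)) c (snd q)) (levm (loc c (h (fst q))) (snd q)))"
   using fam_tr_continuous[OF Q P h c S] by (simp add: case_prod_unfold)
  have cd: "continuous_on (S \<times> im c) (%q. Re (det (omega_pot Q (P (fst q)) c (snd q))))"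
   using continuous_on_subset[OF smooth_continuous[OF smooth_on_Re[OF JU smooth_on_det[OF JU fam_form[OF Q P c]]]] sub]
   by (simp add: case_prod_unfold)
  have "continuous_on (S \<times> im c) (%q. (loc c (f (fst q)) (snd q) + loc c (g (fst q)) (snd q) *
    tr (omega_pot Q (P (fst q)) c (snd q)) (levm (loc c (h (fst q))) (snd q))) *
    (fact CARD('n) * 2 ^ CARD('n) * Re (det (omega_pot Q (P (fst q)) c (snd q)))))"
   by (intro continuous_intros cf f g ct cd)
  thus ?thesis
  proof (rule continuous_on_eq)
   fix q assume q: "q : S \<times> im c"
   hence "loc c (lap (omega_pot Q (P (fst q))) (h (fst q))) (snd q) = tr (omega_pot Q (P (fst q)) c (snd q)) (levm (loc c (h (fst q))) (snd q))"
    using S by (intro lap_loc ks_kf[OF S(2) Q] fam_slice[OF h] c) auto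
   thus "(loc c (f (fst q)) (snd q) + loc c (g (fst q)) (snd q) *
    tr (omega_pot Q (P (fst q)) c (snd q)) (levm (loc c (h (fst q))) (snd q))) *
    (fact CARD('n) * 2 ^ CARD('n) * Re (det (omega_pot Q (P (fst q)) c (snd q))))
    = (case q of (p, z) => loc c (%x. f p x + g p x * lap (omega_pot Q (P p)) (h p) x) z * vol_density (omega_pot Q (P p)) c z)"
    by (simp add: case_prod_unfold vol_density_def)
  qed
 qed
 show "continuous_on S (%p. FI (omega_pot Q (P p)) (%x. f p x + g p x * lap (omega_pot Q (P p)) (h p) x))"
  by (rule form_integral_param_continuous) (rule *)
qed

text \<open>By Jacobi's formula the Monge-Ampere density changes by the Laplacian of the derivative
  of the potential. Taking the derivative within \<open>S\<close> covers the ends of a segment of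
  potentials.\<close>

theorem variation:
 assumes Q: "kf Q" and P: "smooth_fam J P" and f: "smooth_fam J f"
  and P': "!!p x. p : J ==> ((%p. P p x) has_real_derivative P' p x) (at p)"
  and f': "!!p x. p : J ==> ((%p. f p x) has_real_derivative f' p x) (at p)"
  and S: "S \<subseteq> J" "!!p. p : S ==> ks Q (P p)" "convex S" "p : S"
 shows "((%p. FI (omega_pot Q (P p)) (f p)) has_real_derivative
  FI (omega_pot Q (P p)) (%x. f' p x + f p x * lap (omega_pot Q (P p)) (P' p) x)) (at p within S)"
proof (rule form_integral_param_derivative[OF _ _ _ S(3,4)])
 have o: "open J" by (rule fam_open[OF P])
 have P's: "smooth_fam J P'" and f's: "smooth_fam J f'" using fam_deriv(1) P P' f f' by blast+
 show "continuous_on (S \<times> im c) (%(p, z). loc c (%x. f' p x + f p x * lap (omega_pot Q (P p)) (P' p) x) z * vol_density (omega_pot Q (P p)) c z)"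
  if "c : A" for c
  by (rule fam_integral_continuous(2)[OF Q P f's f P's S(1,2) that])
 fix c p assume c: "c : A" and p: "p : S"
 have pJ: "p : J" using p S by auto
 have kp: "kf (omega_pot Q (P p))" by (rule ks_kf[OF S(2)[OF p] Q])
 show "continuous_on (im c) (%z. loc c (f p) z * vol_density (omega_pot Q (P p)) c z)"
  by (intro continuous_on_mult smooth_continuous[OF smooth_vol_density[OF kp c]]
   smooth_continuous[OF smooth_funD[OF fam_slice[OF f pJ] c]])
 fix z assume z: "z : im c"
 let ?H = "%(p, z). omega_pot Q (P p) c z"
 note JU = open_prod[OF o c] and Hs = fam_form[OF Q P c]
 have pz: "(p, z) : J \<times> im c" using pJ z by auto
 have pd: "pd (?H (p, z))" using ks_pd[OF S(2)[OF p] c z] by simp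
 have "((%p. det (?H (p, z))) has_vector_derivative dv (1, 0) (%q. det (?H q)) (p, z)) (at p)"
  by (rule dv_time_slice[OF JU smooth_on_det[OF JU Hs] pz])
 also have "dv (1, 0) (%q. det (?H q)) (p, z) = det (?H (p, z)) * trace (matrix_inv (?H (p, z)) ** levm (loc c (P' p)) z)"
  using dv_det[OF JU Hs pz pd_det_nz[OF pd], of "(1, 0)"] dv_fam_form[OF Q P c P' pJ z] by simp
 also have "trace (matrix_inv (?H (p, z)) ** levm (loc c (P' p)) z) = of_real (tr (?H (p, z)) (levm (loc c (P' p)) z))"
  by (rule trace_inv_real[OF pd herm_levm[OF open_image[OF c] smooth_funD[OF fam_slice[OF P's pJ] c] z]])
 finally have "((%p. Re (det (?H (p, z)))) has_vector_derivative Re (det (?H (p, z)) * of_real (tr (?H (p, z)) (levm (loc c (P' p)) z)))) (at p)"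
  by (rule bounded_linear.has_vector_derivative[OF bounded_linear_Re])
 hence "((%p. Re (det (?H (p, z)))) has_real_derivative Re (det (?H (p, z))) * tr (?H (p, z)) (levm (loc c (P' p)) z)) (at p)"
  by (simp add: has_real_derivative_iff_has_vector_derivative)
 hence v: "((%p. vol_density (omega_pot Q (P p)) c z) has_real_derivative 
   fact CARD('n) * 2 ^ CARD('n) * (Re (det (?H (p, z))) * tr (?H (p, z)) (levm (loc c (P' p)) z))) (at p)"
  unfolding vol_density_def by (simp add: DERIV_cmult)
 have "((%p. loc c (f p) z * vol_density (omega_pot Q (P p)) c z) has_real_derivative
   loc c (f' p) z * vol_density (omega_pot Q (P p)) c z + 
   fact CARD('n) * 2 ^ CARD('n) * (Re (det (?H (p, z))) * tr (?H (p, z)) (levm (loc c (P' p)) z)) * loc c (f p) z) (at p)"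
  by (rule DERIV_mult[OF f'[OF pJ] v])
 also have "loc c (f' p) z * vol_density (omega_pot Q (P p)) c z + 
   fact CARD('n) * 2 ^ CARD('n) * (Re (det (?H (p, z))) * tr (?H (p, z)) (levm (loc c (P' p)) z)) * loc c (f p) z
   = loc c (%x. f' p x + f p x * lap (omega_pot Q (P p)) (P' p) x) z * vol_density (omega_pot Q (P p)) c z"
  by (simp add: lap_loc[OF kp fam_slice[OF P's pJ] c z] vol_density_def algebra_simps)
 finally show "((%p. loc c (f p) z * vol_density (omega_pot Q (P p)) c z) has_real_derivative
  loc c (%x. f' p x + f p x * lap (omega_pot Q (P p)) (P' p) x) z * vol_density (omega_pot Q (P p)) c z) (at p within S)"
  by (rule has_field_derivative_at_within)
qed

text \<open>\<open>a t s\<close> is the derivative of the Monge-Ampere energy along the segment from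
  \<open>\<psi>\<close> to \<open>\<eta> t\<close>, so its integral \<open>E t\<close> is the energy
  difference of the two. The normalisation makes \<open>E\<close> constant in time; at time 1 it is
  nonnegative because \<open>\<psi> <= 0 = \<eta> 1\<close>; and by concavity it is at most the
  initial slope \<open>a t 0\<close>.\<close>

theorem energy_inequality:
 assumes Q: "kf Q" and \<eta>: "smooth_fam {0<..} \<eta>" and ks\<eta>: "!!t. t > 0 ==> ks Q (\<eta> t)"
  and \<eta>': "!!t x. t > 0 ==> ((%t. \<eta> t x) has_real_derivative \<eta>' t x) (at t)"
  and norm: "!!t. t > 0 ==> FI (omega_pot Q (\<eta> t)) (\<eta>' t) = 0"
  and \<eta>1: "!!x. \<eta> 1 x = 0" and \<psi>: "ks Q \<psi>" and \<psi>0: "!!x. \<psi> x <= 0" and t: "t > 0"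
 shows "FI (omega_pot Q \<psi>) \<psi> <= FI (omega_pot Q \<psi>) (\<eta> t)"
proof -
 define P where "P t s x = \<psi> x + s * (\<eta> t x - \<psi> x)" for t s x
 define a where "a t s = FI (omega_pot Q (P t s)) (%x. \<eta> t x - \<psi> x)" for t s
 define b where "b t s = FI (omega_pot Q (P t s)) (%x. s * \<eta>' t x)" for t s
 define D where "D t s = FI (omega_pot Q (P t s)) (%x. \<eta>' t x + (\<eta> t x - \<psi> x) * lap (omega_pot Q (P t s)) (%x. s * \<eta>' t x) x)" for t s
 have \<psi>s: "smooth_fun A \<psi>" by (rule ks_smooth[OF \<psi>])
 have \<eta>s: "smooth_fun A (\<eta> t)" if "t > 0" for t using ks_smooth[OF ks\<eta>[OF that]] .
 have \<eta>'f: "smooth_fam {0<..} \<eta>'" by (rule fam_deriv(1)[OF \<eta>]) (use \<eta>' in auto)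
 have \<eta>'s: "smooth_fun A (\<eta>' t)" if "t > 0" for t using fam_slice[OF \<eta>'f] that by simp
 have ksP: "ks Q (P t s)" if "t > 0" "0 <= s" "s <= 1" for t s
  unfolding P_def[abs_def] by (rule ks_convex[OF \<psi> ks\<eta>[OF that(1)] that(2,3)])
 have oU: "open (UNIV :: real set)" "open ({0<..} :: real set)" by auto
 have Pt: "smooth_fam UNIV (P t)" if "t > 0" for t
  unfolding P_def[abs_def] by (intro fam_add fam_mult fam_diff fam_fun fam_scalar oU smooth_intros \<psi>s \<eta>s that)
 have at: "((%s. a t s) has_real_derivative FI (omega_pot Q (P t s)) 
   (%x. 0 + (\<eta> t x - \<psi> x) * lap (omega_pot Q (P t s)) (%x. \<eta> t x - \<psi> x) x)) (at s within {0..1})"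
  if "t > 0" "s : {0..1}" for t s
  unfolding a_def[abs_def]
  by (rule variation[OF Q Pt[OF that(1)], where f="%_ x. \<eta> t x - \<psi> x" and f'="%_ x. 0" and P'="%_ x. \<eta> t x - \<psi> x"])
    (use that ksP in \<open>auto intro!: fam_fun smooth_fun_diff \<psi>s \<eta>s derivative_eq_intros simp: P_def\<close>)
 have ca: "continuous_on {0..1} (a t)" if "t > 0" for t
  by (rule DERIV_continuous_on, rule at[OF that])
 \<comment> \<open>Concavity of the energy: the derivative of the slope along the segment is an
   integral that \<open>dirichlet\<close> shows to be nonpositive.\<close>
 have at0: "a t s <= a t 0" if "t > 0" "s : {0..1}" for t s
 proof (rule DERIV_nonpos_imp_decreasing_open[of 0 s "a t"])
  show "0 <= s" using that by simp
  show "continuous_on {0..s} (a t)"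
   by (rule continuous_on_subset[OF ca]) (use that in auto)
  show "EX y. (a t has_real_derivative y) (at x) & y <= 0" if x: "0 < x" "x < s" for x
  proof (intro exI conjI)
   have x1: "x : {0..1}" "x : interior {0..1}" using x \<open>s : {0..1}\<close> by auto
   show "(a t has_real_derivative FI (omega_pot Q (P t x)) 
     (%y. 0 + (\<eta> t y - \<psi> y) * lap (omega_pot Q (P t x)) (%x. \<eta> t x - \<psi> x) y)) (at x)"
    using at[OF \<open>t > 0\<close> x1(1)] unfolding at_within_interior[OF x1(2)] .
   show "FI (omega_pot Q (P t x)) (%y. 0 + (\<eta> t y - \<psi> y) * lap (omega_pot Q (P t x)) (%x. \<eta> t x - \<psi> x) y) <= 0"
    using dirichlet[OF ks_kf[OF ksP Q] smooth_fun_diff[OF \<eta>s \<psi>s], of t x] that x1 \<open>t > 0\<close> by simp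
  qed
 qed
 have bt: "((%s. b t s) has_real_derivative D t s) (at s within {0..1})" if "t > 0" "s : {0..1}" for t s
 proof -
  have k: "kf (omega_pot Q (P t s))" using ks_kf[OF ksP Q] that by simp
  have "((%s. b t s) has_real_derivative FI (omega_pot Q (P t s)) 
   (%x. \<eta>' t x + s * \<eta>' t x * lap (omega_pot Q (P t s)) (%x. \<eta> t x - \<psi> x) x)) (at s within {0..1})"
   unfolding b_def[abs_def]
   by (rule variation[OF Q Pt[OF that(1)], where f="%s x. s * \<eta>' t x" and f'="%_. \<eta>' t" and P'="%_ x. \<eta> t x - \<psi> x"])
     (use that ksP in \<open>auto intro!: fam_fun fam_mult fam_scalar smooth_fun_diff smooth_intros \<psi>s \<eta>s \<eta>'s derivative_eq_intros simp: P_def\<close>)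
  \<comment> \<open>Green's formula identifies the derivative of \<open>b\<close> in
    \<open>s\<close> with that of \<open>a\<close> in \<open>t\<close>. This is the closedness of
    the one-form on potentials whose primitive is the energy.\<close>
  also have "FI (omega_pot Q (P t s)) 
   (%x. \<eta>' t x + s * \<eta>' t x * lap (omega_pot Q (P t s)) (%x. \<eta> t x - \<psi> x) x) = D t s"
  proof -
   have s1: "smooth_fun A (%x. s * \<eta>' t x)" and s2: "smooth_fun A (%x. \<eta> t x - \<psi> x)" 
    using that by (auto intro!: smooth_fun_mult smooth_fun_diff smooth_fun_const \<eta>s \<psi>s \<eta>'s)
   have c: "continuous_on UNIV (%x. s * \<eta>' t x * lap (omega_pot Q (P t s)) (%x. \<eta> t x - \<psi> x) x)"
    "continuous_on UNIV (%x. (\<eta> t x - \<psi> x) * lap (omega_pot Q (P t s)) (%x. s * \<eta>' t x) x)"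
    "continuous_on UNIV (\<eta>' t)"
    by (intro smooth_fun_continuous smooth_fun_mult[OF s1 smooth_fun_lap[OF k s2]] smooth_fun_mult[OF s2 smooth_fun_lap[OF k s1]] \<eta>'s that)+
   show ?thesis unfolding D_def
    by (simp only: form_integral_add[OF k c(3,1)] form_integral_add[OF k c(3,2)] green[OF k s1 s2])
  qed
  finally show ?thesis .
 qed
 have as: "((%t. a t s) has_real_derivative D t s) (at t within {0<..})" if "t > 0" "s : {0..1}" for t s
  unfolding a_def[abs_def] D_def
  by (rule variation[OF Q, where J="{0<..}" and P="%t. P t s" and f="%t x. \<eta> t x - \<psi> x" and f'=\<eta>' and P'="%t x. s * \<eta>' t x"])
    (use that ksP in \<open>auto intro!: fam_fun fam_add fam_diff fam_mult fam_scalar smooth_intros \<eta> \<psi>s \<eta>' derivative_eq_intros simp: P_def[abs_def]\<close>)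
 have oJ: "open ({0<..} \<times> UNIV :: (real \<times> real) set)" by (intro open_Times oU)
 have fst_fam: "smooth_fam ({0<..} \<times> UNIV) (%p :: real \<times> real. F (fst p))" if "smooth_fam {0<..} F" for F
  by (rule fam_compose[OF that oJ]) (auto intro!: smooth_on_linear[OF bounded_linear_fst] smooth_intros oJ)
 have snd_fam: "smooth_fam ({0<..} \<times> UNIV) (%(p :: real \<times> real) x. snd p)"
  by (rule fam_scalar[OF oJ]) (auto intro!: smooth_on_linear[OF bounded_linear_snd] smooth_intros oJ)
 have cD: "continuous_on ({0<..} \<times> {0..1}) (%(t, s). D t s)"
 proof -
  have "continuous_on ({0<..} \<times> {0..1}) (%p. FI (omega_pot Q ((%p. P (fst p) (snd p)) p))
   (%x. (%p. \<eta>' (fst p)) p x + (%p x. \<eta> (fst p) x - \<psi> x) p x * lap (omega_pot Q ((%p. P (fst p) (snd p)) p)) ((%p x. snd p * \<eta>' (fst p) x) p) x))"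
  proof (rule fam_integral_continuous(1)[OF Q])
   show "smooth_fam ({0<..} \<times> UNIV) (%p. P (fst p) (snd p))"
    unfolding P_def[abs_def] by (intro fam_add fam_mult fam_diff fam_fun[OF oJ \<psi>s] fst_fam[OF \<eta>] snd_fam)
   show "smooth_fam ({0<..} \<times> UNIV) (%p :: real \<times> real. \<eta>' (fst p))" by (rule fst_fam[OF \<eta>'f])
   show "smooth_fam ({0<..} \<times> UNIV) (%(p :: real \<times> real) x. \<eta> (fst p) x - \<psi> x)" by (intro fam_diff fst_fam[OF \<eta>] fam_fun[OF oJ \<psi>s])
   show "smooth_fam ({0<..} \<times> UNIV) (%p x. snd p * \<eta>' (fst p) x)" by (intro fam_mult snd_fam fst_fam[OF \<eta>'f])
  qed (use ksP in auto)
  thus ?thesis by (simp add: D_def case_prod_unfold)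
 qed
 define E where "E t = integral {0..1} (a t)" for t
 have ai: "a t integrable_on {0..1}" if "t > 0" for t
  by (rule integrable_continuous_interval[OF ca[OF that]])
 have "(E has_real_derivative 0) (at t within {0<..})" if t: "t : {0<..}" for t
 proof -
  have "((%t. integral (cbox 0 1) (a t)) has_real_derivative integral (cbox 0 1) (D t)) (at t within {0<..})"
   by (rule leibniz_rule_field_derivative) (use as ai cD t in auto)
  moreover have "(D t has_integral b t 1 - b t 0) {0..1}"
   by (rule fundamental_theorem_of_calculus) 
     (use bt t in \<open>auto simp: has_real_derivative_iff_has_vector_derivative[symmetric]\<close>)
  \<comment> \<open>At \<open>s = 1\<close> the segment has reached \<open>\<eta> t\<close>, where
    the normalisation of the flow makes the integral vanish: the energy is conserved.\<close>
  moreover have "b t 1 = 0" using norm[of t] t by (simp add: b_def P_def[abs_def])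
  moreover have "b t 0 = 0" using form_integral_cmult[of "omega_pot Q (P t 0)" 0 "\<eta>' t"] by (simp add: b_def)
  ultimately show ?thesis unfolding E_def by (simp add: integral_unique)
 qed
 then obtain e where e: "!!t. t > 0 ==> E t = e"
  using has_field_derivative_zero_constant[of "{0<..}" E] by auto
 have "0 <= E 1" unfolding E_def
 proof (rule integral_nonneg[OF ai])
  fix s :: real assume s: "s : {0..1}"
  have k: "kf (omega_pot Q (P 1 s))" using ks_kf[OF ksP Q] s by simp
  have "FI (omega_pot Q (P 1 s)) (%x. 0 * 1) <= a 1 s" unfolding a_def[abs_def]
   by (rule form_integral_mono[OF k _ smooth_fun_continuous[OF smooth_fun_diff[OF \<eta>s \<psi>s]]]) (simp_all add: \<eta>1 \<psi>0)
  thus "0 <= a 1 s" unfolding form_integral_cmult by simp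
 qed simp
 also have "E 1 = E t" using e t by simp
 also have "E t <= integral {0..1} (%s::real. a t 0)"
  unfolding E_def by (rule integral_le[OF ai[OF t]]) (use at0[OF t] in auto)
 also have "... = a t 0" by simp
 also have "a t 0 = FI (omega_pot Q \<psi>) (\<eta> t) - FI (omega_pot Q \<psi>) \<psi>"
  unfolding a_def P_def[abs_def]
  using form_integral_diff[OF ks_kf[OF \<psi> Q] smooth_fun_continuous[OF \<eta>s[OF t]] smooth_fun_continuous[OF \<psi>s]] by simp
 finally show ?thesis by simp
qed

end

section \<open>Maximum principles along the flow\<close>

lemma continuous_on_sesq2:
 "continuous_on S H ==> continuous_on S v ==> continuous_on S (%q. qf (H q :: complex^'n::finite^'n) (v q))"
 unfolding sesq_def by (intro continuous_intros)

lemma sesq_matrix_minus: "sesq (- A) v w = - sesq A v w"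
 by (simp add: sesq_def sum_negf)

lemma sesq_normalize:
 fixes v :: "complex^'n::finite"
 assumes "v ~= 0"
 defines "e \<equiv> of_real (1 / norm v) *s v"
 shows "norm e = 1" "qf A v = (norm v)^2 * qf A e"
proof -
 show "norm e = 1" unfolding e_def norm_complex_scale using assms by (simp add: norm_divide)
 have "v = of_real (norm v) *s e" unfolding e_def vector_smult_assoc using assms by simp
 hence "sesq A v v = sesq A (of_real (norm v) *s e) (of_real (norm v) *s e)" by simp
 also have "... = of_real ((norm v)^2) * sesq A e e"
  by (simp add: sesq_scale1 sesq_scale2 power2_eq_square)
 finally show "qf A v = (norm v)^2 * qf A e" by (simp only: Re_complex_of_real_mult)
qed

text \<open>By homogeneity only unit vectors matter, and the quotient of the two forms is continuous
  on the compact product of \<open>K\<close> with the unit sphere.\<close>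

lemma form_bound:
 fixes K :: "'p::topological_space set" and P Q :: "'p => complex^'n::finite^'n"
 assumes K: "compact K" and c: "continuous_on K P" "continuous_on K Q" and pd: "!!q. q : K ==> pd (P q)"
 obtains C where "C > 0" "!!q e. q : K ==> qf (Q q) e <= C * qf (P q) e"
proof -
 define g where "g x = qf (Q (fst x)) (snd x) / qf (P (fst x)) (snd x)" for x
 have pos: "0 < qf (P q) e" if "q : K" "e ~= 0" for q e
  using pd[OF that(1)] that(2) by (simp add: pd_def)
 have "continuous_on (K \<times> sphere 0 1) g" unfolding g_def[abs_def]
 proof (rule continuous_on_divide)
  have cPQ: "continuous_on (K \<times> sphere 0 1) (%x. P (fst x))" "continuous_on (K \<times> sphere 0 1) (%x. Q (fst x))"
   by (auto intro!: continuous_on_compose2[OF c(1)] continuous_on_compose2[OF c(2)] continuous_intros)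
  show "continuous_on (K \<times> sphere 0 1) (%x. qf (Q (fst x)) (snd x))"
   "continuous_on (K \<times> sphere 0 1) (%x. qf (P (fst x)) (snd x))"
   by (rule continuous_on_sesq2[OF cPQ(2) continuous_on_snd[OF continuous_on_id]],
     rule continuous_on_sesq2[OF cPQ(1) continuous_on_snd[OF continuous_on_id]])
  show "ALL x:K \<times> sphere 0 1. qf (P (fst x)) (snd x) ~= 0"
  proof
   fix x assume "x : K \<times> sphere (0 :: complex^'n) 1"
   hence "fst x : K" "snd x ~= 0" by auto
   from pos[OF this] show "qf (P (fst x)) (snd x) ~= 0" by simp
  qed
 qed
 hence "compact (g ` (K \<times> sphere 0 1))" by (rule compact_continuous_image) (intro compact_Times K compact_sphere)
 then obtain C where C: "C > 0" "ALL y:g ` (K \<times> sphere 0 1). norm y <= C" 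
  using compact_imp_bounded bounded_pos by metis
 show ?thesis
 proof
  show "C > 0" by (rule C)
  fix q e assume q: "q : K"
  show "qf (Q q) e <= C * qf (P q) e"
  proof (cases "e = 0")
   case False
   define e' where "e' = of_real (1 / norm e) *s e"
   note N = sesq_normalize[OF False, folded e'_def]
   have "g (q, e') <= C" using C(2)[rule_format, of "g (q, e')"] q N(1) by auto
   moreover have "e' ~= 0" using N(1) by auto
   ultimately have "qf (Q q) e' <= C * qf (P q) e'"
    using pos[OF q] by (simp add: g_def pos_divide_le_eq)
   hence "(norm e)^2 * qf (Q q) e' <= (norm e)^2 * (C * qf (P q) e')"
    by (rule mult_left_mono) simp
   thus ?thesis unfolding N(2)[of "Q q"] N(2)[of "P q"] by (simp add: mult_ac)
  qed simp
 qed
qed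

lemma levi_exp:
 fixes g :: "complex^'n::finite => real"
 assumes S: "open S" and g: "smooth_on S g" and z: "z : S"
 shows "exp (g z) * Re (levi g z v v) <= Re (levi (%u. exp (g u)) z v v)"
 by (subst levi_compose[OF S g z open_UNIV, where f=exp and ?f1.0=exp and ?f2.0=exp])
  (auto intro!: smooth_intros)

text \<open>The comparison stops at \<open>t0\<close> because a space-time maximum may be attained
  at the final time of the interval.\<close>

lemma deriv_nonneg_at_right_max:
 fixes f :: "real => real"
 assumes d: "(f has_real_derivative l) (at t0)" and a: "a < t0" and max: "!!t. a <= t ==> t <= t0 ==> f t <= f t0"
 shows "0 <= l"
proof (rule ccontr)
 assume "\<not> 0 <= l"
 then obtain e where e: "e > 0" "!!h. 0 < h ==> h < e ==> f t0 < f (t0 - h)"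
  using DERIV_neg_dec_left[OF d] by auto
 define h where "h = min (e / 2) (t0 - a)"
 have "0 < h" "h < e" "a <= t0 - h" using e(1) a by (auto simp: h_def)
 thus False using e(2)[of h] max[of "t0 - h"] by auto
qed

context cmanifold
begin

lemma fam_continuous:
 assumes F: "smooth_fam J F"
 shows "continuous_on (J \<times> UNIV) (%(p, x). F p x)"
proof -
 note J = fam_open[OF F]
 have "isCont (%(p, x). F p x) q" if q: "q : J \<times> UNIV" for q
 proof -
  obtain c where c: "c : A" "snd q : fst c" by (rule chart_at)
  have "continuous_on (J \<times> fst c) (%q. (%(p, z). loc c (F p) z) (fst q, snd c (snd q)))"
   by (rule continuous_on_compose2[OF smooth_continuous[OF famD[OF F c(1)]]])
     (auto intro!: continuous_intros continuous_on_compose2[OF cont_chart[OF c(1)]])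
  hence "continuous_on (J \<times> fst c) (%(p, x). F p x)"
   by (rule continuous_on_eq) (auto simp: chart_inv_snd[OF c(1)])
  moreover have "open (J \<times> fst c)" by (intro open_Times J open_chart[OF c(1)])
  moreover have "q : J \<times> fst c" using q c by (cases q) auto
  ultimately show ?thesis using continuous_on_eq_continuous_at by blast
 qed
 thus ?thesis by (simp add: continuous_at_imp_continuous_on)
qed

lemma fam_attains_max:
 assumes F: "smooth_fam J F" and S: "compact S" "S ~= {}" "S \<subseteq> J"
 obtains p x where "p : S" "!!q y. q : S ==> F q y <= F p x"
proof -
 have "compact (S \<times> (UNIV :: 'a set))" by (intro compact_Times S compact_X)
 moreover have "S \<times> (UNIV :: 'a set) ~= {}" using S by auto
 moreover have "continuous_on (S \<times> UNIV) (%(p, x). F p x)"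
  by (rule continuous_on_subset[OF fam_continuous[OF F]]) (use S in auto)
 ultimately obtain q where "q : S \<times> UNIV" "ALL y:S \<times> UNIV. (%(p, x). F p x) y <= (%(p, x). F p x) q"
  using continuous_attains_sup by blast
 thus ?thesis using that[of "fst q" "snd q"] by (auto simp: case_prod_unfold)
qed

lemma smooth_fun_bounded:
 assumes "smooth_fun A f"
 obtains C where "C > 0" "!!x. \<bar>f x\<bar> <= C"
proof -
 have "compact (f ` UNIV)" by (rule compact_continuous_image[OF smooth_fun_continuous[OF assms] compact_X])
 thus ?thesis using that compact_imp_bounded[of "range f"] unfolding bounded_pos by auto
qed

lemma levm_at_max:
 assumes F: "smooth_fun A F" and max: "!!y. F y <= F x" and c: "c : A" "x : fst c"
 shows "qf (levm (loc c F) (snd c x)) v <= 0"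
proof -
 have z: "snd c x : im c" using c by auto
 show ?thesis
  unfolding sesq_levm[OF open_image[OF c(1)] smooth_funD[OF F c(1)] z]
  by (rule levi_nonpos_at_max[OF open_image[OF c(1)] smooth_funD[OF F c(1)] z]) 
    (use max c in \<open>simp add: chart_inv_snd\<close>)
qed

text \<open>A maximum over space and \<open>[1,t]\<close> that is attained after time 1 would be a
  spatial maximum with nonnegative time derivative, against \<open>neg\<close>. The constant is the
  maximum at time 1.\<close>

theorem max_principle:
 assumes Y: "smooth_fam {0<..} Y" and d: "!!t x. t > 0 ==> ((%t. Y t x) has_real_derivative Y' t x) (at t)"
  and neg: "!!t x. t > 1 ==> (!!y. Y t y <= Y t x) ==> Y' t x < 0"
 obtains C where "!!t x. 1 <= t ==> Y t x <= C"
proof -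
 obtain p x1 where "p : {1}" "!!q y. q : {1} ==> Y q y <= Y p x1"
  by (rule fam_attains_max[OF Y, of "{1}"]) auto
 hence x1: "Y 1 y <= Y 1 x1" for y by auto
 have "Y t x <= Y 1 x1" if t: "1 <= t" for t x
 proof -
  obtain t0 x0 where m: "t0 : {1..t}" "!!s y. s : {1..t} ==> Y s y <= Y t0 x0"
   by (rule fam_attains_max[OF Y, of "{1..t}"]) (use t in auto)
  have "t0 = 1"
  proof (rule ccontr)
   assume "t0 ~= 1"
   hence t0: "t0 > 1" using m by auto
   have "0 <= Y' t0 x0"
    by (rule deriv_nonneg_at_right_max[OF d t0]) (use t0 m in auto)
   moreover have "Y' t0 x0 < 0" by (rule neg[OF t0]) (use m in auto)
   ultimately show False by simp
  qed
  thus ?thesis using m(2)[of t x] x1[of x0] t by auto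
 qed
 thus ?thesis by (rule that)
qed

text \<open>\<open>log(\<omega>^n/Q^n)\<close>, which does not depend on the chart.\<close>

definition ldr :: "('a, 'n) form11 => ('a, 'n) form11 => 'a => real" where
 "ldr Q \<omega> x = (let c = (SOME c. c : A & x : fst c) in lndet (\<omega> c) (snd c x) - lndet (Q c) (snd c x))"

lemma ldr_loc:
 assumes Q: "kf Q" and \<omega>: "kf \<omega>" and c: "c : A" and z: "z : im c"
 shows "loc c (ldr Q \<omega>) z = lndet (\<omega> c) z - lndet (Q c) z"
proof -
 define x where "x = chart_inv c z"
 define k where "k = (SOME c. c : A & x : fst c)"
 have "EX c. c : A & x : fst c" using chart_at by metis
 from someI_ex[OF this] have k: "k : A" "x : fst k" by (auto simp: k_def)
 have zo: "z : ov c k" using ov_iff[OF c] z k(2) by (simp add: x_def)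
 have T: "transition c k z = snd k x" by (simp add: transition_def x_def)
 have kx: "snd k x : im k" using k by auto
 have J: "cmod (det (jac (transition c k) z)) > 0" using jac_transition_nz[OF c k(1) zo] by simp
 have *: "lndet (\<alpha> c) z = ln ((cmod (det (jac (transition c k) z)))^2) + lndet (\<alpha> k) (snd k x)" if "kf \<alpha>" for \<alpha>
 proof -
  have "Re (det (\<alpha> c z)) = (cmod (det (jac (transition c k) z)))^2 * Re (det (\<alpha> k (snd k x)))"
   unfolding kf_cong[OF that c k(1) zo] T det_cong Re_complex_of_real_mult ..
  moreover have "Re (det (\<alpha> k (snd k x))) > 0" using pd_det(1)[OF kf_pd[OF that k(1) kx]] .
  ultimately show ?thesis using J by (simp add: lndet_def ln_mult)
 qed
 show ?thesis unfolding *[OF Q] *[OF \<omega>] by (simp add: ldr_def x_def[symmetric] k_def[symmetric] Let_def)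
qed

end

text \<open>The flow seen from time 1: since \<open>\<eta>\<close> vanishes there, the metric of the
  flow at that time is \<open>Q\<close> itself. The assumption \<open>ric\<close> is the equation of
  the Ricci potential, with the Ricci form written as minus the complex Hessian of
  \<open>lndet\<close>.\<close>

locale ma_flow = cmanifold A for A :: "('a::t2_space, 'n::finite) chart set" +
 fixes Q \<beta> :: "('a, 'n) form11" and \<eta> \<rho> :: "real => 'a => real"
 assumes Q: "kf Q"
  and \<beta>: "real_form11 A \<beta>" "!!c z v. c : A ==> z : im c ==> 0 <= qf (\<beta> c z) v"
  and \<eta>: "smooth_fam {0<..} \<eta>" and ks\<eta>: "!!t. t > 0 ==> ks Q (\<eta> t)"
  and \<eta>1: "!!x. \<eta> 1 x = 0"
  and \<rho>s: "!!t. t > 0 ==> smooth_fun A (\<rho> t)"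
  and \<eta>': "!!t x. t > 0 ==> ((%t. \<eta> t x) has_real_derivative 1 - exp (\<rho> t x)) (at t)"
  and norm\<eta>: "!!t. t > 0 ==> FI (omega_pot Q (\<eta> t)) (%x. 1 - exp (\<rho> t x)) = 0"
  and ric: "!!t c z. t > 0 ==> c : A ==> z : im c ==>
   levm (lndet (omega_pot Q (\<eta> t) c)) z = - (omega_pot Q (\<eta> t) c z + \<beta> c z + levm (loc c (\<rho> t)) z)"
begin

abbreviation "h t \<equiv> omega_pot Q (\<eta> t)"

lemma h_kf: "t > 0 ==> kf (h t)" by (rule ks_kf[OF ks\<eta> Q])

lemma h_pd: "t > 0 ==> c : A ==> z : im c ==> pd (h t c z)"
 by (rule kf_pd[OF h_kf])

lemma h1: "h 1 c z = Q c z"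
proof -
 have "levm (loc c (\<eta> 1)) z = levm (%_. 0) z" by (simp add: \<eta>1)
 thus ?thesis by (simp add: omega_pot_eq levm_const)
qed

lemma \<eta>_smooth: "t > 0 ==> smooth_fun A (\<eta> t)" by (rule ks_smooth[OF ks\<eta>])

lemma \<eta>'_fam: "smooth_fam {0<..} (%t x. 1 - exp (\<rho> t x))"
 by (rule fam_deriv(1)[OF \<eta>]) (use \<eta>' in auto)

lemma \<eta>_le:
 assumes "1 <= t"
 shows "\<eta> t x <= t - 1"
proof -
 have "\<eta> t x - t <= \<eta> 1 x - 1"
 proof (rule DERIV_nonpos_imp_nonincreasing[OF assms])
  fix s assume "1 <= s" "s <= t"
  hence "((%t. \<eta> t x - t) has_real_derivative (1 - exp (\<rho> s x)) - 1) (at s)"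
   by (intro DERIV_diff \<eta>' DERIV_ident) auto
  thus "EX y. ((%t. \<eta> t x - t) has_real_derivative y) (at s) & y <= 0" by (intro exI conjI) auto
 qed
 thus ?thesis by (simp add: \<eta>1)
qed

lemma h_fam: "c : A ==> smooth_on ({0<..} \<times> im c) (%(t, z). h t c z)"
 by (rule fam_form[OF Q \<eta>])

lemma dv_h:
 assumes "c : A" "t > 0" "z : im c"
 shows "dv (1, 0) (%(t, z). h t c z) (t, z) = - levm (loc c (%x. exp (\<rho> t x))) z"
proof -
 have e: "smooth_on (im c) (%z. exp (loc c (\<rho> t) z))"
  by (intro smooth_intros open_image smooth_funD[OF \<rho>s] assms)
 have "dv (1, 0) (%(t, z). h t c z) (t, z) = levm (%z. 1 - exp (loc c (\<rho> t) z)) z"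
  by (rule dv_fam_form[OF Q \<eta> assms(1)]) (use assms \<eta>' in auto)
 also have "... = levm (%_. 1) z - levm (%z. exp (loc c (\<rho> t) z)) z"
  by (rule levm_diff[OF open_image[OF assms(1)] smooth_on_const[OF open_image[OF assms(1)]] e assms(3)])
 finally show ?thesis by (simp add: levm_const)
qed

lemma levm_exp_ge:
 assumes "c : A" "t > 0" "z : im c"
 shows "exp (loc c (\<rho> t) z) * qf (levm (loc c (\<rho> t)) z) v <= qf (levm (loc c (%x. exp (\<rho> t x))) z) v"
proof -
 note o = open_image[OF assms(1)] and r = smooth_funD[OF \<rho>s[OF assms(2)] assms(1)]
 have e: "smooth_on (im c) (%z. exp (loc c (\<rho> t) z))" by (intro smooth_intros o r)
 show ?thesis using levi_exp[OF o r assms(3)] by (simp add: sesq_levm[OF o r assms(3)] sesq_levm[OF o e assms(3)])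
qed

text \<open>The maximum principle is applied to
  \<open>ldr Q (h t) + \<eta> t - \<rho> 1 - t\<close>. The terms with \<eta> and \<rho> are such
  that, by the Ricci equations at times \<open>t\<close> and 1, the complex Hessian is minus that of
  \<open>\<rho> t\<close>; the summand \<open>- t\<close> removes the constant 1 of the flow
  equation and makes the time derivative strictly negative at maxima.\<close>

theorem det_bound:
 obtains C where "C > 0"
  "!!t c z. 1 <= t ==> c : A ==> z : im c ==>
   Re (det (h t c z)) <= C * exp (t - loc c (\<eta> t) z) * Re (det (Q c z))"
proof -
 define Y where "Y t x = ldr Q (h t) x + \<eta> t x - \<rho> 1 x - t" for t x
 define Y' where "Y' t x = lap (h t) (%x. 1 - exp (\<rho> t x)) x - exp (\<rho> t x)" for t x
 have op: "open ({0<..} :: real set)" by simp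
 have lnd: "smooth_on ({0<..} \<times> im c) (lndet (%(t, z). h t c z))" if "c : A" for c
  by (rule smooth_on_lndet[OF open_prod[OF op that] h_fam[OF that]]) (auto intro!: h_pd[OF _ that])
 have ldrf: "smooth_fam {0<..} (%t. ldr Q (h t))" unfolding smooth_fam_def
 proof (intro conjI ballI op)
  fix c assume c: "c : A"
  have \<kappa>c: "smooth_on (im c) (lndet (Q c))"
   by (rule smooth_on_lndet[OF open_image[OF c] kf_smooth[OF Q c] kf_pd[OF Q c]])
  have "smooth_on ({0 :: real<..} \<times> im c) (%q. lndet (Q c) (snd q))"
   by (rule smooth_on_compose[OF open_prod[OF op c] open_image[OF c] _ \<kappa>c])
     (auto intro!: open_prod c smooth_on_linear[OF bounded_linear_snd] smooth_intros)
  from smooth_on_diff[OF open_prod[OF op c] lnd[OF c] this]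
  show "smooth_on ({0<..} \<times> im c) (%(t, z). loc c (ldr Q (h t)) z)"
   by (rule smooth_on_cong[THEN iffD1, rotated]) (auto simp: ldr_loc[OF Q h_kf c] lndet_def)
 qed
 have Yf: "smooth_fam {0<..} Y" unfolding Y_def[abs_def]
  by (intro fam_add fam_diff ldrf \<eta> fam_fun[OF op \<rho>s] fam_scalar[OF op] smooth_intros op) simp
 have dY: "((%t. Y t x) has_real_derivative Y' t x) (at t)" if t: "t > 0" for t x
 proof -
  obtain c where c: "c : A" "x : fst c" by (rule chart_at)
  define z where "z = snd c x"
  have z: "z : im c" "chart_inv c z = x" using c chart_inv_snd by (auto simp: z_def)
  have tz: "(t, z) : {0<..} \<times> im c" using t z by auto
  have "((%t. lndet (%(t, z). h t c z) (t, z)) has_vector_derivative dv (1, 0) (lndet (%(t, z). h t c z)) (t, z)) (at t)"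
   by (rule dv_time_slice[OF open_prod[OF op c(1)] lnd[OF c(1)] tz])
  also have "dv (1, 0) (lndet (%(t, z). h t c z)) (t, z) = tr (h t c z) (dv (1, 0) (%(t, z). h t c z) (t, z))"
   by (subst dv_lndet(2)[OF open_prod[OF op c(1)] h_fam[OF c(1)] _ tz]) (auto intro!: h_pd[OF _ c(1)])
  also have "dv (1, 0) (%(t, z). h t c z) (t, z) = levm (loc c (%x. 1 - exp (\<rho> t x))) z"
   by (rule dv_fam_form[OF Q \<eta> c(1)]) (use z t \<eta>' in auto)
  also have "tr (h t c z) (levm (loc c (%x. 1 - exp (\<rho> t x))) z) = lap (h t) (%x. 1 - exp (\<rho> t x)) x"
   using lap_loc[OF h_kf[OF t] _ c(1) z(1), of "%x. 1 - exp (\<rho> t x)"] fam_slice[OF \<eta>'_fam, of t] t z by simp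
  finally have "((%t. lndet (h t c) z) has_real_derivative lap (h t) (%x. 1 - exp (\<rho> t x)) x) (at t)"
   by (simp add: has_real_derivative_iff_has_vector_derivative lndet_def)
  hence "((%t. lndet (h t c) z - lndet (Q c) z + \<eta> t x - \<rho> 1 x - t) has_real_derivative
    lap (h t) (%x. 1 - exp (\<rho> t x)) x - 0 + (1 - exp (\<rho> t x)) - 0 - 1) (at t)"
   by (intro DERIV_diff DERIV_add DERIV_const DERIV_ident \<eta>' t)
  hence "((%t. lndet (h t c) z - lndet (Q c) z + \<eta> t x - \<rho> 1 x - t) has_real_derivative Y' t x) (at t)"
   by (simp add: Y'_def)
  thus ?thesis
  proof (rule has_field_derivative_transform_within_open[OF _ op])
   show "t : {0<..}" using t by simp
   fix s :: real assume "s : {0<..}"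
   thus "lndet (h s c) z - lndet (Q c) z + \<eta> s x - \<rho> 1 x - s = Y s x"
    using ldr_loc[OF Q h_kf c(1) z(1), of s] z by (simp add: Y_def)
  qed
 qed
 \<comment> \<open>At a spatial maximum \<open>\<rho> t\<close> has nonnegative complex Hessian,
   hence so has its exponential, and the time derivative of \<open>Y\<close> is at most minus that
   exponential.\<close>
 have neg: "Y' t x < 0" if t: "t > 1" and max: "!!y. Y t y <= Y t x" for t x
 proof -
  obtain c where c: "c : A" "x : fst c" by (rule chart_at)
  define z where "z = snd c x"
  have z: "z : im c" "chart_inv c z = x" using c chart_inv_snd by (auto simp: z_def)
  have t0: "t > 0" using t by simp
  note o = open_image[OF c(1)]
  have Ys: "smooth_fun A (Y t)" using fam_slice[OF Yf] t0 by simp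
  have ld: "smooth_on (im c) (lndet (h t c))" if "t > 0" for t
   by (rule smooth_on_lndet[OF o kf_smooth[OF h_kf[OF that] c(1)] h_pd[OF that c(1)]])
  have \<kappa>1: "lndet (Q c) = lndet (h 1 c)" by (simp add: lndet_def fun_eq_iff h1)
  note e = smooth_funD[OF \<eta>_smooth[OF t0] c(1)] and r1 = smooth_funD[OF \<rho>s[of 1] c(1)]
  have "levm (loc c (Y t)) z = levm (%z. ((lndet (h t c) z - lndet (h 1 c) z) + loc c (\<eta> t) z) - loc c (\<rho> 1) z - t) z"
   by (rule levm_cong_open[OF o z(1)]) (simp add: Y_def ldr_loc[OF Q h_kf[OF t0] c(1)] \<kappa>1)
  also have "... = ((levm (lndet (h t c)) z - levm (lndet (h 1 c)) z) + levm (loc c (\<eta> t)) z) - levm (loc c (\<rho> 1)) z - levm (%_. t) z"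
  proof -
   have s1: "smooth_on (im c) (%z. lndet (h t c) z - lndet (h 1 c) z)" 
    using smooth_on_diff[OF o ld[OF t0] ld[of 1]] by simp
   have s2: "smooth_on (im c) (%z. (lndet (h t c) z - lndet (h 1 c) z) + loc c (\<eta> t) z)"
    by (rule smooth_on_add[OF o s1 e])
   have s3: "smooth_on (im c) (%z. ((lndet (h t c) z - lndet (h 1 c) z) + loc c (\<eta> t) z) - loc c (\<rho> 1) z)"
    using smooth_on_diff[OF o s2 r1] by simp
   show ?thesis
    using levm_diff[OF o s3 smooth_on_const[OF o] z(1), of t] levm_diff[OF o s2 r1 z(1)] levm_add[OF o s1 e z(1)]
     levm_diff[OF o ld[OF t0] ld[of 1] z(1)] by simp
  qed
  also have "... = - levm (loc c (\<rho> t)) z"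
   using ric[OF t0 c(1) z(1)] ric[OF _ c(1) z(1), of 1] h1[of c z] by (simp add: levm_const omega_pot_eq)
  finally have lY: "levm (loc c (Y t)) z = - levm (loc c (\<rho> t)) z" .
  have "0 <= qf (levm (loc c (%x. exp (\<rho> t x))) z) v" for v
  proof -
   have "qf (- levm (loc c (\<rho> t)) z) v <= 0"
    using levm_at_max[OF Ys max c, of v] lY by (simp add: z_def)
   hence "0 <= qf (levm (loc c (\<rho> t)) z) v"
    by (simp add: sesq_matrix_minus)
   hence "0 <= exp (loc c (\<rho> t) z) * qf (levm (loc c (\<rho> t)) z) v" by simp
   also note levm_exp_ge[OF c(1) t0 z(1)]
   finally show ?thesis .
  qed
  hence 1: "0 <= tr (h t c z) (levm (loc c (%x. exp (\<rho> t x))) z)"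
   by (rule tr_nonneg[OF h_pd[OF t0 c(1) z(1)]])
  have "lap (h t) (%x. 1 - exp (\<rho> t x)) x = tr (h t c z) (levm (loc c (%x. 1 - exp (\<rho> t x))) z)"
   using lap_loc[OF h_kf[OF t0] _ c(1) z(1), of "%x. 1 - exp (\<rho> t x)"] fam_slice[OF \<eta>'_fam, of t] t z by simp
  also have "levm (loc c (%x. 1 - exp (\<rho> t x))) z = 0 - levm (loc c (%x. exp (\<rho> t x))) z"
   using levm_diff[OF o smooth_on_const[OF o] smooth_on_exp[OF o smooth_funD[OF \<rho>s[OF t0] c(1)]] z(1), of 1] by (simp add: levm_const)
  finally have "lap (h t) (%x. 1 - exp (\<rho> t x)) x <= 0"
   using 1 unfolding tr_diff by (simp add: tr_def trace_def matrix_matrix_mult_def)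
  thus ?thesis unfolding Y'_def by (smt (verit) exp_gt_zero)
 qed
 obtain C1 where C1: "!!t x. 1 <= t ==> Y t x <= C1"
  using max_principle[OF Yf dY neg] by metis
 obtain C2 where C2: "C2 > 0" "!!x. \<bar>\<rho> 1 x\<bar> <= C2" using smooth_fun_bounded[OF \<rho>s[of 1]] by auto
 show ?thesis
 proof
  show "exp (C1 + C2) > 0" by simp
  fix t :: real and c z assume t: "1 <= t" and c: "c : A" and z: "z : im c"
  have t0: "t > 0" using t by simp
  have p: "Re (det (h t c z)) > 0" "Re (det (Q c z)) > 0"
   using pd_det(1)[OF h_pd[OF t0 c z]] pd_det(1)[OF kf_pd[OF Q c z]] by auto
  have "ln (Re (det (h t c z))) - ln (Re (det (Q c z))) + loc c (\<eta> t) z - loc c (\<rho> 1) z - t <= C1"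
   using C1[OF t, of "chart_inv c z"] ldr_loc[OF Q h_kf[OF t0] c z] by (simp add: Y_def lndet_def)
  hence "ln (Re (det (h t c z))) <= C1 + C2 + (t - loc c (\<eta> t) z) + ln (Re (det (Q c z)))"
   using C2(2)[of "chart_inv c z"] by linarith
  hence "exp (ln (Re (det (h t c z)))) <= exp (C1 + C2 + (t - loc c (\<eta> t) z) + ln (Re (det (Q c z))))" by simp
  thus "Re (det (h t c z)) <= exp (C1 + C2) * exp (t - loc c (\<eta> t) z) * Re (det (Q c z))"
   using p by (simp add: exp_add)
 qed
qed

end

text \<open>Merges the constants obtained in finitely many charts into one; hence the demand that
  \<open>P\<close> be monotone in the constant.\<close>

lemma uniform_const:
 fixes P :: "'i => real => bool"
 assumes "finite I" "!!i. i : I ==> EX C>0. P i C" "!!i C D. i : I ==> P i C ==> C <= D ==> P i D"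
 obtains C where "C > 0" "!!i. i : I ==> P i C"
proof -
 obtain C where C: "!!i. i : I ==> C i > 0 & P i (C i)" using assms(2) by metis
 show ?thesis
 proof
  show "1 + (SUM i:I. C i) > 0" using C by (intro add_pos_nonneg sum_nonneg) (auto intro: less_imp_le)
  fix i assume i: "i : I"
  have "C i <= (SUM i:I. C i)" by (rule member_le_sum[OF i _ assms(1)]) (use C in \<open>auto intro: less_imp_le\<close>)
  thus "P i (1 + (SUM i:I. C i))" using assms(3)[OF i] C[OF i] by (metis add_increasing zero_le_one)
 qed
qed

context cmanifold
begin

text \<open>Compact pieces of the chart images whose preimages still cover the manifold, so that
  local bounds obtained from compactness become global.\<close>

definition Kc :: "('a, 'n) chart => (complex^'n) set" where
 "Kc c = snd c ` closure {x. P\<theta> c x ~= 0}"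

lemma
 assumes "c : PC"
 shows Kc_compact: "compact (Kc c)" and Kc_sub: "Kc c \<subseteq> im c"
proof -
 have "c : A" using PC assms by auto
 note sc = supp_chart[OF this closed_closure P\<theta>_supp[OF assms] P\<theta>_zero]
 show "compact (Kc c)" "Kc c \<subseteq> im c" unfolding Kc_def using sc(2,3) by auto
qed

lemma Kc_cover:
 obtains c where "c : PC" "x : fst c" "snd c x : Kc c"
proof -
 have "EX c:PC. P\<theta> c x ~= 0"
 proof (rule ccontr)
  assume "\<not> ?thesis"
  hence "(SUM c:PC. P\<theta> c x) = 0" by (intro sum.neutral) auto
  thus False by (simp add: P\<theta>_sum)
 qed
 then obtain c where c: "c : PC" "P\<theta> c x ~= 0" by blast
 hence "x : closure {x. P\<theta> c x ~= 0}" by (intro subsetD[OF closure_subset]) auto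
 thus ?thesis using that[OF c(1)] P\<theta>_supp[OF c(1)] by (auto simp: Kc_def)
qed

lemma kf_nonneg:
 assumes "kf Q" "c : A" "z : im c"
 shows "0 <= qf (Q c z) v"
 using kf_pd[OF assms] unfolding pd_def by (cases "v = 0") (auto simp: less_imp_le)

lemma smooth_on_ln_form:
 assumes Q: "kf Q" and c: "c : A"
 shows "smooth_on ((- {0}) \<times> im c) (%q. ln (qf (Q c (snd q)) (fst q)))"
proof (rule smooth_on_ln)
 have o: "open ((- {0 :: complex^'n}) \<times> im c)" by (intro open_Times open_image[OF c]) auto
 show "open ((- {0 :: complex^'n}) \<times> im c)" by (intro open_Times open_image[OF c]) auto
 have f: "smooth_on ((- {0 :: complex^'n}) \<times> im c) fst"
  and s: "smooth_on ((- {0 :: complex^'n}) \<times> im c) snd"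
  by (rule smooth_on_linear[OF bounded_linear_fst o smooth_on_ident[OF o]],
    rule smooth_on_linear[OF bounded_linear_snd o smooth_on_ident[OF o]])
 have k: "smooth_on ((- {0 :: complex^'n}) \<times> im c) (%q. Q c (snd q))"
  by (rule smooth_on_compose[OF o open_image[OF c] s kf_smooth[OF Q c]]) auto
 show "smooth_on ((- {0 :: complex^'n}) \<times> im c) (%q. qf (Q c (snd q)) (fst q))"
  unfolding sesq_def by (intro smooth_on_Re smooth_on_sum smooth_on_mult smooth_on_entry smooth_on_nth smooth_on_cnj o f k)
 fix q assume "q : (- {0 :: complex^'n}) \<times> im c"
 hence "fst q ~= 0" "snd q : im c" by auto
 thus "0 < qf (Q c (snd q)) (fst q)" using kf_pd[OF Q c, of "snd q"] by (simp add: pd_def)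
qed

text \<open>Plays the part of a curvature bound for the reference metric: \<open>v\<close> is a
  constant vector of the chart, and the second derivatives of the logarithm of \<open>Q\<close> on
  \<open>v\<close> are bounded because \<open>Kc c\<close> and the unit sphere are compact.\<close>

lemma ln_form_bound:
 assumes Q: "kf Q"
 obtains C where "C > 0" "!!c z v e. c : PC ==> z : Kc c ==> norm v = 1 ==>
  qf (levm (%u. ln (Re (sesq (Q c u) v v))) z) e <= C * qf (Q c z) e"
proof (rule uniform_const[OF PC(1), where P="%c C. ALL z:Kc c. ALL v e. norm v = 1 \<longrightarrow>
  qf (levm (%u. ln (Re (sesq (Q c u) v v))) z) e <= C * qf (Q c z) e"])
 fix c assume cP: "c : PC"
 have c: "c : A" using PC cP by auto
 note o = open_image[OF c]
 have oq: "open ((- {0 :: complex^'n}) \<times> im c)" by (intro open_Times o) auto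
 have sub: "sphere 0 1 \<times> Kc c \<subseteq> (- {0 :: complex^'n}) \<times> im c" using Kc_sub[OF cP] by auto
 obtain C where "C > 0" "!!q e. q : sphere (0 :: complex^'n) 1 \<times> Kc c ==> 
  qf ((%(v, z). levm (%u. ln (Re (sesq (Q c u) v v))) z) q) e <= C * qf (Q c (snd q)) e"
 proof (rule form_bound[of "sphere (0 :: complex^'n) 1 \<times> Kc c" "%q. Q c (snd q)" "%(v, z). levm (%u. ln (qf (Q c u) v)) z"])
  show "compact (sphere (0 :: complex^'n) 1 \<times> Kc c)" by (intro compact_Times compact_sphere Kc_compact cP)
  show "continuous_on (sphere (0 :: complex^'n) 1 \<times> Kc c) (%q. Q c (snd q))"
   by (rule continuous_on_compose2[OF smooth_continuous[OF kf_smooth[OF Q c]]]) (use Kc_sub[OF cP] in \<open>auto intro!: continuous_intros\<close>)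
  show "continuous_on (sphere (0 :: complex^'n) 1 \<times> Kc c) (%(v, z). levm (%u. ln (qf (Q c u) v)) z)"
   using continuous_on_subset[OF smooth_continuous[OF smooth_on_levm_slice[OF oq smooth_on_ln_form[OF Q c]]] sub] by simp
  show "pd (Q c (snd q))" if "q : sphere (0 :: complex^'n) 1 \<times> Kc c" for q using that Kc_sub[OF cP] by (intro kf_pd[OF Q c]) auto
 qed blast
 thus "EX C>0. ALL z:Kc c. ALL v e. norm v = 1 \<longrightarrow>
  qf (levm (%u. ln (Re (sesq (Q c u) v v))) z) e <= C * qf (Q c z) e"
  by fastforce
next
 fix c C D assume cP: "c : PC" and 1: "ALL z:Kc c. ALL v e. norm v = 1 \<longrightarrow>
  qf (levm (%u. ln (Re (sesq (Q c u) v v))) z) e <= C * qf (Q c z) e" and "C <= (D :: real)"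
 show "ALL z:Kc c. ALL v e. norm v = 1 \<longrightarrow>
  qf (levm (%u. ln (Re (sesq (Q c u) v v))) z) e <= D * qf (Q c z) e"
 proof (intro ballI allI impI)
  fix z v e assume z: "z : Kc c" and v: "norm (v :: complex^'n) = 1"
  have c: "c : A" using PC cP by auto
  have "C * qf (Q c z) e <= D * qf (Q c z) e"
   by (rule mult_right_mono[OF \<open>C <= D\<close> kf_nonneg[OF Q c]]) (use z Kc_sub[OF cP] in auto)
  thus "qf (levm (%u. ln (Re (sesq (Q c u) v v))) z) e <= D * qf (Q c z) e"
   using 1 z v by (meson order_trans)
 qed
qed (use that in blast)

lemma real_form11_bound:
 assumes Q: "kf Q" and \<beta>: "real_form11 A \<beta>"
 obtains C where "C > 0" "!!c z v. c : PC ==> z : Kc c ==> qf (\<beta> c z) v <= C * qf (Q c z) v"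
proof (rule uniform_const[OF PC(1), where P="%c C. ALL z:Kc c. ALL v. qf (\<beta> c z) v <= C * qf (Q c z) v"])
 fix c assume cP: "c : PC"
 have c: "c : A" using PC cP by auto
 have "smooth_on (im c) (\<beta> c)" using \<beta> c by (simp add: real_form11_def)
 hence \<beta>c: "continuous_on (Kc c) (\<beta> c)" using smooth_continuous continuous_on_subset Kc_sub[OF cP] by blast
 have \<kappa>c: "continuous_on (Kc c) (Q c)" 
  using smooth_continuous[OF kf_smooth[OF Q c]] continuous_on_subset Kc_sub[OF cP] by blast
 have pd: "pd (Q c z)" if "z : Kc c" for z using that Kc_sub[OF cP] kf_pd[OF Q c] by auto
 show "EX C>0. ALL z:Kc c. ALL v. qf (\<beta> c z) v <= C * qf (Q c z) v"
  by (rule form_bound[OF Kc_compact[OF cP] \<kappa>c \<beta>c pd]) blast+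
next
 fix c C D assume cP: "c : PC" and 1: "ALL z:Kc c. ALL v. qf (\<beta> c z) v <= C * qf (Q c z) v" and "C <= (D :: real)"
 show "ALL z:Kc c. ALL v. qf (\<beta> c z) v <= D * qf (Q c z) v"
 proof (intro ballI allI)
  fix z v assume z: "z : Kc c"
  have c: "c : A" using PC cP by auto
  have "C * qf (Q c z) v <= D * qf (Q c z) v"
   by (rule mult_right_mono[OF \<open>C <= D\<close> kf_nonneg[OF Q c]]) (use z Kc_sub[OF cP] in auto)
  thus "qf (\<beta> c z) v <= D * qf (Q c z) v" using 1 z by (meson order_trans)
 qed
qed (use that in blast)

end

context ma_flow
begin

text \<open>At a maximum of \<open>f\<close> the space condition bounds the trace of
  \<open>Q\<close> with respect to \<open>h\<close>, provided the Hessian of \<rho> in the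
  maximising direction is controlled; that control is what the time condition supplies. Together
  with \<open>det_bound\<close> the trace bound becomes an upper bound for \<open>h\<close> at the
  maximum, hence for \<open>f\<close> everywhere.\<close>

theorem c2_bound:
 obtains C where "C > 0"
  "!!T B t c z v. 1 <= T ==> 0 <= B ==> (!!t x. t : {1..T} ==> - B <= \<eta> t x) ==>
   t : {1..T} ==> c : A ==> z : im c ==>
   qf (h t c z) v <= exp (C * (1 + T + B)) * qf (Q c z) v"
proof -
 obtain Cd where Cd: "Cd > 0" "!!t c z. 1 <= t ==> c : A ==> z : im c ==>
   Re (det (h t c z)) <= Cd * exp (t - loc c (\<eta> t) z) * Re (det (Q c z))"
  by (rule det_bound) blast
 obtain C1 where C1: "C1 > 0" "!!c z v e. c : PC ==> z : Kc c ==> norm v = 1 ==>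
  qf (levm (%u. ln (Re (sesq (Q c u) v v))) z) e <= C1 * qf (Q c z) e"
  by (rule ln_form_bound[OF Q]) blast
 obtain C2 where C2: "C2 > 0" "!!c z v. c : PC ==> z : Kc c ==> qf (\<beta> c z) v <= C2 * qf (Q c z) v"
  by (rule real_form11_bound[OF Q \<beta>(1)]) blast
 \<comment> \<open>The multiple \<open>a\<close> of the trace of \<open>Q\<close> must absorb the
   multiples \<open>C1\<close> and \<open>C2\<close> of that trace and leave one copy over;
   \<open>c3\<close> collects the constants on the other side.\<close>
 define a where "a = C1 + C2 + 1"
 define c3 where "c3 = 1 + a + a * real CARD('n)"
 define D0 where "D0 = Cd * c3 ^ (CARD('n) - 1)"
 have a: "a > 0" using C1(1) C2(1) by (simp add: a_def)
 hence c3: "c3 > 0" unfolding c3_def by (intro add_pos_nonneg) auto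
 hence D0: "D0 > 0" using Cd(1) by (simp add: D0_def)
 define f where "f c t z v = ln (qf (h t c z) v) - ln (qf (Q c z) v) - a * loc c (\<eta> t) z" for c t z v
 have hpos: "qf (h t c z) v > 0" "qf (Q c z) v > 0" if "t > 0" "c : A" "z : im c" "v ~= 0" for t c z v
  using h_pd[OF that(1-3)] kf_pd[OF Q that(2,3)] that(4) by (auto simp: pd_def)
 show ?thesis
 proof
  show "0 < \<bar>ln D0\<bar> + 1 + a" using a by simp
  fix T B t :: real and c z v
  assume T: "1 <= T" and B: "0 <= B" and \<eta>B: "!!t x. t : {1..T} ==> - B <= \<eta> t x"
   and t: "t : {1..T}" and c: "c : A" and z: "z : im c"
  define g where "g c q = f c (fst q) (fst (snd q)) (snd (snd q))" for c q
  \<comment> \<open>The values of \<open>f\<close> at unit vectors over the compact pieces. Since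
    \<open>f\<close> changes neither when \<open>v\<close> is scaled nor when point and vector are
    moved to another chart, these are all its values at nonzero vectors and times in
    \<open>[1,T]\<close>.\<close>
  define V where "V = (\<Union>c\<in>PC. g c ` ({1..T} \<times> Kc c \<times> sphere 0 1))"
  have "compact V" unfolding V_def
  proof (intro compact_UN PC(1) compact_continuous_image compact_Times compact_Icc compact_sphere Kc_compact)
   fix c assume cP: "c : PC"
   have c: "c : A" using PC cP by auto
   let ?K = "{1..T} \<times> Kc c \<times> sphere (0 :: complex^'n) 1"
   have pc: "continuous_on ?K (%q. (fst q, fst (snd q)))" by (intro continuous_intros)
   have ps: "(%q. (fst q, fst (snd q))) ` ?K \<subseteq> {0<..} \<times> im c" using Kc_sub[OF cP] by auto
   have 1: "continuous_on ?K (%q. h (fst q) c (fst (snd q)))"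
    using continuous_on_compose2[OF smooth_continuous[OF h_fam[OF c]] pc ps] by simp
   have 2: "continuous_on ?K (%q. Q c (fst (snd q)))"
    by (rule continuous_on_compose2[OF smooth_continuous[OF kf_smooth[OF Q c]]]) (use Kc_sub[OF cP] in \<open>auto intro!: continuous_intros\<close>)
   have 3: "continuous_on ?K (%q. loc c (\<eta> (fst q)) (fst (snd q)))"
    using continuous_on_compose2[OF smooth_continuous[OF famD[OF \<eta> c]] pc ps] by simp
   have s: "continuous_on ?K (%q. snd (snd q))" by (intro continuous_intros)
   have nz: "qf (h (fst q) c (fst (snd q))) (snd (snd q)) ~= 0"
    "qf (Q c (fst (snd q))) (snd (snd q)) ~= 0" if q: "q : ?K" for q
   proof -
    have "fst q > 0" "fst (snd q) : im c" "snd (snd q) ~= 0" using q Kc_sub[OF cP] by auto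
    from hpos[OF this(1) c this(2,3)] show "qf (h (fst q) c (fst (snd q))) (snd (snd q)) ~= 0"
     "qf (Q c (fst (snd q))) (snd (snd q)) ~= 0" by auto
   qed
   show "continuous_on ?K (g c)" unfolding g_def[abs_def] f_def
    by (rule continuous_on_diff[OF continuous_on_diff[OF continuous_on_ln[OF continuous_on_sesq2[OF 1 s]] continuous_on_ln[OF continuous_on_sesq2[OF 2 s]]]
      continuous_on_mult[OF continuous_on_const 3]]) (use nz in blast)+
  qed
  have glob: "EX y:V. f c t z v = y" if t: "t : {1..T}" and c: "c : A" and z: "z : im c" and v: "v ~= 0" for c t z v
  proof -
   obtain k where k: "k : PC" "chart_inv c z : fst k" "snd k (chart_inv c z) : Kc k" by (rule Kc_cover)
   have kA: "k : A" using PC k by auto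
   have zo: "z : ov c k" using ov_iff[OF c] z k(2) by simp
   define w where "w = transition c k z"
   define J where "J = jac (transition c k) z"
   have w: "w : Kc k" "chart_inv k w = chart_inv c z" "w : im k"
    using k(3) transition_maps[OF c kA zo] by (auto simp: w_def transition_def)
   have "invertible J" using jac_transition_nz[OF c kA zo] invertible_det_nz by (auto simp: J_def)
   hence Jv: "J *v v ~= 0" using v by (metis invertible_def matrix_vector_mul_assoc matrix_vector_mul_lid matrix_vector_mult_0_right)
   define e where "e = of_real (1 / norm (J *v v)) *s (J *v v)"
   note N = sesq_normalize[OF Jv, folded e_def]
   have t0: "t > 0" using t by simp
   have e0: "e ~= 0" using N(1) by auto
   have n0: "0 < (norm (J *v v))^2" using Jv by simp
   have l: "ln (qf (\<alpha> c z) v) = ln ((norm (J *v v))^2) + ln (qf (\<alpha> k w) e)" if "kf \<alpha>" "qf (\<alpha> k w) e > 0" for \<alpha>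
    unfolding kf_cong[OF that(1) c kA zo] sesq_cong J_def[symmetric] w_def[symmetric] N(2)
    by (rule ln_mult_pos[OF n0 that(2)])
   have "f c t z v = f k t w e"
    unfolding f_def l[OF h_kf[OF t0] hpos(1)[OF t0 kA w(3) e0]] l[OF Q hpos(2)[OF t0 kA w(3) e0]] by (simp add: w(2))
   moreover have "f k t w e : V" unfolding V_def
    using k(1) t w(1) N(1) by (intro UN_I image_eqI[where x="(t, w, e)"]) (auto simp: g_def)
   ultimately show ?thesis by blast
  qed
  have "V ~= {}"
  proof -
   have "axis undefined 1 ~= (0 :: complex^'n)" by (simp add: axis_eq_0_iff)
   from glob[OF t c z this] show ?thesis by auto
  qed
  with \<open>compact V\<close> obtain m where m: "m : V" "!!y. y : V ==> y <= m" 
   using compact_attains_sup[of V] by blast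
  have fm: "f c t z v <= m" if "t : {1..T}" "c : A" "z : im c" "v ~= 0" for c t z v
   using glob[OF that] m(2) by blast
  have mb: "m <= \<bar>ln D0\<bar> + T + B + a * B"
  proof -
   obtain k t0 z0 v0 where k: "k : PC" and t0: "t0 : {1..T}" and z0K: "z0 : Kc k" and v0: "norm v0 = 1" and mf: "m = f k t0 z0 v0"
    using m(1) unfolding V_def g_def by auto
   have kA: "k : A" using PC k by auto
   have z0: "z0 : im k" using Kc_sub[OF k] z0K by auto
   have v00: "v0 ~= 0" using v0 by auto
   have t0p: "t0 > 0" using t0 by simp
   note o = open_image[OF kA]
   show ?thesis
   proof (cases "t0 = 1")
    case True
    have "m = - a * loc k (\<eta> 1) z0" unfolding mf f_def True h1 by simp
    thus ?thesis using T B a by (simp add: \<eta>1)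
   next
    case False
    hence t01: "t0 > 1" using t0 by simp
    let ?H = "h t0 k z0" and ?L = "%z. ln (qf (h t0 k z) v0)" and ?Lk = "%z. ln (qf (Q k z) v0)"
    let ?hv = "qf ?H v0" and ?X = "tr ?H (Q k z0)"
    let ?r = "qf (levm (loc k (\<rho> t0)) z0) v0" and ?u = "exp (loc k (\<rho> t0) z0)"
    note H = h_pd[OF t0p kA z0]
    note hp = hpos[OF t0p kA z0 v00]
    have Ls: "smooth_on (im k) ?L" "smooth_on (im k) ?Lk"
     using hpos[OF t0p kA _ v00] by (auto intro!: smooth_intros o kf_smooth[OF h_kf[OF t0p] kA] kf_smooth[OF Q kA])
    note es = smooth_funD[OF \<eta>_smooth[OF t0p] kA]
    have ae: "smooth_on (im k) (%z. a * loc k (\<eta> t0) z)" by (intro smooth_intros o es)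
    \<comment> \<open>The vector \<open>v0\<close> is kept constant in the chart, so
      \<open>z0\<close> maximises a function of the point alone.\<close>
    have space: "tr ?H (levm (%z. ?L z - ?Lk z - a * loc k (\<eta> t0) z) z0) <= tr ?H 0"
    proof (rule tr_mono[OF H])
     fix e
     have Gs: "smooth_on (im k) (%z. ?L z - ?Lk z - a * loc k (\<eta> t0) z)" by (intro smooth_on_diff o Ls ae)
     show "qf (levm (%z. ?L z - ?Lk z - a * loc k (\<eta> t0) z) z0) e <= qf 0 e"
      unfolding sesq_levm[OF o Gs z0]
      using levi_nonpos_at_max[OF o Gs z0, of e] fm[OF t0 kA _ v00] mf by (simp add: f_def sesq_def)
    qed
    have "levm (%z. ?L z - ?Lk z - a * loc k (\<eta> t0) z) z0 = levm ?L z0 - levm ?Lk z0 - a *\<^sub>R (?H - Q k z0)"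
     using levm_diff[OF o smooth_on_diff[OF o Ls] ae z0] levm_diff[OF o Ls z0] levm_scale[OF o es z0, of a] by (simp add: omega_pot_eq)
    with space have space2: "tr ?H (levm ?L z0) - tr ?H (levm ?Lk z0) - a * (real CARD('n) - ?X) <= 0"
     by (simp add: tr_diff tr_scaleR tr_self[OF H]) (simp add: tr_def trace_def matrix_matrix_mult_def)
    have time: "0 <= - qf (levm (loc k (%x. exp (\<rho> t0 x))) z0) v0 / ?hv - a * (1 - ?u)"
    proof (rule deriv_nonneg_at_right_max[OF _ t01, of "%t. f k t z0 v0"])
     have "((%t. h t k z0) has_vector_derivative dv (1, 0) (%(t, z). h t k z) (t0, z0)) (at t0)"
      using dv_time_slice[OF open_prod[OF _ kA] h_fam[OF kA], of t0 z0] t0p z0 by simp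
     hence d1: "((%t. h t k z0) has_vector_derivative - levm (loc k (%x. exp (\<rho> t0 x))) z0) (at t0)"
      unfolding dv_h[OF kA t0p z0] .
     have bl: "bounded_linear (%M :: complex^'n^'n. qf M v0)"
      unfolding sesq_def by (intro bounded_linear_intros bounded_linear_compose[OF bounded_linear_Re] bounded_linear_sum bounded_linear_compose[OF bounded_linear_vec_nth] bounded_linear_vec_nth)
     have "((%t. qf (h t k z0) v0) has_real_derivative - qf (levm (loc k (%x. exp (\<rho> t0 x))) z0) v0) (at t0)"
      using bounded_linear.has_vector_derivative[OF bl d1] by (simp add: has_real_derivative_iff_has_vector_derivative sesq_matrix_minus)
     from DERIV_chain2[OF DERIV_ln_divide[OF hp(1)] this]
     have "((%t. ln (qf (h t k z0) v0)) has_real_derivative 1 / ?hv * - qf (levm (loc k (%x. exp (\<rho> t0 x))) z0) v0) (at t0)" .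
     from DERIV_diff[OF DERIV_diff[OF this DERIV_const[of "?Lk z0"]] DERIV_cmult[OF \<eta>'[OF t0p], of a]]
     show "((%t. f k t z0 v0) has_real_derivative - qf (levm (loc k (%x. exp (\<rho> t0 x))) z0) v0 / ?hv - a * (1 - ?u)) (at t0)"
      unfolding f_def by simp
     fix s assume "1 <= s" "s <= t0"
     thus "f k s z0 v0 <= f k t0 z0 v0" using fm[OF _ kA z0 v00, of s] t0 mf by simp
    qed
    \<comment> \<open>The time condition bounds the Hessian of \<open>exp \<rho>\<close> by
      \<open>a * (?u - 1)\<close>, and the Hessian of \<rho> itself appears with the factor
      \<open>?u\<close>; dividing by \<open>?u\<close> leaves a bound without \<rho>.\<close>
    have rb: "?r / ?hv <= a"
    proof -
     have "?u * (?r / ?hv) <= qf (levm (loc k (%x. exp (\<rho> t0 x))) z0) v0 / ?hv"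
      using divide_right_mono[OF levm_exp_ge[OF kA t0p z0, of v0] less_imp_le[OF hp(1)]] by simp
     also have "... <= - a * (1 - ?u)" using time by simp
     also have "... <= ?u * a" using a by (simp add: algebra_simps)
     finally show ?thesis by (rule mult_left_le_imp_le[OF _ exp_gt_zero])
    qed
    have ld: "smooth_on (im k) (lndet (h t0 k))"
     by (rule smooth_on_lndet[OF o kf_smooth[OF h_kf[OF t0p] kA] h_pd[OF t0p kA]])
    have "Re (levi (lndet (h t0 k)) z0 v0 v0) = - (?hv + qf (\<beta> k z0) v0 + ?r)"
     unfolding sesq_levm[OF o ld z0, symmetric] ric[OF t0p kA z0] sesq_matrix_minus sesq_matrix_add by simp
    hence "- (?hv + qf (\<beta> k z0) v0 + ?r) / ?hv <= tr ?H (levm ?L z0)"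
     using tr_levi_ln_form_ge[OF o kf_smooth[OF h_kf[OF t0p] kA] h_pd[OF t0p kA] kf_closed[OF h_kf[OF t0p] kA] z0 v00] by simp
    moreover have "- (x + b + r) / x = - 1 - b / x - r / x" if "x > 0" for x b r :: real
     using that by (simp add: field_simps)
    ultimately have L1: "- 1 - qf (\<beta> k z0) v0 / ?hv - ?r / ?hv <= tr ?H (levm ?L z0)"
     using hp(1) by simp
    have \<kappa>0: "herm (Q k z0)" "!!w. 0 <= qf (Q k z0) w"
     using kf_pd[OF Q kA z0] unfolding pd_def by (auto, metis less_imp_le order_refl sesq_zero1 zero_complex.sel(1))
    have kX: "qf (Q k z0) w <= ?X * qf ?H w" for w
     by (rule form_le_tr[OF H \<kappa>0])
    have L2: "qf (\<beta> k z0) v0 / ?hv <= C2 * ?X"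
    proof -
     have "qf (\<beta> k z0) v0 <= C2 * qf (Q k z0) v0" by (rule C2(2)[OF k z0K])
     also have "... <= C2 * (?X * ?hv)" using kX C2(1) by (intro mult_left_mono) auto
     finally show ?thesis using hp(1) by (simp add: pos_divide_le_eq mult.assoc)
    qed
    have "tr ?H (levm ?Lk z0) <= tr ?H (C1 *\<^sub>R Q k z0)"
     by (rule tr_mono[OF H]) (use C1(2)[OF k z0K v0] in \<open>simp add: sesq_matrix_scaleR\<close>)
    hence L3: "tr ?H (levm ?Lk z0) <= C1 * ?X" by (simp add: tr_scaleR)
    have "?X <= c3" using space2 L1 L2 L3 rb unfolding c3_def a_def by (simp add: algebra_simps)
    hence kc: "qf (Q k z0) w <= c3 * qf ?H w" for w
     using order_trans[OF kX[of w] mult_right_mono[of ?X c3 "qf ?H w"]] H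
     unfolding pd_def by (cases "w = 0") (auto simp: less_imp_le)
    have "?hv <= (Cd * exp (t0 - loc k (\<eta> t0) z0)) * c3 ^ (CARD('n) - 1) * qf (Q k z0) v0"
     by (rule form_le_of_det_le[OF kf_pd[OF Q kA z0] H c3 kc Cd(2)[OF _ kA z0]]) (use t0 in simp)
    also have "... = D0 * exp (t0 - loc k (\<eta> t0) z0) * qf (Q k z0) v0" by (simp add: D0_def)
    finally have "ln ?hv <= ln (D0 * exp (t0 - loc k (\<eta> t0) z0) * qf (Q k z0) v0)"
     using hp by (subst ln_le_cancel_iff) (auto simp: D0)
    also have "... = ln D0 + (t0 - loc k (\<eta> t0) z0) + ln (qf (Q k z0) v0)"
     using D0 hp(2) by (simp add: ln_mult_pos)
    finally have "m <= ln D0 + (t0 - loc k (\<eta> t0) z0) - a * loc k (\<eta> t0) z0" unfolding mf f_def by simp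
    moreover have "- a * loc k (\<eta> t0) z0 <= a * B"
     using mult_left_mono[OF \<eta>B[OF t0, of "chart_inv k z0"] less_imp_le[OF a]] by simp
    moreover have "- B <= loc k (\<eta> t0) z0" "t0 <= T" using \<eta>B[OF t0] t0 by auto
    ultimately show ?thesis by linarith
   qed
  qed
  show "qf (h t c z) v <= exp ((\<bar>ln D0\<bar> + 1 + a) * (1 + T + B)) * qf (Q c z) v"
  proof (cases "v = 0")
   case False
   have t0: "t > 0" using t by simp
   note p = hpos[OF t0 c z False]
   have "a * loc c (\<eta> t) z <= a * T"
    using \<eta>_le[of t "chart_inv c z"] t a by (intro mult_left_mono) auto
   hence "ln (qf (h t c z) v) <= \<bar>ln D0\<bar> + T + B + a * B + a * T + ln (qf (Q c z) v)"
    using fm[OF t c z False] mb unfolding f_def by linarith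
   also have "\<bar>ln D0\<bar> + T + B + a * B + a * T <= (\<bar>ln D0\<bar> + 1 + a) * (1 + T + B)"
    using T B a by (simp add: algebra_simps)
   finally have "exp (ln (qf (h t c z) v)) <= exp ((\<bar>ln D0\<bar> + 1 + a) * (1 + T + B) + ln (qf (Q c z) v))"
    by simp
   thus ?thesis using p by (simp add: exp_add)
  qed simp
 qed
qed

end

section \<open>The logarithmic test function\<close>

definition cip :: "complex^'n::finite => complex^'n => complex" where
 "cip v w = (SUM j:UNIV. v $ j * cnj (w $ j))"

lemma inner_cip: "v \<bullet> w = Re (cip v w)" "(\<i> *s v) \<bullet> w = - Im (cip v w)"
 by (simp_all add: cip_def inner_vec_def inner_complex_def Re_sum Im_sum sum_negf[symmetric])

lemma cmod_cip_le: "(cmod (cip v w))^2 <= (norm v)^2 * (norm w)^2"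
proof -
 have "cmod (cip v w) <= (SUM j:UNIV. cmod (v $ j * cnj (w $ j)))" unfolding cip_def by (rule norm_sum)
 also have "... = (SUM j:UNIV. \<bar>cmod (v $ j)\<bar> * \<bar>cmod (w $ j)\<bar>)" by (simp add: norm_mult)
 also have "... <= norm v * norm w" unfolding norm_vec_def by (rule L2_set_mult_ineq)
 finally show ?thesis using power_mono[of "cmod (cip v w)" "norm v * norm w" 2] by (simp add: power_mult_distrib)
qed

lemma levi_radial:
 fixes p z :: "complex^'n::finite" and \<xi> :: "real => real"
 assumes J: "open J" and \<xi>: "smooth_on J \<xi>" "smooth_on J \<xi>1"
  and d: "!!x. x : J ==> (\<xi> has_real_derivative \<xi>1 x) (at x)" "!!x. x : J ==> (\<xi>1 has_real_derivative \<xi>2 x) (at x)"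
  and z: "(norm (z - p))^2 : J"
 shows "Re (levi (%u. \<xi> ((norm (u - p))^2)) z v v)
  = \<xi>1 ((norm (z - p))^2) * (norm v)^2 + \<xi>2 ((norm (z - p))^2) * (cmod (cip v (z - p)))^2"
proof -
 let ?g = "%u. (norm (u - p))^2"
 have S: "open (?g -` J)" by (rule open_vimage[OF J]) (intro continuous_intros)
 have zS: "z : ?g -` J" using z by simp
 note g = smooth_on_norm_square[OF S]
 have c: "levi (%u. \<xi> (?g u)) z v v = of_real (\<xi>1 (?g z)) * levi ?g z v v + of_real (\<xi>2 (?g z) * (cmod (wd v (%u. of_real (?g u)) z))^2)"
  by (rule levi_compose[OF S g zS J _ \<xi> d]) auto
 have 1: "dv w ?g = (%u. 2 * (w \<bullet> (u - p)))" for w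
  unfolding power2_norm_eq_inner
  by (rule ext has_derivative_imp_dv)+ (auto intro!: derivative_eq_intros simp: inner_commute)
 have 2: "dv w (%u. 2 * (w \<bullet> (u - p))) z = 2 * (norm w)^2" for w
  unfolding power2_norm_eq_inner by (rule has_derivative_imp_dv) (auto intro!: derivative_eq_intros)
 show ?thesis
  unfolding c levi_real[OF S g zS] wd_def dv_of_real[OF S g zS] 1 2
  unfolding inner_cip(2) unfolding inner_cip(1) norm_complex_scale cmod_power2
  by (simp add: power_divide algebra_simps)
qed

definition rank1 :: "complex^'n => complex^'n::finite^'n" where
 "rank1 w = (\<chi> j k. cnj (w $ j) * w $ k)"

lemma sesq_rank1: "sesq (rank1 w) x y = cip x w * cnj (cip y w)"
 unfolding sesq_def rank1_def cip_def cnj_sum sum_product vec_lambda_beta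
 by (intro sum.cong refl) simp

lemma herm_rank1: "herm (rank1 w)"
 by (simp add: herm_def rank1_def)

text \<open>Relative to the identity, a rank one form has at most one nonzero eigenvalue, and that
  one equals its trace.\<close>

theorem det_rank1_update:
 fixes w :: "complex^'n::finite"
 shows "Re (det (a *\<^sub>R mat 1 - b *\<^sub>R rank1 w)) = a ^ (CARD('n) - 1) * (a - b * (norm w)^2)"
proof -
 obtain E \<mu> where E: "cong E (mat 1) = (mat 1 :: complex^'n^'n)" and \<mu>: "cong E (rank1 w) = diagm \<mu>"
  using simultaneous_diagonalization[OF pd_mat1 herm_rank1] by blast
 \<comment> \<open>Vanishing off-diagonal entries mean that at most one column of \<open>E\<close>
   fails to be orthogonal to \<open>w\<close>.\<close>
 have off: "cip (column i E) w = 0 \<or> cip (column j E) w = 0" if "i ~= j" for i j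
  using arg_cong[OF \<mu>, of "%M. M $ i $ j"] that unfolding cong_nth sesq_rank1 by (auto simp: diagm_def)
 have \<mu>e: "\<mu> i = (cmod (cip (column i E) w))^2" for i
  using diag_eigenvalue[OF \<mu>, of i] unfolding sesq_rank1 complex_norm_square[symmetric] by simp
 obtain i0 where i0: "!!i. i ~= i0 ==> \<mu> i = 0"
  using off \<mu>e by (metis norm_zero power_zero_numeral)
 have t1: "tr (mat 1) (rank1 w) = (SUM i:UNIV. \<mu> i)"
  unfolding tr_orthonormal[OF E] diag_eigenvalue[OF \<mu>] ..
 have "matrix_inv (mat 1 :: complex^'n^'n) = mat 1"
  using pd_inverse(1)[OF pd_mat1] by simp
 hence "tr (mat 1) (rank1 w) = (SUM j:UNIV. Re (cnj (w $ j) * w $ j))"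
  by (simp add: tr_def trace_def rank1_def)
 moreover have "Re (cnj x * x) = (cmod x)^2" for x
  unfolding cmod_power2 by (simp add: power2_eq_square)
 ultimately have "tr (mat 1) (rank1 w) = (norm w)^2"
  by (simp add: norm_vec_def L2_set_def sum_nonneg)
 moreover have "(SUM i:UNIV. \<mu> i) = \<mu> i0 + (SUM i:UNIV - {i0}. \<mu> i)" by (rule sum.remove) auto
 ultimately have m0: "\<mu> i0 = (norm w)^2" using i0 t1 by simp
 have "cong E (a *\<^sub>R mat 1 - b *\<^sub>R rank1 w) $ i $ j = diagm (%i. a - b * \<mu> i) $ i $ j" for i j
  using arg_cong[OF E, of "%M. M $ i $ j"] arg_cong[OF \<mu>, of "%M. M $ i $ j"]
  unfolding cong_nth sesq_matrix_diff sesq_matrix_scaleR by (simp add: diagm_def mat_def)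
 hence "cong E (a *\<^sub>R mat 1 - b *\<^sub>R rank1 w) = diagm (%i. a - b * \<mu> i)" by (simp add: vec_eq_iff)
 from det_diag_ratio[OF pd_mat1 E this]
 have "Re (det (a *\<^sub>R mat 1 - b *\<^sub>R rank1 w)) = (\<Prod>i\<in>UNIV. a - b * \<mu> i)" by simp
 also have "... = (a - b * \<mu> i0) * (\<Prod>i\<in>UNIV - {i0}. a - b * \<mu> i)" by (rule prod.remove) auto
 also have "(\<Prod>i\<in>UNIV - {i0}. a - b * \<mu> i) = (\<Prod>i\<in>UNIV - {i0}. a)" by (rule prod.cong) (auto simp: i0)
 finally show ?thesis using m0 by (simp add: card_Diff_singleton)
qed

lemma smooth_on_real_deriv:
 fixes F :: "real => real"
 assumes "smooth_on UNIV F"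
 shows "smooth_on UNIV (deriv F)" "(F has_real_derivative deriv F x) (at x)"
proof -
 have d: "(F has_real_derivative dv 1 F x) (at x)" for x
 proof -
  have "((%s. F (0 + s *\<^sub>R 1)) has_vector_derivative dv 1 F (0 + x *\<^sub>R 1)) (at x)"
   by (rule dv_path[OF open_UNIV assms]) simp
  thus ?thesis by (simp add: has_real_derivative_iff_has_vector_derivative)
 qed
 hence "deriv F = dv 1 F" by (auto simp: fun_eq_iff intro!: DERIV_imp_deriv)
 thus "smooth_on UNIV (deriv F)" "(F has_real_derivative deriv F x) (at x)"
  using smooth_on_dv[OF open_UNIV assms] d by simp_all
qed

text \<open>Composed with a logarithm, \<open>F\<close> leaves the pole untouched below
  \<open>x0\<close> and switches it off above \<open>x1\<close>. The bounds start at
  \<open>x0\<close> because below it the explicit form \<open>F x = x\<close> takes over.\<close>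

lemma log_cutoff:
 fixes x0 x1 :: real
 assumes x: "x0 < x1" "x1 <= 0"
 obtains F C where "smooth_on UNIV F" "C > 0" "!!x. F x <= 0"
  "!!x. x < x0 ==> F x = x & deriv F x = 1 & deriv (deriv F) x = 0"
  "!!x. x1 <= x ==> F x = 0"
  "!!x. x0 <= x ==> \<bar>F x\<bar> <= C & \<bar>deriv F x\<bar> <= C & \<bar>deriv (deriv F) x\<bar> <= C"
proof -
 define D where "D x = flat_exp 0 (x1 - x) + flat_exp 0 (x - x0)" for x
 \<comment> \<open>The identity times a smooth step that falls from 1 to 0 between \<open>x0\<close>
   and \<open>x1\<close>.\<close>
 define F where "F x = x * (flat_exp 0 (x1 - x) / D x)" for x
 have pos: "flat_exp 0 y > 0" if "y > 0" for y using that by (simp add: flat_exp_def)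
 have D: "D x > 0" for x
  using pos[of "x1 - x"] pos[of "x - x0"] flat_exp_nonneg[of 0 "x1 - x"] flat_exp_nonneg[of 0 "x - x0"] x(1)
  unfolding D_def by (cases "x < x1") (auto intro: add_pos_nonneg add_nonneg_pos)
 have fe: "smooth_on UNIV (%x. flat_exp 0 (x1 - x))" "smooth_on UNIV (%x. flat_exp 0 (x - x0))"
  by (rule smooth_on_compose[OF _ _ _ smooth_on_flat_exp]; auto intro!: smooth_intros)+
 have F: "smooth_on UNIV F"
  unfolding F_def[abs_def] by (intro smooth_intros fe open_UNIV) (use D in \<open>auto simp: D_def[abs_def] intro!: smooth_intros fe less_imp_neq[symmetric]\<close>)
 have Flow: "F x = x" if "x <= x0" for x
  using that D[of x] by (simp add: F_def D_def) (simp add: flat_exp_def)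
 have Fhigh: "F x = 0" if "x1 <= x" for x
  using that by (simp add: F_def) (simp add: flat_exp_def)
 have Fneg: "F x <= 0" for x
 proof (cases "x1 <= x")
  case False
  thus ?thesis using x D[of x] flat_exp_nonneg[of 0 "x1 - x"] unfolding F_def
   by (intro mult_nonpos_nonneg divide_nonneg_pos) auto
 qed (simp add: Fhigh)
 note F1 = smooth_on_real_deriv[OF F]
 note F2 = smooth_on_real_deriv[OF F1(1)]
 have dlow: "deriv F x = 1" if "x < x0" for x
 proof (rule DERIV_imp_deriv)
  show "(F has_real_derivative 1) (at x)"
   by (rule has_field_derivative_transform_within_open[OF DERIV_ident, of "{..<x0}"]) (use that Flow in auto)
 qed
 have ddlow: "deriv (deriv F) x = 0" if "x < x0" for x
 proof (rule DERIV_imp_deriv)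
  show "(deriv F has_real_derivative 0) (at x)"
   by (rule has_field_derivative_transform_within_open[OF DERIV_const[of 1], of "{..<x0}"]) (use that dlow in auto)
 qed
 have dhigh: "deriv F x = 0" if "x1 < x" for x
 proof (rule DERIV_imp_deriv)
  show "(F has_real_derivative 0) (at x)"
   by (rule has_field_derivative_transform_within_open[OF DERIV_const[of 0], of "{x1<..}"]) (use that Fhigh in auto)
 qed
 have ddhigh: "deriv (deriv F) x = 0" if "x1 < x" for x
 proof (rule DERIV_imp_deriv)
  show "(deriv F has_real_derivative 0) (at x)"
   by (rule has_field_derivative_transform_within_open[OF DERIV_const[of 0], of "{x1<..}"]) (use that dhigh in auto)
 qed
 have bd: "EX C>0. ALL x:{x0..x1}. \<bar>G x\<bar> <= C" if "smooth_on UNIV G" for G :: "real => real"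
 proof -
  have "compact (G ` {x0..x1})"
   by (intro compact_continuous_image continuous_on_subset[OF smooth_continuous[OF that]]) auto
  thus ?thesis using compact_imp_bounded[of "G ` {x0..x1}"] unfolding bounded_pos by auto
 qed
 obtain C0 C1 C2 where C: "C0 > 0" "C1 > 0" "C2 > 0" "ALL x:{x0..x1}. \<bar>F x\<bar> <= C0"
  "ALL x:{x0..x1}. \<bar>deriv F x\<bar> <= C1" "ALL x:{x0..x1}. \<bar>deriv (deriv F) x\<bar> <= C2"
  using bd[OF F] bd[OF F1(1)] bd[OF F2(1)] by metis
 show ?thesis
 proof (rule that[OF F, of "C0 + C1 + C2"])
  show "C0 + C1 + C2 > 0" using C by simp
  show "\<bar>F x\<bar> <= C0 + C1 + C2 & \<bar>deriv F x\<bar> <= C0 + C1 + C2 & \<bar>deriv (deriv F) x\<bar> <= C0 + C1 + C2" if "x0 <= x" for x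
  proof (cases "x <= x1")
   case True
   hence "\<bar>F x\<bar> <= C0" "\<bar>deriv F x\<bar> <= C1" "\<bar>deriv (deriv F) x\<bar> <= C2" using C(4-) that by auto
   thus ?thesis using C(1-3) by auto
  qed (use Fhigh dhigh ddhigh C in auto)
 qed (use Fneg Flow dlow ddlow Fhigh in auto)
qed

context
 fixes F :: "real => real" and e2 :: real and p :: "complex^'n::finite"
 assumes F: "smooth_on UNIV F" and e2: "e2 > 0"
begin

text \<open>\<open>e2\<close> is the square of the smoothing radius, so \<open>ln (tq z)\<close> is
  a regularised logarithm of the squared distance to \<open>p\<close>.\<close>

definition "tq z = (norm (z - p))^2 + e2"

definition "tf z = F (ln (tq z))"

lemma tq_pos: "tq z > 0" and tq_ge: "e2 <= tq z"
 using e2 by (auto simp: tq_def add_nonneg_pos)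

lemma smooth_on_tf: "open S ==> smooth_on S tf"
 unfolding tf_def[abs_def] tq_def
 by (rule smooth_on_compose[OF _ open_UNIV _ F]) (use tq_pos in \<open>auto intro!: smooth_intros smooth_on_norm_square simp: tq_def\<close>)

lemma levi_tf:
 "Re (levi tf z v v) = deriv F (ln (tq z)) / tq z * (norm v)^2
   + (deriv (deriv F) (ln (tq z)) - deriv F (ln (tq z))) / (tq z)^2 * (cmod (cip v (z - p)))^2"
proof -
 let ?J = "{- e2<..}"
 note d = smooth_on_real_deriv[OF F]
 note dd = smooth_on_real_deriv[OF d(1)]
 have J: "open ?J" by simp
 have ls: "smooth_on ?J (%s. ln (s + e2))" by (intro smooth_intros J) auto
 have s1: "smooth_on ?J (%s. F (ln (s + e2)))"
  by (rule smooth_on_compose[OF J open_UNIV ls F]) auto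
 have s2: "smooth_on ?J (%s. deriv F (ln (s + e2)) / (s + e2))"
  by (intro smooth_on_divide_real J smooth_on_compose[OF J open_UNIV ls d(1)] smooth_intros) auto
 have "Re (levi (%u. F (ln ((norm (u - p))^2 + e2))) z v v)
  = deriv F (ln ((norm (z - p))^2 + e2)) / ((norm (z - p))^2 + e2) * (norm v)^2
   + (deriv (deriv F) (ln ((norm (z - p))^2 + e2)) - deriv F (ln ((norm (z - p))^2 + e2))) / ((norm (z - p))^2 + e2)^2 * (cmod (cip v (z - p)))^2"
 proof (rule levi_radial[OF J s1 s2])
  fix s assume s: "s : ?J"
  have l: "((%s. ln (s + e2)) has_real_derivative 1 / (s + e2)) (at s)"
   using s by (auto intro!: derivative_eq_intros)
  show "((%s. F (ln (s + e2))) has_real_derivative deriv F (ln (s + e2)) / (s + e2)) (at s)"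
   using DERIV_chain2[OF d(2) l] by simp
  have 1: "((%s. deriv F (ln (s + e2))) has_real_derivative deriv (deriv F) (ln (s + e2)) * (1 / (s + e2))) (at s)"
   by (rule DERIV_chain2[OF dd(2) l])
  have "((%s. deriv F (ln (s + e2)) / (s + e2)) has_real_derivative
    (deriv (deriv F) (ln (s + e2)) * (1 / (s + e2)) * (s + e2) - deriv F (ln (s + e2)) * 1) / ((s + e2) * (s + e2))) (at s)"
   using s by (intro DERIV_divide 1) (auto intro!: derivative_eq_intros)
  thus "((%s. deriv F (ln (s + e2)) / (s + e2)) has_real_derivative (deriv (deriv F) (ln (s + e2)) - deriv F (ln (s + e2))) / (s + e2)^2) (at s)"
   using s by (simp add: power2_eq_square)
 next
  show "(norm (z - p))^2 : ?J" using e2 by (simp add: less_le_trans[OF _ zero_le_power2])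
 qed
 thus ?thesis by (simp add: tf_def[abs_def] tq_def)
qed

lemma cip_tq: "(cmod (cip v (z - p)))^2 <= (norm v)^2 * (tq z - e2)"
 using cmod_cip_le[of v "z - p"] by (simp add: tq_def)

lemma levi_tf_outer:
 assumes C: "\<bar>deriv F (ln (tq z))\<bar> <= C" "\<bar>deriv (deriv F) (ln (tq z))\<bar> <= C" and q: "b <= tq z" "b > 0"
 shows "\<bar>Re (levi tf z v v)\<bar> <= 3 * C / b * (norm v)^2"
proof -
 let ?q = "tq z" and ?F1 = "deriv F (ln (tq z))" and ?F2 = "deriv (deriv F) (ln (tq z))"
 have C0: "C >= 0" using C(1) by linarith
 have "(cmod (cip v (z - p)))^2 <= ?q * (norm v)^2"
 proof -
  have "(norm v)^2 * (?q - e2) = ?q * (norm v)^2 - e2 * (norm v)^2" by (simp add: algebra_simps)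
  moreover have "0 <= e2 * (norm v)^2" using e2 by simp
  ultimately show ?thesis using cip_tq[of v z] by linarith
 qed
 hence 1: "(cmod (cip v (z - p)))^2 / ?q^2 <= (norm v)^2 / ?q"
  using tq_pos[of z] by (simp add: field_simps power2_eq_square)
 have "\<bar>Re (levi tf z v v)\<bar> <= \<bar>?F1\<bar> * ((norm v)^2 / ?q) + \<bar>?F2 - ?F1\<bar> * ((cmod (cip v (z - p)))^2 / ?q^2)"
  unfolding levi_tf by (rule order_trans[OF abs_triangle_ineq]) (use tq_pos[of z] in \<open>simp add: abs_mult\<close>)
 also have "... <= C * ((norm v)^2 / ?q) + (2 * C) * ((norm v)^2 / ?q)"
  using C C0 1 tq_pos[of z] by (intro add_mono mult_mono) auto
 also have "... = 3 * C * ((norm v)^2 / ?q)" by simp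
 also have "... <= 3 * C * ((norm v)^2 / b)" using C0 q by (intro mult_left_mono divide_left_mono) auto
 finally show ?thesis by simp
qed

text \<open>Where \<open>F\<close> is the identity, smoothing leaves a strictly positive Levi form.
  The lower bound \<open>e2 / (tq z)^2\<close> is of order \<open>1 / e2\<close> within distance
  \<open>sqrt e2\<close> of the pole, and this is the source of the mass there.\<close>

lemma
 assumes "deriv F (ln (tq z)) = 1" "deriv (deriv F) (ln (tq z)) = 0"
 shows levi_tf_inner: "Re (levi tf z v v) = (norm v)^2 / tq z - (cmod (cip v (z - p)))^2 / (tq z)^2"
  and levi_tf_inner_ge: "e2 / (tq z)^2 * (norm v)^2 <= Re (levi tf z v v)"
proof -
 show *: "Re (levi tf z v v) = (norm v)^2 / tq z - (cmod (cip v (z - p)))^2 / (tq z)^2"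
  unfolding levi_tf assms by simp
 have "e2 / (tq z)^2 * (norm v)^2 = (norm v)^2 / tq z - (norm v)^2 * (tq z - e2) / (tq z)^2"
  using tq_pos[of z] by (simp add: field_simps power2_eq_square)
 also have "... <= Re (levi tf z v v)" unfolding * by (intro diff_left_mono divide_right_mono cip_tq) simp
 finally show "e2 / (tq z)^2 * (norm v)^2 <= Re (levi tf z v v)" .
qed

end

text \<open>The bounding form is a multiple of the identity minus a rank one form, so its
  determinant is explicit: the large factor \<open>C + d / q\<close> occurs n - 1 times, while in
  the direction of \<open>w\<close> the pole nearly cancels.\<close>

lemma det_psh_log_le:
 fixes H :: "complex^'n::finite^'n"
 assumes H: "pd H" and le: "!!v. qf H v <= (C + d / q) * (norm v)^2 - d / q^2 * (cmod (cip v w))^2"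
  and C: "C > 0" and d: "d >= 0" and q: "q > 0" "(norm w)^2 <= q"
 shows "Re (det H) <= (C + d / q) ^ (CARD('n) - 1) * (C + d / q - d / q^2 * (norm w)^2)"
proof -
 define A where "A = (C + d / q) *\<^sub>R mat 1 - (d / q^2) *\<^sub>R rank1 w"
 have A: "qf A v = (C + d / q) * (norm v)^2 - d / q^2 * (cmod (cip v w))^2" for v
  unfolding A_def sesq_matrix_diff sesq_matrix_scaleR minus_complex.sel Re_complex_of_real_mult Re_sesq_mat1 sesq_rank1
  by (simp add: complex_norm_square[symmetric] del: of_real_power)
 have "0 < qf A v" if "v ~= 0" for v
 proof -
  have "d / q^2 * (cmod (cip v w))^2 <= d / q^2 * ((norm v)^2 * q)"
   using order_trans[OF cmod_cip_le[of v w] mult_left_mono[OF q(2), of "(norm v)^2"]] d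
   by (intro mult_left_mono) auto
  also have "... = d / q * (norm v)^2" using q by (simp add: power2_eq_square)
  finally have "C * (norm v)^2 <= qf A v" unfolding A by (simp add: algebra_simps)
  moreover have "0 < C * (norm v)^2" using C that by simp
  ultimately show ?thesis by linarith
 qed
 hence pA: "pd A" unfolding pd_def A_def by (auto intro!: herm_diff herm_scaleR herm_mat1 herm_rank1)
 have "Re (det H) <= Re (det A)"
 proof (rule det_le_of_form_le[OF pA])
  show "herm H" using H by (simp add: pd_def)
  show "0 <= qf H v" for v using H unfolding pd_def by (cases "v = 0") (auto simp: less_imp_le)
  show "qf H v <= qf A v" for v using le A by simp
 qed
 thus ?thesis unfolding A_def det_rank1_update .
qed

text \<open>Used with \<open>k\<close> equal to n - 1. It separates a spread-out part of the
  density, of order \<open>1 / q ^ k\<close>, from the concentrated Monge-Ampere part of the pole,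
  which alone carries the full power of \<open>d\<close>. The cases are whether the background
  \<open>C\<close> or the pole \<open>d / q\<close> dominates.\<close>

lemma log_density_split:
 fixes C d q e2 :: real
 assumes C: "C >= 1" and d: "0 < d" "d <= 1" and q: "0 < q" "q <= 1" and e2: "0 < e2" "e2 <= q"
 shows "(C + d / q) ^ k * (C + d * e2 / q^2) <= (2 * C) ^ Suc k / q ^ k + 2 ^ Suc k * d ^ Suc k * e2 / q ^ (k + 2)"
proof (cases "d / q <= C")
 case True
 have "d * e2 / q^2 = (d / q) * (e2 / q)" by (simp add: power2_eq_square)
 also have "... <= C * 1" using True e2 q d C by (intro mult_mono) auto
 finally have "(C + d / q) ^ k * (C + d * e2 / q^2) <= (2 * C) ^ k * (2 * C)"
  using True C q d e2 by (intro mult_mono power_mono) auto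
 also have "... = (2 * C) ^ Suc k / 1" by simp
 also have "... <= (2 * C) ^ Suc k / q ^ k" using C q by (intro divide_left_mono power_le_one) auto
 finally show ?thesis using d e2 q by (simp add: add_increasing2)
next
 case False
 have "(C + d / q) ^ k * (C + d * e2 / q^2) <= (2 * d / q) ^ k * (C + d * e2 / q^2)"
  using False C q d e2 by (intro mult_right_mono power_mono) auto
 also have "... = (2 * d) ^ k / q ^ k * C + (2 * d) ^ k * d * e2 / q ^ (k + 2)"
  using q by (simp add: power_divide algebra_simps power_add power2_eq_square add_divide_distrib)
 also have "... <= (2 * C) ^ Suc k / q ^ k + 2 ^ Suc k * d ^ Suc k * e2 / q ^ (k + 2)"
 proof (rule add_mono)
  have "(2 * d) ^ k * C <= (2 * C) ^ k * (2 * C)" using C d by (intro mult_mono power_mono) auto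
  thus "(2 * d) ^ k / q ^ k * C <= (2 * C) ^ Suc k / q ^ k"
   using divide_right_mono[of "(2 * d) ^ k * C" "(2 * C) ^ k * (2 * C)" "q ^ k"] q by (simp add: mult.commute)
  have "(2 * d) ^ k * d * e2 <= 2 ^ Suc k * d ^ Suc k * e2"
   using d e2 by (intro mult_right_mono) (auto simp: power_mult_distrib)
  thus "(2 * d) ^ k * d * e2 / q ^ (k + 2) <= 2 ^ Suc k * d ^ Suc k * e2 / q ^ (k + 2)"
   using q by (intro divide_right_mono) auto
 qed
 finally show ?thesis .
qed

section \<open>Integration over dyadic balls\<close>

lemma dyadic_index:
 fixes q :: real
 assumes "(1/4) ^ m <= q" "q <= 1"
 shows "EX k<=m. (1/4) ^ Suc k < q & q <= (1/4) ^ k"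
 using assms(1)
proof (induction m)
 case 0
 thus ?case using assms(2) by auto
next
 case (Suc m)
 consider "(1/4) ^ m <= q" | "(1/4) ^ Suc m < q" "q < (1/4) ^ m" | "q = (1/4) ^ Suc m" using Suc.prems by linarith
 thus ?case
 proof cases
  case 1
  thus ?thesis using Suc.IH le_SucI by blast
 next
  case 2
  thus ?thesis by (intro exI[of _ m]) auto
 next
  case 3
  have "((1/4) :: real) ^ Suc (Suc m) < (1/4) ^ Suc m" by (rule power_strict_decreasing) auto
  hence "Suc m <= Suc m & (1/4) ^ Suc (Suc m) < q & q <= (1/4) ^ Suc m" unfolding 3 by (simp del: power_Suc)
  thus ?thesis by blast
 qed
qed

lemma sum_linear_quarter: "(\<Sum>k\<le>m. real (Suc k) * (1/4) ^ k) <= 2"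
proof -
 have "real (Suc k) <= 2 ^ k" for k by (metis of_nat_mono Suc_leI less_exp of_nat_numeral of_nat_power)
 hence "(\<Sum>k\<le>m. real (Suc k) * (1/4) ^ k) <= (\<Sum>k\<le>m. 2 ^ k * (1/4) ^ k)"
  by (intro sum_mono mult_right_mono) auto
 also have "... = (\<Sum>k\<le>m. (1/2) ^ k)" by (simp add: power_mult_distrib[symmetric])
 also have "... = 2 - (1/2) ^ m" by (induction m) auto
 also have "... <= 2" by simp
 finally show ?thesis .
qed

lemma sum_quarter_power: "(1/4) ^ m * (\<Sum>k\<le>m. 4 ^ k) <= (2::real)"
proof -
 have "3 * (\<Sum>k\<le>m. 4 ^ k) = (4 * 4 ^ m - 1 :: real)" by (induction m) auto
 hence "(1/4) ^ m * (3 * (\<Sum>k\<le>m. 4 ^ k)) = (1/4) ^ m * (4 * 4 ^ m - 1 :: real)" by simp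
 hence "3 * ((1/4) ^ m * (\<Sum>k\<le>m. 4 ^ k)) = 4 * ((1/4) ^ m * 4 ^ m) - (1/4 :: real) ^ m"
  by (simp only: right_diff_distrib mult.left_commute mult_1_right)
 also have "(1/4) ^ m * 4 ^ m = (1 :: real)" by (simp add: power_mult_distrib[symmetric])
 also have "4 * 1 - (1/4) ^ m <= (4 :: real)" by simp
 finally show ?thesis by simp
qed

lemma measure_dyadic_ball:
 fixes p :: "complex^'n::finite"
 shows "measure lborel (cball p ((1/2) ^ k)) = unit_ball_vol (2 * CARD('n)) * (1/4) ^ (k * CARD('n))"
proof -
 have "measure lborel (cball p ((1/2) ^ k)) = unit_ball_vol (DIM(complex^'n)) * ((1/2) ^ k) ^ DIM(complex^'n)"
  by (rule content_cball) simp
 also have "((1/2) ^ k) ^ DIM(complex^'n) = ((1/4) :: real) ^ (k * CARD('n))"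
 proof -
  have "((1/2) ^ k) ^ DIM(complex^'n) = (((1/2) :: real) ^ 2) ^ (k * CARD('n))"
   unfolding power_mult[symmetric] by (simp add: mult_ac)
  thus ?thesis by (simp add: power2_eq_square)
 qed
 finally show ?thesis by (simp add: mult.commute)
qed

text \<open>Points with \<open>q\<close> between two successive powers of 1/4 lie in a ball of
  radius \<open>(1/2) ^ k\<close>, of volume of order \<open>(1/4) ^ (k * n)\<close>. In the first
  term \<open>- ln q\<close> is bounded by a multiple of \<open>k + 1\<close> and the series
  converges; in the second it is bounded by a multiple of \<open>m\<close> and what remains is
  geometric. So only \<open>b\<close> is multiplied by \<open>m\<close>.\<close>

lemma dyadic_integral_bound:
 fixes p :: "complex^'n::finite" and g :: "complex^'n => real"
 defines "U \<equiv> unit_ball_vol (2 * CARD('n))"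
 assumes g: "integrable lborel g" and a: "a >= 0" and b: "b >= 0" and K: "K >= 0"
  and le: "!!z. g z <= K * indicator (cball p 1) z \<or> 
   (let q = (norm (z - p))^2 + (1/4) ^ m in q <= 1 & g z <= - ln q * (a / q ^ (CARD('n) - 1) + b * (1/4) ^ m / q ^ (CARD('n) + 1)))"
 shows "(LBINT z. g z) <= K * U + 2 * ln 4 * U * 4 ^ CARD('n) * (a + 4 * b * real m)"
proof -
 define n where "n = CARD('n)"
 have n: "n >= 1" by (simp add: n_def Suc_le_eq)
 define c where "c k = real (Suc k) * ln 4 * a * 4 ^ (Suc k * (n - 1)) + real m * ln 4 * b * (1/4) ^ m * 4 ^ (Suc k * (n + 1))" for k
 have l4: "ln 4 > (0::real)" by simp
 have c0: "c k >= 0" for k unfolding c_def using a b l4 by simp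
 define R where "R z = K * indicator (cball p 1) z + (\<Sum>k\<le>m. c k * indicator (cball p ((1/2) ^ k)) z)" for z
 have ib: "integrable lborel (indicator (cball p r) :: _ => real)" for r
  using emeasure_lborel_cball_finite[of p r] by (intro integrable_real_indicator) auto
 have R: "integrable lborel R" unfolding R_def[abs_def] by (intro Bochner_Integration.integrable_add integrable_mult_right Bochner_Integration.integrable_sum ib)
 have "g z <= R z" for z
 proof -
  define q where "q = (norm (z - p))^2 + (1/4) ^ m"
  have s0: "0 <= (\<Sum>k\<le>m. c k * indicator (cball p ((1/2) ^ k)) z)" by (intro sum_nonneg mult_nonneg_nonneg c0) auto
  from le[of z] show ?thesis
  proof
   assume "g z <= K * indicator (cball p 1) z"
   thus ?thesis using s0 by (simp add: R_def)
  next
   assume "let q = (norm (z - p))^2 + (1/4) ^ m in q <= 1 & g z <= - ln q * (a / q ^ (CARD('n) - 1) + b * (1/4) ^ m / q ^ (CARD('n) + 1))"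
   hence q1: "q <= 1" and gq: "g z <= - ln q * (a / q ^ (n - 1) + b * (1/4) ^ m / q ^ (n + 1))"
    by (auto simp: Let_def q_def n_def)
   have qm: "(1/4) ^ m <= q" by (simp add: q_def)
   hence q0: "q > 0" by (rule less_le_trans[rotated]) simp
   obtain k where k: "k <= m" "(1/4) ^ Suc k < q" "q <= (1/4) ^ k" using dyadic_index[OF qm q1] by blast
   have "ln ((1/4 :: real) ^ j) = - (real j * ln 4)" for j by (simp add: ln_realpow ln_div)
   hence lk: "- ln q <= real (Suc k) * ln 4" "- ln q <= real m * ln 4"
    using k(2) qm q0 ln_le_cancel_iff[of "(1/4) ^ Suc k" q] ln_le_cancel_iff[of "(1/4) ^ m" q] by (auto simp del: power_Suc)
   have lq: "0 <= - ln q" using q0 q1 by simp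
   have iq: "1 / q ^ j <= 4 ^ (Suc k * j)" for j
   proof -
    have "(1/4) ^ (Suc k * j) <= q ^ j" unfolding power_mult using k(2) by (intro power_mono) auto
    hence "1 / q ^ j <= 1 / (1/4) ^ (Suc k * j)" using q0 by (intro divide_left_mono mult_pos_pos) auto
    thus ?thesis by (simp add: power_one_over)
   qed
   have "- ln q * (a * (1 / q ^ (n - 1))) <= (real (Suc k) * ln 4) * (a * 4 ^ (Suc k * (n - 1)))"
    using lk lq iq a q0 by (intro mult_mono) auto
   moreover have "- ln q * (b * (1/4) ^ m * (1 / q ^ (n + 1))) <= (real m * ln 4) * (b * (1/4) ^ m * 4 ^ (Suc k * (n + 1)))"
    using lk lq iq[of "n + 1"] b q0 by (intro mult_mono) auto
   ultimately have "g z <= c k" using gq unfolding c_def by (simp add: algebra_simps)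
   also have "norm (z - p) <= (1/2) ^ k"
   proof (rule power2_le_imp_le)
    have "(norm (z - p))^2 <= q" by (simp add: q_def)
    also have "... <= (1/4) ^ k" by (rule k(3))
    also have "... = ((1/2) ^ k)^2" by (simp add: power2_eq_square power_mult_distrib[symmetric])
    finally show "(norm (z - p))^2 <= ((1/2) ^ k)^2" .
   qed simp
   hence "c k = c k * indicator (cball p ((1/2) ^ k)) z" by (simp add: dist_norm norm_minus_commute)
   also have "... <= (\<Sum>k\<le>m. c k * indicator (cball p ((1/2) ^ k)) z)"
    by (rule member_le_sum) (use k c0 in auto)
   also have "... <= R z" unfolding R_def using K by simp
   finally show ?thesis .
  qed
 qed
 hence "(LBINT z. g z) <= (LBINT z. R z)" by (rule integral_mono[OF g R])
 also have "... = K * measure lborel (cball p 1) + (\<Sum>k\<le>m. c k * measure lborel (cball p ((1/2) ^ k)))"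
 proof -
  have 1: "integrable lborel (%z. K * indicator (cball p 1) z :: real)" by (intro integrable_mult_right ib)
  have 2: "integrable lborel (%z. c k * indicator (cball p ((1/2) ^ k)) z :: real)" for k by (intro integrable_mult_right ib)
  show ?thesis unfolding R_def Bochner_Integration.integral_add[OF 1 Bochner_Integration.integrable_sum[OF 2]] Bochner_Integration.integral_sum[OF 2]
   by (simp only: integral_mult_right_zero) (simp add: Bochner_Integration.integral_indicator)
 qed
 also have "measure lborel (cball p 1) = U" using measure_dyadic_ball[of p 0] by (simp add: U_def)
 also have "(\<Sum>k\<le>m. c k * measure lborel (cball p ((1/2) ^ k)))
  = (\<Sum>k\<le>m. ln 4 * U * 4 ^ (n - 1) * a * (real (Suc k) * (1/4) ^ k) + (ln 4 * U * 4 ^ (n + 1) * b * real m * (1/4) ^ m) * 4 ^ k)"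
 proof (rule sum.cong[OF refl])
  fix k
  obtain l where l: "n = Suc l" using n by (cases n) auto
  have "(4 :: real) ^ (Suc k * l) * (1/4) ^ (k * n) = 4 ^ l * (1/4) ^ k"
   by (simp add: l power_add power_divide field_simps)
  moreover have "(4 :: real) ^ (Suc k * (n + 1)) * (1/4) ^ (k * n) = 4 ^ (n + 1) * 4 ^ k"
   by (simp add: power_add power_divide field_simps)
  ultimately show "c k * measure lborel (cball p ((1/2) ^ k)) = ln 4 * U * 4 ^ (n - 1) * a * (real (Suc k) * (1/4) ^ k) + (ln 4 * U * 4 ^ (n + 1) * b * real m * (1/4) ^ m) * 4 ^ k"
   unfolding measure_dyadic_ball U_def[symmetric] unfolding n_def[symmetric] c_def l by (simp add: algebra_simps)
 qed
 also have "... = ln 4 * U * 4 ^ (n - 1) * a * (\<Sum>k\<le>m. real (Suc k) * (1/4) ^ k) + ln 4 * U * 4 ^ (n + 1) * b * real m * ((1/4) ^ m * (\<Sum>k\<le>m. 4 ^ k))"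
  by (simp add: sum.distrib sum_distrib_left mult.assoc)
 also have "... <= ln 4 * U * 4 ^ (n - 1) * a * 2 + ln 4 * U * 4 ^ (n + 1) * b * real m * 2"
  using a b l4 by (intro add_mono mult_left_mono sum_linear_quarter sum_quarter_power) (auto simp: U_def)
 also have "... <= ln 4 * U * 4 ^ n * a * 2 + ln 4 * U * 4 ^ (n + 1) * b * real m * 2"
  using a l4 n by (intro add_mono mult_right_mono mult_left_mono power_increasing) (auto simp: U_def)
 also have "... = 2 * ln 4 * U * 4 ^ n * (a + 4 * b * real m)" by (simp add: algebra_simps)
 finally show ?thesis by (simp add: n_def)
qed

lemma sum_Basis_complex_vec: "(SUM i:Basis. g (i :: complex^'n::finite)) = (SUM j:UNIV. g (axis j 1) + g (axis j \<i>))"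
proof -
 have inj: "inj_on (%(j, u). axis j u :: complex^'n) (UNIV \<times> {1, \<i>})"
  by (auto simp: inj_on_def axis_eq_axis)
 have "Basis = (%(j, u). axis j u :: complex^'n) ` (UNIV \<times> {1, \<i>})"
  by (auto simp: Basis_vec_def Basis_complex_def image_iff)
 hence "(SUM i:Basis. g i) = (SUM (j, u):UNIV \<times> {1, \<i>}. g (axis j u :: complex^'n))"
  using sum.reindex[OF inj, of g] by (simp add: case_prod_unfold o_def)
 also have "... = (SUM j:UNIV. SUM u:{1, \<i>}. g (axis j u))" by (rule sum.cartesian_product[symmetric])
 finally show ?thesis by simp
qed

lemma supp_set_integrable:
 assumes "supp_in U K g" "continuous_on U g"
 shows "set_integrable lborel U g"
proof -
 have "ext0 U g = (%z. indicator U z *\<^sub>R g z)" by (auto simp: ext0_def fun_eq_iff indicator_def)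
 thus ?thesis using integrable_ext0[OF assms] unfolding set_integrable_def by simp
qed

text \<open>The shape comes from \<open>bump 0 1\<close>: the derivative of
  \<open>flat_exp 0\<close> is \<open>flat_exp 2\<close>, and the inner function
  \<open>1 - |w|^2\<close> contributes the factor 2.\<close>

definition mvb :: "complex^'n::finite => real" where
 "mvb w = 2 * flat_exp 2 (1 - (norm w)^2)"

lemma mvb_nonneg: "0 <= mvb w" by (simp add: mvb_def flat_exp_nonneg)

lemma mvb_zero: "1 <= norm w ==> mvb w = 0"
 by (simp add: mvb_def flat_exp_def not_less)

lemma mvb_le: "mvb w <= 4"
proof -
 have "flat_exp 2 x <= 2" for x :: real
 proof (cases "x > 0")
  case True
  define y where "y = inverse x"
  have y: "y > 0" using True by (simp add: y_def)
  have "1 + y + y^2 / 2 <= exp y" using exp_lower_Taylor_quadratic[of y] y by simp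
  hence "y^2 <= 2 * exp y" using y by (simp add: field_simps)
  hence "y^2 * exp (- y) <= 2 * exp y * exp (- y)" by (intro mult_right_mono) auto
  also have "... = 2" by (simp add: exp_minus)
  finally show ?thesis using True by (simp add: flat_exp_def y_def)
 qed (simp add: flat_exp_def)
 thus ?thesis by (simp add: mvb_def)
qed

lemma smooth_on_mvb: "open S ==> smooth_on S (mvb :: complex^'n::finite => real)"
proof -
 assume S: "open S"
 have "smooth_on S (%w :: complex^'n. 1 - (norm w)^2)"
  using smooth_on_norm_square[OF S, of 0] by (auto intro!: smooth_intros S)
 from smooth_on_compose[OF S open_UNIV this smooth_on_flat_exp[of 2]]
 show ?thesis unfolding mvb_def[abs_def] by (auto intro!: smooth_intros S)
qed

lemma dv_bump: "dv i (bump 0 1) w = - (w \<bullet> i) * mvb w" for w :: "complex^'n::finite"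
proof (rule has_derivative_imp_dv)
 have "((%w. 1^2 - (norm (w - 0))^2) has_derivative (%h. - (2 * (w \<bullet> h)))) (at w)"
  unfolding power2_norm_eq_inner by (auto intro!: derivative_eq_intros simp: inner_commute)
 from has_derivative_compose[OF this flat_exp_deriv[of 0, unfolded has_field_derivative_def]]
 show "(bump 0 1 has_derivative (%i. - (w \<bullet> i) * mvb w)) (at w)"
  unfolding bump_def[abs_def] mvb_def by (simp add: mult_ac numeral_2_eq_2)
qed

text \<open>Since \<open>mvb w\<close> times \<open>w\<close> is minus the gradient of \<open>bump 0 1\<close>, the radial derivative of the weighted
 averages of \<open>f\<close> around \<open>p\<close> is an average of the Laplacian of \<open>f\<close>.\<close>

theorem weighted_mean_value:
 fixes f :: "complex^'n::finite => real"
 assumes U: "open U" and f: "smooth_on U f" and r: "cball p r \<subseteq> U" "0 < ep" "2 * ep <= r"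
  and N: "0 <= N" "!!z v. z : cball p r ==> norm v = 1 ==> Re (levi f z v v) <= N"
 shows "(LBINT w:ball 0 2. mvb w * f (p + ep *\<^sub>R w))
  <= f p * (LBINT w:ball 0 2. mvb (w :: complex^'n)) + 2 * real CARD('n) * N * ep^2 * (LBINT w:ball 0 2. bump 0 1 (w :: complex^'n))"
proof -
 let ?W = "ball 0 2 :: (complex^'n) set" and ?K = "cball 0 1 :: (complex^'n) set"
 have W: "open ?W" "compact ?K" "?K \<subseteq> ?W" by auto
 have inU: "p + s *\<^sub>R w : cball p r" if "s : {0..ep}" "w : ?W" for s w
 proof -
  have "norm (s *\<^sub>R w) <= ep * 2" using that by (auto intro!: mult_mono)
  thus ?thesis using r by (simp add: dist_norm)
 qed
 have inU': "p + s *\<^sub>R w : U" if "s : {0..ep}" "w : ?W" for s w using inU[OF that] r by auto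
 note df = smooth_on_dv[OF U f]
 have m0: "mvb w = 0" if "w : ?W - ?K" for w :: "complex^'n" using that by (intro mvb_zero) auto
 have b0: "bump 0 1 w = 0" if "w : ?W - ?K" for w :: "complex^'n" using that by (intro bump_zero) auto
 define D where "D s w = (SUM i:Basis. mvb w * (w \<bullet> i) * dv i f (p + s *\<^sub>R w))" for s w
 define a where "a s = (LBINT w:?W. mvb w * f (p + s *\<^sub>R w))" for s
 define Ia where "Ia = (LBINT w:?W. bump 0 1 w)"
 have Dd: "mvb w * dv w f (p + s *\<^sub>R w) = D s w" if "s : {0..ep}" "w : ?W" for s w
 proof -
  interpret L: bounded_linear "%v. dv v f (p + s *\<^sub>R w)" by (rule dv_linear[OF U f inU'[OF that]])
  have "dv w f (p + s *\<^sub>R w) = dv (SUM i:Basis. (w \<bullet> i) *\<^sub>R i) f (p + s *\<^sub>R w)" by (simp only: euclidean_representation)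
  also have "... = (SUM i:Basis. (w \<bullet> i) * dv i f (p + s *\<^sub>R w))"
   unfolding L.sum L.scaleR real_scaleR_def ..
  finally show ?thesis by (simp add: D_def sum_distrib_left mult.assoc)
 qed
 have path: "continuous_on ({0..ep} \<times> ?W) (%q. p + fst q *\<^sub>R snd q)" by (intro continuous_intros)
 have da: "(a has_real_derivative (LBINT w:?W. D s w)) (at s within {0..ep})" if s: "s : {0..ep}" for s
  unfolding a_def[abs_def]
 proof (rule lint_param_derivative[OF W])
  show "((%s. mvb w * f (p + s *\<^sub>R w)) has_real_derivative D s w) (at s within {0..ep})" if "s : {0..ep}" "w : ?W" for s w
  proof -
   have "((%s. f (p + s *\<^sub>R w)) has_real_derivative dv w f (p + s *\<^sub>R w)) (at s)"
    using dv_path[OF U f inU'[OF that]] by (simp add: has_real_derivative_iff_has_vector_derivative)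
   from DERIV_cmult[OF this, of "mvb w"] show ?thesis unfolding Dd[OF that] by (rule has_field_derivative_at_within)
  qed
  show "continuous_on ?W (%w. mvb w * f (p + s *\<^sub>R w))" if "s : {0..ep}" for s
   by (intro continuous_on_mult smooth_continuous[OF smooth_on_mvb[OF W(1)]]
    continuous_on_compose2[OF smooth_continuous[OF f], of _ "%w. p + s *\<^sub>R w"] continuous_intros) (use inU' that in auto)
  have "continuous_on ({0..ep} \<times> ?W) (%q. D (fst q) (snd q))" unfolding D_def
   by (intro continuous_on_sum continuous_on_mult continuous_on_compose2[OF smooth_continuous[OF smooth_on_mvb[OF W(1)]], of _ snd]
     continuous_on_compose2[OF smooth_continuous[OF df] path] continuous_intros) (use inU' in auto)
  thus "continuous_on ({0..ep} \<times> ?W) (%(s, w). D s w)" by (simp add: case_prod_unfold)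
 qed (use s m0 in \<open>auto simp: D_def\<close>)
 have lap: "(LBINT w:?W. D s w) <= s * (4 * real CARD('n) * N * Ia)" if s: "s : {0..ep}" for s
 proof -
  have aff: "smooth_on ?W (%w. p + s *\<^sub>R w)" by (intro smooth_intros W)
  have sub: "(%w. p + s *\<^sub>R w) ` ?W \<subseteq> U" using inU'[OF s] by auto
  have c1: "continuous_on ?W (%w. g (p + s *\<^sub>R w))" if "smooth_on U g" for g :: "_ => real"
   by (rule smooth_continuous[OF smooth_on_compose[OF W(1) U aff that sub]])
  have i1: "set_integrable lborel ?W (%w. mvb w * (w \<bullet> i) * dv i f (p + s *\<^sub>R w))" for i
   by (rule supp_set_integrable[where K="?K"], use W m0 in \<open>simp add: supp_in_def\<close>)
     (intro continuous_on_mult smooth_continuous[OF smooth_on_mvb[OF W(1)]] c1 df continuous_intros)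
  have i2: "set_integrable lborel ?W (%w. s * (bump 0 1 w * dv i (dv i f) (p + s *\<^sub>R w)))" for i
   by (rule supp_set_integrable[where K="?K"], use W b0 in \<open>simp add: supp_in_def\<close>)
     (intro continuous_on_mult smooth_continuous[OF smooth_on_bump[OF W(1)]] c1 smooth_on_dv[OF U df] continuous_intros)
  \<comment> \<open>Integration by parts moves the weight onto second derivatives of
    \<open>f\<close>; the factor \<open>s\<close> is the inner derivative of the dilation.\<close>
  have parts: "(LBINT w:?W. mvb w * (w \<bullet> i) * dv i f (p + s *\<^sub>R w)) = (LBINT w:?W. s * (bump 0 1 w * dv i (dv i f) (p + s *\<^sub>R w)))" for i
  proof -
   have sg: "smooth_on ?W (%w. dv i f (p + s *\<^sub>R w))" by (rule smooth_on_compose[OF W(1) U aff df sub])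
   have "(LBINT w:?W. dv i (%w. bump 0 1 w * dv i f (p + s *\<^sub>R w)) w) = 0"
    by (rule lint_dv_zero[where K="?K"]) (use W b0 in \<open>auto simp: supp_in_def intro!: smooth_intros smooth_on_bump sg\<close>)
   also have "(LBINT w:?W. dv i (%w. bump 0 1 w * dv i f (p + s *\<^sub>R w)) w)
    = (LBINT w:?W. s * (bump 0 1 w * dv i (dv i f) (p + s *\<^sub>R w)) - mvb w * (w \<bullet> i) * dv i f (p + s *\<^sub>R w))"
   proof (rule set_lebesgue_integral_cong)
    show "ALL w. w : ?W \<longrightarrow> dv i (%w. bump 0 1 w * dv i f (p + s *\<^sub>R w)) w
     = s * (bump 0 1 w * dv i (dv i f) (p + s *\<^sub>R w)) - mvb w * (w \<bullet> i) * dv i f (p + s *\<^sub>R w)"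
    proof (intro allI impI)
     fix w assume w: "w : ?W"
     have "dv i (%w. dv i f (p + s *\<^sub>R w)) w = dv (dv i (%w. p + s *\<^sub>R w) w) (dv i f) (p + s *\<^sub>R w)"
      by (rule dv_compose[OF W(1) U aff df inU'[OF s w] w])
     also have "dv i (%w. p + s *\<^sub>R w) w = s *\<^sub>R i"
      by (rule has_derivative_imp_dv) (auto intro!: derivative_eq_intros)
     also have "dv (s *\<^sub>R i) (dv i f) (p + s *\<^sub>R w) = s * dv i (dv i f) (p + s *\<^sub>R w)"
      using linear_scale[OF bounded_linear.linear[OF dv_linear[OF U df inU'[OF s w]]], of s i] by simp
     finally show "dv i (%w. bump 0 1 w * dv i f (p + s *\<^sub>R w)) w
      = s * (bump 0 1 w * dv i (dv i f) (p + s *\<^sub>R w)) - mvb w * (w \<bullet> i) * dv i f (p + s *\<^sub>R w)"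
      using dv_mult[OF W(1) smooth_on_bump[OF W(1)] sg w, of i 0 1] by (simp add: dv_bump)
    qed
   qed simp
   also have "... = (LBINT w:?W. s * (bump 0 1 w * dv i (dv i f) (p + s *\<^sub>R w))) - (LBINT w:?W. mvb w * (w \<bullet> i) * dv i f (p + s *\<^sub>R w))"
    by (rule set_integral_diff(2)[OF i2 i1])
   finally show ?thesis by simp
  qed
  have "(LBINT w:?W. D s w) = (SUM i:Basis. LBINT w:?W. mvb w * (w \<bullet> i) * dv i f (p + s *\<^sub>R w))"
   unfolding D_def by (rule set_lint_sum[OF finite_Basis i1])
  also have "... = (SUM i:Basis. LBINT w:?W. s * (bump 0 1 w * dv i (dv i f) (p + s *\<^sub>R w)))"
   by (simp only: parts)
  also have "... = (LBINT w:?W. (SUM i:Basis. s * (bump 0 1 w * dv i (dv i f) (p + s *\<^sub>R w))))"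
   by (rule set_lint_sum[OF finite_Basis i2, symmetric])
  also have "... <= (LBINT w:?W. s * (4 * real CARD('n) * N) * bump 0 1 w)"
  proof (rule set_integral_mono)
   show "set_integrable lborel ?W (%w. SUM i:Basis. s * (bump 0 1 w * dv i (dv i f) (p + s *\<^sub>R w)))"
    unfolding set_integrable_def scaleR_sum_right
    by (rule Bochner_Integration.integrable_sum) (use i2 in \<open>simp add: set_integrable_def\<close>)
   show "set_integrable lborel ?W (%w. s * (4 * real CARD('n) * N) * bump 0 1 w)"
    by (rule supp_set_integrable[where K="?K"], use W b0 in \<open>simp add: supp_in_def\<close>)
      (intro continuous_on_mult smooth_continuous[OF smooth_on_bump[OF W(1)]] continuous_intros)
   fix w assume w: "w : ?W"
   have "(SUM i:Basis. dv i (dv i f) (p + s *\<^sub>R w)) = (SUM j:UNIV. 4 * Re (levi f (p + s *\<^sub>R w) (axis j 1) (axis j 1)))"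
    unfolding sum_Basis_complex_vec levi_real[OF U f inU'[OF s w]] i_axis by (simp add: add_divide_distrib)
   also have "... <= (SUM j:(UNIV :: 'n set). 4 * N)"
    by (intro sum_mono mult_left_mono N(2) inU[OF s w]) (auto simp: norm_axis_1)
   finally have "(SUM i:Basis. dv i (dv i f) (p + s *\<^sub>R w)) <= 4 * real CARD('n) * N" by simp
   hence "(s * bump 0 1 w) * (SUM i:Basis. dv i (dv i f) (p + s *\<^sub>R w)) <= (s * bump 0 1 w) * (4 * real CARD('n) * N)"
    using s by (intro mult_left_mono mult_nonneg_nonneg bump_nonneg) auto
   thus "(SUM i:Basis. s * (bump 0 1 w * dv i (dv i f) (p + s *\<^sub>R w))) <= s * (4 * real CARD('n) * N) * bump 0 1 w"
    by (simp add: sum_distrib_left mult_ac)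
  qed
  also have "... = s * (4 * real CARD('n) * N) * Ia" unfolding Ia_def by (rule set_integral_mult_right)
  finally show ?thesis by (simp add: mult.assoc)
 qed
 have ca: "continuous_on {0..ep} a" by (rule DERIV_continuous_on, rule da)
 \<comment> \<open>The derivative of the average at radius \<open>s\<close> is bounded by a multiple
   of \<open>s\<close>; subtracting the primitive of that bound leaves a nonincreasing
   function.\<close>
 have "a ep - 2 * real CARD('n) * N * Ia * ep^2 <= a 0 - 2 * real CARD('n) * N * Ia * 0^2"
 proof (rule DERIV_nonpos_imp_decreasing_open[of 0 ep "%s. a s - 2 * real CARD('n) * N * Ia * s^2"])
  show "continuous_on {0..ep} (%s. a s - 2 * real CARD('n) * N * Ia * s^2)" by (intro continuous_intros ca)
  fix s assume s: "0 < s" "s < ep"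
  have s1: "s : {0..ep}" "s : interior {0..ep}" using s by auto
  have "((%s. a s - 2 * real CARD('n) * N * Ia * s^2) has_real_derivative (LBINT w:?W. D s w) - 2 * real CARD('n) * N * Ia * (2 * s)) (at s)"
   by (rule DERIV_diff[OF da[OF s1(1), unfolded at_within_interior[OF s1(2)]]])
     (auto intro!: derivative_eq_intros)
  moreover have "(LBINT w:?W. D s w) - 2 * real CARD('n) * N * Ia * (2 * s) <= 0" using lap[OF s1(1)] by (simp add: mult_ac)
  ultimately show "EX y. ((%s. a s - 2 * real CARD('n) * N * Ia * s^2) has_real_derivative y) (at s) & y <= 0" by blast
 qed (use r in simp)
 moreover have "a 0 = f p * (LBINT w:?W. mvb w)"
  unfolding a_def by (simp add: mult.commute[of _ "f p"])
 ultimately show ?thesis unfolding a_def Ia_def by (simp add: mult_ac)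
qed

context cmanifold
begin

text \<open>Nothing is known about the position of the minimum point in the final argument, so one
  radius and one constant have to serve balls centred anywhere.\<close>

lemma good_balls:
 assumes \<kappa>: "kf \<kappa>"
 obtains r C where "0 < r" "r <= 1/2" "C >= 1"
  "!!x. EX c:A. x : fst c & cball (snd c x) r \<subseteq> im c &
   (ALL z:cball (snd c x) r. ALL v. (norm v)^2 <= C * qf (\<kappa> c z) v & qf (\<kappa> c z) v <= C * (norm v)^2)"
proof -
 define P where "P c D \<longleftrightarrow> (ALL z0:Kc c. cball z0 (1/D) \<subseteq> im c &
  (ALL z:cball z0 (1/D). ALL v. (norm v)^2 <= D * qf (\<kappa> c z) v & qf (\<kappa> c z) v <= D * (norm v)^2))" for c and D :: real
 \<comment> \<open>Asking for all larger constants makes the property monotone by construction, as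
   \<open>uniform_const\<close> requires.\<close>
 define Q where "Q c D \<longleftrightarrow> (ALL E>=D. P c E)" for c and D :: real
 have ex: "EX D>0. Q c D" if cP: "c : PC" for c
 proof -
  have c: "c : A" using PC cP by auto
  obtain e where e: "e > 0" "(\<Union>x\<in>Kc c. cball x e) \<subseteq> im c"
   using compact_subset_open_imp_cball_epsilon_subset[OF Kc_compact[OF cP] open_image[OF c] Kc_sub[OF cP]] by blast
  define K where "K = {x + y | x y. x : Kc c & y : cball 0 e}"
  have K: "compact K" unfolding K_def by (rule compact_sums[OF Kc_compact[OF cP] compact_cball])
  have Kin: "z : K" if "z0 : Kc c" "z : cball z0 e" for z z0
  proof -
   have "z = z0 + (z - z0)" "z - z0 : cball 0 e" using that by (auto simp: dist_norm norm_minus_commute)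
   thus ?thesis unfolding K_def using that(1) by blast
  qed
  have Ks: "K \<subseteq> im c"
  proof
   fix z assume "z : K"
   then obtain x y where "x : Kc c" "y : cball 0 e" "z = x + y" by (auto simp: K_def)
   hence "x : Kc c" "z : cball x e" by (auto simp: dist_norm)
   thus "z : im c" using e(2) by blast
  qed
  have ck: "continuous_on K (\<kappa> c)" using smooth_continuous[OF kf_smooth[OF \<kappa> c]] continuous_on_subset Ks by blast
  have pk: "pd (\<kappa> c z)" if "z : K" for z using that Ks kf_pd[OF \<kappa> c] by auto
  obtain C1 where C1: "C1 > 0" "!!z v. z : K ==> qf (mat 1) v <= C1 * qf (\<kappa> c z) v"
   using form_bound[OF K ck continuous_on_const pk] by blast
  obtain C2 where C2: "C2 > 0" "!!z v. z : K ==> qf (\<kappa> c z) v <= C2 * qf (mat 1) v"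
   using form_bound[OF K continuous_on_const ck pd_mat1] by blast
  have "Q c (C1 + C2 + 1/e)" unfolding Q_def
  proof (intro allI impI)
   fix D assume D: "D >= C1 + C2 + 1/e"
   have ie: "1/e > 0" using e(1) by simp
   have D0: "D > 0" "1/e <= D" using D C1(1) C2(1) ie by linarith+
   have "1/D <= 1/(1/e)" by (rule divide_left_mono[OF D0(2) zero_le_one mult_pos_pos[OF D0(1) ie]])
   hence De: "1/D <= e" by simp
   have sub: "cball z0 (1/D) \<subseteq> cball z0 e" for z0 :: "complex^'n" using De by auto
   show "P c D" unfolding P_def
   proof (intro ballI conjI allI)
    fix z0 assume z0: "z0 : Kc c"
    show "cball z0 (1/D) \<subseteq> im c" using sub e(2) z0 by blast
    fix z v assume "z : cball z0 (1/D)"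
    hence z: "z : K" using Kin[OF z0] sub by blast
    have k0: "0 <= qf (\<kappa> c z) v" using kf_nonneg[OF \<kappa> c] z Ks by blast
    have "(norm v)^2 <= C1 * qf (\<kappa> c z) v" using C1(2)[OF z, of v] by (simp add: Re_sesq_mat1)
    also have "... <= D * qf (\<kappa> c z) v" using D C2(1) ie by (intro mult_right_mono k0) linarith
    finally show "(norm v)^2 <= D * qf (\<kappa> c z) v" .
    have "qf (\<kappa> c z) v <= C2 * (norm v)^2" using C2(2)[OF z, of v] by (simp add: Re_sesq_mat1)
    also have "... <= D * (norm v)^2" using D C1(1) ie by (intro mult_right_mono zero_le_power2) linarith
    finally show "qf (\<kappa> c z) v <= D * (norm v)^2" .
   qed
  qed
  moreover have "C1 + C2 + 1/e > 0" using C1(1) C2(1) e(1) by (simp add: add_pos_pos)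
  ultimately show ?thesis by blast
 qed
 obtain D where D: "D > 0" "!!c. c : PC ==> Q c D"
  by (rule uniform_const[OF PC(1), of Q]) (use ex in \<open>auto simp: Q_def\<close>)
 show ?thesis
 proof (rule that[of "1/(D + 2)" "D + 2"])
  fix x
  obtain c where c: "c : PC" "x : fst c" "snd c x : Kc c" by (rule Kc_cover)
  have "P c (D + 2)" using D(2)[OF c(1)] by (simp add: Q_def)
  thus "EX c:A. x : fst c & cball (snd c x) (1/(D+2)) \<subseteq> im c &
   (ALL z:cball (snd c x) (1/(D+2)). ALL v. (norm v)^2 <= (D+2) * qf (\<kappa> c z) v & qf (\<kappa> c z) v <= (D+2) * (norm v)^2)"
   using c PC unfolding P_def by blast
 qed (use D(1) in \<open>auto simp: field_simps\<close>)
qed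

text \<open>Positivity is transported from the chart \<open>c\<close> by the transition map; at
  points outside that chart the extension vanishes on a whole neighbourhood.\<close>

lemma ks_glob:
 assumes Q: "kf Q" and c: "c : A" and K: "supp_in (im c) K g" and g: "smooth_on (im c) g"
  and pd: "!!z. z : im c ==> pd (Q c z + levm g z)"
 shows "ks Q (glob c g)"
 unfolding ks_def
proof (intro conjI ballI)
 show s: "smooth_fun A (glob c g)" by (rule smooth_fun_glob[OF c K g])
 fix c' z assume c': "c' : A" and z: "z : im c'"
 show "pd (Q c' z + levm (loc c' (glob c g)) z)"
 proof (cases "chart_inv c' z : fst c")
  case True
  hence zo: "z : ov c' c" using ov_iff[OF c'] z by simp
  have w: "transition c' c z : im c" by (rule transition_maps(4)[OF c' c zo])
  have "levm (loc c (glob c g)) (transition c' c z) = levm g (transition c' c z)"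
   by (rule levm_cong_open[OF open_image[OF c] w]) (rule loc_glob[OF c])
  hence "Q c' z + levm (loc c' (glob c g)) z = cong (jac (transition c' c) z) (Q c (transition c' c z) + levm g (transition c' c z))"
   by (simp only: kf_cong[OF Q c' c zo] levm_transition[OF c' c zo s] cong_add)
  thus ?thesis using pd_cong[OF pd[OF w] jac_transition_nz[OF c' c zo]] by simp
 next
  case False
  then obtain W where W: "open W" "z : W" "!!y. y : W ==> loc c' (glob c g) y = 0"
   by (rule glob_vanish[OF c K c' z]) blast
  have "levm (loc c' (glob c g)) z = levm (%_. 0) z" by (rule levm_cong_open[OF W])
  thus ?thesis using kf_pd[OF Q c' z] by (simp add: levm_const)
 qed
qed

text \<open>The potential is \<open>d * F (ln (|z - z0|^2 + (1/4) ^ m))\<close>, extended by zero.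
  The density grows like the power n of \<open>4 ^ m\<close> on a ball whose volume shrinks at the
  same rate, so its mass there is independent of \<open>m\<close>. The constants depend on neither
  the centre nor the chart, \<open>d\<close> or \<open>m\<close>.\<close>

theorem test_function:
 fixes r Ck :: real
 assumes Q: "kf Q" and r: "0 < r" "r <= 1/2" and Ck: "Ck >= 1"
 obtains \<delta>0 A1 A2 m0 where "0 < \<delta>0" "\<delta>0 <= 1" "0 <= A1" "0 <= A2" "2 * (1/2) ^ m0 <= r"
  "!!c z0 d m. c : A ==> cball z0 r \<subseteq> im c ==>
   (!!z v. z : cball z0 r ==> (norm v)^2 <= Ck * qf (Q c z) v & qf (Q c z) v <= Ck * (norm v)^2) ==>
   0 < d ==> d <= \<delta>0 ==> m0 <= m ==>
   EX \<psi>. ks Q \<psi> & (ALL x. \<psi> x <= 0) &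
    FI (omega_pot Q \<psi>) (%x. - \<psi> x) <= A1 + A2 * d ^ (CARD('n) + 1) * real m &
    (ALL z. norm (z - z0) < (1/2) ^ m \<longrightarrow> (d / 4 * 4 ^ m) ^ CARD('n) <= Re (det (omega_pot Q \<psi> c z)))"
proof -
 \<comment> \<open>At distance \<open>r / 2\<close> and beyond, the argument of the logarithm is at
   least \<open>r^2 / 4\<close>, so the cut-off is complete inside the ball.\<close>
 define x1 where "x1 = ln (r^2 / 4)"
 define x0 where "x0 = x1 - 1"
 define b where "b = exp x0"
 have r2: "0 < r^2 / 4" "r^2 / 4 <= 1" using r power_mono[of r "1/2" 2] by (auto simp: power2_eq_square)
 have x: "x0 < x1" "x1 <= 0" using r2 by (auto simp: x0_def x1_def)
 have b: "b > 0" by (simp add: b_def)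
 obtain F C where F: "smooth_on UNIV F" and C: "C > 0" and Fneg: "!!x. F x <= 0"
  and Flow: "!!x. x < x0 ==> F x = x & deriv F x = 1 & deriv (deriv F) x = 0"
  and Fhigh: "!!x. x1 <= x ==> F x = 0"
  and Fb: "!!x. x0 <= x ==> \<bar>F x\<bar> <= C & \<bar>deriv F x\<bar> <= C & \<bar>deriv (deriv F) x\<bar> <= C"
  using log_cutoff[OF x] by metis
 define U where "U = unit_ball_vol (2 * CARD('n))"
 define cn where "cn = (fact CARD('n) * 2 ^ CARD('n) :: real)"
 \<comment> \<open>In the cut-off region the Levi form of the test function is bounded but has no
   sign; this choice keeps its contribution below half of \<open>Q\<close>.\<close>
 define \<delta>0 where "\<delta>0 = min 1 (b / (6 * C * Ck))"
 \<comment> \<open>These are the constants delivered by \<open>dyadic_integral_bound\<close>. Only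
   the concentrated part of the density enters \<open>A2\<close>; its n powers of \<open>d\<close>
   are joined by one more from the potential.\<close>
 define A1 where "A1 = cn * (C * (Ck + 1) ^ CARD('n) * U + 2 * ln 4 * U * 4 ^ CARD('n) * (2 * Ck) ^ CARD('n))"
 define A2 where "A2 = cn * (2 * ln 4 * U * 4 ^ CARD('n) * (4 * 2 ^ CARD('n)))"
 have U0: "U >= 0" by (simp add: U_def)
 have cn: "cn > 0" by (simp add: cn_def)
 \<comment> \<open>Makes the smoothing radius so small that the ball of radius
   \<open>(1/2) ^ m\<close> lies where \<open>F\<close> is still the identity.\<close>
 obtain m1 where m1: "(1/2 :: real) ^ m1 < min (r / 2) (b / 2)" using real_arch_pow_inv[of "min (r/2) (b/2)" "1/2"] r b by auto
 show ?thesis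
 proof (rule that[of \<delta>0 A1 A2 m1])
  show "0 < \<delta>0" "\<delta>0 <= 1" using b C Ck by (auto simp: \<delta>0_def)
  show "0 <= A1" "0 <= A2" unfolding A1_def A2_def using U0 cn C Ck by (auto intro!: mult_nonneg_nonneg add_nonneg_nonneg)
  show "2 * (1/2) ^ m1 <= r" using m1 by simp
  fix c z0 d m
  assume c: "c : A" and ball: "cball z0 r \<subseteq> im c"
   and bd: "!!z v. z : cball z0 r ==> (norm v)^2 <= Ck * qf (Q c z) v & qf (Q c z) v <= Ck * (norm v)^2"
   and d: "0 < d" "d <= \<delta>0" and m: "m1 <= m"
  have \<delta>1: "d <= 1" and \<delta>b: "d * (3 * C / b) <= 1 / (2 * Ck)"
  proof -
   show "d <= 1" using d by (simp add: \<delta>0_def)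
   have "d <= b / (6 * C * Ck)" using d by (simp add: \<delta>0_def)
   hence "d * (3 * C / b) <= b / (6 * C * Ck) * (3 * C / b)" using C b by (intro mult_right_mono) auto
   also have "... = 1 / (2 * Ck)" using b C Ck by (simp add: field_simps)
   finally show "d * (3 * C / b) <= 1 / (2 * Ck)" .
  qed
  define e2 where "e2 = (1/4 :: real) ^ m"
  have e2: "e2 > 0" by (simp add: e2_def)
  define q where "q = tq e2 z0"
  define f where "f = tf F e2 z0"
  define g where "g z = d * f z" for z
  note o = open_image[OF c]
  have q0: "q z > 0" "e2 <= q z" for z unfolding q_def using tq_pos[OF F e2] tq_ge[OF F e2] by auto
  have f_eq: "f z = F (ln (q z))" for z by (simp add: f_def q_def tf_def[OF F e2])
  have q_eq: "q z = (norm (z - z0))^2 + e2" for z by (simp add: q_def tq_def[OF F e2])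
  have fs: "smooth_on S f" if "open S" for S unfolding f_def by (rule smooth_on_tf[OF F e2 that])
  have gs: "smooth_on (im c) g" unfolding g_def[abs_def] by (intro smooth_intros o fs)
  have q_far: "x1 <= ln (q z)" if "r / 2 <= norm (z - z0)" for z
  proof -
   have "r^2 / 4 <= (norm (z - z0))^2" using power_mono[OF that, of 2] r by (simp add: power_divide)
   hence "r^2 / 4 <= q z" using e2 by (simp add: q_eq)
   thus ?thesis unfolding x1_def using r2 q0(1)[of z] by (subst ln_le_cancel_iff) auto
  qed
  have K: "supp_in (im c) (cball z0 (r/2)) g"
  proof -
   have "cball z0 (r/2) \<subseteq> cball z0 r" using r by auto
   hence "cball z0 (r/2) \<subseteq> im c" using ball by blast
   moreover have "g z = 0" if "z : im c - cball z0 (r/2)" for z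
    unfolding g_def f_eq using that by (subst Fhigh) (auto intro!: q_far simp: dist_norm norm_minus_commute)
   ultimately show ?thesis using o by (simp add: supp_in_def)
  qed
  have lg: "levm g z = d *\<^sub>R levm f z" for z
   unfolding g_def[abs_def] by (rule levm_scale[OF open_UNIV fs[OF open_UNIV] UNIV_I])
  have sf: "sesq (levm f z) v v = levi f z v v" for z v by (rule sesq_levm[OF open_UNIV fs[OF open_UNIV] UNIV_I])
  define H where "H z = Q c z + levm g z" for z
  have Hform: "qf (H z) v = qf (Q c z) v + d * Re (levi f z v v)" for z v
   unfolding H_def lg sesq_matrix_add sesq_matrix_scaleR sf by simp
  have inner: "Re (levi f z v v) = (norm v)^2 / q z - (cmod (cip v (z - z0)))^2 / (q z)^2"
   "e2 / (q z)^2 * (norm v)^2 <= Re (levi f z v v)" if "ln (q z) < x0" for z v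
   using levi_tf_inner[OF F e2, of z0 z v] levi_tf_inner_ge[OF F e2, of z0 z v] Flow[OF that] unfolding f_def q_def by auto
  have outer: "\<bar>d * Re (levi f z v v)\<bar> <= 1 / (2 * Ck) * (norm v)^2" if z: "x0 <= ln (q z)" for z v
  proof -
   have "b <= q z" using z q0(1)[of z] unfolding b_def by (metis exp_le_cancel_iff exp_ln)
   hence "\<bar>Re (levi f z v v)\<bar> <= 3 * C / b * (norm v)^2"
    using levi_tf_outer[OF F e2, of z0 z C b v] Fb[OF z] b unfolding f_def q_def by auto
   hence "d * \<bar>Re (levi f z v v)\<bar> <= d * (3 * C / b * (norm v)^2)" using d by (intro mult_left_mono) auto
   also have "... <= 1 / (2 * Ck) * (norm v)^2" using mult_right_mono[OF \<delta>b, of "(norm v)^2"] by (simp add: mult_ac)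
   finally show ?thesis using d by (simp add: abs_mult)
  qed
  have Hh: "herm (H z)" if "z : im c" for z
   unfolding H_def by (intro herm_add herm_levm[OF o gs that]) (use kf_pd[OF Q c that] in \<open>simp add: pd_def\<close>)
  have Hpd: "pd (H z)" if z: "z : im c" for z
  proof (cases "z : cball z0 r")
   case True
   note bz = bd[OF True]
   have "0 < qf (H z) v" if v: "v ~= 0" for v
   proof (cases "ln (q z) < x0")
    case True
    have "0 <= Re (levi f z v v)" using inner(2)[OF True, of v] e2 by (meson divide_nonneg_nonneg less_imp_le mult_nonneg_nonneg order_trans zero_le_power2)
    moreover have "0 < qf (Q c z) v" using kf_pd[OF Q c z] v by (simp add: pd_def)
    ultimately show ?thesis unfolding Hform using d by (simp add: add_pos_nonneg)
   next
    case False
    have n0: "0 < (norm v)^2" using v by simp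
    have "(norm v)^2 / Ck <= qf (Q c z) v" using bz[of v] Ck by (simp add: field_simps)
    moreover have "- (1 / (2 * Ck) * (norm v)^2) <= d * Re (levi f z v v)" using outer[of z v] False by linarith
    moreover have "(norm v)^2 / Ck - 1 / (2 * Ck) * (norm v)^2 > 0" using n0 Ck by (simp add: field_simps)
    ultimately show ?thesis unfolding Hform by linarith
   qed
   thus ?thesis using Hh[OF z] by (simp add: pd_def)
  next
   case False
   have W: "open (im c - cball z0 (r/2))" "z : im c - cball z0 (r/2)" using o z False r by auto
   have "levm g z = levm (%_. 0) z"
    by (rule levm_cong_open[OF W]) (use K in \<open>auto simp: supp_in_def\<close>)
   thus ?thesis using kf_pd[OF Q c z] by (simp add: H_def levm_const)
  qed
  define \<psi> where "\<psi> = glob c g"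
  have ks: "ks Q \<psi>" unfolding \<psi>_def
   by (rule ks_glob[OF Q c K gs]) (use Hpd in \<open>simp add: H_def\<close>)
  have g0: "g z <= 0" for z unfolding g_def f_eq using d Fneg by (simp add: mult_nonneg_nonpos)
  have \<psi>0: "\<psi> x <= 0" for x unfolding \<psi>_def glob_def using g0 by simp
  have om: "omega_pot Q \<psi> c z = H z" if z: "z : im c" for z
  proof -
   have "levm (loc c \<psi>) z = levm g z"
    by (rule levm_cong_open[OF o z]) (simp add: \<psi>_def loc_glob[OF c])
   thus ?thesis by (simp add: omega_pot_eq H_def)
  qed
  \<comment> \<open>On this ball \<open>q z\<close> is below \<open>2 * e2\<close>, so the lower
    bound \<open>e2 / (q z)^2\<close> is at least \<open>4 ^ m / 4\<close>.\<close>
  have low: "(d / 4 * 4 ^ m) ^ CARD('n) <= Re (det (omega_pot Q \<psi> c z))" if z: "norm (z - z0) < (1/2) ^ m" for z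
  proof -
   have mm: "(1/2 :: real) ^ m <= (1/2) ^ m1" using m by (intro power_decreasing) auto
   have "norm (z - z0) <= r" using z mm m1 r by linarith
   hence zb: "z : cball z0 r" by (simp add: dist_norm norm_minus_commute)
   have "(norm (z - z0))^2 < ((1/2) ^ m)^2" using z by (intro power_strict_mono) auto
   also have "((1/2) ^ m)^2 = e2" by (simp add: e2_def power2_eq_square power_mult_distrib[symmetric])
   finally have q2: "q z < 2 * e2" by (simp add: q_eq)
   have "e2 <= (1/2) ^ m" unfolding e2_def by (intro power_mono) auto
   hence "q z < b" using q2 mm m1 by linarith
   hence "ln (q z) < ln b" using q0[of z] b by simp
   hence lq: "ln (q z) < x0" by (simp add: b_def)
   have zi: "z : im c" using zb ball by blast
   have "(d / 4 * 4 ^ m) ^ CARD('n) * Re (det (mat 1 :: complex^'n^'n)) <= Re (det (H z))"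
   proof (rule det_ge_of_form_ge[OF pd_mat1 Hh[OF zi]])
    show "0 <= d / 4 * 4 ^ m" using d by simp
    fix v :: "complex^'n"
    have "(q z)^2 <= (2 * e2)^2" using q2 q0(1)[of z] by (intro power_mono) auto
    hence "e2 / (2 * e2)^2 <= e2 / (q z)^2" using e2 q0(1)[of z] by (intro divide_left_mono) auto
    moreover have "e2 / (2 * e2)^2 = 4 ^ m / 4" unfolding e2_def by (simp add: power2_eq_square field_simps power_one_over)
    ultimately have "4 ^ m / 4 <= e2 / (q z)^2" by (simp only:)
    hence "4 ^ m / 4 * (norm v)^2 <= e2 / (q z)^2 * (norm v)^2" by (rule mult_right_mono) simp
    also note inner(2)[OF lq, of v]
    finally have "4 ^ m / 4 * (norm v)^2 <= Re (levi f z v v)" .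
    hence "d * (4 ^ m / 4 * (norm v)^2) <= d * Re (levi f z v v)" using d by (intro mult_left_mono) auto
    thus "d / 4 * 4 ^ m * qf (mat 1) v <= qf (H z) v"
     unfolding Hform Re_sesq_mat1 using kf_nonneg[OF Q c zi, of v] by (simp add: mult_ac)
   qed
   thus ?thesis using om[OF zi] by simp
  qed
  have "FI (omega_pot Q \<psi>) (%x. - \<psi> x) <= A1 + A2 * d ^ (CARD('n) + 1) * real m"
  proof -
   have k\<psi>: "kf (omega_pot Q \<psi>)" by (rule ks_kf[OF ks Q])
   define G where "G z = - g z * Re (det (H z))" for z
   have Gs: "supp_in (im c) (cball z0 (r/2)) G" using K by (simp add: supp_in_def G_def)
   have Gc: "continuous_on (im c) G" unfolding G_def[abs_def] H_def
    by (intro continuous_on_mult continuous_on_minus smooth_continuous[OF gs]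
     smooth_continuous[OF smooth_on_Re[OF o smooth_on_det[OF o smooth_on_add[OF o kf_smooth[OF Q c] smooth_on_levm[OF o gs]]]]])
   have "FI (omega_pot Q \<psi>) (%x. - \<psi> x) = (LBINT z:im c. -1 * g z * vol_density (omega_pot Q \<psi>) c z)"
    using form_integral_glob[OF k\<psi> c K gs continuous_on_const, of "-1"] by (simp add: \<psi>_def)
   also have "... = (LBINT z:im c. cn * G z)"
    by (rule set_lebesgue_integral_cong) (use o om in \<open>auto simp: vol_density_def cn_def G_def\<close>)
   also have "... = cn * (LBINT z:im c. G z)" by (rule set_integral_mult_right)
   also have "(LBINT z:im c. G z) = (LBINT z. ext0 (im c) G z)" by (rule set_integral_ext0)
   also have "... <= (C * (Ck + 1) ^ CARD('n)) * unit_ball_vol (2 * CARD('n)) + 2 * ln 4 * unit_ball_vol (2 * CARD('n)) * 4 ^ CARD('n) * (d * (2 * Ck) ^ CARD('n) + 4 * (d * (2 ^ CARD('n) * d ^ CARD('n))) * real m)"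
   proof (rule dyadic_integral_bound[OF integrable_ext0[OF Gs Gc]])
    show "0 <= d * (2 * Ck) ^ CARD('n)" "0 <= d * (2 ^ CARD('n) * d ^ CARD('n))" "0 <= C * (Ck + 1) ^ CARD('n)"
     using d C Ck by auto
    fix z
    show "ext0 (im c) G z <= C * (Ck + 1) ^ CARD('n) * indicator (cball z0 1) z \<or>
     (let q = (norm (z - z0))^2 + (1/4) ^ m in q <= 1 & ext0 (im c) G z <= - ln q * (d * (2 * Ck) ^ CARD('n) / q ^ (CARD('n) - 1) + d * (2 ^ CARD('n) * d ^ CARD('n)) * (1/4) ^ m / q ^ (CARD('n) + 1)))"
    proof (cases "z : cball z0 (r/2)")
     case False
     hence "ext0 (im c) G z = 0" using Gs by (auto simp: ext0_def supp_in_def)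
     thus ?thesis using C Ck by simp
    next
     case True
     hence zr: "z : cball z0 r" and z1: "z : cball z0 1" using r by auto
     have zi: "z : im c" using zr ball by blast
     note bz = bd[OF zr]
     have dH: "0 < Re (det (H z))" by (rule pd_det(1)[OF Hpd[OF zi]])
     show ?thesis
     proof (cases "ln (q z) < x0")
      case lt: True
      have "ln (q z) < 0" using lt x by simp
      hence q1: "q z <= 1" using q0(1)[of z] by simp
      have "Re (det (H z)) <= (Ck + d / q z) ^ (CARD('n) - 1) * (Ck + d / q z - d / (q z)^2 * (norm (z - z0))^2)"
      proof (rule det_psh_log_le[OF Hpd[OF zi]])
       fix v
       have "qf (H z) v <= Ck * (norm v)^2 + d * ((norm v)^2 / q z - (cmod (cip v (z - z0)))^2 / (q z)^2)"
        unfolding Hform inner(1)[OF lt] using bz[of v] by simp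
       thus "qf (H z) v <= (Ck + d / q z) * (norm v)^2 - d / (q z)^2 * (cmod (cip v (z - z0)))^2"
        by (simp add: algebra_simps)
      qed (use Ck d q0(1)[of z] e2 in \<open>auto simp: q_eq\<close>)
      also have "Ck + d / q z - d / (q z)^2 * (norm (z - z0))^2 = Ck + d * e2 / (q z)^2"
      proof -
       have nq: "(norm (z - z0))^2 = q z - e2" by (simp add: q_eq)
       show ?thesis unfolding nq using q0(1)[of z] by (simp add: field_simps power2_eq_square)
      qed
      also have "(Ck + d / q z) ^ (CARD('n) - 1) * (Ck + d * e2 / (q z)^2)
       <= (2 * Ck) ^ Suc (CARD('n) - 1) / q z ^ (CARD('n) - 1) + 2 ^ Suc (CARD('n) - 1) * d ^ Suc (CARD('n) - 1) * e2 / q z ^ (CARD('n) - 1 + 2)"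
       by (rule log_density_split[OF Ck d(1) \<delta>1 q0(1) q1 e2 q0(2)])
      also have "Suc (CARD('n) - 1) = CARD('n)" by simp
      also have "CARD('n) - 1 + 2 = CARD('n) + 1" by (metis Suc_1 Suc_diff_1 add_Suc_right add_Suc Suc_eq_plus1 zero_less_card_finite)
      finally have det: "Re (det (H z)) <= (2 * Ck) ^ CARD('n) / q z ^ (CARD('n) - 1) + 2 ^ CARD('n) * d ^ CARD('n) * e2 / q z ^ (CARD('n) + 1)" .
      have "G z = - (d * ln (q z)) * Re (det (H z))" using Flow[OF lt] by (simp add: G_def g_def f_eq)
      also have "... <= - (d * ln (q z)) * ((2 * Ck) ^ CARD('n) / q z ^ (CARD('n) - 1) + 2 ^ CARD('n) * d ^ CARD('n) * e2 / q z ^ (CARD('n) + 1))"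
       using \<open>ln (q z) < 0\<close> d by (intro mult_left_mono det) (simp add: mult_nonneg_nonpos)
      also have "... = - ln (q z) * (d * (2 * Ck) ^ CARD('n) / q z ^ (CARD('n) - 1) + d * (2 ^ CARD('n) * d ^ CARD('n)) * e2 / q z ^ (CARD('n) + 1))"
       by (simp add: algebra_simps)
      finally show ?thesis using q1 zi by (auto simp: Let_def ext0_def q_eq e2_def)
     next
      \<comment> \<open>Away from the pole both the potential and the density are bounded, which is
        the alternative with the indicator of the unit ball.\<close>
      case ge: False
      define M where "M = (Ck + 1) *\<^sub>R (mat 1 :: complex^'n^'n)"
      have dM: "Re (det M) = (Ck + 1) ^ CARD('n)"
      proof -
       have "Re (det M) = (Ck + 1) ^ (CARD('n) - 1) * (Ck + 1)"
        using det_rank1_update[of "Ck + 1" 0 "0 :: complex^'n"] by (simp add: M_def)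
       also have "... = (Ck + 1) ^ Suc (CARD('n) - 1)" by (rule power_Suc2[symmetric])
       finally show ?thesis by simp
      qed
      have Mf: "qf M v = (Ck + 1) * (norm v)^2" for v
       unfolding M_def sesq_matrix_scaleR Re_complex_of_real_mult Re_sesq_mat1 ..
      have "pd M" unfolding pd_def using Ck Mf by (auto simp: M_def intro!: herm_scaleR herm_mat1 mult_pos_pos)
      hence "Re (det (H z)) <= Re (det M)"
      proof (rule det_le_of_form_le[OF _ Hh[OF zi]])
       fix v
       show "0 <= qf (H z) v" using Hpd[OF zi] unfolding pd_def by (cases "v = 0") (auto simp: less_imp_le)
       have "1 / (2 * Ck) <= 1" using Ck by simp
       hence "1 / (2 * Ck) * (norm v)^2 <= 1 * (norm v)^2" by (rule mult_right_mono) simp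
       moreover have "d * Re (levi f z v v) <= 1 / (2 * Ck) * (norm v)^2" using outer[of z v] ge by linarith
       ultimately show "qf (H z) v <= qf M v"
        unfolding Hform Mf using bz[of v] by (simp add: algebra_simps)
      qed
      hence "Re (det (H z)) <= (Ck + 1) ^ CARD('n)" by (simp only: dM)
      moreover have "- g z <= C"
      proof -
       have "\<bar>f z\<bar> <= C" using Fb[of "ln (q z)"] ge by (simp add: f_eq)
       hence "d * \<bar>f z\<bar> <= 1 * C" using d \<delta>1 by (intro mult_mono) auto
       moreover have "- g z <= d * \<bar>f z\<bar>" unfolding g_def using d abs_ge_minus_self[of "d * f z"] by (simp add: abs_mult)
       ultimately show ?thesis by simp
      qed
      ultimately have "G z <= C * (Ck + 1) ^ CARD('n)"
       unfolding G_def using g0[of z] dH C by (intro mult_mono) auto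
      thus ?thesis using z1 zi by (simp add: ext0_def)
     qed
    qed
   qed
   also have "... <= C * (Ck + 1) ^ CARD('n) * U + 2 * ln 4 * U * 4 ^ CARD('n) * ((2 * Ck) ^ CARD('n) + 4 * 2 ^ CARD('n) * (d ^ (CARD('n) + 1) * real m))"
   proof -
    have "d * (2 * Ck) ^ CARD('n) <= 1 * (2 * Ck) ^ CARD('n)" using \<delta>1 Ck by (intro mult_right_mono) auto
    hence "d * (2 * Ck) ^ CARD('n) + 4 * (d * (2 ^ CARD('n) * d ^ CARD('n))) * real m <= (2 * Ck) ^ CARD('n) + 4 * 2 ^ CARD('n) * (d ^ (CARD('n) + 1) * real m)"
     by (simp add: mult_ac)
    thus ?thesis unfolding U_def[symmetric] using U0 by (intro add_left_mono mult_left_mono) auto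
   qed
   finally have "FI (omega_pot Q \<psi>) (%x. - \<psi> x) <= cn * (C * (Ck + 1) ^ CARD('n) * U + 2 * ln 4 * U * 4 ^ CARD('n) * ((2 * Ck) ^ CARD('n) + 4 * 2 ^ CARD('n) * (d ^ (CARD('n) + 1) * real m)))"
    using cn by simp
   also have "... = A1 + A2 * d ^ (CARD('n) + 1) * real m" unfolding A1_def A2_def by (simp add: algebra_simps)
   finally show ?thesis .
  qed
  thus "EX \<psi>. ks Q \<psi> & (ALL x. \<psi> x <= 0) &
    FI (omega_pot Q \<psi>) (%x. - \<psi> x) <= A1 + A2 * d ^ (CARD('n) + 1) * real m &
    (ALL z. norm (z - z0) < (1/2) ^ m \<longrightarrow> (d / 4 * 4 ^ m) ^ CARD('n) <= Re (det (omega_pot Q \<psi> c z)))"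
   using ks \<psi>0 low by blast
 qed
qed

end

section \<open>The lower bound\<close>

lemma lint_scale:
 fixes g :: "'e::euclidean_space => real"
 assumes g: "g : borel_measurable borel" and ep: "ep > 0"
 shows "(LBINT z. g z) = ep ^ DIM('e) * (LBINT w. g (p + ep *\<^sub>R w))"
proof -
 have "(LBINT z. g z) = (LINT z|density (distr lborel borel (%x. p + ep *\<^sub>R x)) (%_. \<bar>ep\<bar> ^ DIM('e)). g z)"
  using lborel_affine[of ep p] ep by simp
 also have "... = (LINT z|distr lborel borel (%x. p + ep *\<^sub>R x). (\<bar>ep\<bar> ^ DIM('e)) *\<^sub>R g z)"
  by (rule integral_density) (use g in auto)
 also have "... = (LBINT w. (\<bar>ep\<bar> ^ DIM('e)) *\<^sub>R g (p + ep *\<^sub>R w))"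
  by (rule integral_distr) (use g in auto)
 finally show ?thesis using ep by simp
qed

lemma mvb_integral_pos: "0 < (LBINT w:ball 0 2. mvb (w :: complex^'n::finite))"
proof -
 have ge: "2 * exp (-2) <= mvb w" if "norm w <= 1/2" for w :: "complex^'n"
 proof -
  define x where "x = 1 - (norm w)^2"
  have "(norm w)^2 <= (1/2)^2" using that by (intro power_mono) auto
  hence x: "1/2 <= x" "x <= 1" by (auto simp: x_def power2_eq_square)
  hence "1 <= inverse x" "inverse x <= 2" by (auto simp: field_simps)
  hence "1 * exp (-2) <= inverse x ^ 2 * exp (- inverse x)" by (intro mult_mono) auto
  thus ?thesis using x by (simp add: mvb_def flat_exp_def x_def[symmetric])
 qed
 have s: "supp_in (ball 0 2) (cball 0 1) (mvb :: complex^'n => real)"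
  by (auto simp: supp_in_def mvb_zero)
 have i1: "integrable lborel (%w :: complex^'n. 2 * exp (-2) * indicator (cball 0 (1/2)) w :: real)"
  using emeasure_lborel_cball_finite[of "0 :: complex^'n" "1/2"] by (intro integrable_mult_right integrable_real_indicator) auto
 have i2: "integrable lborel (%w :: complex^'n. indicator (ball 0 2) w *\<^sub>R mvb w)"
  using supp_set_integrable[OF s smooth_continuous[OF smooth_on_mvb]] by (simp add: set_integrable_def)
 have "0 < 2 * exp (-2) * measure lborel (cball (0 :: complex^'n) ((1/2) ^ 1))"
  unfolding measure_dyadic_ball by simp
 also have "... = (LBINT w. 2 * exp (-2) * indicator (cball (0 :: complex^'n) (1/2)) w)" by simp
 also have "... <= (LBINT w. indicator (ball (0 :: complex^'n) 2) w *\<^sub>R mvb w)"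
  by (rule integral_mono[OF i1 i2]) (use ge mvb_nonneg in \<open>auto simp: indicator_def\<close>)
 finally show ?thesis by (simp add: set_lebesgue_integral_def)
qed

context cmanifold
begin

text \<open>Along the path \<open>s * P\<close> the derivative of the volume is the integral of a
  Laplacian.\<close>

lemma volume_invariant:
 assumes Q: "kf Q" and P: "ks Q P"
 shows "FI (omega_pot Q P) (%x. 1) = FI Q (%x. 1)"
proof -
 have om0: "omega_pot Q (%x. 0) = Q"
  by (intro ext) (simp add: omega_pot_eq levm_const)
 have 0: "ks Q (%x. 0)"
  using kf_pd[OF Q] by (simp add: ks_def smooth_fun_const levm_const)
 have ksP: "ks Q (%x. s * P x)" if "s : {0..1}" for s
  using ks_convex[OF 0 P, of s] that by simp
 have oU: "open (UNIV :: real set)" by simp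
 define a where "a s = FI (omega_pot Q (%x. s * P x)) (%x. 1)" for s
 have "(a has_real_derivative 0) (at s within {0..1})" if s: "s : {0..1}" for s
 proof -
  have "(a has_real_derivative FI (omega_pot Q (%x. s * P x)) (%x. 0 + 1 * lap (omega_pot Q (%x. s * P x)) P x)) (at s within {0..1})"
   unfolding a_def[abs_def]
   by (rule variation[OF Q, where J=UNIV and P="%s x. s * P x" and f="%_ _. 1" and f'="%_ _. 0" and P'="%_. P"])
     (use s ksP in \<open>auto intro!: fam_fun fam_mult fam_scalar oU ks_smooth[OF P] smooth_fun_const smooth_intros derivative_eq_intros\<close>)
  thus ?thesis using form_integral_lap[OF ks_kf[OF ksP[OF s] Q] ks_smooth[OF P]] by simp
 qed
 then obtain e where "!!s. s : {0..1} ==> a s = e"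
  using has_field_derivative_zero_constant[of "{0..1}" a] by auto
 hence "a 1 = a 0" by simp
 thus ?thesis by (simp add: a_def om0)
qed

text \<open>A quarter of the rescaled \<open>mvb\<close> is a cut-off function with values between 0
  and 1, since \<open>mvb\<close> is at most 4. Rescaling the integral produces the average that
  \<open>weighted_mean_value\<close> estimates.\<close>

lemma local_mass:
 assumes \<omega>: "kf \<omega>" and c: "c : A" and ep: "ep > 0" "cball z0 (2 * ep) \<subseteq> im c"
  and u: "continuous_on UNIV u" "!!x. 0 <= u x"
  and D: "!!z. norm (z - z0) < ep ==> D <= vol_density \<omega> c z" 
 shows "D / 4 * (ep^2) ^ CARD('n) * (LBINT w:ball 0 2. mvb w * loc c u (z0 + ep *\<^sub>R w)) <= FI \<omega> u"
proof -
 define b where "b z = mvb ((1 / ep) *\<^sub>R (z - z0)) / 4" for z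
 note o = open_image[OF c]
 have Ks: "cball z0 ep \<subseteq> im c" using ep by auto
 have bs: "smooth_on (im c) b"
  unfolding b_def[abs_def]
  by (intro smooth_on_divide_real smooth_on_compose[OF o open_UNIV _ smooth_on_mvb[OF open_UNIV]] smooth_intros o) auto
 have b0: "b z = 0" if "ep <= norm (z - z0)" for z
 proof -
  have "norm ((1 / ep) *\<^sub>R (z - z0)) = norm (z - z0) / ep" unfolding norm_scaleR using ep(1) by simp
  thus ?thesis unfolding b_def using that ep(1) by (subst mvb_zero) auto
 qed
 have b01: "0 <= b z" "b z <= 1" for z using mvb_nonneg mvb_le unfolding b_def by auto
 have K: "supp_in (im c) (cball z0 ep) b"
  using o Ks by (auto simp: supp_in_def dist_norm norm_minus_commute intro!: b0)
 define \<zeta> where "\<zeta> = glob c b"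
 have \<zeta>c: "continuous_on UNIV \<zeta>" unfolding \<zeta>_def by (rule smooth_fun_continuous[OF smooth_fun_glob[OF c K bs]])
 have \<zeta>01: "0 <= \<zeta> x" "\<zeta> x <= 1" for x using b01 by (auto simp: \<zeta>_def glob_def)
 have uc: "continuous_on (im c) (loc c u)" by (rule continuous_loc[OF u(1) c])
 define G where "G z = loc c u z * b z" for z
 have Gs: "supp_in (im c) (cball z0 ep) G" using K by (simp add: supp_in_def G_def)
 have Gc: "continuous_on (im c) G" unfolding G_def[abs_def] by (intro continuous_on_mult uc smooth_continuous[OF bs])
 have "D * (LBINT z:im c. G z) = (LBINT z:im c. D * G z)" by (rule set_integral_mult_right[symmetric])
 also have "... <= (LBINT z:im c. G z * vol_density \<omega> c z)"
 proof (rule set_integral_mono)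
  show "set_integrable lborel (im c) (%z. D * G z)"
   by (intro set_integrable_mult_right supp_set_integrable[OF Gs Gc])
  show "set_integrable lborel (im c) (%z. G z * vol_density \<omega> c z)"
   by (rule supp_set_integrable[where K="cball z0 ep"])
     (use Gs in \<open>auto simp: supp_in_def intro!: continuous_on_mult Gc smooth_continuous[OF smooth_vol_density[OF \<omega> c]]\<close>)
  fix z assume z: "z : im c"
  show "D * G z <= G z * vol_density \<omega> c z"
  proof (cases "norm (z - z0) < ep")
   case True
   have "0 <= G z" unfolding G_def using u(2) b01(1) by simp
   thus ?thesis using mult_right_mono[OF D[OF True], of "G z"] by (simp add: mult.commute)
  next
   case False
   thus ?thesis using b0[of z] by (simp add: G_def)
  qed
 qed
 also have "... = FI \<omega> (%x. u x * \<zeta> x)"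
  unfolding G_def \<zeta>_def by (rule form_integral_glob[OF \<omega> c K bs u(1), symmetric])
 also have "... <= FI \<omega> u"
  by (rule form_integral_mono[OF \<omega> continuous_on_mult[OF u(1) \<zeta>c] u(1)]) (use mult_left_le[OF \<zeta>01(2) u(2)] in simp)
 finally have 1: "D * (LBINT z:im c. G z) <= FI \<omega> u" .
 have "(LBINT z:im c. G z) = (LBINT z. ext0 (im c) G z)" by (rule set_integral_ext0)
 also have "... = ep ^ DIM(complex^'n) * (LBINT w. ext0 (im c) G (z0 + ep *\<^sub>R w))"
  by (rule lint_scale[OF borel_measurable_continuous_onI[OF continuous_on_ext0[OF Gs Gc]] ep(1)])
 also have "(LBINT w. ext0 (im c) G (z0 + ep *\<^sub>R w)) = (LBINT w:ball 0 2. (mvb w * loc c u (z0 + ep *\<^sub>R w)) / 4)"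
  unfolding set_lebesgue_integral_def
 proof (rule Bochner_Integration.integral_cong[OF refl])
  fix w :: "complex^'n"
  have bw: "b (z0 + ep *\<^sub>R w) = mvb w / 4" using ep by (simp add: b_def)
  show "ext0 (im c) G (z0 + ep *\<^sub>R w) = indicat_real (ball 0 2) w *\<^sub>R (mvb w * loc c u (z0 + ep *\<^sub>R w) / 4)"
  proof (cases "w : ball 0 2")
   case True
   hence "z0 + ep *\<^sub>R w : cball z0 (2 * ep)" using ep(1) by (simp add: dist_norm)
   thus ?thesis using True ep(2) bw by (auto simp: ext0_def G_def)
  next
   case False
   hence "mvb w = 0" by (intro mvb_zero) auto
   thus ?thesis using False bw by (simp add: ext0_def G_def)
  qed
 qed
 also have "... = (LBINT w:ball 0 2. mvb w * loc c u (z0 + ep *\<^sub>R w)) / 4" by (rule set_integral_divide_zero)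
 also have "ep ^ DIM(complex^'n) = (ep^2) ^ CARD('n)" by (simp add: power_mult[symmetric] mult.commute)
 finally have "D * (LBINT z:im c. G z) = D / 4 * (ep^2) ^ CARD('n) * (LBINT w:ball 0 2. mvb w * loc c u (z0 + ep *\<^sub>R w))"
  by simp
 thus ?thesis using 1 by (simp only:)
qed

end

context ma_flow
begin

theorem lower_bound:
 obtains M where "M > 0" "!!t x. 1 <= t ==> - M * (1 + t) <= \<eta> t x"
proof -
 obtain Cc where Cc: "Cc > 0"
  "!!T B t c z v. 1 <= T ==> 0 <= B ==> (!!t x. t : {1..T} ==> - B <= \<eta> t x) ==>
   t : {1..T} ==> c : A ==> z : im c ==>
   qf (h t c z) v <= exp (Cc * (1 + T + B)) * qf (Q c z) v"
  by (rule c2_bound) blast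
 obtain r Ck where r: "0 < r" "r <= 1/2" and Ck: "Ck >= 1" and good:
  "!!x. EX c:A. x : fst c & cball (snd c x) r \<subseteq> im c &
   (ALL z:cball (snd c x) r. ALL v. (norm v)^2 <= Ck * qf (Q c z) v & qf (Q c z) v <= Ck * (norm v)^2)"
  by (rule good_balls[OF Q]) blast
 obtain \<delta>0 A1 A2 m0 where \<delta>0: "0 < \<delta>0" "\<delta>0 <= 1" and A12: "0 <= A1" "0 <= A2" and m0: "2 * (1/2) ^ m0 <= r"
  and test: "!!c z0 d m. c : A ==> cball z0 r \<subseteq> im c ==>
   (!!z v. z : cball z0 r ==> (norm v)^2 <= Ck * qf (Q c z) v & qf (Q c z) v <= Ck * (norm v)^2) ==>
   0 < d ==> d <= \<delta>0 ==> m0 <= m ==>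
   EX \<psi>. ks Q \<psi> & (ALL x. \<psi> x <= 0) &
    FI (omega_pot Q \<psi>) (%x. - \<psi> x) <= A1 + A2 * d ^ (CARD('n) + 1) * real m &
    (ALL z. norm (z - z0) < (1/2) ^ m \<longrightarrow> (d / 4 * 4 ^ m) ^ CARD('n) <= Re (det (omega_pot Q \<psi> c z)))"
  by (rule test_function[OF Q r Ck]) blast
 define V where "V = FI Q (%x. 1)"
 define cn where "cn = (fact CARD('n) * 2 ^ CARD('n) :: real)"
 define Ib where "Ib = (LBINT w:ball 0 2. mvb (w :: complex^'n))"
 define Ia where "Ia = (LBINT w:ball 0 2. bump 0 1 (w :: complex^'n))"
 have cn: "cn > 0" by (simp add: cn_def)
 have Ib: "Ib > 0" unfolding Ib_def by (rule mvb_integral_pos)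
 have Ia: "Ia >= 0" unfolding Ia_def set_lebesgue_integral_def by (rule Bochner_Integration.integral_nonneg) (simp add: bump_nonneg)
 \<comment> \<open>The coefficient of \<open>d ^ n * B\<close> in the final inequality:
   \<open>cn / 4\<close> comes from \<open>local_mass\<close>, the power of 1/4 from the density of
   the test measure, \<open>Ib\<close> from the weight.\<close>
 define a where "a = cn / 4 * (1/4) ^ CARD('n) * Ib"
 have a: "a > 0" using cn Ib by (simp add: a_def)
 \<comment> \<open>By \<open>\<delta>a\<close>, the part of the error that is proportional to
   \<open>B\<close> is then at most half of the gain. The choice depends on neither \<open>T\<close>
   nor \<open>B\<close>.\<close>
 define d where "d = min \<delta>0 (a / (2 * (A2 * Cc + 1)))"
 have AC: "A2 * Cc + 1 > 0" using A12 Cc(1) by (simp add: add_nonneg_pos)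
 have d: "0 < d" "d <= \<delta>0" using \<delta>0 a AC by (auto simp: d_def)
 have \<delta>a: "A2 * Cc * d <= a / 2"
 proof -
  have "A2 * Cc * d <= (A2 * Cc + 1) * (a / (2 * (A2 * Cc + 1)))"
   using A12 Cc(1) d a AC by (intro mult_mono) (auto simp: d_def)
  moreover have "x * (a / (2 * x)) = a / 2" if "x > 0" for x using that by simp
  ultimately show ?thesis using AC by metis
 qed
 define K where "K = \<bar>V\<bar> + A1 + A2 * d ^ (CARD('n) + 1) * (real m0 + 1 + Cc) + cn / 4 * (d / 4) ^ CARD('n) * (2 * real CARD('n) * Ck * Ia)"
 have K: "K >= 0" unfolding K_def using A12 d cn Cc(1) Ck Ia by (intro add_nonneg_nonneg mult_nonneg_nonneg) auto
 define M where "M = 2 * K / (a * d ^ CARD('n)) + 1"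
 have M: "M > 0" unfolding M_def using K a d by (simp add: add_nonneg_pos)
 have "- M * (1 + T) <= \<eta> T x" if T: "1 <= T" for T x
 proof -
  \<comment> \<open>The minimum of \<eta> over space and \<open>[1,T]\<close> is found as a maximum
    of its negative.\<close>
  have neg: "smooth_fam {0<..} (%t x. 0 - \<eta> t x)" by (intro fam_diff \<eta> fam_scalar smooth_intros) auto
  obtain t1 p where t1: "t1 : {1..T}" and min0: "!!t y. t : {1..T} ==> 0 - \<eta> t y <= 0 - \<eta> t1 p"
   by (rule fam_attains_max[OF neg, of "{1..T}"]) (use T in auto)
  show ?thesis
  proof (cases "\<eta> t1 p >= 0")
   case True
   have "\<eta> T x >= 0" using min0[of T x] T True by auto
   moreover have "- M * (1 + T) <= 0" using M T by simp
   ultimately show ?thesis by linarith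
  next
   case False
   define B where "B = - \<eta> t1 p"
   have B: "B > 0" using False by (simp add: B_def)
   have minB: "- B <= \<eta> t y" if "t : {1..T}" for t y using min0[OF that, of y] by (simp add: B_def)
   have t1p: "t1 > 0" using t1 by simp
   define E where "E = Cc * (1 + T + B)"
   have E: "E >= 0" using Cc(1) T B by (simp add: E_def)
   \<comment> \<open>Large enough that \<open>ep^2 * exp E <= 1\<close>, as the exponential of 1 is
     below 4: the exponentially large bound on the metric then costs only a constant in the mean
     value inequality, while \<open>m\<close> grows only linearly in \<open>E\<close>.\<close>
   define m where "m = m0 + nat \<lceil>E\<rceil>"
   have m: "m0 <= m" "real m <= real m0 + 1 + E" using E by (auto simp: m_def) linarith+
   define ep where "ep = (1/2 :: real) ^ m"
   have ep: "ep > 0" by (simp add: ep_def)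
   have \<epsilon>2: "ep^2 = (1/4) ^ m" by (simp add: ep_def power2_eq_square power_mult_distrib[symmetric])
   have \<epsilon>r: "2 * ep <= r"
   proof -
    have "ep <= (1/2) ^ m0" unfolding ep_def using m by (intro power_decreasing) auto
    thus ?thesis using m0 by linarith
   qed
   have \<epsilon>E: "ep^2 * exp E <= 1"
   proof -
    have "exp E <= exp (real (nat \<lceil>E\<rceil>))" using E by (simp add: real_nat_ceiling_ge)
    also have "... = exp 1 ^ nat \<lceil>E\<rceil>" by (simp add: exp_of_nat_mult[symmetric])
    also have "... <= 4 ^ nat \<lceil>E\<rceil>" using exp_le by (intro power_mono) auto
    also have "... <= 4 ^ m" by (intro power_increasing) (auto simp: m_def)
    finally have "ep^2 * exp E <= (1/4) ^ m * 4 ^ m" unfolding \<epsilon>2 by (intro mult_left_mono) auto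
    also have "... = 1" by (simp add: power_mult_distrib[symmetric])
    finally show ?thesis .
   qed
   obtain c where c: "c : A" "p : fst c" and ball: "cball (snd c p) r \<subseteq> im c" and
    bd: "!!z v. z : cball (snd c p) r ==> (norm v)^2 <= Ck * qf (Q c z) v & qf (Q c z) v <= Ck * (norm v)^2"
    using good[of p] by blast
   define z0 where "z0 = snd c p"
   obtain \<psi> where \<psi>: "ks Q \<psi>" "!!x. \<psi> x <= 0"
    and I\<psi>: "FI (omega_pot Q \<psi>) (%x. - \<psi> x) <= A1 + A2 * d ^ (CARD('n) + 1) * real m"
    and low: "!!z. norm (z - z0) < (1/2) ^ m ==> (d / 4 * 4 ^ m) ^ CARD('n) <= Re (det (omega_pot Q \<psi> c z))"
    using test[OF c(1) ball bd d m(1)] unfolding z0_def by blast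
   have k\<psi>: "kf (omega_pot Q \<psi>)" by (rule ks_kf[OF \<psi>(1) Q])
   have en: "FI (omega_pot Q \<psi>) \<psi> <= FI (omega_pot Q \<psi>) (\<eta> t1)"
    by (rule energy_inequality[OF Q \<eta> ks\<eta> \<eta>' norm\<eta> \<eta>1 \<psi> t1p])
   have \<eta>c: "continuous_on UNIV (\<eta> t1)" by (rule smooth_fun_continuous[OF \<eta>_smooth[OF t1p]])
   \<comment> \<open>\<open>T - \<eta> t1\<close> is nonnegative by \<open>\<eta>_le\<close>, so its
     integral over the whole manifold controls the part near \<open>p\<close>.\<close>
   have up: "FI (omega_pot Q \<psi>) (%x. T - \<eta> t1 x) <= T * V + A1 + A2 * d ^ (CARD('n) + 1) * real m"
   proof -
    have "FI (omega_pot Q \<psi>) (%x. T - \<eta> t1 x) = FI (omega_pot Q \<psi>) (%x. T * 1) - FI (omega_pot Q \<psi>) (\<eta> t1)"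
     using form_integral_diff[OF k\<psi> continuous_on_const \<eta>c, of T] by simp
    moreover have "FI (omega_pot Q \<psi>) (%x. T * 1) = T * V"
     unfolding form_integral_cmult V_def volume_invariant[OF Q \<psi>(1)] ..
    moreover have "FI (omega_pot Q \<psi>) (%x. - \<psi> x) = - FI (omega_pot Q \<psi>) \<psi>"
     using form_integral_cmult[of "omega_pot Q \<psi>" "-1" \<psi>] by simp
    ultimately show ?thesis using en I\<psi> by linarith
   qed
   define D where "D = cn * (d / 4 * 4 ^ m) ^ CARD('n)"
   have mass: "D / 4 * (ep^2) ^ CARD('n) * (LBINT w:ball 0 2. mvb w * (T - \<eta> t1 (chart_inv c (z0 + ep *\<^sub>R w)))) <= FI (omega_pot Q \<psi>) (%x. T - \<eta> t1 x)"
   proof (rule local_mass[OF k\<psi> c(1) ep])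
    have "cball z0 (2 * ep) \<subseteq> cball z0 r" using \<epsilon>r by auto
    thus "cball z0 (2 * ep) \<subseteq> im c" using ball unfolding z0_def by blast
    show "continuous_on UNIV (%x. T - \<eta> t1 x)" by (intro continuous_intros \<eta>c)
    show "0 <= T - \<eta> t1 x" for x using \<eta>_le[of t1 x] t1 by auto
    show "D <= vol_density (omega_pot Q \<psi>) c z" if "norm (z - z0) < ep" for z
     unfolding D_def vol_density_def cn_def[symmetric] using low[of z] that cn by (intro mult_left_mono) (auto simp: ep_def)
   qed
   \<comment> \<open>Density times volume of the small ball: the scale \<open>m\<close> drops
     out.\<close>
   have D\<epsilon>: "D / 4 * (ep^2) ^ CARD('n) = cn / 4 * (d / 4) ^ CARD('n)"
   proof -
    have "(4 ^ m) ^ CARD('n) * ((1/4) ^ m) ^ CARD('n) = (1 :: real)" unfolding power_mult_distrib[symmetric] by (simp add: power_mult_distrib[symmetric])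
    thus ?thesis unfolding D_def \<epsilon>2 power_mult_distrib by (simp add: mult.assoc)
   qed
   have mv: "(LBINT w:ball 0 2. mvb w * loc c (\<eta> t1) (z0 + ep *\<^sub>R w)) <= loc c (\<eta> t1) z0 * Ib + 2 * real CARD('n) * (exp E * Ck) * ep^2 * Ia"
    unfolding Ib_def Ia_def
   proof (rule weighted_mean_value[OF open_image[OF c(1)] smooth_funD[OF \<eta>_smooth[OF t1p] c(1)] _ ep \<epsilon>r])
    show "cball z0 r \<subseteq> im c" using ball by (simp add: z0_def)
    show "0 <= exp E * Ck" using Ck by simp
    fix z v assume z: "z : cball z0 r" and v: "norm (v :: complex^'n) = 1"
    have zi: "z : im c" using z ball by (auto simp: z0_def)
    have "Re (levi (loc c (\<eta> t1)) z v v) = qf (h t1 c z) v - qf (Q c z) v"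
     unfolding sesq_levm[OF open_image[OF c(1)] smooth_funD[OF \<eta>_smooth[OF t1p] c(1)] zi, symmetric]
     by (simp add: omega_pot_eq sesq_matrix_add)
    also have "... <= qf (h t1 c z) v" using kf_nonneg[OF Q c(1) zi, of v] by simp
    also have "... <= exp E * qf (Q c z) v" unfolding E_def
     by (rule Cc(2)[OF T less_imp_le[OF B] minB t1 c(1) zi])
    also have "... <= exp E * Ck" using bd[of z v] z v by (intro mult_left_mono) (auto simp: z0_def)
    finally show "Re (levi (loc c (\<eta> t1)) z v v) <= exp E * Ck" .
   qed
   have \<eta>B: "loc c (\<eta> t1) z0 = - B" using chart_inv_snd[OF c] by (simp add: z0_def B_def)
   have "2 * real CARD('n) * (exp E * Ck) * ep^2 * Ia <= 2 * real CARD('n) * Ck * Ia"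
   proof -
    have "(2 * real CARD('n) * Ck * Ia) * (ep^2 * exp E) <= (2 * real CARD('n) * Ck * Ia) * 1"
     using \<epsilon>E Ck Ia by (intro mult_left_mono) auto
    thus ?thesis by (simp add: mult_ac)
   qed
   hence mv2: "(LBINT w:ball 0 2. mvb w * loc c (\<eta> t1) (z0 + ep *\<^sub>R w)) <= - B * Ib + 2 * real CARD('n) * Ck * Ia"
    using mv unfolding \<eta>B by linarith
   have "(LBINT w:ball 0 2. mvb w * (T - loc c (\<eta> t1) (z0 + ep *\<^sub>R w)))
    = T * Ib - (LBINT w:ball 0 2. mvb w * loc c (\<eta> t1) (z0 + ep *\<^sub>R w))"
   proof -
    have W: "open (ball 0 2 :: (complex^'n) set)" by simp
    have sub: "(%w. z0 + ep *\<^sub>R w) ` ball 0 2 \<subseteq> im c"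
    proof (rule image_subsetI)
     fix w :: "complex^'n" assume "w : ball 0 2"
     hence "norm (ep *\<^sub>R w) <= ep * 2" using ep by simp
     hence "z0 + ep *\<^sub>R w : cball z0 r" using \<epsilon>r by (simp add: dist_norm)
     thus "z0 + ep *\<^sub>R w : im c" using ball by (auto simp: z0_def)
    qed
    have mc: "continuous_on (ball 0 2) (mvb :: complex^'n => real)" by (rule smooth_continuous[OF smooth_on_mvb[OF W]])
    have fc: "continuous_on (ball 0 2) (%w. loc c (\<eta> t1) (z0 + ep *\<^sub>R w))"
     by (rule continuous_on_compose2[OF smooth_continuous[OF smooth_funD[OF \<eta>_smooth[OF t1p] c(1)]] _ sub]) (intro continuous_intros)
    have s: "supp_in (ball 0 2) (cball 0 1) (%w :: complex^'n. mvb w * g w)" for g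
     by (auto simp: supp_in_def mvb_zero)
    have "set_integrable lborel (ball 0 2) (%w :: complex^'n. mvb w * T)"
     "set_integrable lborel (ball 0 2) (%w. mvb w * loc c (\<eta> t1) (z0 + ep *\<^sub>R w))"
     by (rule supp_set_integrable[OF s], intro continuous_on_mult mc fc continuous_on_const)+
    from set_integral_diff(2)[OF this] show ?thesis unfolding Ib_def by (simp add: right_diff_distrib mult.commute[of _ T])
   qed
   hence "B * Ib - 2 * real CARD('n) * Ck * Ia <= (LBINT w:ball 0 2. mvb w * (T - loc c (\<eta> t1) (z0 + ep *\<^sub>R w)))"
   proof -
    have "0 < T * Ib" using T Ib by simp
    thus ?thesis using mv2 \<open>_ = T * Ib - _\<close> by linarith
   qed
   hence "cn / 4 * (d / 4) ^ CARD('n) * (B * Ib - 2 * real CARD('n) * Ck * Ia) <= cn / 4 * (d / 4) ^ CARD('n) * (LBINT w:ball 0 2. mvb w * (T - loc c (\<eta> t1) (z0 + ep *\<^sub>R w)))"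
    using cn d by (intro mult_left_mono) auto
   also have "... <= T * V + A1 + A2 * d ^ (CARD('n) + 1) * real m" using mass up unfolding D\<epsilon> by linarith
   finally have "cn / 4 * (d / 4) ^ CARD('n) * (B * Ib) - cn / 4 * (d / 4) ^ CARD('n) * (2 * real CARD('n) * Ck * Ia) <= T * V + A1 + A2 * d ^ (CARD('n) + 1) * real m"
    by (simp only: right_diff_distrib)
   moreover have "cn / 4 * (d / 4) ^ CARD('n) * (B * Ib) = a * d ^ CARD('n) * B"
    by (simp add: a_def power_divide)
   ultimately have fin: "a * d ^ CARD('n) * B <= T * V + A1 + A2 * d ^ (CARD('n) + 1) * real m + cn / 4 * (d / 4) ^ CARD('n) * (2 * real CARD('n) * Ck * Ia)"
    by linarith
   define dn where "dn = d ^ CARD('n)"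
   have dn: "dn > 0" using d by (simp add: dn_def)
   have d1: "d ^ (CARD('n) + 1) = d * dn" by (simp add: dn_def)
   have "A2 * d ^ (CARD('n) + 1) * real m <= A2 * d ^ (CARD('n) + 1) * (real m0 + 1 + E)"
    using m A12 d by (intro mult_left_mono) auto
   also have "... = A2 * d ^ (CARD('n) + 1) * (real m0 + 1 + Cc * (1 + T)) + (A2 * Cc * d) * (dn * B)"
    unfolding E_def d1 by (simp add: algebra_simps)
   also have "... <= A2 * d ^ (CARD('n) + 1) * (real m0 + 1 + Cc * (1 + T)) + a / 2 * (dn * B)"
    using \<delta>a dn B by (intro add_left_mono mult_right_mono) auto
   finally have mbound: "A2 * d ^ (CARD('n) + 1) * real m <= A2 * d ^ (CARD('n) + 1) * (real m0 + 1 + Cc * (1 + T)) + a / 2 * (dn * B)" .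
   have "A2 * d ^ (CARD('n) + 1) * (real m0 + 1 + Cc * (1 + T)) <= A2 * d ^ (CARD('n) + 1) * ((real m0 + 1 + Cc) * (1 + T))"
    using A12 d T Cc(1) by (intro mult_left_mono) (auto simp: algebra_simps)
   moreover have "T * V <= \<bar>V\<bar> * (1 + T)"
   proof -
    have "T * V <= T * \<bar>V\<bar>" using T by (intro mult_left_mono) auto
    also have "... <= \<bar>V\<bar> * (1 + T)" by (simp add: algebra_simps)
    finally show ?thesis .
   qed
   moreover have "A1 <= A1 * (1 + T)" using A12 T by (simp add: algebra_simps)
   moreover have "cn / 4 * (d / 4) ^ CARD('n) * (2 * real CARD('n) * Ck * Ia) <= cn / 4 * (d / 4) ^ CARD('n) * (2 * real CARD('n) * Ck * Ia) * (1 + T)"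
   proof -
    have "0 <= cn / 4 * (d / 4) ^ CARD('n) * (2 * real CARD('n) * Ck * Ia)"
     using cn d Ck Ia by (intro mult_nonneg_nonneg) auto
    from mult_left_mono[OF _ this, of 1 "1 + T"] T show ?thesis by simp
   qed
   moreover have "K * (1 + T) = \<bar>V\<bar> * (1 + T) + A1 * (1 + T) + A2 * d ^ (CARD('n) + 1) * ((real m0 + 1 + Cc) * (1 + T)) + cn / 4 * (d / 4) ^ CARD('n) * (2 * real CARD('n) * Ck * Ia) * (1 + T)"
    unfolding K_def by (simp only: distrib_right mult.assoc)
   moreover have "a * dn * B - a / 2 * (dn * B) = a * dn / 2 * B" by simp
   ultimately have "a * dn / 2 * B <= K * (1 + T)"
    using fin mbound unfolding dn_def[symmetric] by linarith
   hence "B <= 2 * K / (a * dn) * (1 + T)" using a dn by (simp add: field_simps)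
   also have "... <= M * (1 + T)" using T by (intro mult_right_mono) (auto simp: M_def dn_def)
   finally show ?thesis using minB[of T x] T by auto
  qed
 qed
 with M show ?thesis by (rule that)
qed

end

section \<open>Passage from the flow in its original form to the setting at time 1\<close>

context cmanifold
begin

lemma form_integral_cong:
 assumes "!!c z. c : A ==> z : im c ==> \<omega> c z = \<omega>' c z"
 shows "FI \<omega> f = FI \<omega>' f"
 unfolding form_integral_PU
proof (rule sum.cong[OF refl])
 fix c assume "c : PC"
 hence c: "c : A" using PC by auto
 show "(LBINT z:im c. loc c (P\<theta> c) z * loc c f z * vol_density \<omega> c z) = (LBINT z:im c. loc c (P\<theta> c) z * loc c f z * vol_density \<omega>' c z)"
  by (rule set_lebesgue_integral_cong) (use open_image[OF c] assms[OF c] in \<open>auto simp: vol_density_def\<close>)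
qed

lemma kaehler_potential_ks:
 assumes \<omega>: "kf \<omega>" and \<phi>: "\<phi> : kaehler_potentials A \<omega>"
 shows "ks \<omega> \<phi>"
 unfolding ks_def
proof (intro conjI ballI)
 show s: "smooth_fun A \<phi>" using \<phi> by (simp add: kaehler_potentials_def)
 fix c z assume c: "c : A" and z: "z : im c"
 have "herm (\<omega> c z)" using kf_pd[OF \<omega> c z] by (simp add: pd_def)
 hence "herm (\<omega> c z + levm (loc c \<phi>) z)"
  by (intro herm_add herm_levm[OF open_image[OF c] smooth_funD[OF s c] z])
 thus "pd (\<omega> c z + levm (loc c \<phi>) z)"
  using \<phi> c z unfolding pd_def kaehler_potentials_def positive_def omega_pot_eq form_value_sesq by blast
qed

lemma ricci_form_levm:
 assumes \<omega>: "kf \<omega>" and c: "c : A" and z: "z : im c"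
 shows "ricci_form \<omega> c z = - levm (lndet (\<omega> c)) z"
proof -
 note o = open_image[OF c]
 have ld: "smooth_on (im c) (lndet (\<omega> c))"
  by (rule smooth_on_lndet[OF o kf_smooth[OF \<omega> c] kf_pd[OF \<omega> c]])
 have "levm (%u. ln (vol_density \<omega> c u)) z = levm (%u. ln (fact CARD('n) * 2 ^ CARD('n)) + lndet (\<omega> c) u) z"
  by (rule levm_cong_open[OF o z]) (use pd_det(1)[OF kf_pd[OF \<omega> c]] in \<open>simp add: vol_density_def lndet_def ln_mult_pos\<close>)
 also have "... = levm (lndet (\<omega> c)) z"
  using levm_add[OF o smooth_on_const[OF o] ld z] by (simp add: levm_const)
 finally show ?thesis by (simp add: ricci_form_def levm_def vec_eq_iff)
qed

lemma omega_pot_diff: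
 assumes "smooth_fun A P" "smooth_fun A Q" "c : A" "z : im c"
 shows "omega_pot (omega_pot \<omega> P) (%x. Q x - P x) c z = omega_pot \<omega> Q c z"
 using levm_diff[OF open_image[OF assms(3)] smooth_funD[OF assms(2,3)] smooth_funD[OF assms(1,3)] assms(4)]
 by (simp add: omega_pot_eq)

end

theorem theorem1p3:
  fixes A :: "('a::t2_space, 'n::finite) chart set"
    and \<omega>\<^sub>0 \<beta> :: "('a, 'n) form11"
    and \<phi> :: "real \<Rightarrow> 'a \<Rightarrow> real"
  assumes "compact_complex_manifold A"
    and "kaehler_form A \<omega>\<^sub>0"
    and "closed_real_form11 A \<beta>" and "semipositive A \<beta>"
    and "represents_c1 A (\<lambda>c z. \<omega>\<^sub>0 c z + \<beta> c z)"
    and "inverse_MA_flow A \<omega>\<^sub>0 \<beta> \<phi>"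
  shows "\<exists>M>0. \<forall>t\<ge>0. C0_norm (\<phi> t) \<le> M * (t + 1)"
proof -
 interpret cmanifold A by unfold_locales (rule assms(1))
 have \<omega>: "kf \<omega>\<^sub>0" using assms(2) by (simp add: kf_def)
 have \<phi>s: "!!c. c : A ==> smooth_on ({0..} \<times> im c) (%(t, z). loc c (\<phi> t) z)"
  and \<phi>k: "!!t. t >= 0 ==> \<phi> t : kaehler_potentials A \<omega>\<^sub>0"
  and "ALL t>=0. EX \<rho>. ricci_potential A \<omega>\<^sub>0 \<beta> (\<phi> t) \<rho> &
    (ALL x. ((%s. \<phi> s x) has_real_derivative 1 - exp (\<rho> x)) (at t within {0..}))"
  using assms(6) unfolding inverse_MA_flow_def by auto
 \<comment> \<open>A Ricci potential is picked for each time separately. Joint smoothness in time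
   and space of its exponential is recovered in \<open>\<eta>'_fam\<close> from that of the
   flow.\<close>
 then obtain \<rho> where \<rho>: "!!t. t >= 0 ==> ricci_potential A \<omega>\<^sub>0 \<beta> (\<phi> t) (\<rho> t)"
  and \<phi>': "!!t x. t >= 0 ==> ((%s. \<phi> s x) has_real_derivative 1 - exp (\<rho> t x)) (at t within {0..})"
  by metis
 have ks: "ks \<omega>\<^sub>0 (\<phi> t)" if "t >= 0" for t by (rule kaehler_potential_ks[OF \<omega> \<phi>k[OF that]])
 have kt: "kf (omega_pot \<omega>\<^sub>0 (\<phi> t))" if "t >= 0" for t by (rule ks_kf[OF ks[OF that] \<omega>])
 have sm: "smooth_fun A (\<phi> t)" if "t >= 0" for t by (rule ks_smooth[OF ks[OF that]])
 have \<phi>f: "smooth_fam {0<..} \<phi>" unfolding smooth_fam_def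
 proof (intro conjI ballI)
  fix c assume c: "c : A"
  show "smooth_on ({0<..} \<times> im c) (%(t, z). loc c (\<phi> t) z)"
   by (rule smooth_on_subset[OF \<phi>s[OF c]]) (auto intro!: open_Times open_image[OF c])
 qed simp
 define Q where "Q = omega_pot \<omega>\<^sub>0 (\<phi> 1)"
 define \<eta> where "\<eta> t x = \<phi> t x - \<phi> 1 x" for t x
 have Q: "kf Q" unfolding Q_def by (rule kt) simp
 have om: "omega_pot Q (\<eta> t) c z = omega_pot \<omega>\<^sub>0 (\<phi> t) c z" if "t >= 0" "c : A" "z : im c" for t c z
  unfolding Q_def \<eta>_def[abs_def] by (rule omega_pot_diff) (use sm that in auto)
 have s0: "smooth_fun A (\<rho> t)" if "t >= 0" for t using \<rho>[OF that] by (simp add: ricci_potential_def)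
 interpret ma_flow A Q \<beta> \<eta> \<rho>
 proof unfold_locales
  show "kf Q" by (rule Q)
  show "real_form11 A \<beta>" using assms(3) by (simp add: closed_real_form11_def)
  show "0 <= qf (\<beta> c z) v" if "c : A" "z : im c" for c z v
   using assms(4) that unfolding semipositive_def form_value_sesq by blast
  show "smooth_fam {0<..} \<eta>" unfolding \<eta>_def[abs_def] by (intro fam_diff \<phi>f fam_fun sm) auto
  show "\<eta> 1 x = 0" for x by (simp add: \<eta>_def)
  fix t :: real assume t: "t > 0"
  hence t0: "t >= 0" by simp
  show "ks Q (\<eta> t)" unfolding ks_def
  proof (intro conjI ballI)
   show "smooth_fun A (\<eta> t)" unfolding \<eta>_def[abs_def] by (intro smooth_fun_diff sm t0) simp
   fix c z assume "c : A" "z : im c"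
   thus "pd (Q c z + levm (loc c (\<eta> t)) z)"
    using ks_pd[OF ks[OF t0]] om[OF t0] by (simp add: omega_pot_eq[symmetric])
  qed
  show "smooth_fun A (\<rho> t)" by (rule s0[OF t0])
  show "((%t. \<eta> t x) has_real_derivative 1 - exp (\<rho> t x)) (at t)" for x
  proof -
   have "((%s. \<phi> s x) has_real_derivative 1 - exp (\<rho> t x)) (at t)"
    using \<phi>'[OF t0, of x] at_within_open_subset[of t "{0<..}" "{0..}"] t by (simp add: subset_eq)
   from DERIV_diff[OF this DERIV_const[of "\<phi> 1 x"]] show ?thesis by (simp add: \<eta>_def)
  qed
  \<comment> \<open>The normalisation of \<rho> refers to the volume of
    \<open>\<omega>\<^sub>0\<close>, which \<open>volume_invariant\<close> identifies with the
    volume of the metric at time \<open>t\<close>.\<close>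
  show "FI (omega_pot Q (\<eta> t)) (%x. 1 - exp (\<rho> t x)) = 0"
  proof -
   have es: "continuous_on UNIV (%x. exp (\<rho> t x))" by (intro continuous_intros smooth_fun_continuous s0 t0)
   have "FI (omega_pot \<omega>\<^sub>0 (\<phi> t)) (%x. exp (\<rho> t x)) / FI \<omega>\<^sub>0 (%x. 1) = 1"
    using \<rho>[OF t0] by (simp add: ricci_potential_def)
   hence "FI (omega_pot \<omega>\<^sub>0 (\<phi> t)) (%x. exp (\<rho> t x)) = FI \<omega>\<^sub>0 (%x. 1)"
    by (auto simp: divide_eq_1_iff)
   hence "FI (omega_pot \<omega>\<^sub>0 (\<phi> t)) (%x. 1 - exp (\<rho> t x)) = 0"
    using form_integral_diff[OF kt[OF t0] continuous_on_const es, of 1] volume_invariant[OF \<omega> ks[OF t0]] by simp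
   thus ?thesis using form_integral_cong[OF om[OF t0]] by simp
  qed
  fix c z assume c: "c : A" and z: "z : im c"
  have "ricci_form (omega_pot \<omega>\<^sub>0 (\<phi> t)) c z = omega_pot \<omega>\<^sub>0 (\<phi> t) c z + \<beta> c z + levm (loc c (\<rho> t)) z"
   using \<rho>[OF t0] c z unfolding ricci_potential_def ddbar_levm by blast
  hence "levm (lndet (omega_pot \<omega>\<^sub>0 (\<phi> t) c)) z = - (omega_pot \<omega>\<^sub>0 (\<phi> t) c z + \<beta> c z + levm (loc c (\<rho> t)) z)"
   using ricci_form_levm[OF kt[OF t0] c z] by (metis minus_minus)
  moreover have "levm (lndet (omega_pot Q (\<eta> t) c)) z = levm (lndet (omega_pot \<omega>\<^sub>0 (\<phi> t) c)) z"
   by (rule levm_cong_open[OF open_image[OF c] z]) (simp add: lndet_def om[OF t0 c])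
  ultimately show "levm (lndet (omega_pot Q (\<eta> t) c)) z = - (omega_pot Q (\<eta> t) c z + \<beta> c z + levm (loc c (\<rho> t)) z)"
   by (simp add: om[OF t0 c z])
 qed
 obtain M where M: "M > 0" "!!t x. 1 <= t ==> - M * (1 + t) <= \<eta> t x" by (rule lower_bound) blast
 obtain C1 where C1: "C1 > 0" "!!x. \<bar>\<phi> 1 x\<bar> <= C1" using smooth_fun_bounded[OF sm[of 1]] by auto
 \<comment> \<open>On \<open>{0..1}\<close> smoothness up to the initial time gives continuity, and
   the finitely many compact pieces \<open>Kc c\<close> cover the manifold.\<close>
 obtain C0 where C0: "C0 > 0" "!!c. c : PC ==> ALL t:{0..1}. ALL z:Kc c. \<bar>loc c (\<phi> t) z\<bar> <= C0"
 proof (rule uniform_const[OF PC(1), where P="%c C. ALL t:{0..1}. ALL z:Kc c. \<bar>loc c (\<phi> t) z\<bar> <= C"])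
  fix c assume cP: "c : PC"
  have c: "c : A" using PC cP by auto
  have "continuous_on ({0..1} \<times> Kc c) (%(t, z). loc c (\<phi> t) z)"
   by (rule continuous_on_subset[OF smooth_continuous[OF \<phi>s[OF c]]]) (use Kc_sub[OF cP] in auto)
  hence "compact ((%(t, z). loc c (\<phi> t) z) ` ({0..1} \<times> Kc c))"
   by (rule compact_continuous_image) (intro compact_Times compact_Icc Kc_compact cP)
  then obtain C where "C > 0" "ALL y:(%(t, z). loc c (\<phi> t) z) ` ({0..1} \<times> Kc c). norm y <= C"
   using compact_imp_bounded bounded_pos by metis
  thus "EX C>0. ALL t:{0..1}. ALL z:Kc c. \<bar>loc c (\<phi> t) z\<bar> <= C" by fastforce
 qed (fastforce, blast)
 have b01: "\<bar>\<phi> t x\<bar> <= C0" if "t : {0..1}" for t x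
 proof -
  obtain c where c: "c : PC" "x : fst c" "snd c x : Kc c" by (rule Kc_cover)
  hence "c : A" using PC by auto
  thus ?thesis using C0(2)[OF c(1)] that c chart_inv_snd[of c x] by force
 qed
 show ?thesis
 proof (intro exI conjI allI impI)
  show "0 < C0 + C1 + M + 1" using C0(1) C1(1) M(1) by simp
  fix t :: real assume t: "0 <= t"
  have "\<bar>\<phi> t x\<bar> <= (C0 + C1 + M + 1) * (t + 1)" for x
  proof (cases "t <= 1")
   case True
   have "\<bar>\<phi> t x\<bar> <= C0 * 1" using b01[of t x] t True by simp
   also have "... <= (C0 + C1 + M + 1) * (t + 1)" using t C0(1) C1(1) M(1) by (intro mult_mono) auto
   finally show ?thesis .
  next
   case False
   hence t1: "1 <= t" by simp
   define Mt where "Mt = M * (t + 1)"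
   have "- Mt <= \<eta> t x" using M(2)[OF t1, of x] by (simp add: Mt_def add.commute)
   moreover have "0 <= Mt" using M(1) t by (simp add: Mt_def)
   ultimately have "\<bar>\<phi> t x\<bar> <= C1 + (t + 1) + Mt"
    using \<eta>_le[OF t1, of x] C1(2)[of x] t unfolding \<eta>_def by linarith
   also have "... <= C1 * (t + 1) + (t + 1) + M * (t + 1) + C0 * (t + 1)"
    using t C0(1) C1(1) by (simp add: Mt_def algebra_simps)
   also have "... = (C0 + C1 + M + 1) * (t + 1)" by (simp add: algebra_simps)
   finally show ?thesis .
  qed
  thus "C0_norm (\<phi> t) <= (C0 + C1 + M + 1) * (t + 1)"
   unfolding C0_norm_def by (intro cSUP_least) auto
 qed
qed

end
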